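(* Let $k$ be a field. For $n\ge3$ let $Z_n$ be the zig-zag graph with $n$ loops, and let $z_n=[Z_n]\in K_0(\mathrm{Var}_k)$. Then for every $n\ge3$, $z_n$ is the coefficient of $t^n$ in $$\frac{1}{1-\mathbb{L}^2t}-\frac{\mathbb{M}^2\,\mathbb{L}^2\,t^3\,P(\mathbb{L},\mathbb{L}t)}{\big(1-\mathbb{M}\mathbb{L}t-\mathbb{M}\mathbb{L}^2t^2\big)^2\big(1-t-\mathbb{M}^2\mathbb{L}t^2\big)},$$ where $\mathbb{M}=\mathbb{L}-1$ and $$\begin{aligned}P(x,y)={}&x(x-1)^3y^5+(x-1)(2x^3-3x^2+x+1)y^4+(x-1)(x^3-3x^2+2x+1)y^3\\&-(3x^3-3x^2+2)y^2-(x^3-x^2+1)y+x^2+x+1.\end{aligned}$$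
   Context: $K_0(\mathrm{Var}_k)$ is the Grothendieck ring of varieties over $k$, $\mathbb{L}=[\mathbb{A}^1_k]$. For a connected graph $G$ with $N_G$ edges, $\Psi_G=\sum_T\prod_{e\notin T}\alpha_e$ (sum over spanning trees $T$), and $[G]=[\Psi_G]$ is the class of the affine hypersurface $\{\Psi_G=0\}\subset\mathbb{A}^{N_G}_k$. The zig-zag graph $Z_n$ has $n+1$ vertices $u_1,\dots,u_{n+1}$ and the $2n$ edges $u_iu_{i+1}$ ($1\le i\le n$), $u_iu_{i+2}$ ($1\le i\le n-1$), and $u_1u_{n+1}$. (In particular $Z_3$ is the complete graph $K_4$.) The rational expression is expanded as a power series in $t$ with coefficients in $\mathbb{Z}[\mathbb{L}]$. *)

theory Defs
  imports
    "HOL-Algebra.QuotRing"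
    "HOL-Analysis.Abstract_Topology"
    "HOL-Library.Poly_Mapping"
    "HOL-Library.FuncSet"
    "HOL-Computational_Algebra.Polynomial"
    "HOL-Computational_Algebra.Formal_Power_Series"
begin

section \<open>Commutative algebra\<close>

definition field_ring :: "'k::field ring" where
  "field_ring = \<lparr>carrier = UNIV, monoid.mult = (*), one = 1, zero = 0, add = (+)\<rparr>"

text \<open>The polynomial ring over a field with set of indeterminates \<open>V\<close>; a polynomial is a finitely
  supported map from exponent vectors to coefficients.\<close>

type_synonym ('v, 'k) mpoly = "('v \<Rightarrow>\<^sub>0 nat) \<Rightarrow>\<^sub>0 'k"

definition poly_const :: "'k::field \<Rightarrow> ('v, 'k) mpoly" where
  "poly_const c = Poly_Mapping.single 0 c"

definition poly_var :: "'v \<Rightarrow> ('v, 'k::field) mpoly" where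
  "poly_var v = Poly_Mapping.single (Poly_Mapping.single v 1) 1"

definition poly_ring :: "'v set \<Rightarrow> ('v, 'k::field) mpoly ring" where
  "poly_ring V = \<lparr>carrier = {f. \<forall>m \<in> Poly_Mapping.keys f. Poly_Mapping.keys m \<subseteq> V},
     monoid.mult = (*), one = 1, zero = 0, add = (+)\<rparr>"

definition local_ring :: "'a ring \<Rightarrow> bool" where
  "local_ring R \<longleftrightarrow> cring R \<and> ideal (carrier R - Units R) R"

text \<open>Localization at a multiplicative set \<open>S\<close>: \<open>fraction A S a s\<close> is the fraction \<open>a/s\<close>, as a set of
  pairs.\<close>

definition fraction :: "'a ring \<Rightarrow> 'a set \<Rightarrow> 'a \<Rightarrow> 'a \<Rightarrow> ('a \<times> 'a) set" where
  "fraction A S a s = {(b, t). b \<in> carrier A \<and> t \<in> S \<and>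
     (\<exists>u\<in>S. u \<otimes>\<^bsub>A\<^esub> (a \<otimes>\<^bsub>A\<^esub> t) = u \<otimes>\<^bsub>A\<^esub> (b \<otimes>\<^bsub>A\<^esub> s))}"

definition localization :: "'a ring \<Rightarrow> 'a set \<Rightarrow> ('a \<times> 'a) set ring" where
  "localization A S = \<lparr>
     carrier = {fraction A S a s |a s. a \<in> carrier A \<and> s \<in> S},
     monoid.mult = (\<lambda>x y. \<Union>(a, s)\<in>x. \<Union>(b, t)\<in>y. fraction A S (a \<otimes>\<^bsub>A\<^esub> b) (s \<otimes>\<^bsub>A\<^esub> t)),
     one = fraction A S \<one>\<^bsub>A\<^esub> \<one>\<^bsub>A\<^esub>,
     zero = fraction A S \<zero>\<^bsub>A\<^esub> \<one>\<^bsub>A\<^esub>,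
     add = (\<lambda>x y. \<Union>(a, s)\<in>x. \<Union>(b, t)\<in>y.
       fraction A S ((a \<otimes>\<^bsub>A\<^esub> t) \<oplus>\<^bsub>A\<^esub> (b \<otimes>\<^bsub>A\<^esub> s)) (s \<otimes>\<^bsub>A\<^esub> t))\<rparr>"

section \<open>Locally ringed spaces over a field\<close>

text \<open>The structure sheaf is given through its stalks: a section over an open set \<open>U\<close> is the family
  of its germs, an element of the product of the stalks at the points of \<open>U\<close>. Every sheaf is of this
  form (up to isomorphism), and a morphism of sheaves is the same as a family of maps of stalks that
  respects sections. The structure of a space over \<open>k\<close> is given by the maps \<open>scal X p\<close> from \<open>k\<close> to
  the stalks.\<close>

record ('k, 'p, 's) kspace =
  ktop :: "'p topology"
  stalk :: "'p \<Rightarrow> 's ring"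
  scal :: "'p \<Rightarrow> 'k \<Rightarrow> 's"
  sect :: "'p set \<Rightarrow> ('p \<Rightarrow> 's) set"

locale locally_ringed =
  fixes X :: "('k::field, 'p, 's) kspace"
  assumes stalk_local: "p \<in> topspace (ktop X) \<Longrightarrow> local_ring (stalk X p)"
    and scal_hom: "p \<in> topspace (ktop X) \<Longrightarrow> scal X p \<in> ring_hom field_ring (stalk X p)"
    and sect_germs: "openin (ktop X) U \<Longrightarrow> sect X U \<subseteq> (\<Pi>\<^sub>E p\<in>U. carrier (stalk X p))"
    and sect_scal: "openin (ktop X) U \<Longrightarrow> (\<lambda>p\<in>U. scal X p c) \<in> sect X U"
    and sect_add: "\<lbrakk>openin (ktop X) U; s \<in> sect X U; t \<in> sect X U\<rbrakk>
      \<Longrightarrow> (\<lambda>p\<in>U. s p \<oplus>\<^bsub>stalk X p\<^esub> t p) \<in> sect X U"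
    and sect_mult: "\<lbrakk>openin (ktop X) U; s \<in> sect X U; t \<in> sect X U\<rbrakk>
      \<Longrightarrow> (\<lambda>p\<in>U. s p \<otimes>\<^bsub>stalk X p\<^esub> t p) \<in> sect X U"
    and sect_restrict: "\<lbrakk>openin (ktop X) U; openin (ktop X) V; V \<subseteq> U; s \<in> sect X U\<rbrakk>
      \<Longrightarrow> restrict s V \<in> sect X V"
    and sect_glue: "\<lbrakk>openin (ktop X) U; s \<in> (\<Pi>\<^sub>E p\<in>U. carrier (stalk X p));
        \<And>p. p \<in> U \<Longrightarrow> \<exists>V. openin (ktop X) V \<and> p \<in> V \<and> V \<subseteq> U \<and> restrict s V \<in> sect X V\<rbrakk>
      \<Longrightarrow> s \<in> sect X U"
    and germ_exists: "\<lbrakk>p \<in> topspace (ktop X); a \<in> carrier (stalk X p)\<rbrakk>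
      \<Longrightarrow> \<exists>U s. openin (ktop X) U \<and> p \<in> U \<and> s \<in> sect X U \<and> s p = a"
    and germ_eq: "\<lbrakk>openin (ktop X) U; s \<in> sect X U; t \<in> sect X U; p \<in> U; s p = t p\<rbrakk>
      \<Longrightarrow> \<exists>V. openin (ktop X) V \<and> p \<in> V \<and> V \<subseteq> U \<and> (\<forall>q\<in>V. s q = t q)"

text \<open>A morphism \<open>X \<rightarrow> Y\<close> is a pair of a map \<open>f\<close> on points and, for each \<open>p\<close>, a local homomorphism
  from the stalk of \<open>Y\<close> at \<open>f p\<close> to the stalk of \<open>X\<close> at \<open>p\<close>.\<close>

type_synonym ('p, 's, 'q, 't) mor = "('p \<Rightarrow> 'q) \<times> ('p \<Rightarrow> 't \<Rightarrow> 's)"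

definition morphism ::
  "('k::field, 'p, 's) kspace \<Rightarrow> ('k, 'q, 't) kspace \<Rightarrow> ('p, 's, 'q, 't) mor \<Rightarrow> bool" where
  "morphism X Y m \<longleftrightarrow> (case m of (f, \<phi>) \<Rightarrow>
     continuous_map (ktop X) (ktop Y) f \<and>
     (\<forall>p\<in>topspace (ktop X).
        \<phi> p \<in> ring_hom (stalk Y (f p)) (stalk X p) \<and>
        (\<forall>a\<in>carrier (stalk Y (f p)). \<phi> p a \<in> Units (stalk X p) \<longrightarrow> a \<in> Units (stalk Y (f p))) \<and>
        (\<forall>c. \<phi> p (scal Y (f p) c) = scal X p c)) \<and>
     (\<forall>V s. openin (ktop Y) V \<longrightarrow> s \<in> sect Y V \<longrightarrow>
        (\<lambda>p\<in>{p \<in> topspace (ktop X). f p \<in> V}. \<phi> p (s (f p)))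
          \<in> sect X {p \<in> topspace (ktop X). f p \<in> V}))"

definition mor_id :: "('p, 's, 'p, 's) mor" where
  "mor_id = (\<lambda>p. p, \<lambda>p a. a)"

definition mor_comp ::
  "('q, 't, 'r, 'u) mor \<Rightarrow> ('p, 's, 'q, 't) mor \<Rightarrow> ('p, 's, 'r, 'u) mor" where
  "mor_comp n m = (\<lambda>p. fst n (fst m p), \<lambda>p a. snd m p (snd n (fst m p) a))"

text \<open>Equality of morphisms, disregarding the values outside the domains.\<close>

definition mor_eq ::
  "('k::field, 'p, 's) kspace \<Rightarrow> ('k, 'q, 't) kspace \<Rightarrow> ('p, 's, 'q, 't) mor
     \<Rightarrow> ('p, 's, 'q, 't) mor \<Rightarrow> bool" where
  "mor_eq X Y m m' \<longleftrightarrow> (\<forall>p\<in>topspace (ktop X). fst m p = fst m' p \<and>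
     (\<forall>a\<in>carrier (stalk Y (fst m p)). snd m p a = snd m' p a))"

definition isomorphic ::
  "('k::field, 'p, 's) kspace \<Rightarrow> ('k, 'q, 't) kspace \<Rightarrow> bool" where
  "isomorphic X Y \<longleftrightarrow> (\<exists>m n. morphism X Y m \<and> morphism Y X n \<and>
     mor_eq X X (mor_comp n m) mor_id \<and> mor_eq Y Y (mor_comp m n) mor_id)"

definition open_subspace :: "('k, 'p, 's) kspace \<Rightarrow> 'p set \<Rightarrow> ('k, 'p, 's) kspace" where
  "open_subspace X U = X\<lparr>ktop := subtopology (ktop X) U\<rparr>"

text \<open>A homeomorphism onto a closed subset that is surjective on stalks, equivalently for which
  \<open>O_X \<rightarrow> i_* O_Z\<close> is surjective.\<close>

definition closed_immersion ::
  "('k::field, 'p, 's) kspace \<Rightarrow> ('k, 'q, 't) kspace \<Rightarrow> ('p, 's, 'q, 't) mor \<Rightarrow> bool" where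
  "closed_immersion Z X m \<longleftrightarrow> morphism Z X m \<and>
     embedding_map (ktop Z) (ktop X) (fst m) \<and>
     closedin (ktop X) (fst m ` topspace (ktop Z)) \<and>
     (\<forall>p\<in>topspace (ktop Z). snd m p ` carrier (stalk X (fst m p)) = carrier (stalk Z p))"

section \<open>Schemes of finite type over a field\<close>

text \<open>The spectrum of a ring \<open>A\<close> that is a \<open>k\<close>-algebra through \<open>\<iota>\<close>. The stalk at a prime \<open>P\<close> is the
  localization at \<open>P\<close>, and sections are the families that locally are fractions.\<close>

definition primes :: "'a ring \<Rightarrow> 'a set set" where
  "primes A = {P. primeideal P A}"

definition zariski :: "'a ring \<Rightarrow> 'a set topology" where
  "zariski A = topology (\<lambda>U. \<exists>S. S \<subseteq> carrier A \<and> U = {P \<in> primes A. \<not> S \<subseteq> P})"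

definition Spec :: "'a ring \<Rightarrow> ('k::field \<Rightarrow> 'a) \<Rightarrow> ('k, 'a set, ('a \<times> 'a) set) kspace" where
  "Spec A \<iota> = \<lparr>
     ktop = zariski A,
     stalk = (\<lambda>P. localization A (carrier A - P)),
     scal = (\<lambda>P c. fraction A (carrier A - P) (\<iota> c) \<one>\<^bsub>A\<^esub>),
     sect = (\<lambda>U. {s \<in> (\<Pi>\<^sub>E P\<in>U. carrier (localization A (carrier A - P))).
       \<forall>P\<in>U. \<exists>V a b. openin (zariski A) V \<and> P \<in> V \<and> V \<subseteq> U \<and> a \<in> carrier A \<and> b \<in> carrier A \<and>
         (\<forall>Q\<in>V. b \<notin> Q \<and> s Q = fraction A (carrier A - Q) a b)})\<rparr>"

text \<open>The closed subscheme of affine space with coordinates \<open>V\<close> that is defined by the ideal \<open>I\<close>.\<close>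

definition affine_scheme ::
  "'v set \<Rightarrow> ('v, 'k::field) mpoly set
     \<Rightarrow> ('k, ('v, 'k) mpoly set set, (('v, 'k) mpoly set \<times> ('v, 'k) mpoly set) set) kspace" where
  "affine_scheme V I = Spec (poly_ring V Quot I) (\<lambda>c. I +>\<^bsub>poly_ring V\<^esub> poly_const c)"

definition affine_space ::
  "nat \<Rightarrow> ('k::field, (nat, 'k) mpoly set, ((nat, 'k) mpoly \<times> (nat, 'k) mpoly) set) kspace" where
  "affine_space n = Spec (poly_ring {..<n}) poly_const"

definition hypersurface ::
  "'v set \<Rightarrow> ('v, 'k::field) mpoly
     \<Rightarrow> ('k, ('v, 'k) mpoly set set, (('v, 'k) mpoly set \<times> ('v, 'k) mpoly set) set) kspace" where
  "hypersurface V f = affine_scheme V (PIdl\<^bsub>poly_ring V\<^esub> f)"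

text \<open>Every finitely generated \<open>k\<close>-algebra is, up to isomorphism, a quotient of a polynomial ring
  in \<open>n\<close> variables.\<close>

definition finite_type_scheme :: "('k::field, 'p, 's) kspace \<Rightarrow> bool" where
  "finite_type_scheme X \<longleftrightarrow> locally_ringed X \<and>
     (\<exists>\<U>. finite \<U> \<and> \<Union>\<U> = topspace (ktop X) \<and>
       (\<forall>U\<in>\<U>. openin (ktop X) U \<and>
          (\<exists>(n::nat) I. ideal I (poly_ring {..<n}) \<and>
             isomorphic (open_subspace X U) (affine_scheme {..<n} I))))"

text \<open>Isomorphism classes are formed among schemes whose points and germs lie in two fixed types.
  The points and the stalks of a scheme of finite type over \<open>k\<close> have cardinality at most the maximum
  of \<open>|k|\<close> and \<open>\<aleph>\<^sub>0\<close>, and these types are larger, so every such scheme has an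
  isomorphic copy there.\<close>

type_synonym 'k scheme =
  "('k, (nat, 'k) mpoly set set, ((nat, 'k) mpoly set \<times> (nat, 'k) mpoly set) set) kspace"

text \<open>Fibre products over \<open>k\<close>, as categorical products of schemes of finite type over \<open>k\<close>.\<close>

definition is_product where
  "is_product (P :: 'k::field scheme) p q (X :: 'k scheme) (Y :: 'k scheme) \<longleftrightarrow>
     finite_type_scheme P \<and> morphism P X p \<and> morphism P Y q \<and>
     (\<forall>(T :: 'k scheme) f g. finite_type_scheme T \<and> morphism T X f \<and> morphism T Y g \<longrightarrow>
       (\<exists>h. morphism T P h \<and> mor_eq T X (mor_comp p h) f \<and> mor_eq T Y (mor_comp q h) g \<and>
         (\<forall>h'. morphism T P h' \<and> mor_eq T X (mor_comp p h') f \<and> mor_eq T Y (mor_comp q h') g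
            \<longrightarrow> mor_eq T P h' h)))"

definition separated :: "'k::field scheme \<Rightarrow> bool" where
  "separated X \<longleftrightarrow> (\<exists>P p q d. is_product P p q X X \<and> closed_immersion X P d \<and>
     mor_eq X X (mor_comp p d) mor_id \<and> mor_eq X X (mor_comp q d) mor_id)"

definition variety :: "'k::field scheme \<Rightarrow> bool" where
  "variety X \<longleftrightarrow> finite_type_scheme X \<and> separated X"

section \<open>The Grothendieck ring of varieties\<close>

definition iso_class :: "('k::field, 'p, 's) kspace \<Rightarrow> 'k scheme set" where
  "iso_class X = {W. variety W \<and> isomorphic W X}"

definition iso_class_prod :: "'k::field scheme set \<Rightarrow> 'k scheme set \<Rightarrow> 'k scheme set" where
  "iso_class_prod A B = {W. variety W \<and> (\<exists>X\<in>A. \<exists>Y\<in>B. \<exists>p q. is_product W p q X Y)}"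

text \<open>The free abelian group on the isomorphism classes of varieties, with the product induced by
  the fibre product over \<open>k\<close>. Fibre products of varieties exist and are varieties, so the first
  case in the definition of \<open>class_mult\<close> does not occur for classes of varieties.\<close>

definition class_mult :: "'k::field scheme set \<Rightarrow> 'k scheme set \<Rightarrow> 'k scheme set \<Rightarrow>\<^sub>0 int" where
  "class_mult A B = (if iso_class_prod A B = {} then 0 else frag_of (iso_class_prod A B))"

definition variety_ring :: "('k::field scheme set \<Rightarrow>\<^sub>0 int) ring" where
  "variety_ring = \<lparr>
     carrier = {u. Poly_Mapping.keys u \<subseteq> iso_class ` {X :: 'k scheme. variety X}},
     monoid.mult = (\<lambda>u v. frag_extend (\<lambda>A. frag_extend (class_mult A) v) u),
     one = frag_of (iso_class (Spec (field_ring :: 'k ring) (\<lambda>c::'k. c))),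
     zero = 0,
     add = (+)\<rparr>"

text \<open>The ideal generated by the elements \<open>[X] - [Z] - [X \<setminus> Z]\<close>, for closed subschemes \<open>Z\<close> of \<open>X\<close>;
  here \<open>U\<close> is any variety isomorphic to the open subscheme \<open>X \<setminus> Z\<close>.\<close>

inductive_set scissor_ideal :: "('k::field scheme set \<Rightarrow>\<^sub>0 int) set" where
  scissor: "\<lbrakk>variety X; variety Z; variety U; closed_immersion Z X i;
      isomorphic U (open_subspace X (topspace (ktop X) - fst i ` topspace (ktop Z)))\<rbrakk> \<Longrightarrow>
    frag_of (iso_class X) - frag_of (iso_class Z) - frag_of (iso_class U) \<in> scissor_ideal"
| diff: "\<lbrakk>a \<in> scissor_ideal; b \<in> scissor_ideal\<rbrakk> \<Longrightarrow> a - b \<in> scissor_ideal"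
| mult: "\<lbrakk>a \<in> scissor_ideal; u \<in> carrier variety_ring\<rbrakk> \<Longrightarrow> u \<otimes>\<^bsub>variety_ring\<^esub> a \<in> scissor_ideal"

definition K0_Var :: "('k::field scheme set \<Rightarrow>\<^sub>0 int) set ring" where
  "K0_Var = variety_ring Quot scissor_ideal"

definition K0_class :: "('k::field, 'p, 's) kspace \<Rightarrow> ('k scheme set \<Rightarrow>\<^sub>0 int) set" where
  "K0_class X = scissor_ideal +>\<^bsub>variety_ring\<^esub> frag_of (iso_class X)"

definition Lefschetz :: "('k::field scheme set \<Rightarrow>\<^sub>0 int) set" where
  "Lefschetz = K0_class (affine_space 1)"

text \<open>The value of an integer polynomial at an element of a ring.\<close>

definition int_poly_eval :: "'a ring \<Rightarrow> int poly \<Rightarrow> 'a \<Rightarrow> 'a" where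
  "int_poly_eval R f a =
     (\<Oplus>\<^bsub>R\<^esub>i\<in>{..Polynomial.degree f}. [Polynomial.coeff f i] \<cdot>\<^bsub>R\<^esub> (a [^]\<^bsub>R\<^esub> i))"

section \<open>Graph hypersurfaces\<close>

text \<open>A finite simple graph is a pair of a vertex set and a set of two-element sets of vertices.\<close>

definition graph_connected :: "'v set \<Rightarrow> 'v set set \<Rightarrow> bool" where
  "graph_connected V E \<longleftrightarrow> V \<noteq> {} \<and> (\<forall>u\<in>V. \<forall>v\<in>V. (\<lambda>x y. {x, y} \<in> E)\<^sup>*\<^sup>* u v)"

definition graph_acyclic :: "'v set set \<Rightarrow> bool" where
  "graph_acyclic E \<longleftrightarrow> \<not> (\<exists>c. 3 \<le> length c \<and> distinct c \<and>
     (\<forall>i<length c. {c ! i, c ! (Suc i mod length c)} \<in> E))"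

definition spanning_trees :: "'v set \<times> 'v set set \<Rightarrow> 'v set set set" where
  "spanning_trees G = {T. T \<subseteq> snd G \<and> graph_connected (fst G) T \<and> graph_acyclic T}"

definition graph_poly :: "'v set \<times> 'v set set \<Rightarrow> ('v set, 'k::field) mpoly" where
  "graph_poly G = (\<Sum>T\<in>spanning_trees G. \<Prod>e\<in>snd G - T. poly_var e)"

definition graph_class :: "'v set \<times> 'v set set \<Rightarrow> ('k::field scheme set \<Rightarrow>\<^sub>0 int) set" where
  "graph_class G = K0_class (hypersurface (snd G) (graph_poly G))"

definition zigzag :: "nat \<Rightarrow> nat set \<times> nat set set" where
  "zigzag n = ({1..n+1}, {{i, i+1} |i. 1 \<le> i \<and> i \<le> n} \<union> {{i, i+2} |i. 1 \<le> i \<and> i \<le> n-1} \<union> {{1, n+1}})"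

section \<open>The generating function\<close>

definition P_poly :: "'a::comm_ring_1 \<Rightarrow> 'a \<Rightarrow> 'a" where
  "P_poly x y = x*(x-1)^3*y^5 + (x-1)*(2*x^3-3*x^2+x+1)*y^4 + (x-1)*(x^3-3*x^2+2*x+1)*y^3
     - (3*x^3-3*x^2+2)*y^2 - (x^3-x^2+1)*y + x^2+x+1"

text \<open>Power series in \<open>t\<close> over the polynomial ring in one indeterminate \<open>L\<close> over the integers. For a
  power series \<open>D\<close> with constant term 1, \<open>fps_left_inverse D 1\<close> is the inverse of \<open>D\<close>.\<close>

definition zigzag_series :: "int poly fps" where
  "zigzag_series = (let L = fps_const [:0, 1:]; M = L - 1; t = fps_X in
     fps_left_inverse (1 - L^2*t) 1
     - M^2 * L^2 * t^3 * P_poly L (L*t)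
       * fps_left_inverse ((1 - M*L*t - M*L^2*t^2)^2 * (1 - t - M^2*L*t^2)) 1)"

end

theory Submission
  imports Defs 
begin

text \<open>
  The graph polynomial \<open>\<Psi>\<close> of a graph is the determinant of the Gram matrix of a basis of its cycle space, with respect to
  the form in which the edges are orthogonal and the edge \<open>e\<close> has square length \<open>\<alpha>\<^sub>e\<close>. The
  zig-zag graph is a strip of \<open>n - 1\<close> triangles, each of which shares an edge with the next, together with an
  edge that closes the path through all vertices of the strip to a cycle. For this
  basis the Gram matrix is tridiagonal with one more row and column for this long cycle, and each diagonal entry
  contains an indeterminate of its own. After a linear change of coordinates one has to find
  the class of the locus where a generic matrix of this shape, with a border that is determined by the
  off-diagonal entries, has a non-zero determinant (\<open>bordered_det\<close>).

  That the graph polynomial is this determinant (\<open>zigzag_poly\<close>) is shown by deletion and contraction: removing the first vertex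
  of the strip relates five sums over spanning trees, for the ways in which the first two
  vertices and the last one are merged, to those of a shorter strip (\<open>strip_sums\<close>).

  The class of the locus is found by elimination, starting with the first diagonal entry \<open>p\<close>. Where \<open>p\<close> is
  invertible, a Gauss step leaves a matrix of the same shape with one row less; where \<open>p = 0\<close>, the off-diagonal
  entry \<open>y\<close> next to it serves as a pivot for two rows, or else only the tridiagonal part
  is left. The entry that borders the first row is \<open>y + r\<close>, where \<open>r\<close> is initially the first edge of the path. A
  Gauss step changes \<open>r\<close>, and the answer depends on whether the new value vanishes or is a unit; so there are two
  sequences of classes, next to that of the tridiagonal determinants, and they satisfy
  linear recursions with coefficients in \<open>\<int>[L]\<close> (\<open>path_class\<close>, \<open>border_class_step\<close>). Solving them gives
  the rational function (\<open>zigzag_series_coeff\<close>).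

  All this uses only a few properties of classes of the open sets \<open>g \<noteq> 0\<close> in an affine space: cutting along
  a coordinate hyperplane (\<open>open_class_scissor\<close>), a change of one coordinate that is affine with an
  invertible factor (\<open>open_class_subst\<close>), and the effect of free and of invertible coordinates (\<open>open_class_free\<close>,
  \<open>open_class_unit\<close>). They hold in the Grothendieck ring because such sets are affine, with
  one more coordinate and the equation \<open>s g = 1\<close> (\<open>principal_open\<close>), because polynomial substitutions that are mutually
  inverse modulo the equations give isomorphisms (\<open>subst_isomorphic\<close>), and because affine
  schemes have the expected products and diagonals (\<open>product_universal\<close>, \<open>zero_scheme_variety\<close>). Behind these is the universal
  property of spectra among locally ringed spaces (\<open>to_spec_morphism\<close>, \<open>mor_eq_specI\<close>).
\<close>

section \<open>Localization of commutative rings\<close>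

lemma (in cring) unitI:
  assumes "a \<in> carrier R" "b \<in> carrier R" "a \<otimes> b = \<one>"
  shows "a \<in> Units R"
  using assms m_comm[of a b] by (auto simp: Units_def intro!: bexI[of _ b])

locale mult_set = cring A for A :: "'a ring" (structure) +
  fixes S
  assumes S_sub: "S \<subseteq> carrier A" and S_one: "\<one> \<in> S"
    and S_mult: "\<lbrakk>s \<in> S; t \<in> S\<rbrakk> \<Longrightarrow> s \<otimes> t \<in> S"
begin

abbreviation frac where "frac \<equiv> fraction A S"
abbreviation loc where "loc \<equiv> localization A S"

lemma S_carr [simp]: "s \<in> S \<Longrightarrow> s \<in> carrier A"
  using S_sub by blast

declare S_one [simp] S_mult [simp]

lemma frac_subset:
  assumes "a \<in> carrier A" "b \<in> carrier A" "s \<in> S" "t \<in> S" "u \<in> S"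
    and e: "u \<otimes> (a \<otimes> t) = u \<otimes> (b \<otimes> s)"
  shows "frac b t \<subseteq> frac a s"
proof (clarsimp simp: fraction_def)
  fix c r v assume c: "c \<in> carrier A" "r \<in> S" "v \<in> S" "v \<otimes> (b \<otimes> r) = v \<otimes> (c \<otimes> t)"
  have "(u \<otimes> v \<otimes> t) \<otimes> (a \<otimes> r) = (v \<otimes> r) \<otimes> (u \<otimes> (a \<otimes> t))"
    using assms(1-5) c(1-3) by (simp add: m_ac)
  also have "\<dots> = (u \<otimes> s) \<otimes> (v \<otimes> (b \<otimes> r))" unfolding e using assms(1-5) c(1-3) by (simp add: m_ac)
  also have "\<dots> = (u \<otimes> v \<otimes> t) \<otimes> (c \<otimes> s)" unfolding c(4) using assms(1-5) c(1-3) by (simp add: m_ac)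
  finally show "\<exists>u\<in>S. u \<otimes> (a \<otimes> r) = u \<otimes> (c \<otimes> s)"
    using assms(3-5) c(3) by (intro bexI[of _ "u \<otimes> v \<otimes> t"]) auto
qed

lemma frac_eq_iff:
  assumes "a \<in> carrier A" "b \<in> carrier A" "s \<in> S" "t \<in> S"
  shows "frac a s = frac b t \<longleftrightarrow> (\<exists>u\<in>S. u \<otimes> (a \<otimes> t) = u \<otimes> (b \<otimes> s))"
proof
  assume eq: "frac a s = frac b t"
  have "(b, t) \<in> frac b t" using assms S_one by (auto simp: fraction_def)
  then have "(b, t) \<in> frac a s" using eq by simp
  then show "\<exists>u\<in>S. u \<otimes> (a \<otimes> t) = u \<otimes> (b \<otimes> s)" by (simp add: fraction_def)
next
  assume "\<exists>u\<in>S. u \<otimes> (a \<otimes> t) = u \<otimes> (b \<otimes> s)"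
  then obtain u where "u \<in> S" "u \<otimes> (a \<otimes> t) = u \<otimes> (b \<otimes> s)" by blast
  then show "frac a s = frac b t"
    using frac_subset[of a b s t u] frac_subset[of b a t s u] assms by auto
qed

lemma frac_eqI:
  assumes "a \<in> carrier A" "b \<in> carrier A" "s \<in> S" "t \<in> S" "a \<otimes> t = b \<otimes> s"
  shows "frac a s = frac b t"
  unfolding frac_eq_iff[OF assms(1-4)] using assms by (intro bexI[of _ \<one>]) auto

lemma mem_frac:
  assumes "a \<in> carrier A" "s \<in> S"
  shows "(b, t) \<in> frac a s \<longleftrightarrow> b \<in> carrier A \<and> t \<in> S \<and> frac b t = frac a s"
  using frac_eq_iff[of a b s t] assms by (auto simp: fraction_def)

lemma frac_self: "\<lbrakk>a \<in> carrier A; s \<in> S\<rbrakk> \<Longrightarrow> (a, s) \<in> frac a s"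
  by (simp add: mem_frac)

lemma frac_cancel:
  assumes "a \<in> carrier A" "s \<in> S" "t \<in> S"
  shows "frac (a \<otimes> t) (s \<otimes> t) = frac a s"
  using assms by (intro frac_eqI) (auto simp: m_ac)

lemma loc_carrier: "carrier loc = {frac a s |a s. a \<in> carrier A \<and> s \<in> S}"
  by (simp add: localization_def)

lemma frac_in_loc [simp]: "\<lbrakk>a \<in> carrier A; s \<in> S\<rbrakk> \<Longrightarrow> frac a s \<in> carrier loc"
  by (auto simp: loc_carrier)

lemma loc_cases [consumes 1]:
  assumes "x \<in> carrier loc"
  obtains a s where "a \<in> carrier A" "s \<in> S" "x = frac a s"
  using assms by (auto simp: loc_carrier)

lemma loc_one: "\<one>\<^bsub>loc\<^esub> = frac \<one> \<one>" and loc_zero: "\<zero>\<^bsub>loc\<^esub> = frac \<zero> \<one>"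
  by (simp_all add: localization_def)

text \<open>The operations of the localization are unions over all representatives of the two fractions; such
  a union is a single fraction when the operation is compatible with equality of fractions.\<close>

lemma UN_frac:
  assumes "a \<in> carrier A" "s \<in> S" "b \<in> carrier A" "t \<in> S"
    and "\<And>a' s' b' t'. \<lbrakk>a' \<in> carrier A; s' \<in> S; b' \<in> carrier A; t' \<in> S; frac a' s' = frac a s;
      frac b' t' = frac b t\<rbrakk> \<Longrightarrow> f a' s' b' t' = f a s b t"
  shows "(\<Union>(a, s)\<in>frac a s. \<Union>(b, t)\<in>frac b t. f a s b t) = f a s b t"
proof -
  have 1: "f a' s' b' t' = f a s b t" if "(a', s') \<in> frac a s" "(b', t') \<in> frac b t" for a' s' b' t'
    by (rule assms(5)) (use that assms(1-4) in \<open>simp_all add: mem_frac\<close>)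
  have 2: "(\<Union>(b, t)\<in>frac b t. f a' s' b t) = f a s b t" if "(a', s') \<in> frac a s" for a' s'
    by (rule UN_constant_eq[OF frac_self[OF assms(3,4)]]) (clarify, rule 1[OF that], assumption)
  show ?thesis
    by (rule UN_constant_eq[OF frac_self[OF assms(1,2)]]) (clarify, rule 2, assumption)
qed

lemma loc_mult [simp]:
  assumes "a \<in> carrier A" "s \<in> S" "b \<in> carrier A" "t \<in> S"
  shows "frac a s \<otimes>\<^bsub>loc\<^esub> frac b t = frac (a \<otimes> b) (s \<otimes> t)"
proof -
  have 1: "frac (a' \<otimes> b') (s' \<otimes> t') = frac (a \<otimes> b) (s \<otimes> t)"
    if h: "a' \<in> carrier A" "s' \<in> S" "b' \<in> carrier A" "t' \<in> S" "frac a' s' = frac a s"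
      "frac b' t' = frac b t" for a' s' b' t'
  proof -
    obtain u v where u: "u \<in> S" "u \<otimes> (a' \<otimes> s) = u \<otimes> (a \<otimes> s')"
      and v: "v \<in> S" "v \<otimes> (b' \<otimes> t) = v \<otimes> (b \<otimes> t')"
      using h assms by (auto simp: frac_eq_iff)
    have "(u \<otimes> v) \<otimes> ((a' \<otimes> b') \<otimes> (s \<otimes> t)) = (u \<otimes> (a' \<otimes> s)) \<otimes> (v \<otimes> (b' \<otimes> t))"
      using h(1-4) u(1) v(1) assms by (simp add: m_ac)
    also have "\<dots> = (u \<otimes> v) \<otimes> ((a \<otimes> b) \<otimes> (s' \<otimes> t'))"
      unfolding u(2) v(2) using h(1-4) u(1) v(1) assms by (simp add: m_ac)
    finally show ?thesis using h(1-4) assms u(1) v(1) by (subst frac_eq_iff) (auto intro!: bexI[of _ "u \<otimes> v"])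
  qed
  have "(\<Union>(a, s)\<in>frac a s. \<Union>(b, t)\<in>frac b t. frac (a \<otimes> b) (s \<otimes> t)) = frac (a \<otimes> b) (s \<otimes> t)"
    by (rule UN_frac[where f = "\<lambda>a s b t. frac (a \<otimes> b) (s \<otimes> t)", OF assms]) (rule 1)
  then show ?thesis by (simp add: localization_def)
qed

lemma loc_add [simp]:
  assumes "a \<in> carrier A" "s \<in> S" "b \<in> carrier A" "t \<in> S"
  shows "frac a s \<oplus>\<^bsub>loc\<^esub> frac b t = frac (a \<otimes> t \<oplus> b \<otimes> s) (s \<otimes> t)"
proof -
  have 1: "frac (a' \<otimes> t' \<oplus> b' \<otimes> s') (s' \<otimes> t') = frac (a \<otimes> t \<oplus> b \<otimes> s) (s \<otimes> t)"
    if h: "a' \<in> carrier A" "s' \<in> S" "b' \<in> carrier A" "t' \<in> S" "frac a' s' = frac a s"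
      "frac b' t' = frac b t" for a' s' b' t'
  proof -
    obtain u v where u: "u \<in> S" "u \<otimes> (a' \<otimes> s) = u \<otimes> (a \<otimes> s')"
      and v: "v \<in> S" "v \<otimes> (b' \<otimes> t) = v \<otimes> (b \<otimes> t')"
      using h assms by (auto simp: frac_eq_iff)
    have "(u \<otimes> v) \<otimes> ((a' \<otimes> t' \<oplus> b' \<otimes> s') \<otimes> (s \<otimes> t))
        = (u \<otimes> (a' \<otimes> s)) \<otimes> (v \<otimes> (t \<otimes> t')) \<oplus> (v \<otimes> (b' \<otimes> t)) \<otimes> (u \<otimes> (s \<otimes> s'))"
      using h(1-4) u(1) v(1) assms by (simp add: m_ac l_distr r_distr)
    also have "\<dots> = (u \<otimes> v) \<otimes> ((a \<otimes> t \<oplus> b \<otimes> s) \<otimes> (s' \<otimes> t'))"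
      unfolding u(2) v(2) using h(1-4) u(1) v(1) assms by (simp add: m_ac l_distr r_distr)
    finally have e: "(u \<otimes> v) \<otimes> ((a' \<otimes> t' \<oplus> b' \<otimes> s') \<otimes> (s \<otimes> t))
      = (u \<otimes> v) \<otimes> ((a \<otimes> t \<oplus> b \<otimes> s) \<otimes> (s' \<otimes> t'))" .
    show ?thesis
      by (subst frac_eq_iff) (use h(1-4) assms u(1) v(1) e in \<open>auto intro!: bexI[of _ "u \<otimes> v"]\<close>)
  qed
  have "(\<Union>(a, s)\<in>frac a s. \<Union>(b, t)\<in>frac b t. frac (a \<otimes> t \<oplus> b \<otimes> s) (s \<otimes> t))
      = frac (a \<otimes> t \<oplus> b \<otimes> s) (s \<otimes> t)"
    by (rule UN_frac[where f = "\<lambda>a s b t. frac (a \<otimes> t \<oplus> b \<otimes> s) (s \<otimes> t)", OF assms]) (rule 1)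
  then show ?thesis by (simp add: localization_def)
qed

lemma loc_add_same:
  assumes "a \<in> carrier A" "s \<in> S" "b \<in> carrier A"
  shows "frac a s \<oplus>\<^bsub>loc\<^esub> frac b s = frac (a \<oplus> b) s"
proof -
  have "frac ((a \<oplus> b) \<otimes> s) (s \<otimes> s) = frac (a \<oplus> b) s" using assms by (intro frac_cancel) auto
  then show ?thesis using assms by (simp add: l_distr)
qed

lemma loc_cring: "cring loc"
proof (rule cringI)
  show "abelian_group loc"
  proof (rule abelian_groupI)
    fix x y z assume "x \<in> carrier loc" "y \<in> carrier loc" "z \<in> carrier loc"
    then obtain a s b t c r where [simp]: "a \<in> carrier A" "s \<in> S" "b \<in> carrier A" "t \<in> S"
      "c \<in> carrier A" "r \<in> S" and xyz: "x = frac a s" "y = frac b t" "z = frac c r"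
      by (auto elim!: loc_cases)
    show "x \<oplus>\<^bsub>loc\<^esub> y \<in> carrier loc" by (simp add: xyz)
    show "x \<oplus>\<^bsub>loc\<^esub> y \<oplus>\<^bsub>loc\<^esub> z = x \<oplus>\<^bsub>loc\<^esub> (y \<oplus>\<^bsub>loc\<^esub> z)"
      by (simp add: xyz) (intro frac_eqI; simp add: m_ac a_ac l_distr r_distr)
    show "x \<oplus>\<^bsub>loc\<^esub> y = y \<oplus>\<^bsub>loc\<^esub> x"
      by (simp add: xyz) (intro frac_eqI; simp add: m_ac a_ac l_distr r_distr)
    show "\<zero>\<^bsub>loc\<^esub> \<oplus>\<^bsub>loc\<^esub> x = x" by (simp add: xyz loc_zero)
    have "frac (\<ominus> a) s \<oplus>\<^bsub>loc\<^esub> x = \<zero>\<^bsub>loc\<^esub>"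
      by (simp add: xyz loc_zero loc_add_same l_neg del: loc_add) (intro frac_eqI; simp add: l_neg)
    then show "\<exists>y\<in>carrier loc. y \<oplus>\<^bsub>loc\<^esub> x = \<zero>\<^bsub>loc\<^esub>" by (rule bexI) simp
  qed (simp add: loc_zero)
  show "comm_monoid loc"
  proof (rule comm_monoidI)
    fix x y z assume "x \<in> carrier loc" "y \<in> carrier loc" "z \<in> carrier loc"
    then obtain a s b t c r where [simp]: "a \<in> carrier A" "s \<in> S" "b \<in> carrier A" "t \<in> S"
      "c \<in> carrier A" "r \<in> S" and xyz: "x = frac a s" "y = frac b t" "z = frac c r"
      by (auto elim!: loc_cases)
    show "x \<otimes>\<^bsub>loc\<^esub> y \<in> carrier loc" by (simp add: xyz)
    show "x \<otimes>\<^bsub>loc\<^esub> y \<otimes>\<^bsub>loc\<^esub> z = x \<otimes>\<^bsub>loc\<^esub> (y \<otimes>\<^bsub>loc\<^esub> z)" by (simp add: xyz m_assoc)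
    show "x \<otimes>\<^bsub>loc\<^esub> y = y \<otimes>\<^bsub>loc\<^esub> x" by (simp add: xyz m_comm)
    show "\<one>\<^bsub>loc\<^esub> \<otimes>\<^bsub>loc\<^esub> x = x" by (simp add: xyz loc_one)
  qed (simp add: loc_one)
  fix x y z assume "x \<in> carrier loc" "y \<in> carrier loc" "z \<in> carrier loc"
  then obtain a s b t c r where [simp]: "a \<in> carrier A" "s \<in> S" "b \<in> carrier A" "t \<in> S"
    "c \<in> carrier A" "r \<in> S" and xyz: "x = frac a s" "y = frac b t" "z = frac c r"
    by (auto elim!: loc_cases)
  show "(x \<oplus>\<^bsub>loc\<^esub> y) \<otimes>\<^bsub>loc\<^esub> z = x \<otimes>\<^bsub>loc\<^esub> z \<oplus>\<^bsub>loc\<^esub> y \<otimes>\<^bsub>loc\<^esub> z"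
    by (simp add: xyz) (intro frac_eqI; simp add: m_ac a_ac l_distr r_distr)
qed

lemma loc_hom: "(\<lambda>a. frac a \<one>) \<in> ring_hom A loc"
  by (rule ring_hom_memI) (auto simp: loc_one)

lemma frac_unit: 
  assumes "s \<in> S" "t \<in> S"
  shows "frac s t \<in> Units loc"
proof -
  interpret L: cring loc by (rule loc_cring)
  have "frac t s \<otimes>\<^bsub>loc\<^esub> frac s t = \<one>\<^bsub>loc\<^esub>"
    using assms by (simp add: loc_one) (intro frac_eqI; simp add: m_ac)
  then show ?thesis using assms L.m_comm[of "frac t s" "frac s t"]
    by (intro L.unitI[of _ "frac t s"]) auto
qed

lemma frac_split:
  assumes "a \<in> carrier A" "s \<in> S"
  shows "frac a s = frac a \<one> \<otimes>\<^bsub>loc\<^esub> inv\<^bsub>loc\<^esub> (frac s \<one>)"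
proof -
  interpret L: cring loc by (rule loc_cring)
  have "frac s \<one> \<otimes>\<^bsub>loc\<^esub> frac \<one> s = \<one>\<^bsub>loc\<^esub>"
    using assms by (simp add: loc_one) (intro frac_eqI; simp add: m_ac)
  then have "inv\<^bsub>loc\<^esub> (frac s \<one>) = frac \<one> s"
    using assms by (intro L.comm_inv_char) auto
  then show ?thesis using assms by simp
qed

declare S_carr [simp del]

end

text \<open>The homomorphism out of a localization that is induced by \<open>\<chi>\<close>; it does not depend on the
  representative that the choice operator picks as soon as \<open>\<chi>\<close> maps the denominators to units.\<close>

definition loc_lift :: "'b ring \<Rightarrow> ('a \<Rightarrow> 'b) \<Rightarrow> ('a \<times> 'a) set \<Rightarrow> 'b" where
  "loc_lift R \<chi> x = (case SOME z. z \<in> x of (a, s) \<Rightarrow> \<chi> a \<otimes>\<^bsub>R\<^esub> inv\<^bsub>R\<^esub> (\<chi> s))"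

locale loc_hom = mult_set A S + R: cring R for A :: "'a ring" (structure) and S and R :: "'b ring" +
  fixes \<chi>
  assumes chi_hom: "\<chi> \<in> ring_hom A R" and chi_units: "s \<in> S \<Longrightarrow> \<chi> s \<in> Units R"
begin

declare S_carr [simp]

lemma chi_closed [simp]: "a \<in> carrier A \<Longrightarrow> \<chi> a \<in> carrier R"
  using chi_hom by (rule ring_hom_closed)

lemmas chi_simps = ring_hom_mult[OF chi_hom] ring_hom_add[OF chi_hom] ring_hom_one[OF chi_hom]

declare chi_units [simp]

lemma lift_frac:
  assumes "a \<in> carrier A" "s \<in> S"
  shows "loc_lift R \<chi> (frac a s) = \<chi> a \<otimes>\<^bsub>R\<^esub> inv\<^bsub>R\<^esub> (\<chi> s)"
proof -
  obtain b t where bt: "(SOME z. z \<in> frac a s) = (b, t)" by fastforce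
  have "(b, t) \<in> frac a s" using someI[of "\<lambda>z. z \<in> frac a s", OF frac_self[OF assms]] bt by simp
  then obtain u where u: "b \<in> carrier A" "t \<in> S" "u \<in> S" "u \<otimes> (a \<otimes> t) = u \<otimes> (b \<otimes> s)"
    by (auto simp: fraction_def)
  have "\<chi> (u \<otimes> (a \<otimes> t)) = \<chi> (u \<otimes> (b \<otimes> s))" using u by simp
  then have "\<chi> u \<otimes>\<^bsub>R\<^esub> (\<chi> a \<otimes>\<^bsub>R\<^esub> \<chi> t) = \<chi> u \<otimes>\<^bsub>R\<^esub> (\<chi> b \<otimes>\<^bsub>R\<^esub> \<chi> s)"
    using u(1-3) assms by (simp add: chi_simps)
  then have e: "\<chi> a \<otimes>\<^bsub>R\<^esub> \<chi> t = \<chi> b \<otimes>\<^bsub>R\<^esub> \<chi> s"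
    using u(1-3) assms by (subst (asm) R.Units_l_cancel) auto
  have "\<chi> a \<otimes>\<^bsub>R\<^esub> inv\<^bsub>R\<^esub> (\<chi> s) = (\<chi> a \<otimes>\<^bsub>R\<^esub> \<chi> t) \<otimes>\<^bsub>R\<^esub> (inv\<^bsub>R\<^esub> (\<chi> s) \<otimes>\<^bsub>R\<^esub> inv\<^bsub>R\<^esub> (\<chi> t))"
  proof -
    have "(\<chi> a \<otimes>\<^bsub>R\<^esub> \<chi> t) \<otimes>\<^bsub>R\<^esub> (inv\<^bsub>R\<^esub> (\<chi> s) \<otimes>\<^bsub>R\<^esub> inv\<^bsub>R\<^esub> (\<chi> t))
      = \<chi> a \<otimes>\<^bsub>R\<^esub> inv\<^bsub>R\<^esub> (\<chi> s) \<otimes>\<^bsub>R\<^esub> (\<chi> t \<otimes>\<^bsub>R\<^esub> inv\<^bsub>R\<^esub> (\<chi> t))"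
      using u(1-3) assms by (simp add: R.m_ac del: R.Units_r_inv)
    then show ?thesis using u(1-3) assms by simp
  qed
  also have "\<dots> = \<chi> b \<otimes>\<^bsub>R\<^esub> inv\<^bsub>R\<^esub> (\<chi> t) \<otimes>\<^bsub>R\<^esub> (\<chi> s \<otimes>\<^bsub>R\<^esub> inv\<^bsub>R\<^esub> (\<chi> s))"
    unfolding e using u(1-3) assms by (simp add: R.m_ac del: R.Units_r_inv)
  also have "\<dots> = \<chi> b \<otimes>\<^bsub>R\<^esub> inv\<^bsub>R\<^esub> (\<chi> t)" using u(1-3) assms by simp
  finally show ?thesis by (simp add: loc_lift_def bt)
qed

lemma lift_frac_one: "a \<in> carrier A \<Longrightarrow> loc_lift R \<chi> (frac a \<one>) = \<chi> a"
  by (simp add: lift_frac chi_simps)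

lemma inv_chi_mult: 
  assumes "s \<in> S" "t \<in> S" 
  shows "inv\<^bsub>R\<^esub> (\<chi> (s \<otimes> t)) = inv\<^bsub>R\<^esub> (\<chi> s) \<otimes>\<^bsub>R\<^esub> inv\<^bsub>R\<^esub> (\<chi> t)"
proof (rule R.comm_inv_char)
  have "\<chi> (s \<otimes> t) \<otimes>\<^bsub>R\<^esub> (inv\<^bsub>R\<^esub> (\<chi> s) \<otimes>\<^bsub>R\<^esub> inv\<^bsub>R\<^esub> (\<chi> t)) =
    (\<chi> s \<otimes>\<^bsub>R\<^esub> inv\<^bsub>R\<^esub> (\<chi> s)) \<otimes>\<^bsub>R\<^esub> (\<chi> t \<otimes>\<^bsub>R\<^esub> inv\<^bsub>R\<^esub> (\<chi> t))"
    using assms by (simp add: chi_simps R.m_ac del: R.Units_r_inv)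
  then show "\<chi> (s \<otimes> t) \<otimes>\<^bsub>R\<^esub> (inv\<^bsub>R\<^esub> (\<chi> s) \<otimes>\<^bsub>R\<^esub> inv\<^bsub>R\<^esub> (\<chi> t)) = \<one>\<^bsub>R\<^esub>" using assms by simp
qed (use assms in auto)

lemma lift_hom: "loc_lift R \<chi> \<in> ring_hom loc R"
proof (rule ring_hom_memI)
  fix x assume "x \<in> carrier loc"
  then obtain a s where [simp]: "a \<in> carrier A" "s \<in> S" and x: "x = frac a s" by (rule loc_cases)
  show "loc_lift R \<chi> x \<in> carrier R" by (simp add: x lift_frac)
  fix y assume "y \<in> carrier loc"
  then obtain b t where [simp]: "b \<in> carrier A" "t \<in> S" and y: "y = frac b t" by (rule loc_cases)
  show "loc_lift R \<chi> (x \<otimes>\<^bsub>loc\<^esub> y) = loc_lift R \<chi> x \<otimes>\<^bsub>R\<^esub> loc_lift R \<chi> y"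
    by (simp add: x y lift_frac inv_chi_mult) (simp add: chi_simps R.m_ac)
  have "(\<chi> a \<otimes>\<^bsub>R\<^esub> \<chi> t) \<otimes>\<^bsub>R\<^esub> (inv\<^bsub>R\<^esub> (\<chi> s) \<otimes>\<^bsub>R\<^esub> inv\<^bsub>R\<^esub> (\<chi> t))
      = \<chi> a \<otimes>\<^bsub>R\<^esub> inv\<^bsub>R\<^esub> (\<chi> s) \<otimes>\<^bsub>R\<^esub> (\<chi> t \<otimes>\<^bsub>R\<^esub> inv\<^bsub>R\<^esub> (\<chi> t))"
     "(\<chi> b \<otimes>\<^bsub>R\<^esub> \<chi> s) \<otimes>\<^bsub>R\<^esub> (inv\<^bsub>R\<^esub> (\<chi> s) \<otimes>\<^bsub>R\<^esub> inv\<^bsub>R\<^esub> (\<chi> t))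
      = \<chi> b \<otimes>\<^bsub>R\<^esub> inv\<^bsub>R\<^esub> (\<chi> t) \<otimes>\<^bsub>R\<^esub> (\<chi> s \<otimes>\<^bsub>R\<^esub> inv\<^bsub>R\<^esub> (\<chi> s))"
    by (simp_all add: R.m_ac del: R.Units_r_inv)
  then show "loc_lift R \<chi> (x \<oplus>\<^bsub>loc\<^esub> y) = loc_lift R \<chi> x \<oplus>\<^bsub>R\<^esub> loc_lift R \<chi> y"
    by (simp add: x y lift_frac inv_chi_mult) (simp add: chi_simps R.l_distr)
qed (simp add: loc_one lift_frac_one chi_simps)

declare S_carr [simp del]

end

lemma ring_hom_inv_eq:
  assumes "cring A" "cring R" "\<phi> \<in> ring_hom A R" "a \<in> Units A"
  shows "\<phi> a \<in> Units R" "\<phi> (inv\<^bsub>A\<^esub> a) = inv\<^bsub>R\<^esub> (\<phi> a)"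
proof -
  interpret A: cring A by fact
  interpret R: cring R by fact
  have c: "a \<in> carrier A" "inv\<^bsub>A\<^esub> a \<in> carrier A" using assms(4) by auto
  have e: "\<phi> a \<otimes>\<^bsub>R\<^esub> \<phi> (inv\<^bsub>A\<^esub> a) = \<one>\<^bsub>R\<^esub>"
    using ring_hom_mult[OF assms(3) c] assms by (simp add: ring_hom_one[OF assms(3)])
  have c': "\<phi> a \<in> carrier R" "\<phi> (inv\<^bsub>A\<^esub> a) \<in> carrier R" using c assms(3) by (auto simp: ring_hom_closed)
  show "\<phi> a \<in> Units R" using c' e by (rule R.unitI)
  show "\<phi> (inv\<^bsub>A\<^esub> a) = inv\<^bsub>R\<^esub> (\<phi> a)" using R.comm_inv_char[OF c' e] by simp
qed

text \<open>A homomorphism out of a localization is determined by its values on the original ring.\<close>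

lemma (in mult_set) loc_hom_eq:
  assumes "cring R" "\<phi> \<in> ring_hom loc R" "x \<in> carrier loc"
    and "\<And>a. a \<in> carrier A \<Longrightarrow> \<phi> (frac a \<one>) = \<chi> a"
  shows "\<phi> x = loc_lift R \<chi> x"
proof -
  interpret R: cring R by fact
  obtain a s where as: "a \<in> carrier A" "s \<in> S" and x: "x = frac a s" using assms(3) by (rule loc_cases)
  have un: "\<phi> (frac s \<one>) \<in> Units R" if "s \<in> S" for s
    using ring_hom_inv_eq(1)[OF loc_cring assms(1,2) frac_unit[OF that S_one]] .
  have ch: "\<chi> \<in> ring_hom A R"
  proof -
    have "\<phi> \<circ> (\<lambda>a. frac a \<one>) \<in> ring_hom A R" using loc_hom assms(2) by (rule ring_hom_trans)
    then show ?thesis using assms(4) by (simp add: ring_hom_def Pi_def)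
  qed
  have un': "\<chi> s \<in> Units R" if "s \<in> S" for s
    using un[OF that] assms(4)[OF S_carr[OF that]] by simp
  note sc = S_carr[OF as(2)] S_carr[OF S_one]
  interpret loc_hom A S R \<chi>
    by unfold_locales (rule ch, erule un')
  interpret L: cring loc by (rule loc_cring)
  have "\<phi> (frac a s) = \<phi> (frac a \<one>) \<otimes>\<^bsub>R\<^esub> \<phi> (inv\<^bsub>loc\<^esub> (frac s \<one>))"
    using as sc frac_unit[of s \<one>] ring_hom_mult[OF assms(2)] by (subst frac_split) auto
  also have "\<dots> = \<chi> a \<otimes>\<^bsub>R\<^esub> inv\<^bsub>R\<^esub> (\<chi> s)"
    using as sc frac_unit[of s \<one>] by (simp add: ring_hom_inv_eq(2)[OF loc_cring assms(1,2)] assms(4))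
  finally show ?thesis by (simp only: x lift_frac[OF as])
qed

section \<open>Locally ringed spaces and spectra\<close>

lemma local_ringI:
  assumes "cring R" "\<zero>\<^bsub>R\<^esub> \<notin> Units R"
    and add: "\<And>x y. \<lbrakk>x \<in> carrier R; y \<in> carrier R; x \<notin> Units R; y \<notin> Units R\<rbrakk> \<Longrightarrow> x \<oplus>\<^bsub>R\<^esub> y \<notin> Units R"
  shows "local_ring R"
proof -
  interpret cring R by fact
  have mult: "x \<otimes>\<^bsub>R\<^esub> y \<notin> Units R" if "x \<in> carrier R" "y \<in> carrier R" "x \<notin> Units R" for x y
  proof
    assume u: "x \<otimes>\<^bsub>R\<^esub> y \<in> Units R"
    have "x \<otimes>\<^bsub>R\<^esub> (y \<otimes>\<^bsub>R\<^esub> inv\<^bsub>R\<^esub> (x \<otimes>\<^bsub>R\<^esub> y)) = \<one>\<^bsub>R\<^esub>"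
      using that u by (simp add: m_assoc[symmetric])
    then show False using unitI[of x "y \<otimes>\<^bsub>R\<^esub> inv\<^bsub>R\<^esub> (x \<otimes>\<^bsub>R\<^esub> y)"] that u by simp
  qed
  have "ideal (carrier R - Units R) R"
  proof (rule idealI)
    show "subgroup (carrier R - Units R) (add_monoid R)"
    proof (rule add.subgroupI)
      fix x assume x: "x \<in> carrier R - Units R"
      have "\<ominus>\<^bsub>R\<^esub> x = x \<otimes>\<^bsub>R\<^esub> (\<ominus>\<^bsub>R\<^esub> \<one>\<^bsub>R\<^esub>)" using x by (simp add: r_minus)
      then have "\<ominus>\<^bsub>R\<^esub> x \<notin> Units R" using mult[of x "\<ominus>\<^bsub>R\<^esub> \<one>\<^bsub>R\<^esub>"] x by simp
      then show "\<ominus>\<^bsub>R\<^esub> x \<in> carrier R - Units R" using x by simp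
    qed (use assms in auto)
  qed (use mult m_comm in \<open>auto simp: ring_axioms\<close>)
  then show ?thesis using assms(1) by (simp add: local_ring_def)
qed

lemma local_ring_cring: "local_ring R \<Longrightarrow> cring R"
  by (simp add: local_ring_def)

lemma local_ring_add:
  assumes "local_ring R" "x \<in> carrier R" "y \<in> carrier R" "x \<notin> Units R" "y \<notin> Units R"
  shows "x \<oplus>\<^bsub>R\<^esub> y \<notin> Units R"
proof -
  interpret ideal "carrier R - Units R" R using assms(1) by (simp add: local_ring_def)
  show ?thesis using additive_subgroup.a_closed[OF additive_subgroup_axioms, of x y] assms by auto
qed

lemma local_ring_zero: "local_ring R \<Longrightarrow> \<zero>\<^bsub>R\<^esub> \<notin> Units R"
  using additive_subgroup.zero_closed[of "carrier R - Units R" R]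
  by (auto simp: local_ring_def ideal_def)

abbreviation germ :: "'a ring \<Rightarrow> 'a set \<Rightarrow> 'a \<Rightarrow> 'a \<Rightarrow> ('a \<times> 'a) set" where
  "germ A P \<equiv> fraction A (carrier A - P)"

abbreviation stalk_at :: "'a ring \<Rightarrow> 'a set \<Rightarrow> ('a \<times> 'a) set ring" where
  "stalk_at A P \<equiv> localization A (carrier A - P)"

lemma prime_mult_set:
  assumes "primeideal P A"
  shows "mult_set A (carrier A - P)"
proof -
  interpret primeideal P A by fact
  show ?thesis
    by unfold_locales (use I_notcarr one_imp_carrier I_prime in auto)
qed

lemma germ_unit_iff:
  assumes "primeideal P A" "a \<in> carrier A" "s \<in> carrier A - P"
  shows "germ A P a s \<in> Units (stalk_at A P) \<longleftrightarrow> a \<notin> P"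
proof
  interpret P: primeideal P A by fact
  interpret M: mult_set A "carrier A - P" by (rule prime_mult_set) fact
  interpret L: cring "stalk_at A P" by (rule M.loc_cring)
  show "a \<notin> P \<Longrightarrow> germ A P a s \<in> Units (stalk_at A P)" using assms by (intro M.frac_unit) auto
  assume u: "germ A P a s \<in> Units (stalk_at A P)"
  then have "inv\<^bsub>stalk_at A P\<^esub> germ A P a s \<in> carrier (stalk_at A P)" by simp
  then obtain b t where bt: "b \<in> carrier A" "t \<in> carrier A - P"
    and e: "inv\<^bsub>stalk_at A P\<^esub> germ A P a s = germ A P b t" by (rule M.loc_cases)
  have "germ A P a s \<otimes>\<^bsub>stalk_at A P\<^esub> germ A P b t = \<one>\<^bsub>stalk_at A P\<^esub>"
    using L.Units_r_inv[OF u] by (simp add: e)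
  then have "germ A P (a \<otimes>\<^bsub>A\<^esub> b) (s \<otimes>\<^bsub>A\<^esub> t) = germ A P \<one>\<^bsub>A\<^esub> \<one>\<^bsub>A\<^esub>"
    using M.loc_mult[OF assms(2,3) bt] by (simp only: M.loc_one)
  then obtain u where u: "u \<in> carrier A - P"
    "u \<otimes>\<^bsub>A\<^esub> (a \<otimes>\<^bsub>A\<^esub> b \<otimes>\<^bsub>A\<^esub> \<one>\<^bsub>A\<^esub>) = u \<otimes>\<^bsub>A\<^esub> (\<one>\<^bsub>A\<^esub> \<otimes>\<^bsub>A\<^esub> (s \<otimes>\<^bsub>A\<^esub> t))"
    using M.frac_eq_iff[of "a \<otimes>\<^bsub>A\<^esub> b" "\<one>\<^bsub>A\<^esub>" "s \<otimes>\<^bsub>A\<^esub> t" "\<one>\<^bsub>A\<^esub>"]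
      assms(2,3) bt M.S_one M.S_mult[of s t] by (auto simp del: M.S_one M.S_mult)
  have "u \<otimes>\<^bsub>A\<^esub> (s \<otimes>\<^bsub>A\<^esub> t) \<in> carrier A - P" using u(1) assms bt by (intro M.S_mult) auto
  then show "a \<notin> P" using u bt assms P.I_l_closed[of "a \<otimes>\<^bsub>A\<^esub> b" u] P.I_r_closed[of a b] by auto
qed

lemma stalk_at_local:
  assumes "primeideal P A"
  shows "local_ring (stalk_at A P)"
proof -
  interpret P: primeideal P A by fact
  interpret M: mult_set A "carrier A - P" by (rule prime_mult_set) fact
  note unit = germ_unit_iff[OF assms]
  show ?thesis
  proof (rule local_ringI)
    show "cring (stalk_at A P)" by (rule M.loc_cring)
    show "\<zero>\<^bsub>stalk_at A P\<^esub> \<notin> Units (stalk_at A P)"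
      using M.S_one by (auto simp: M.loc_zero unit)
    fix x y assume xy: "x \<in> carrier (stalk_at A P)" "y \<in> carrier (stalk_at A P)"
      "x \<notin> Units (stalk_at A P)" "y \<notin> Units (stalk_at A P)"
    then obtain a s b t where c: "a \<in> carrier A" "s \<in> carrier A - P" "b \<in> carrier A" "t \<in> carrier A - P"
      "x = germ A P a s" "y = germ A P b t" by (auto elim!: M.loc_cases)
    then have "a \<in> P" "b \<in> P" using xy unit by auto
    then have "a \<otimes>\<^bsub>A\<^esub> t \<oplus>\<^bsub>A\<^esub> b \<otimes>\<^bsub>A\<^esub> s \<in> P" using c by (auto intro!: P.a_closed P.I_r_closed)
    then show "x \<oplus>\<^bsub>stalk_at A P\<^esub> y \<notin> Units (stalk_at A P)"
      using c M.S_mult[of s t] by (simp add: M.loc_add unit del: M.S_mult)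
  qed
qed

text \<open>Uniting families of generators gives unions, and multiplying their members gives intersections of the
  sets in the definition of the Zariski topology; so these sets do form a topology.\<close>

lemma openin_zariski:
  assumes "cring A"
  shows "openin (zariski A) U \<longleftrightarrow> (\<exists>S\<subseteq>carrier A. U = {P \<in> primes A. \<not> S \<subseteq> P})"
proof -
  interpret cring A by fact
  let ?op = "\<lambda>U. \<exists>S. S \<subseteq> carrier A \<and> U = {P \<in> primes A. \<not> S \<subseteq> P}"
  have "istopology ?op"
    unfolding istopology_def
  proof (intro conjI allI impI)
    fix U V assume "?op U" "?op V"
    then obtain S T where S: "S \<subseteq> carrier A" "U = {P \<in> primes A. \<not> S \<subseteq> P}"
      and T: "T \<subseteq> carrier A" "V = {P \<in> primes A. \<not> T \<subseteq> P}" by blast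
    let ?W = "{s \<otimes>\<^bsub>A\<^esub> t |s t. s \<in> S \<and> t \<in> T}"
    have "U \<inter> V = {P \<in> primes A. \<not> ?W \<subseteq> P}"
    proof (intro Set.set_eqI iffI)
      fix P assume "P \<in> U \<inter> V"
      then obtain s t where st: "s \<in> S" "s \<notin> P" "t \<in> T" "t \<notin> P" and P: "P \<in> primes A"
        using S T by auto
      have "s \<otimes>\<^bsub>A\<^esub> t \<notin> P"
        using primeideal.I_prime[of P A s t] P st S T by (auto simp: primes_def)
      then show "P \<in> {P \<in> primes A. \<not> ?W \<subseteq> P}" using P st by blast
    next
      fix P assume "P \<in> {P \<in> primes A. \<not> ?W \<subseteq> P}"
      then obtain s t where st: "s \<in> S" "t \<in> T" "s \<otimes>\<^bsub>A\<^esub> t \<notin> P" and P: "P \<in> primes A" by auto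
      interpret P: primeideal P A using P by (simp add: primes_def)
      have "s \<notin> P" "t \<notin> P" using st S T P.I_l_closed[of t s] P.I_r_closed[of s t] by auto
      then show "P \<in> U \<inter> V" using S T st P by auto
    qed
    moreover have "?W \<subseteq> carrier A" using S T by auto
    ultimately show "?op (U \<inter> V)" by blast
  next
    fix \<K> assume "\<forall>K\<in>\<K>. ?op K"
    then obtain f where f: "\<forall>K\<in>\<K>. f K \<subseteq> carrier A \<and> K = {P \<in> primes A. \<not> f K \<subseteq> P}"
      by (rule bchoice[THEN exE])
    have mem: "P \<in> K \<longleftrightarrow> P \<in> primes A \<and> \<not> f K \<subseteq> P" if "K \<in> \<K>" for K P
      using f[rule_format, OF that] by blast
    have "\<Union>\<K> = {P \<in> primes A. \<not> \<Union>(f ` \<K>) \<subseteq> P}"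
    proof (rule Set.set_eqI)
      fix P show "P \<in> \<Union>\<K> \<longleftrightarrow> P \<in> {P \<in> primes A. \<not> \<Union>(f ` \<K>) \<subseteq> P}"
        using mem by (simp add: UN_subset_iff)
    qed
    moreover have "\<Union>(f ` \<K>) \<subseteq> carrier A" using f by blast
    ultimately show "?op (\<Union>\<K>)" by blast
  qed
  then show ?thesis by (simp add: zariski_def topology_inverse')
qed

lemma topspace_zariski:
  assumes "cring A"
  shows "topspace (zariski A) = primes A"
proof
  show "topspace (zariski A) \<subseteq> primes A"
    using openin_topspace[of "zariski A"] unfolding openin_zariski[OF assms] by blast
  have "openin (zariski A) (primes A)"
    unfolding openin_zariski[OF assms]
  proof (intro exI conjI)
    show "primes A = {P \<in> primes A. \<not> carrier A \<subseteq> P}"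
    proof -
      have "\<not> carrier A \<subseteq> P" if "P \<in> primes A" for P
        using that primeideal.I_notcarr[of P A] ideal.Icarr[of P A] by (auto simp: primes_def primeideal_def)
      then show ?thesis by auto
    qed
  qed simp
  then show "primes A \<subseteq> topspace (zariski A)" by (rule openin_subset)
qed

lemma openin_basic: "cring A \<Longrightarrow> f \<in> carrier A \<Longrightarrow> openin (zariski A) {P \<in> primes A. f \<notin> P}"
  unfolding openin_zariski by (intro exI[of _ "{f}"]) auto

lemma zariski_subset: "cring A \<Longrightarrow> openin (zariski A) U \<Longrightarrow> P \<in> U \<Longrightarrow> primeideal P A"
  using openin_subset[of "zariski A" U] by (auto simp: topspace_zariski primes_def)

locale k_algebra = cring A for A :: "'a ring" (structure) +
  fixes \<iota> :: "'k::field \<Rightarrow> 'a"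
  assumes scalars: "\<iota> \<in> ring_hom field_ring A"

lemma Spec_simps [simp]:
  "ktop (Spec A \<iota>) = zariski A"
  "stalk (Spec A \<iota>) P = stalk_at A P"
  "scal (Spec A \<iota>) P c = germ A P (\<iota> c) \<one>\<^bsub>A\<^esub>"
  by (simp_all add: Spec_def)

lemma Spec_sect: "s \<in> sect (Spec A \<iota>) U \<longleftrightarrow> s \<in> (\<Pi>\<^sub>E P\<in>U. carrier (stalk_at A P)) \<and>
   (\<forall>P\<in>U. \<exists>V a b. openin (zariski A) V \<and> P \<in> V \<and> V \<subseteq> U \<and> a \<in> carrier A \<and> b \<in> carrier A \<and>
         (\<forall>Q\<in>V. b \<notin> Q \<and> s Q = germ A Q a b))"
  by (simp add: Spec_def)

lemma Spec_sectE:
  assumes "s \<in> sect (Spec A \<iota>) U" "P \<in> U"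
  obtains V a b where "openin (zariski A) V" "P \<in> V" "V \<subseteq> U" "a \<in> carrier A" "b \<in> carrier A"
    "\<forall>Q\<in>V. b \<notin> Q \<and> s Q = germ A Q a b"
  using Spec_sect[THEN iffD1, OF assms(1), THEN conjunct2, rule_format, OF assms(2)] by (elim exE conjE)

text \<open>The sheaf axioms are built into the description of the sections as families that locally are fractions.
  What is left is that sums and products of fractions are fractions near each point, and that fractions
  with equal germs at a point agree nearby: the element that witnesses their equality stays outside
  all primes of a principal open set.\<close>

lemma (in k_algebra) Spec_locally_ringed: "locally_ringed (Spec A \<iota>)"
proof (unfold locally_ringed_def Spec_simps, intro conjI allI impI)
  note cr = is_cring
  have ms: "mult_set A (carrier A - Q)" if "openin (zariski A) U" "Q \<in> U" for Q U
    using prime_mult_set[OF zariski_subset[OF cr that]] .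
  fix p assume p: "p \<in> topspace (zariski A)"
  then have pp: "primeideal p A" using topspace_zariski[OF cr] by (auto simp: primes_def)
  interpret M: mult_set A "carrier A - p" by (rule prime_mult_set[OF pp])
  show "local_ring (stalk_at A p)" by (rule stalk_at_local[OF pp])
  show "(\<lambda>c. germ A p (\<iota> c) \<one>) \<in> ring_hom field_ring (stalk_at A p)"
    using ring_hom_trans[OF scalars M.loc_hom] by (simp add: comp_def)
  fix x assume "x \<in> carrier (stalk_at A p)"
  then obtain a s where as: "a \<in> carrier A" "s \<in> carrier A - p" "x = germ A p a s" by (rule M.loc_cases)
  let ?U = "{P \<in> primes A. s \<notin> P}"
  have o: "openin (zariski A) ?U" using as by (intro openin_basic[OF cr]) auto
  have "(\<lambda>P\<in>?U. germ A P a s) \<in> sect (Spec A \<iota>) ?U"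
    unfolding Spec_sect
  proof (intro conjI ballI)
    show "(\<lambda>P\<in>?U. germ A P a s) \<in> (\<Pi>\<^sub>E P\<in>?U. carrier (stalk_at A P))"
      using mult_set.frac_in_loc[OF ms[OF o]] as by auto
  next
    fix P assume "P \<in> ?U"
    note * = this
    show "\<exists>V a' b. openin (zariski A) V \<and> P \<in> V \<and> V \<subseteq> ?U \<and> a' \<in> carrier A \<and> b \<in> carrier A \<and>
        (\<forall>Q\<in>V. b \<notin> Q \<and> (\<lambda>P\<in>?U. germ A P a s) Q = germ A Q a' b)"
      by (rule exI[of _ ?U], rule exI[of _ a], rule exI[of _ s]) (use * o as in \<open>auto\<close>)
  qed
  note * = this
  show "\<exists>U s. openin (zariski A) U \<and> p \<in> U \<and> s \<in> sect (Spec A \<iota>) U \<and> s p = x"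
    by (rule exI[of _ ?U], rule exI[of _ "\<lambda>P\<in>?U. germ A P a s"]) (use * o as p topspace_zariski[OF cr] in \<open>auto\<close>)
next
  fix U assume "openin (zariski A) U"
  show "sect (Spec A \<iota>) U \<subseteq> (\<Pi>\<^sub>E p\<in>U. carrier (stalk_at A p))"
    by (rule subsetI, drule Spec_sect[THEN iffD1], elim conjE, assumption)
next
  note cr = is_cring
  have ms: "mult_set A (carrier A - Q)" if "openin (zariski A) U" "Q \<in> U" for Q U
    using prime_mult_set[OF zariski_subset[OF cr that]] .
  fix U c assume U: "openin (zariski A) U"
  have i: "\<iota> c \<in> carrier A" using ring_hom_closed[OF scalars] by (simp add: field_ring_def)
  show "(\<lambda>p\<in>U. germ A p (\<iota> c) \<one>) \<in> sect (Spec A \<iota>) U"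
    unfolding Spec_sect
  proof (intro conjI ballI)
    show "(\<lambda>p\<in>U. germ A p (\<iota> c) \<one>) \<in> (\<Pi>\<^sub>E P\<in>U. carrier (stalk_at A P))"
      using mult_set.frac_in_loc[OF ms[OF U]] mult_set.S_one[OF ms[OF U]] i by auto
  next
    fix P assume "P \<in> U"
    note * = this
    show "\<exists>V a b. openin (zariski A) V \<and> P \<in> V \<and> V \<subseteq> U \<and> a \<in> carrier A \<and> b \<in> carrier A \<and>
        (\<forall>Q\<in>V. b \<notin> Q \<and> (\<lambda>p\<in>U. germ A p (\<iota> c) \<one>) Q = germ A Q a b)"
      by (rule exI[of _ U], rule exI[of _ "\<iota> c"], rule exI[of _ \<one>]) (use * U i mult_set.S_one[OF ms[OF U]] in \<open>auto\<close>)
  qed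
next
  note cr = is_cring
  have ms: "mult_set A (carrier A - Q)" if "openin (zariski A) U" "Q \<in> U" for Q U
    using prime_mult_set[OF zariski_subset[OF cr that]] .
  fix U s t assume U: "openin (zariski A) U" and s: "s \<in> sect (Spec A \<iota>) U" and t: "t \<in> sect (Spec A \<iota>) U"
  have loc: "\<exists>V a b c d. openin (zariski A) V \<and> P \<in> V \<and> V \<subseteq> U \<and> a \<in> carrier A \<and> b \<in> carrier A \<and>
      c \<in> carrier A \<and> d \<in> carrier A \<and>
      (\<forall>Q\<in>V. b \<notin> Q \<and> d \<notin> Q \<and> s Q = germ A Q a b \<and> t Q = germ A Q c d)" if "P \<in> U" for P
  proof -
    obtain V a b where 1: "openin (zariski A) V" "P \<in> V" "V \<subseteq> U" "a \<in> carrier A" "b \<in> carrier A"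
         "\<forall>Q\<in>V. b \<notin> Q \<and> s Q = germ A Q a b" using s \<open>P \<in> U\<close> by (rule Spec_sectE)
    obtain W c d where 2: "openin (zariski A) W" "P \<in> W" "W \<subseteq> U" "c \<in> carrier A" "d \<in> carrier A"
         "\<forall>Q\<in>W. d \<notin> Q \<and> t Q = germ A Q c d" using t \<open>P \<in> U\<close> by (rule Spec_sectE)
    show ?thesis
      by (rule exI[of _ "V \<inter> W"], rule exI[of _ a], rule exI[of _ b], rule exI[of _ c], rule exI[of _ d]) (use 1 2 in \<open>(auto simp: openin_Int)\<close>)
  qed
  have sc: "s \<in> (\<Pi>\<^sub>E P\<in>U. carrier (stalk_at A P))" "t \<in> (\<Pi>\<^sub>E P\<in>U. carrier (stalk_at A P))"
    using s t by (auto simp: Spec_sect)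
  show "(\<lambda>p\<in>U. s p \<oplus>\<^bsub>stalk_at A p\<^esub> t p) \<in> sect (Spec A \<iota>) U"
    unfolding Spec_sect
  proof (intro conjI ballI)
    show "(\<lambda>p\<in>U. s p \<oplus>\<^bsub>stalk_at A p\<^esub> t p) \<in> (\<Pi>\<^sub>E P\<in>U. carrier (stalk_at A P))"
    proof (rule restrict_PiE_iff[THEN iffD2], rule ballI)
      fix P assume P: "P \<in> U"
      interpret L: cring "stalk_at A P" using mult_set.loc_cring[OF ms[OF U P]] .
      show "s P \<oplus>\<^bsub>stalk_at A P\<^esub> t P \<in> carrier (stalk_at A P)" using sc P by (auto simp: PiE_def)
    qed
    fix P assume P: "P \<in> U"
    obtain V a b c d where V: "openin (zariski A) V" "P \<in> V" "V \<subseteq> U" "a \<in> carrier A" "b \<in> carrier A"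
      "c \<in> carrier A" "d \<in> carrier A"
      "\<forall>Q\<in>V. b \<notin> Q \<and> d \<notin> Q \<and> s Q = germ A Q a b \<and> t Q = germ A Q c d" using loc[OF P] by (elim exE conjE)
    have "b \<otimes> d \<notin> Q \<and> s Q \<oplus>\<^bsub>stalk_at A Q\<^esub> t Q = germ A Q (a \<otimes> d \<oplus> c \<otimes> b) (b \<otimes> d)"
      if "Q \<in> V" for Q
    proof -
      interpret Q: mult_set A "carrier A - Q" using ms[OF V(1) that] .
      show ?thesis using V(4-7) V(8)[rule_format, OF that] Q.S_mult[of b d] by (simp add: Q.loc_add)
    qed
    note * = this
    show "\<exists>V a b. openin (zariski A) V \<and> P \<in> V \<and> V \<subseteq> U \<and> a \<in> carrier A \<and> b \<in> carrier A \<and>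
        (\<forall>Q\<in>V. b \<notin> Q \<and> (\<lambda>p\<in>U. s p \<oplus>\<^bsub>stalk_at A p\<^esub> t p) Q = germ A Q a b)"
      by (rule exI[of _ V], rule exI[of _ "a \<otimes> d \<oplus> c \<otimes> b"], rule exI[of _ "b \<otimes> d"]) (use * V(1-7) in \<open>auto\<close>)
  qed
  show "(\<lambda>p\<in>U. s p \<otimes>\<^bsub>stalk_at A p\<^esub> t p) \<in> sect (Spec A \<iota>) U"
    unfolding Spec_sect
  proof (intro conjI ballI)
    show "(\<lambda>p\<in>U. s p \<otimes>\<^bsub>stalk_at A p\<^esub> t p) \<in> (\<Pi>\<^sub>E P\<in>U. carrier (stalk_at A P))"
    proof (rule restrict_PiE_iff[THEN iffD2], rule ballI)
      fix P assume P: "P \<in> U"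
      interpret L: cring "stalk_at A P" using mult_set.loc_cring[OF ms[OF U P]] .
      show "s P \<otimes>\<^bsub>stalk_at A P\<^esub> t P \<in> carrier (stalk_at A P)" using sc P by (auto simp: PiE_def)
    qed
    fix P assume P: "P \<in> U"
    obtain V a b c d where V: "openin (zariski A) V" "P \<in> V" "V \<subseteq> U" "a \<in> carrier A" "b \<in> carrier A"
      "c \<in> carrier A" "d \<in> carrier A"
      "\<forall>Q\<in>V. b \<notin> Q \<and> d \<notin> Q \<and> s Q = germ A Q a b \<and> t Q = germ A Q c d" using loc[OF P] by (elim exE conjE)
    have "b \<otimes> d \<notin> Q \<and> s Q \<otimes>\<^bsub>stalk_at A Q\<^esub> t Q = germ A Q (a \<otimes> c) (b \<otimes> d)" if "Q \<in> V" for Q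
    proof -
      interpret Q: mult_set A "carrier A - Q" using ms[OF V(1) that] .
      show ?thesis using V(4-7) V(8)[rule_format, OF that] Q.S_mult[of b d] by (simp add: Q.loc_mult)
    qed
    note * = this
    show "\<exists>V a b. openin (zariski A) V \<and> P \<in> V \<and> V \<subseteq> U \<and> a \<in> carrier A \<and> b \<in> carrier A \<and>
        (\<forall>Q\<in>V. b \<notin> Q \<and> (\<lambda>p\<in>U. s p \<otimes>\<^bsub>stalk_at A p\<^esub> t p) Q = germ A Q a b)"
      by (rule exI[of _ V], rule exI[of _ "a \<otimes> c"], rule exI[of _ "b \<otimes> d"]) (use * V(1-7) in \<open>auto\<close>)
  qed
  fix p assume p: "p \<in> U" and eq: "s p = t p"
  obtain V a b c d where V: "openin (zariski A) V" "p \<in> V" "V \<subseteq> U" "a \<in> carrier A" "b \<in> carrier A"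
    "c \<in> carrier A" "d \<in> carrier A"
    "\<forall>Q\<in>V. b \<notin> Q \<and> d \<notin> Q \<and> s Q = germ A Q a b \<and> t Q = germ A Q c d" using loc[OF p] by (elim exE conjE)
  interpret M: mult_set A "carrier A - p" using ms[OF U p] .
  have "germ A p a b = germ A p c d" using V(8)[rule_format, OF V(2)] eq by metis
  then obtain u where u: "u \<in> carrier A - p" "u \<otimes> (a \<otimes> d) = u \<otimes> (c \<otimes> b)"
    using V(4-7) V(8)[rule_format, OF V(2)] by (subst (asm) M.frac_eq_iff) auto
  let ?W = "V \<inter> {P \<in> primes A. u \<notin> P}"
  have W: "openin (zariski A) ?W" using V(1) u(1) openin_basic[OF cr, of u] by (auto intro: openin_Int)
  have "s Q = t Q" if "Q \<in> ?W" for Q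
  proof -
    interpret Q: mult_set A "carrier A - Q" using ms[OF W that] .
    have QV: "Q \<in> V" and uQ: "u \<in> carrier A - Q" using that u(1) by auto
    note vq = V(8)[rule_format, OF QV]
    have "b \<in> carrier A - Q" "d \<in> carrier A - Q" using V(5,7) vq by simp_all
    then have "germ A Q a b = germ A Q c d"
      using Q.frac_eq_iff[OF V(4,6)] uQ u(2) by blast
    then show ?thesis using vq by metis
  qed
  moreover have "u \<notin> p" "p \<in> primes A" using u(1) zariski_subset[OF cr U p] by (auto simp: primes_def)
  ultimately show "\<exists>V. openin (zariski A) V \<and> p \<in> V \<and> V \<subseteq> U \<and> (\<forall>q\<in>V. s q = t q)"
    using W V(2,3) by (intro exI[of _ ?W]) auto
next
  fix U V s assume "openin (zariski A) U" and V: "openin (zariski A) V" "V \<subseteq> U" and s: "s \<in> sect (Spec A \<iota>) U"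
  show "restrict s V \<in> sect (Spec A \<iota>) V"
    unfolding Spec_sect
  proof (intro conjI ballI)
    show "restrict s V \<in> (\<Pi>\<^sub>E P\<in>V. carrier (stalk_at A P))" using s V(2) by (auto simp: Spec_sect PiE_def)
    fix P assume P: "P \<in> V"
    then have "P \<in> U" using V(2) by blast
    from s this obtain W a b where W: "openin (zariski A) W" "P \<in> W" "W \<subseteq> U" "a \<in> carrier A" "b \<in> carrier A"
         "\<forall>Q\<in>W. b \<notin> Q \<and> s Q = germ A Q a b" by (rule Spec_sectE)
    note * = W
    show "\<exists>W a b. openin (zariski A) W \<and> P \<in> W \<and> W \<subseteq> V \<and> a \<in> carrier A \<and> b \<in> carrier A \<and>
         (\<forall>Q\<in>W. b \<notin> Q \<and> restrict s V Q = germ A Q a b)"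
      by (rule exI[of _ "V \<inter> W"], rule exI[of _ a], rule exI[of _ b]) (use * V P in \<open>(auto simp: openin_Int)\<close>)
  qed
next
  fix U s assume U: "openin (zariski A) U" and s: "s \<in> (\<Pi>\<^sub>E p\<in>U. carrier (stalk_at A p))"
    and l: "\<forall>p. p \<in> U \<longrightarrow> (\<exists>V. openin (zariski A) V \<and> p \<in> V \<and> V \<subseteq> U \<and> restrict s V \<in> sect (Spec A \<iota>) V)"
  show "s \<in> sect (Spec A \<iota>) U"
    unfolding Spec_sect
  proof (intro conjI ballI)
    fix P assume P: "P \<in> U"
    then obtain V where V: "openin (zariski A) V" "P \<in> V" "V \<subseteq> U" "restrict s V \<in> sect (Spec A \<iota>) V"
      using l by blast
    from V(4,2) obtain W a b where W: "openin (zariski A) W" "P \<in> W" "W \<subseteq> V" "a \<in> carrier A" "b \<in> carrier A"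
         "\<forall>Q\<in>W. b \<notin> Q \<and> restrict s V Q = germ A Q a b" by (rule Spec_sectE)
    have "\<forall>Q\<in>W. b \<notin> Q \<and> s Q = germ A Q a b"
    proof
      fix Q assume Q: "Q \<in> W"
      then have "Q \<in> V" using W(3) by (rule rev_subsetD)
      then show "b \<notin> Q \<and> s Q = germ A Q a b" using W(6)[rule_format, OF Q] by simp
    qed
    moreover have "W \<subseteq> U" using W(3) V(3) by (rule subset_trans)
    ultimately show "\<exists>W a b. openin (zariski A) W \<and> P \<in> W \<and> W \<subseteq> U \<and> a \<in> carrier A \<and> b \<in> carrier A \<and>
         (\<forall>Q\<in>W. b \<notin> Q \<and> s Q = germ A Q a b)"
      using W(1,2,4,5) by (intro exI conjI)
  qed (rule s)
qed


text \<open>A section that is invertible in the stalk at a point is invertible near that point.\<close>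

lemma (in locally_ringed) unit_nbhd:
  assumes U: "openin (ktop X) U" "s \<in> sect X U" "p \<in> U" and u: "s p \<in> Units (stalk X p)"
  shows "\<exists>V r. openin (ktop X) V \<and> p \<in> V \<and> V \<subseteq> U \<and> r \<in> sect X V \<and>
    (\<forall>q\<in>V. s q \<in> Units (stalk X q) \<and> r q = inv\<^bsub>stalk X q\<^esub> (s q))"
proof -
  have top: "U \<subseteq> topspace (ktop X)" using U(1) by (rule openin_subset)
  have cr: "cring (stalk X q)" if "q \<in> U" for q
    using stalk_local[of q] top that by (auto simp: local_ring_def)
  interpret P: cring "stalk X p" using cr[OF U(3)] .
  have "inv\<^bsub>stalk X p\<^esub> (s p) \<in> carrier (stalk X p)" using u by simp
  then obtain U' r0 where r0: "openin (ktop X) U'" "p \<in> U'" "r0 \<in> sect X U'"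
    "r0 p = inv\<^bsub>stalk X p\<^esub> (s p)" using germ_exists[of p] U(3) top by blast
  let ?W = "U \<inter> U'"
  have W: "openin (ktop X) ?W" using U(1) r0(1) by auto
  have sW: "restrict s ?W \<in> sect X ?W" and rW: "restrict r0 ?W \<in> sect X ?W"
    using sect_restrict[OF U(1) W _ U(2)] sect_restrict[OF r0(1) W _ r0(3)] by auto
  have m: "(\<lambda>q\<in>?W. restrict s ?W q \<otimes>\<^bsub>stalk X q\<^esub> restrict r0 ?W q) \<in> sect X ?W" (is "?m \<in> _")
    by (rule sect_mult[OF W sW rW])
  have o: "(\<lambda>q\<in>?W. scal X q 1) \<in> sect X ?W" (is "?o \<in> _") by (rule sect_scal[OF W])
  have one: "scal X q 1 = \<one>\<^bsub>stalk X q\<^esub>" if "q \<in> U" for q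
    using ring_hom_one[OF scal_hom[of q]] top that by (auto simp: field_ring_def)
  have mo: "?m p = ?o p" using U(3) r0 u one by simp
  then obtain V where V: "openin (ktop X) V" "p \<in> V" "V \<subseteq> ?W" "\<forall>q\<in>V. ?m q = ?o q"
    using germ_eq[OF W m o _ mo] U(3) r0(2) by blast
  have inv: "s q \<in> Units (stalk X q) \<and> r0 q = inv\<^bsub>stalk X q\<^esub> (s q)" if q: "q \<in> V" for q
  proof -
    have qU: "q \<in> U" "q \<in> U'" using V q by auto
    interpret Q: cring "stalk X q" using cr[OF qU(1)] .
    have c: "s q \<in> carrier (stalk X q)" "r0 q \<in> carrier (stalk X q)"
      using sect_germs[OF U(1)] sect_germs[OF r0(1)] U(2) r0(3) qU by (auto simp: PiE_def)
    have e: "s q \<otimes>\<^bsub>stalk X q\<^esub> r0 q = \<one>\<^bsub>stalk X q\<^esub>" using V(3,4) q qU one[OF qU(1)] by auto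
    show ?thesis using Q.unitI[OF c e] Q.comm_inv_char[OF c e] by simp
  qed
  have rs: "restrict r0 V \<in> sect X V" using V sect_restrict[OF r0(1) V(1) _ r0(3)] by auto
  show ?thesis by (rule exI[of _ V], rule exI[of _ "restrict r0 V"]) (use V inv rs in \<open>auto\<close>)
qed

section \<open>Morphisms to a spectrum\<close>

lemma (in locally_ringed) mor_id_morphism: "morphism X X mor_id"
proof -
  have "{p \<in> topspace (ktop X). p \<in> V} = V" if "openin (ktop X) V" for V
    using openin_subset[OF that] by auto
  moreover have "restrict s V \<in> sect X V" if "openin (ktop X) V" "s \<in> sect X V" for s V
    using sect_restrict[OF that(1,1) _ that(2)] by simp
  ultimately show ?thesis by (simp add: morphism_def mor_id_def ring_hom_def)
qed

lemma mor_comp_morphism: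
  assumes m: "morphism X Y m" and n: "morphism Y Z n"
  shows "morphism X Z (mor_comp n m)"
proof -
  obtain f \<phi> where mf: "m = (f, \<phi>)" by fastforce
  obtain g \<psi> where ng: "n = (g, \<psi>)" by fastforce
  note M = m[unfolded mf morphism_def, simplified] and N = n[unfolded ng morphism_def, simplified]
  have f: "f p \<in> topspace (ktop Y)" if "p \<in> topspace (ktop X)" for p
    using M that by (auto simp: continuous_map_def)
  have sec: "(\<lambda>p\<in>{p \<in> topspace (ktop X). g (f p) \<in> V}. \<phi> p (\<psi> (f p) (s (g (f p)))))
      \<in> sect X {p \<in> topspace (ktop X). g (f p) \<in> V}" if V: "openin (ktop Z) V" "s \<in> sect Z V" for V s
  proof -
    let ?W = "{q \<in> topspace (ktop Y). g q \<in> V}"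
    have W: "openin (ktop Y) ?W" using N V by (auto intro: openin_continuous_map_preimage)
    have "(\<lambda>q\<in>?W. \<psi> q (s (g q))) \<in> sect Y ?W" using N V by blast
    then have "(\<lambda>p\<in>{p \<in> topspace (ktop X). f p \<in> ?W}. \<phi> p ((\<lambda>q\<in>?W. \<psi> q (s (g q))) (f p)))
       \<in> sect X {p \<in> topspace (ktop X). f p \<in> ?W}" using M W by blast
    moreover have "{p \<in> topspace (ktop X). f p \<in> ?W} = {p \<in> topspace (ktop X). g (f p) \<in> V}"
      using f by auto
    moreover have "(\<lambda>p\<in>{p \<in> topspace (ktop X). g (f p) \<in> V}. \<phi> p ((\<lambda>q\<in>?W. \<psi> q (s (g q))) (f p)))
       = (\<lambda>p\<in>{p \<in> topspace (ktop X). g (f p) \<in> V}. \<phi> p (\<psi> (f p) (s (g (f p)))))"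
      using f by (intro restrict_ext) auto
    ultimately show ?thesis by simp
  qed
  have hom: "(\<lambda>a. \<phi> p (\<psi> (f p) a)) \<in> ring_hom (stalk Z (g (f p))) (stalk X p)"
    if "p \<in> topspace (ktop X)" for p
    using ring_hom_trans[of "\<psi> (f p)" "stalk Z (g (f p))" "stalk Y (f p)" "\<phi> p" "stalk X p"] M N f that
    by (simp add: comp_def)
  have cl: "\<psi> (f p) a \<in> carrier (stalk Y (f p))" if "p \<in> topspace (ktop X)" "a \<in> carrier (stalk Z (g (f p)))" for p a
    using N f that by (blast intro: ring_hom_closed)
  have "continuous_map (ktop X) (ktop Z) (\<lambda>p. g (f p))"
    using continuous_map_compose[of "ktop X" "ktop Y" f "ktop Z" g] M N by (simp add: comp_def)
  then show ?thesis
    unfolding morphism_def mf ng mor_comp_def using sec hom cl M N f by simp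
qed

lemma mor_eq_refl: "mor_eq X Y m m"
  by (simp add: mor_eq_def)

lemma mor_eq_sym: "mor_eq X Y m m' \<Longrightarrow> mor_eq X Y m' m"
  by (simp add: mor_eq_def)

lemma mor_eq_trans: "mor_eq X Y m m' \<Longrightarrow> mor_eq X Y m' m'' \<Longrightarrow> mor_eq X Y m m''"
  by (simp add: mor_eq_def)

lemma mor_comp_assoc: "mor_comp l (mor_comp n m) = mor_comp (mor_comp l n) m"
  by (simp add: mor_comp_def)

lemma mor_comp_id [simp]: "mor_comp m mor_id = m" "mor_comp mor_id m = m"
  by (simp_all add: mor_comp_def mor_id_def)

lemma morphism_point: "morphism X Y m \<Longrightarrow> p \<in> topspace (ktop X) \<Longrightarrow> fst m p \<in> topspace (ktop Y)"
  by (auto simp: morphism_def continuous_map_def split: prod.splits)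

lemma morphism_hom: "morphism X Y m \<Longrightarrow> p \<in> topspace (ktop X) \<Longrightarrow> snd m p \<in> ring_hom (stalk Y (fst m p)) (stalk X p)"
  by (auto simp: morphism_def split: prod.splits)

lemma mor_eq_comp:
  assumes "mor_eq X Y m m'" "mor_eq Y Z n n'" "morphism X Y m" "morphism Y Z n"
  shows "mor_eq X Z (mor_comp n m) (mor_comp n' m')"
  unfolding mor_eq_def
proof (intro ballI conjI)
  fix p assume p: "p \<in> topspace (ktop X)"
  have q: "fst m p \<in> topspace (ktop Y)" by (rule morphism_point[OF assms(3) p])
  have e: "fst m p = fst m' p" and e2: "\<And>a. a \<in> carrier (stalk Y (fst m p)) \<Longrightarrow> snd m p a = snd m' p a"
    using assms(1) p by (auto simp: mor_eq_def)
  have f: "fst n (fst m p) = fst n' (fst m p)"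
    and f2: "\<And>a. a \<in> carrier (stalk Z (fst n (fst m p))) \<Longrightarrow> snd n (fst m p) a = snd n' (fst m p) a"
    using assms(2) q by (auto simp: mor_eq_def)
  show "fst (mor_comp n m) p = fst (mor_comp n' m') p" using e f by (simp add: mor_comp_def)
  fix a assume a: "a \<in> carrier (stalk Z (fst (mor_comp n m) p))"
  then have "snd n (fst m p) a \<in> carrier (stalk Y (fst m p))"
    using ring_hom_closed[OF morphism_hom[OF assms(4) q]] by (simp add: mor_comp_def)
  then show "snd (mor_comp n m) p a = snd (mor_comp n' m') p a"
    using a e e2 f f2 by (simp add: mor_comp_def)
qed

lemma morphism_sect:
  assumes "morphism X Y m" "openin (ktop Y) V" "s \<in> sect Y V"
  shows "(\<lambda>p\<in>{p \<in> topspace (ktop X). fst m p \<in> V}. snd m p (s (fst m p)))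
    \<in> sect X {p \<in> topspace (ktop X). fst m p \<in> V}"
  using assms unfolding morphism_def by (cases m) auto

text \<open>The data of a \<open>k\<close>-algebra homomorphism from \<open>A\<close> to the global sections of \<open>T\<close>, given stalkwise.\<close>

definition global_hom :: "'a ring \<Rightarrow> ('k::field \<Rightarrow> 'a) \<Rightarrow> ('k, 'p, 's) kspace \<Rightarrow> ('p \<Rightarrow> 'a \<Rightarrow> 's) \<Rightarrow> bool" where
  "global_hom A \<iota> T \<chi> \<longleftrightarrow>
     (\<forall>t\<in>topspace (ktop T). \<chi> t \<in> ring_hom A (stalk T t) \<and> (\<forall>c. \<chi> t (\<iota> c) = scal T t c)) \<and>
     (\<forall>a\<in>carrier A. (\<lambda>t\<in>topspace (ktop T). \<chi> t a) \<in> sect T (topspace (ktop T)))"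

text \<open>A point of \<open>T\<close> goes to the prime of functions that do not become invertible in its stalk; on stalks
  the morphism is the extension of \<open>\<chi>\<close> to the localization.\<close>

definition to_spec :: "'a ring \<Rightarrow> ('k, 'p, 's) kspace \<Rightarrow> ('p \<Rightarrow> 'a \<Rightarrow> 's) \<Rightarrow> ('p, 's, 'a set, ('a \<times> 'a) set) mor" where
  "to_spec A T \<chi> = (\<lambda>t. {a \<in> carrier A. \<chi> t a \<notin> Units (stalk T t)}, \<lambda>t. loc_lift (stalk T t) (\<chi> t))"

text \<open>The pullback of a regular function along a morphism to a spectrum.\<close>

definition pullback :: "'a ring \<Rightarrow> ('p, 's, 'a set, ('a \<times> 'a) set) mor \<Rightarrow> 'p \<Rightarrow> 'a \<Rightarrow> 's" where
  "pullback A m t a = snd m t (germ A (fst m t) a \<one>\<^bsub>A\<^esub>)"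

locale spec_map = k_algebra A \<iota> + T: locally_ringed T
  for A :: "'a ring" (structure) and \<iota> :: "'k::field \<Rightarrow> 'a" and T :: "('k, 'p, 's) kspace"
begin

abbreviation pts where "pts \<equiv> topspace (ktop T)"

lemma stalk_cring: "t \<in> pts \<Longrightarrow> cring (stalk T t)"
  using T.stalk_local local_ring_cring by blast

lemma contraction_prime:
  assumes t: "t \<in> pts" and h: "\<chi> \<in> ring_hom A (stalk T t)"
  shows "primeideal {a \<in> carrier A. \<chi> a \<notin> Units (stalk T t)} A"
proof -
  interpret R: cring "stalk T t" by (rule stalk_cring[OF t])
  note loc = T.stalk_local[OF t]
  note hs = ring_hom_mult[OF h] ring_hom_add[OF h] ring_hom_one[OF h] ring_hom_closed[OF h]
  have h0: "\<chi> \<zero> = \<zero>\<^bsub>stalk T t\<^esub>" using h ring_hom_zero R.ring_axioms ring_axioms by blast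
  let ?P = "{a \<in> carrier A. \<chi> a \<notin> Units (stalk T t)}"
  have mult: "a \<otimes> b \<in> ?P" if "a \<in> ?P" "b \<in> carrier A" for a b
  proof -
    have "\<chi> a \<in> Units (stalk T t)" if u: "\<chi> a \<otimes>\<^bsub>stalk T t\<^esub> \<chi> b \<in> Units (stalk T t)"
    proof (rule R.unitI)
      show "\<chi> a \<otimes>\<^bsub>stalk T t\<^esub> (\<chi> b \<otimes>\<^bsub>stalk T t\<^esub> inv\<^bsub>stalk T t\<^esub> (\<chi> a \<otimes>\<^bsub>stalk T t\<^esub> \<chi> b)) = \<one>\<^bsub>stalk T t\<^esub>"
        using u \<open>a \<in> ?P\<close> \<open>b \<in> carrier A\<close> by (simp add: R.m_assoc[symmetric] hs)
    qed (use u \<open>a \<in> ?P\<close> \<open>b \<in> carrier A\<close> hs in auto)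
    then show ?thesis using that by (auto simp: hs)
  qed
  have "ideal ?P A"
  proof (rule idealI)
    show "subgroup ?P (add_monoid A)"
    proof (rule add.subgroupI)
      fix a b assume ab: "a \<in> ?P" "b \<in> ?P"
      then show "a \<oplus> b \<in> ?P" using local_ring_add[OF loc, of "\<chi> a" "\<chi> b"] by (auto simp: hs)
      have "\<ominus> a = a \<otimes> (\<ominus> \<one>)" using ab by (simp add: r_minus)
      then show "\<ominus> a \<in> ?P" using mult[of a "\<ominus> \<one>"] ab by (simp only: a_inv_closed one_closed)
    qed (use h0 local_ring_zero[OF loc] in auto)
  qed (use mult m_comm in \<open>auto simp: ring_axioms\<close>)
  then show ?thesis
  proof (rule primeidealI[OF _ is_cring])
    show "carrier A \<noteq> ?P"
    proof
      assume "carrier A = ?P"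
      then have "\<one> \<in> ?P" using one_closed by blast
      then show False by (simp add: hs)
    qed
    fix a b assume "a \<in> carrier A" "b \<in> carrier A" "a \<otimes> b \<in> ?P"
    then show "a \<in> ?P \<or> b \<in> ?P" using R.Units_m_closed[of "\<chi> a" "\<chi> b"] by (auto simp: hs)
  qed
qed

lemma lift_locale:
  assumes t: "t \<in> pts" and h: "\<chi> \<in> ring_hom A (stalk T t)"
  shows "loc_hom A (carrier A - {a \<in> carrier A. \<chi> a \<notin> Units (stalk T t)}) (stalk T t) \<chi>"
  using prime_mult_set[OF contraction_prime[OF t h]] stalk_cring[OF t] h
  by (auto simp: loc_hom_def loc_hom_axioms_def)

lemma fst_to_spec: "fst (to_spec A T \<chi>) t = {a \<in> carrier A. \<chi> t a \<notin> Units (stalk T t)}"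
  by (simp add: to_spec_def)

lemma pullback_to_spec:
  assumes t: "t \<in> pts" and h: "\<chi> t \<in> ring_hom A (stalk T t)" and a: "a \<in> carrier A"
  shows "pullback A (to_spec A T \<chi>) t a = \<chi> t a"
  using loc_hom.lift_frac_one[OF lift_locale[OF t h] a] by (simp add: pullback_def to_spec_def)

text \<open>The existence half of the universal property of a spectrum: it represents the functor of algebra homomorphisms
  into global sections. Preimages of principal open sets are open because invertibility spreads
  from a point to a neighbourhood.\<close>

lemma to_spec_morphism:
  assumes g: "global_hom A \<iota> T \<chi>"
  shows "morphism T (Spec A \<iota>) (to_spec A T \<chi>)"
proof -
  have h: "\<chi> t \<in> ring_hom A (stalk T t)" and sc: "\<chi> t (\<iota> c) = scal T t c" if "t \<in> pts" for t c
    using g that by (auto simp: global_hom_def)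
  have sec: "(\<lambda>t\<in>pts. \<chi> t a) \<in> sect T pts" if "a \<in> carrier A" for a
    using g that by (auto simp: global_hom_def)
  define f where "f = (\<lambda>t. {a \<in> carrier A. \<chi> t a \<notin> Units (stalk T t)})"
  have prime: "primeideal (f t) A" if "t \<in> pts" for t
    unfolding f_def by (rule contraction_prime[OF that h[OF that]])
  have lift: "loc_hom A (carrier A - f t) (stalk T t) (\<chi> t)" if "t \<in> pts" for t
    unfolding f_def by (rule lift_locale[OF that h[OF that]])
  have nb: "\<exists>V r. openin (ktop T) V \<and> t \<in> V \<and> r \<in> sect T V \<and>
      (\<forall>q\<in>V. b \<notin> f q \<and> r q = inv\<^bsub>stalk T q\<^esub> (\<chi> q b))" if tb: "t \<in> pts" "b \<in> carrier A" "b \<notin> f t" for t b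
  proof -
    have "(\<lambda>t\<in>pts. \<chi> t b) t \<in> Units (stalk T t)" using tb by (simp add: f_def)
    from T.unit_nbhd[OF openin_topspace sec[OF tb(2)] tb(1) this] obtain V r where
      V: "openin (ktop T) V" "t \<in> V" "V \<subseteq> pts" "r \<in> sect T V"
      "\<forall>q\<in>V. (\<lambda>t\<in>pts. \<chi> t b) q \<in> Units (stalk T q) \<and> r q = inv\<^bsub>stalk T q\<^esub> ((\<lambda>t\<in>pts. \<chi> t b) q)"
      by blast
    have "b \<notin> f q \<and> r q = inv\<^bsub>stalk T q\<^esub> (\<chi> q b)" if "q \<in> V" for q
      using V(5)[rule_format, OF that] V(3) that by (auto simp: f_def)
    then show ?thesis using V by blast
  qed
  have cont: "continuous_map (ktop T) (zariski A) f"
    unfolding continuous_map_def topspace_zariski[OF is_cring]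
  proof (intro conjI allI impI)
    show "f \<in> pts \<rightarrow> primes A" using prime by (auto simp: primes_def)
    fix U assume "openin (zariski A) U"
    then obtain S where S: "S \<subseteq> carrier A" "U = {P \<in> primes A. \<not> S \<subseteq> P}"
      unfolding openin_zariski[OF is_cring] by blast
    show "openin (ktop T) {x \<in> pts. f x \<in> U}"
    proof (subst openin_subopen, intro ballI)
      fix t assume "t \<in> {x \<in> pts. f x \<in> U}"
      then obtain b where b: "t \<in> pts" "b \<in> S" "b \<notin> f t" using S by auto
      then obtain V where V: "openin (ktop T) V" "t \<in> V" "\<And>q. q \<in> V \<Longrightarrow> b \<notin> f q" using nb[of t b] S by blast
      moreover have "V \<subseteq> {x \<in> pts. f x \<in> U}"
        using openin_subset[OF V(1)] V(3) prime b S by (auto simp: primes_def)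
      ultimately show "\<exists>V. openin (ktop T) V \<and> t \<in> V \<and> V \<subseteq> {x \<in> pts. f x \<in> U}" by blast
    qed
  qed
  have stalks: "loc_lift (stalk T t) (\<chi> t) \<in> ring_hom (stalk_at A (f t)) (stalk T t)" if "t \<in> pts" for t
    by (rule loc_hom.lift_hom[OF lift[OF that]])
  have local: "a \<in> Units (stalk_at A (f t))" if t: "t \<in> pts" and a: "a \<in> carrier (stalk_at A (f t))"
    and u: "loc_lift (stalk T t) (\<chi> t) a \<in> Units (stalk T t)" for t a
  proof -
    interpret L: loc_hom A "carrier A - f t" "stalk T t" "\<chi> t" by (rule lift[OF t])
    obtain b s where bs: "b \<in> carrier A" "s \<in> carrier A - f t" "a = germ A (f t) b s"
      using a by (rule L.loc_cases)
    have "\<chi> t b \<otimes>\<^bsub>stalk T t\<^esub> inv\<^bsub>stalk T t\<^esub> (\<chi> t s) \<in> Units (stalk T t)" using u bs by (simp add: L.lift_frac)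
    then have "(\<chi> t b \<otimes>\<^bsub>stalk T t\<^esub> inv\<^bsub>stalk T t\<^esub> (\<chi> t s)) \<otimes>\<^bsub>stalk T t\<^esub> \<chi> t s \<in> Units (stalk T t)"
      using L.chi_units[OF bs(2)] by (rule L.R.Units_m_closed)
    then have "\<chi> t b \<in> Units (stalk T t)" using bs L.chi_units[OF bs(2)] by (simp add: L.R.m_assoc)
    then have "b \<notin> {a \<in> carrier A. \<chi> t a \<notin> Units (stalk T t)}" by blast
    then have "b \<notin> f t" unfolding f_def .
    then show ?thesis unfolding bs(3) by (rule germ_unit_iff[OF prime[OF t] bs(1,2), THEN iffD2])
  qed
  have scalc: "loc_lift (stalk T t) (\<chi> t) (germ A (f t) (\<iota> c) \<one>) = scal T t c" if "t \<in> pts" for t c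
    using loc_hom.lift_frac_one[OF lift[OF that], of "\<iota> c"] sc[OF that, of c] ring_hom_closed[OF scalars, of c]
    by (simp add: field_ring_def)
  have sects: "(\<lambda>p\<in>{p \<in> pts. f p \<in> V}. loc_lift (stalk T p) (\<chi> p) (s (f p))) \<in> sect T {p \<in> pts. f p \<in> V}"
    if V: "openin (zariski A) V" and s: "s \<in> sect (Spec A \<iota>) V" for V s
  proof -
    let ?W = "{p \<in> pts. f p \<in> V}"
    let ?s = "\<lambda>p\<in>?W. loc_lift (stalk T p) (\<chi> p) (s (f p))"
    have W: "openin (ktop T) ?W" using cont V by (rule openin_continuous_map_preimage)
    show ?thesis
    proof (rule T.sect_glue[OF W])
      have "s (f p) \<in> carrier (stalk_at A (f p))" if "p \<in> ?W" for p
        using s that by (auto simp: Spec_sect PiE_def)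
      then show "?s \<in> (\<Pi>\<^sub>E p\<in>?W. carrier (stalk T p))"
        using ring_hom_closed[OF stalks] by auto
      fix p assume p: "p \<in> ?W"
      then have fp: "f p \<in> V" by simp
      from s fp obtain V' a b where V': "openin (zariski A) V'" "f p \<in> V'" "V' \<subseteq> V" "a \<in> carrier A" "b \<in> carrier A"
        "\<forall>Q\<in>V'. b \<notin> Q \<and> s Q = germ A Q a b" by (rule Spec_sectE)
      obtain N r where N: "openin (ktop T) N" "p \<in> N" "r \<in> sect T N"
        "\<And>q. q \<in> N \<Longrightarrow> b \<notin> f q \<and> r q = inv\<^bsub>stalk T q\<^esub> (\<chi> q b)" using nb[of p b] p V' by blast
      let ?N = "N \<inter> {p \<in> pts. f p \<in> V'}"
      have oN: "openin (ktop T) ?N" using N(1) openin_continuous_map_preimage[OF cont V'(1)] by auto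
      have "restrict (\<lambda>t\<in>pts. \<chi> t a) ?N \<in> sect T ?N" "restrict r ?N \<in> sect T ?N"
        using T.sect_restrict[OF openin_topspace oN _ sec[OF V'(4)]] T.sect_restrict[OF N(1) oN _ N(3)] by auto
      from T.sect_mult[OF oN this]
      have m: "(\<lambda>q\<in>?N. restrict (\<lambda>t\<in>pts. \<chi> t a) ?N q \<otimes>\<^bsub>stalk T q\<^esub> restrict r ?N q) \<in> sect T ?N" .
      have "restrict ?s ?N = (\<lambda>q\<in>?N. restrict (\<lambda>t\<in>pts. \<chi> t a) ?N q \<otimes>\<^bsub>stalk T q\<^esub> restrict r ?N q)"
      proof (rule restrict_ext)
        fix q assume q: "q \<in> ?N"
        interpret L: loc_hom A "carrier A - f q" "stalk T q" "\<chi> q" using q by (intro lift) auto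
        have "s (f q) = germ A (f q) a b" "b \<notin> f q" using V' q by auto
        moreover have "f q \<in> V" using q V'(3) by auto
        ultimately show "?s q = restrict (\<lambda>t\<in>pts. \<chi> t a) ?N q \<otimes>\<^bsub>stalk T q\<^esub> restrict r ?N q"
          using q N(4)[of q] V'(4,5) L.lift_frac[of a b] by auto
      qed
      then show "\<exists>V. openin (ktop T) V \<and> p \<in> V \<and> V \<subseteq> ?W \<and> restrict ?s V \<in> sect T V"
        using m oN N(2) p V' by (intro exI[of _ ?N]) auto
    qed
  qed
  show ?thesis
    unfolding morphism_def to_spec_def f_def[symmetric]
    using cont stalks local scalc sects by auto
qed

lemma pullback_global_hom:
  assumes m: "morphism T (Spec A \<iota>) m"
  shows "global_hom A \<iota> T (pullback A m)"
    and "\<And>t. t \<in> pts \<Longrightarrow> fst m t = {a \<in> carrier A. pullback A m t a \<notin> Units (stalk T t)}"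
proof -
  have pr: "primeideal (fst m t) A" if "t \<in> pts" for t
    using morphism_point[OF m that] by (simp add: topspace_zariski[OF is_cring] primes_def)
  have hom: "snd m t \<in> ring_hom (stalk_at A (fst m t)) (stalk T t)" if "t \<in> pts" for t
    using morphism_hom[OF m that] by simp
  have ph: "pullback A m t \<in> ring_hom A (stalk T t)" if "t \<in> pts" for t
  proof -
    interpret M: mult_set A "carrier A - fst m t" by (rule prime_mult_set[OF pr[OF that]])
    have "snd m t \<circ> (\<lambda>a. germ A (fst m t) a \<one>) \<in> ring_hom A (stalk T t)"
      by (rule ring_hom_trans[OF M.loc_hom hom[OF that]])
    then show ?thesis by (simp add: pullback_def comp_def fun_eq_iff ring_hom_def Pi_def)
  qed
  show "global_hom A \<iota> T (pullback A m)"
    unfolding global_hom_def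
  proof (intro conjI ballI allI)
    fix t c assume "t \<in> pts"
    then show "pullback A m t (\<iota> c) = scal T t c"
      using m by (auto simp: morphism_def pullback_def split: prod.splits)
  next
    fix a assume a: "a \<in> carrier A"
    have "(\<lambda>P\<in>primes A. germ A P a \<one>) \<in> sect (Spec A \<iota>) (primes A)"
      unfolding Spec_sect
    proof (intro conjI ballI)
      show "(\<lambda>P\<in>primes A. germ A P a \<one>) \<in> (\<Pi>\<^sub>E P\<in>primes A. carrier (stalk_at A P))"
      proof (rule restrict_PiE_iff[THEN iffD2], rule ballI)
        fix P assume "P \<in> primes A"
        then interpret M: mult_set A "carrier A - P" by (intro prime_mult_set) (simp add: primes_def)
        show "germ A P a \<one> \<in> carrier (stalk_at A P)" using a M.S_one by (rule M.frac_in_loc)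
      qed
      fix P assume "P \<in> primes A"
      note * = this
      show "\<exists>V a' b. openin (zariski A) V \<and> P \<in> V \<and> V \<subseteq> primes A \<and> a' \<in> carrier A \<and> b \<in> carrier A \<and>
         (\<forall>Q\<in>V. b \<notin> Q \<and> (\<lambda>P\<in>primes A. germ A P a \<one>) Q = germ A Q a' b)"
        by (rule exI[of _ "primes A"], rule exI[of _ a], rule exI[of _ \<one>]) (use * a mult_set.S_one[OF prime_mult_set] openin_topspace[of "zariski A"] in \<open>(auto simp: topspace_zariski is_cring primes_def)\<close>)
    qed
    note sec = this
    have op: "openin (ktop (Spec A \<iota>)) (primes A)"
      using openin_topspace[of "zariski A"] topspace_zariski[OF is_cring] by simp
    have "(\<lambda>p\<in>{p \<in> pts. fst m p \<in> primes A}. snd m p ((\<lambda>P\<in>primes A. germ A P a \<one>) (fst m p)))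
        \<in> sect T {p \<in> pts. fst m p \<in> primes A}"
      by (rule morphism_sect[OF m op sec])
    moreover have "{p \<in> pts. fst m p \<in> primes A} = pts" using pr by (auto simp: primes_def)
    moreover have "(\<lambda>p\<in>pts. snd m p ((\<lambda>P\<in>primes A. germ A P a \<one>) (fst m p))) = (\<lambda>t\<in>pts. pullback A m t a)"
      using pr by (intro restrict_ext) (auto simp: primes_def pullback_def)
    ultimately show "(\<lambda>t\<in>pts. pullback A m t a) \<in> sect T pts" by simp
  qed (rule ph)
  fix t assume t: "t \<in> pts"
  interpret P: primeideal "fst m t" A by (rule pr[OF t])
  interpret M: mult_set A "carrier A - fst m t" by (rule prime_mult_set[OF pr[OF t]])
  have "pullback A m t a \<in> Units (stalk T t) \<longleftrightarrow> a \<notin> fst m t" if a: "a \<in> carrier A" for a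
  proof -
    have "germ A (fst m t) a \<one> \<in> carrier (stalk_at A (fst m t))" using a M.S_one by (intro M.frac_in_loc) auto
    moreover have "snd m t g \<in> Units (stalk T t) \<longleftrightarrow> g \<in> Units (stalk_at A (fst m t))"
      if "g \<in> carrier (stalk_at A (fst m t))" for g
      using ring_hom_inv_eq(1)[OF M.loc_cring stalk_cring[OF t] hom[OF t], of g] m t that
      by (auto simp: morphism_def split: prod.splits)
    ultimately show ?thesis
      using germ_unit_iff[OF pr[OF t] a M.S_one] by (simp add: pullback_def)
  qed
  then show "fst m t = {a \<in> carrier A. pullback A m t a \<notin> Units (stalk T t)}" by auto
qed

text \<open>A morphism to \<open>Spec A\<close> is determined by the induced map on global functions: the image of a
  point \<open>t\<close> consists of the functions whose pullback is not invertible at \<open>t\<close>.\<close>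

lemma mor_eq_specI:
  assumes m: "morphism T (Spec A \<iota>) m" and n: "morphism T (Spec A \<iota>) n"
    and e: "\<And>t a. t \<in> pts \<Longrightarrow> a \<in> carrier A \<Longrightarrow> pullback A m t a = pullback A n t a"
  shows "mor_eq T (Spec A \<iota>) m n"
  unfolding mor_eq_def
proof (intro ballI conjI)
  fix t assume t: "t \<in> pts"
  show eq: "fst m t = fst n t"
    using pullback_global_hom(2)[OF m t] pullback_global_hom(2)[OF n t] e[OF t] by auto
  have pr: "primeideal (fst m t) A"
    using morphism_point[OF m t] by (simp add: topspace_zariski[OF is_cring] primes_def)
  interpret M: mult_set A "carrier A - fst m t" by (rule prime_mult_set[OF pr])
  fix a assume a: "a \<in> carrier (stalk (Spec A \<iota>) (fst m t))"
  have "snd m t a = loc_lift (stalk T t) (pullback A m t) a"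
    using a morphism_hom[OF m t] by (intro M.loc_hom_eq[OF stalk_cring[OF t]]) (auto simp: pullback_def)
  moreover have "snd n t a = loc_lift (stalk T t) (pullback A m t) a"
    using a morphism_hom[OF n t] eq e[OF t] by (intro M.loc_hom_eq[OF stalk_cring[OF t]]) (auto simp: pullback_def)
  ultimately show "snd m t a = snd n t a" by simp
qed

end

section \<open>Polynomials and their evaluation\<close>

lemma poly_ring_simps [simp]:
  "monoid.mult (poly_ring V) = (*)" "monoid.one (poly_ring V) = 1"
  "ring.zero (poly_ring V) = 0" "ring.add (poly_ring V) = (+)"
  by (simp_all add: poly_ring_def)

lemma field_ring_simps [simp]:
  "carrier field_ring = UNIV" "monoid.mult field_ring = (*)" "monoid.one field_ring = 1"
  "ring.zero field_ring = 0" "ring.add field_ring = (+)"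
  by (simp_all add: field_ring_def)

abbreviation polys :: "'v set \<Rightarrow> ('v, 'k::field) mpoly set" where
  "polys V \<equiv> carrier (poly_ring V)"

lemma polys_iff: "f \<in> polys V \<longleftrightarrow> (\<forall>m\<in>Poly_Mapping.keys f. Poly_Mapping.keys m \<subseteq> V)"
  by (simp add: poly_ring_def)

lemma polys_mono: "V \<subseteq> W \<Longrightarrow> f \<in> polys V \<Longrightarrow> f \<in> polys W"
  by (auto simp: polys_iff)

lemma polys_UNIV [simp]: "f \<in> polys UNIV"
  by (simp add: polys_iff)

lemma polys_zero [simp]: "0 \<in> polys V" and polys_one [simp]: "1 \<in> polys V"
  by (auto simp: polys_iff)

lemma polys_const [simp]: "poly_const c \<in> polys V"
  by (auto simp: polys_iff poly_const_def)

lemma polys_var [simp]: "poly_var v \<in> polys V \<longleftrightarrow> v \<in> V"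
  by (auto simp: polys_iff poly_var_def)

lemma polys_add [simp]: "f \<in> polys V \<Longrightarrow> g \<in> polys V \<Longrightarrow> f + g \<in> polys V"
  using Poly_Mapping.keys_add[of f g] by (fastforce simp: polys_iff)

lemma polys_uminus [simp]: "f \<in> polys V \<Longrightarrow> - f \<in> polys V"
  by (simp add: polys_iff)

lemma polys_diff [simp]: "f \<in> polys V \<Longrightarrow> g \<in> polys V \<Longrightarrow> f - g \<in> polys V"
  using polys_add[of f V "- g"] by simp

lemma polys_mult [simp]:
  assumes "f \<in> polys V" "g \<in> polys V"
  shows "f * g \<in> polys V"
  unfolding polys_iff
proof
  fix m assume "m \<in> Poly_Mapping.keys (f * g)"
  then obtain a b where ab: "m = a + b" "a \<in> Poly_Mapping.keys f" "b \<in> Poly_Mapping.keys g"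
    using keys_mult[of f g] by auto
  then show "Poly_Mapping.keys m \<subseteq> V"
    using assms Poly_Mapping.keys_add[of a b] by (fastforce simp: polys_iff)
qed

lemma polys_power [simp]: "f \<in> polys V \<Longrightarrow> f ^ n \<in> polys V"
  by (induction n) auto

lemma polys_sum: "(\<And>x. x \<in> X \<Longrightarrow> f x \<in> polys V) \<Longrightarrow> sum f X \<in> polys V"
  by (induction X rule: infinite_finite_induct) auto

lemma polys_prod: "(\<And>x. x \<in> X \<Longrightarrow> f x \<in> polys V) \<Longrightarrow> prod f X \<in> polys V"
  by (induction X rule: infinite_finite_induct) auto

lemma poly_ring_cring: "cring (poly_ring V :: ('v, 'k::field) mpoly ring)"
proof (rule cringI)
  show "abelian_group (poly_ring V)"
    by (rule abelian_groupI) (auto simp: algebra_simps intro!: bexI[of _ "- _"])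
  show "comm_monoid (poly_ring V)" by (rule comm_monoidI) (auto simp: algebra_simps)
qed (auto simp: algebra_simps)

lemma poly_ring_minus:
  assumes "f \<in> polys V"
  shows "\<ominus>\<^bsub>poly_ring V\<^esub> f = - f"
proof -
  interpret cring "poly_ring V" by (rule poly_ring_cring)
  show ?thesis using minus_equality[of "- f" f] assms by simp
qed

lemma poly_const_simps:
  "poly_const 0 = 0" "poly_const 1 = 1" "poly_const (a + b) = poly_const a + poly_const b"
  "poly_const (a * b) = poly_const a * poly_const b"
  by (simp_all add: poly_const_def single_add mult_single)

lemma sum_of_terms: "f = (\<Sum>m\<in>Poly_Mapping.keys f. Poly_Mapping.single m (Poly_Mapping.lookup f m))"
  by (rule poly_mapping_eqI) (auto simp: lookup_sum lookup_single when_def in_keys_iff sum.delta)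

lemma single_sum: "Poly_Mapping.single (\<Sum>v\<in>X. e v) (1::'k::field) = (\<Prod>v\<in>X. Poly_Mapping.single (e v) 1)"
  for e :: "'x \<Rightarrow> ('v \<Rightarrow>\<^sub>0 nat)"
proof (induction X rule: infinite_finite_induct)
  case (insert x X)
  have "Poly_Mapping.single (e x + sum e X) (1::'k) = Poly_Mapping.single (e x) 1 * Poly_Mapping.single (sum e X) 1"
    by (simp add: mult_single)
  then show ?case using insert by simp
qed simp_all

lemma single_var_power: "Poly_Mapping.single (Poly_Mapping.single v n) 1 = (poly_var v :: ('v, 'k::field) mpoly) ^ n"
proof (induction n)
  case (Suc n)
  have "Poly_Mapping.single (Poly_Mapping.single v (Suc n)) (1::'k)
      = Poly_Mapping.single (Poly_Mapping.single v 1) 1 * Poly_Mapping.single (Poly_Mapping.single v n) 1"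
    by (simp add: mult_single flip: single_add)
  then show ?case using Suc by (simp add: poly_var_def)
qed simp

text \<open>Every monomial is a constant times a product of powers of indeterminates; this gives an
  induction principle for polynomials that stays inside the given coordinates.\<close>

lemma term_eq: "Poly_Mapping.single m (c::'k::field) =
    poly_const c * (\<Prod>v\<in>Poly_Mapping.keys m. poly_var v ^ Poly_Mapping.lookup m v)"
proof -
  have "Poly_Mapping.single m (1::'k)
      = (\<Prod>v\<in>Poly_Mapping.keys m. Poly_Mapping.single (Poly_Mapping.single v (Poly_Mapping.lookup m v)) 1)"
    by (subst sum_of_terms) (rule single_sum)
  moreover have "Poly_Mapping.single m c = poly_const c * Poly_Mapping.single m 1"
    by (simp add: poly_const_def mult_single)
  ultimately show ?thesis by (simp add: single_var_power)
qed

lemma polys_induct [consumes 1, case_names const var add mult]: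
  assumes f: "f \<in> polys V" and c: "\<And>c. P (poly_const c)" and v: "\<And>v. v \<in> V \<Longrightarrow> P (poly_var v)"
    and add: "\<And>f g. \<lbrakk>f \<in> polys V; g \<in> polys V; P f; P g\<rbrakk> \<Longrightarrow> P (f + g)"
    and mult: "\<And>f g. \<lbrakk>f \<in> polys V; g \<in> polys V; P f; P g\<rbrakk> \<Longrightarrow> P (f * g)"
  shows "P f"
proof -
  have one: "P 1" and zero: "P 0" using c[of 1] c[of 0] by (simp_all add: poly_const_simps)
  have pow: "P (f ^ n)" if "f \<in> polys V" "P f" for f n
    by (induction n) (use one mult that in auto)
  have prod: "P (\<Prod>v\<in>X. poly_var v ^ e v)" if "X \<subseteq> V" for X and e :: "_ \<Rightarrow> nat"
    using that by (induction X rule: infinite_finite_induct) (auto intro!: one mult pow v polys_prod)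
  have "P (\<Sum>m\<in>M. Poly_Mapping.single m (e m))" if "\<And>m. m \<in> M \<Longrightarrow> Poly_Mapping.keys m \<subseteq> V" for M and e :: "_ \<Rightarrow> 'b"
    using that
  proof (induction M rule: infinite_finite_induct)
    case (insert m M)
    have "P (Poly_Mapping.single m (e m))" unfolding term_eq
      using insert by (intro mult c prod polys_prod polys_power polys_const) auto
    moreover have "Poly_Mapping.single m (e m) \<in> polys V" using insert by (auto simp: polys_iff)
    moreover have "(\<Sum>m\<in>M. Poly_Mapping.single m (e m)) \<in> polys V"
      using insert by (intro polys_sum) (auto simp: polys_iff)
    ultimately show ?case using insert by (auto intro: add)
  qed (auto intro: zero)
  then show ?thesis using sum_of_terms[of f] f by (metis polys_iff)
qed

text \<open>Evaluation in an arbitrary commutative ring \<open>R\<close>, with \<open>j\<close> as the structure map; it is needed for the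
  stalks of a scheme, which are not types.\<close>

definition peval :: "'r ring \<Rightarrow> ('k::field \<Rightarrow> 'r) \<Rightarrow> ('v \<Rightarrow> 'r) \<Rightarrow> ('v, 'k) mpoly \<Rightarrow> 'r" where
  "peval R j y f = (\<Oplus>\<^bsub>R\<^esub>m\<in>Poly_Mapping.keys f. j (Poly_Mapping.lookup f m) \<otimes>\<^bsub>R\<^esub>
     (\<Otimes>\<^bsub>R\<^esub>v\<in>Poly_Mapping.keys m. y v [^]\<^bsub>R\<^esub> Poly_Mapping.lookup m v))"

locale evaluation = cring R for R :: "'r ring" (structure) +
  fixes j :: "'k::field \<Rightarrow> 'r" and y :: "'v \<Rightarrow> 'r"
  assumes j_hom: "j \<in> ring_hom field_ring R" and y_closed: "y v \<in> carrier R"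
begin

lemma j_simps: "j (a + b) = j a \<oplus> j b" "j (a * b) = j a \<otimes> j b" "j 1 = \<one>" "j a \<in> carrier R"
  using ring_hom_add[OF j_hom] ring_hom_mult[OF j_hom] ring_hom_one[OF j_hom] ring_hom_closed[OF j_hom]
  by simp_all

lemma j_zero: "j 0 = \<zero>"
proof -
  have "j 0 = \<ominus> j 0 \<oplus> (j 0 \<oplus> j 0)" using j_simps(4)[of 0] by (simp add: r_neg1)
  also have "\<dots> = \<zero>" using j_simps(1)[of 0 0] j_simps(4)[of 0] by (simp add: l_neg)
  finally show ?thesis .
qed

definition mon :: "('v \<Rightarrow>\<^sub>0 nat) \<Rightarrow> 'r" where
  "mon m = (\<Otimes>v\<in>Poly_Mapping.keys m. y v [^] Poly_Mapping.lookup m v)"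

lemma mon_closed [simp]: "mon m \<in> carrier R"
  unfolding mon_def by (rule finprod_closed) (auto simp: y_closed)

lemma mon_extend:
  assumes "finite X" "Poly_Mapping.keys m \<subseteq> X"
  shows "mon m = (\<Otimes>v\<in>X. y v [^] Poly_Mapping.lookup m v)"
  unfolding mon_def
  by (rule finprod_mono_neutral_cong_left) (use assms in \<open>auto simp: y_closed in_keys_iff\<close>)

lemma mon_add: "mon (m + n) = mon m \<otimes> mon n"
proof -
  let ?X = "Poly_Mapping.keys m \<union> Poly_Mapping.keys n"
  have "mon (m + n) = (\<Otimes>v\<in>?X. y v [^] Poly_Mapping.lookup (m + n) v)"
    by (rule mon_extend) (use Poly_Mapping.keys_add[of m n] in auto)
  also have "\<dots> = (\<Otimes>v\<in>?X. y v [^] Poly_Mapping.lookup m v \<otimes> y v [^] Poly_Mapping.lookup n v)"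
    by (rule finprod_cong') (auto simp: y_closed lookup_add nat_pow_mult)
  also have "\<dots> = mon m \<otimes> mon n"
    by (subst finprod_multf) (auto simp: y_closed mon_extend[of ?X])
  finally show ?thesis .
qed

abbreviation ev :: "('v, 'k) mpoly \<Rightarrow> 'r" where "ev \<equiv> peval R j y"

lemma ev_def: "ev f = (\<Oplus>m\<in>Poly_Mapping.keys f. j (Poly_Mapping.lookup f m) \<otimes> mon m)"
  by (simp add: peval_def mon_def)

lemma ev_extend:
  assumes "finite X" "Poly_Mapping.keys f \<subseteq> X"
  shows "ev f = (\<Oplus>m\<in>X. j (Poly_Mapping.lookup f m) \<otimes> mon m)"
  unfolding ev_def
  by (rule add.finprod_mono_neutral_cong_left) (use assms in \<open>auto simp: j_simps j_zero in_keys_iff\<close>)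

lemma ev_closed [simp]: "ev f \<in> carrier R"
  unfolding ev_def by (rule finsum_closed) (auto simp: j_simps)

lemma ev_add: "ev (f + g) = ev f \<oplus> ev g"
proof -
  let ?X = "Poly_Mapping.keys f \<union> Poly_Mapping.keys g"
  have "ev (f + g) = (\<Oplus>m\<in>?X. j (Poly_Mapping.lookup (f + g) m) \<otimes> mon m)"
    by (rule ev_extend) (use Poly_Mapping.keys_add[of f g] in auto)
  also have "\<dots> = (\<Oplus>m\<in>?X. j (Poly_Mapping.lookup f m) \<otimes> mon m \<oplus> j (Poly_Mapping.lookup g m) \<otimes> mon m)"
    by (rule add.finprod_cong') (auto simp: j_simps lookup_add l_distr)
  also have "\<dots> = ev f \<oplus> ev g"
    by (subst finsum_addf) (auto simp: j_simps ev_extend[of ?X])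
  finally show ?thesis .
qed

lemma ev_single: "ev (Poly_Mapping.single m c) = j c \<otimes> mon m"
  by (cases "c = 0") (simp_all add: ev_def j_zero j_simps)

lemma ev_zero: "ev 0 = \<zero>" by (simp add: ev_def)

lemma single_induct [case_names zero single add]:
  assumes "P 0" "\<And>m c. P (Poly_Mapping.single m c)" "\<And>f g. P f \<Longrightarrow> P g \<Longrightarrow> P (f + g)"
  shows "P (f :: ('v, 'k) mpoly)"
proof -
  have "P (\<Sum>m\<in>M. Poly_Mapping.single m (e m))" for M e
    by (induction M rule: infinite_finite_induct) (use assms in auto)
  then show ?thesis using sum_of_terms[of f] by metis
qed

lemma ev_mult: "ev (f * g) = ev f \<otimes> ev g"
proof (induction f rule: single_induct)
  case (single m c)
  show ?case
  proof (induction g rule: single_induct)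
    case (single n d)
    then show ?case by (simp add: mult_single ev_single j_simps mon_add m_ac)
  qed (simp_all add: ev_zero ev_add distrib_left r_distr)
qed (simp_all add: ev_zero ev_add distrib_right l_distr)

lemma ev_const: "ev (poly_const c) = j c"
  by (simp add: poly_const_def ev_single mon_def j_simps)

lemma ev_var: "ev (poly_var v) = y v"
  by (simp add: poly_var_def ev_single mon_def j_simps y_closed)

lemma ev_hom: "ev \<in> ring_hom (poly_ring V) R"
  using ev_const[of 1] by (intro ring_hom_memI) (auto simp: ev_add ev_mult poly_const_simps j_simps)

end

lemma poly_hom_eq:
  assumes "h \<in> ring_hom (poly_ring V) R" "h' \<in> ring_hom (poly_ring V) R"
    and "\<And>c. h (poly_const c) = h' (poly_const c)" "\<And>v. v \<in> V \<Longrightarrow> h (poly_var v) = h' (poly_var v)"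
    and "f \<in> polys V"
  shows "h f = h' f"
  using assms(5)
  by (induction rule: polys_induct)
    (use assms(3,4) ring_hom_add[OF assms(1)] ring_hom_add[OF assms(2)] ring_hom_mult[OF assms(1)]
      ring_hom_mult[OF assms(2)] in auto)

lemma poly_const_hom: "poly_const \<in> ring_hom field_ring (poly_ring V)"
  by (rule ring_hom_memI) (auto simp: poly_const_simps)

text \<open>Substitution of polynomials for the indeterminates.\<close>

definition psubst :: "('v \<Rightarrow> ('w, 'k::field) mpoly) \<Rightarrow> ('v, 'k) mpoly \<Rightarrow> ('w, 'k) mpoly" where
  "psubst \<sigma> = peval (poly_ring UNIV) poly_const \<sigma>"

lemma psubst_evaluation: "evaluation (poly_ring UNIV) poly_const \<sigma>"
  by (intro evaluation.intro poly_ring_cring evaluation_axioms.intro poly_const_hom) auto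

lemma psubst_simps [simp]:
  "psubst \<sigma> (f + g) = psubst \<sigma> f + psubst \<sigma> g" "psubst \<sigma> (f * g) = psubst \<sigma> f * psubst \<sigma> g"
  "psubst \<sigma> (poly_const c) = poly_const c" "psubst \<sigma> (poly_var v) = \<sigma> v"
  "psubst \<sigma> 0 = 0" "psubst \<sigma> 1 = 1"
proof -
  interpret evaluation "poly_ring UNIV" poly_const \<sigma> by (rule psubst_evaluation)
  show "psubst \<sigma> (f + g) = psubst \<sigma> f + psubst \<sigma> g" "psubst \<sigma> (f * g) = psubst \<sigma> f * psubst \<sigma> g"
    "psubst \<sigma> (poly_const c) = poly_const c" "psubst \<sigma> (poly_var v) = \<sigma> v"
    "psubst \<sigma> 0 = 0" "psubst \<sigma> 1 = 1"
    using ev_add[of f g] ev_mult[of f g] ev_const[of c] ev_const[of 1] ev_var[of v] ev_zero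
    by (simp_all add: psubst_def poly_const_simps)
qed

lemma psubst_uminus [simp]: "psubst \<sigma> (- f) = - psubst \<sigma> f"
  using psubst_simps(1)[of \<sigma> "- f" f] by (simp add: eq_neg_iff_add_eq_0 del: psubst_simps(1))

lemma psubst_diff [simp]: "psubst \<sigma> (f - g) = psubst \<sigma> f - psubst \<sigma> g"
  using psubst_simps(1)[of \<sigma> f "- g"] by simp

lemma psubst_power [simp]: "psubst \<sigma> (f ^ n) = psubst \<sigma> f ^ n"
  by (induction n) auto

lemma psubst_sum: "psubst \<sigma> (sum f X) = (\<Sum>x\<in>X. psubst \<sigma> (f x))"
  by (induction X rule: infinite_finite_induct) auto

lemma psubst_polys:
  assumes "f \<in> polys V" "\<And>v. v \<in> V \<Longrightarrow> \<sigma> v \<in> polys W"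
  shows "psubst \<sigma> f \<in> polys W"
  using assms(1) by (induction rule: polys_induct) (use assms(2) in auto)

lemma psubst_cong:
  assumes "f \<in> polys V" "\<And>v. v \<in> V \<Longrightarrow> \<sigma> v = \<tau> v"
  shows "psubst \<sigma> f = psubst \<tau> f"
  using assms(1) by (induction rule: polys_induct) (use assms(2) in auto)

lemma psubst_psubst: "psubst \<tau> (psubst \<sigma> f) = psubst (\<lambda>v. psubst \<tau> (\<sigma> v)) f"
  using polys_UNIV[of f] by (induction rule: polys_induct) auto

lemma psubst_var [simp]: "psubst poly_var f = f"
  using polys_UNIV[of f] by (induction rule: polys_induct) auto

lemma psubst_ident:
  assumes "f \<in> polys V" "\<And>v. v \<in> V \<Longrightarrow> \<sigma> v = poly_var v"
  shows "psubst \<sigma> f = f"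
  using psubst_cong[OF assms] by simp

section \<open>Morphisms of spectra induced by homomorphisms\<close>

lemma (in k_algebra) germ_section:
  assumes "openin (zariski A) U" "a \<in> carrier A" "b \<in> carrier A" "\<And>P. P \<in> U \<Longrightarrow> b \<notin> P"
  shows "(\<lambda>P\<in>U. germ A P a b) \<in> sect (Spec A \<iota>) U"
  unfolding Spec_sect
proof (intro conjI ballI)
  show "(\<lambda>P\<in>U. germ A P a b) \<in> (\<Pi>\<^sub>E P\<in>U. carrier (stalk_at A P))"
  proof (rule restrict_PiE_iff[THEN iffD2], rule ballI)
    fix P assume P: "P \<in> U"
    interpret M: mult_set A "carrier A - P" by (rule prime_mult_set[OF zariski_subset[OF is_cring assms(1) P]])
    show "germ A P a b \<in> carrier (stalk_at A P)" using assms P by (intro M.frac_in_loc) auto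
  qed
  fix P assume "P \<in> U"
  then have P: "P \<in> U" .
  show "\<exists>V a' b'. openin (zariski A) V \<and> P \<in> V \<and> V \<subseteq> U \<and> a' \<in> carrier A \<and> b' \<in> carrier A \<and>
       (\<forall>Q\<in>V. b' \<notin> Q \<and> (\<lambda>P\<in>U. germ A P a b) Q = germ A Q a' b')"
    by (rule exI[of _ U], rule exI[of _ a], rule exI[of _ b]) (use assms P in auto)
qed

text \<open>The induced morphism is obtained from the universal property, so that its compatibility with pullbacks needs
  no separate argument.\<close>

definition spec_hom :: "'a ring \<Rightarrow> 'b ring \<Rightarrow> ('k::field \<Rightarrow> 'b) \<Rightarrow> ('a \<Rightarrow> 'b) \<Rightarrow>
    ('b set, ('b \<times> 'b) set, 'a set, ('a \<times> 'a) set) mor" where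
  "spec_hom A B \<iota> \<phi> = to_spec A (Spec B \<iota>) (\<lambda>Q a. germ B Q (\<phi> a) \<one>\<^bsub>B\<^esub>)"

locale alg_hom = A: k_algebra A \<iota> + B: k_algebra B \<iota>'
  for A :: "'a ring" and \<iota> :: "'k::field \<Rightarrow> 'a" and B :: "'b ring" and \<iota>' +
  fixes \<phi>
  assumes hom: "\<phi> \<in> ring_hom A B" and phi_scalars: "\<phi> (\<iota> c) = \<iota>' c"
begin

lemma phi_closed: "a \<in> carrier A \<Longrightarrow> \<phi> a \<in> carrier B"
  using hom by (rule ring_hom_closed)

lemma points: "Q \<in> topspace (ktop (Spec B \<iota>')) \<longleftrightarrow> primeideal Q B"
  by (simp add: topspace_zariski[OF B.is_cring] primes_def)

lemma germ_hom:
  assumes "primeideal Q B"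
  shows "(\<lambda>a. germ B Q (\<phi> a) \<one>\<^bsub>B\<^esub>) \<in> ring_hom A (stalk_at B Q)"
  using ring_hom_trans[OF hom mult_set.loc_hom[OF prime_mult_set[OF assms]]] by (simp add: comp_def)

lemma spec_hom_morphism: "morphism (Spec B \<iota>') (Spec A \<iota>) (spec_hom A B \<iota>' \<phi>)"
  and pullback_spec_hom: "primeideal Q B \<Longrightarrow> a \<in> carrier A \<Longrightarrow>
    pullback A (spec_hom A B \<iota>' \<phi>) Q a = germ B Q (\<phi> a) \<one>\<^bsub>B\<^esub>"
  and spec_hom_fst: "primeideal Q B \<Longrightarrow> fst (spec_hom A B \<iota>' \<phi>) Q = {a \<in> carrier A. \<phi> a \<in> Q}"
proof -
  interpret S: spec_map A \<iota> "Spec B \<iota>'"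
    by (intro spec_map.intro A.k_algebra_axioms B.Spec_locally_ringed)
  have "global_hom A \<iota> (Spec B \<iota>') (\<lambda>Q a. germ B Q (\<phi> a) \<one>\<^bsub>B\<^esub>)"
    unfolding global_hom_def
  proof (intro conjI ballI allI)
    fix a assume a: "a \<in> carrier A"
    have "\<one>\<^bsub>B\<^esub> \<notin> P" if "P \<in> topspace (zariski B)" for P
      using mult_set.S_one[OF prime_mult_set, of P B] that points by auto
    then show "(\<lambda>Q\<in>topspace (ktop (Spec B \<iota>')). germ B Q (\<phi> a) \<one>\<^bsub>B\<^esub>)
        \<in> sect (Spec B \<iota>') (topspace (ktop (Spec B \<iota>')))"
      using phi_closed[OF a] unfolding Spec_simps by (intro B.germ_section) auto
  qed (use germ_hom points phi_scalars in auto)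
  then show "morphism (Spec B \<iota>') (Spec A \<iota>) (spec_hom A B \<iota>' \<phi>)"
    unfolding spec_hom_def by (rule S.to_spec_morphism)
  show "pullback A (spec_hom A B \<iota>' \<phi>) Q a = germ B Q (\<phi> a) \<one>\<^bsub>B\<^esub>" if "primeideal Q B" "a \<in> carrier A" for Q a
    unfolding spec_hom_def using that germ_hom points by (subst S.pullback_to_spec) auto
  show "fst (spec_hom A B \<iota>' \<phi>) Q = {a \<in> carrier A. \<phi> a \<in> Q}" if Q: "primeideal Q B" for Q
  proof -
    interpret M: mult_set B "carrier B - Q" by (rule prime_mult_set[OF Q])
    show ?thesis unfolding spec_hom_def S.fst_to_spec Spec_simps
      using germ_unit_iff[OF Q phi_closed M.S_one] by auto
  qed
qed

lemma pullback_comp: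
  assumes m: "morphism T (Spec B \<iota>') m" and t: "t \<in> topspace (ktop T)" and a: "a \<in> carrier A"
  shows "pullback A (mor_comp (spec_hom A B \<iota>' \<phi>) m) t a = pullback B m t (\<phi> a)"
  using pullback_spec_hom[of "fst m t" a] morphism_point[OF m t] a
  by (simp add: pullback_def mor_comp_def points[simplified])

end

lemma closedin_zariski:
  assumes "cring A"
  shows "closedin (zariski A) C \<longleftrightarrow> (\<exists>S\<subseteq>carrier A. C = {P \<in> primes A. S \<subseteq> P})"
proof -
  have "closedin (zariski A) C \<longleftrightarrow> C \<subseteq> primes A \<and> (\<exists>S\<subseteq>carrier A. primes A - C = {P \<in> primes A. \<not> S \<subseteq> P})"
    by (simp add: closedin_def topspace_zariski[OF assms] openin_zariski[OF assms])
  also have "\<dots> \<longleftrightarrow> (\<exists>S\<subseteq>carrier A. C = {P \<in> primes A. S \<subseteq> P})"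
  proof
    assume "C \<subseteq> primes A \<and> (\<exists>S\<subseteq>carrier A. primes A - C = {P \<in> primes A. \<not> S \<subseteq> P})"
    then obtain S where S: "C \<subseteq> primes A" "S \<subseteq> carrier A" "primes A - C = {P \<in> primes A. \<not> S \<subseteq> P}" by (elim conjE exE)
    have "C = primes A - (primes A - C)" using S(1) by (simp add: double_diff)
    also have "\<dots> = {P \<in> primes A. S \<subseteq> P}" unfolding S(3) by auto
    finally show "\<exists>S\<subseteq>carrier A. C = {P \<in> primes A. S \<subseteq> P}" using S(2) by (intro exI[of _ S] conjI)
  next
    assume "\<exists>S\<subseteq>carrier A. C = {P \<in> primes A. S \<subseteq> P}"
    then obtain S where S: "S \<subseteq> carrier A" "C = {P \<in> primes A. S \<subseteq> P}" by (elim conjE exE)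
    have "primes A - C = {P \<in> primes A. \<not> S \<subseteq> P}" unfolding S(2) by auto
    moreover have "C \<subseteq> primes A" unfolding S(2) by (rule Collect_restrict)
    ultimately show "C \<subseteq> primes A \<and> (\<exists>S\<subseteq>carrier A. primes A - C = {P \<in> primes A. \<not> S \<subseteq> P})"
      using S(1) by (intro conjI exI[of _ S])
  qed
  finally show ?thesis .
qed

text \<open>A surjective homomorphism of algebras induces a closed immersion; its image consists of the
  primes that contain the kernel.\<close>

locale surj_alg_hom = alg_hom +
  assumes surj: "b \<in> carrier B \<Longrightarrow> \<exists>a\<in>carrier A. \<phi> a = b"
begin

lemma image_prime:
  assumes P: "primeideal P A" and k: "\<And>a. a \<in> carrier A \<Longrightarrow> \<phi> a = \<zero>\<^bsub>B\<^esub> \<Longrightarrow> a \<in> P"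
  shows "primeideal (\<phi> ` P) B" and "a \<in> carrier A \<Longrightarrow> \<phi> a \<in> \<phi> ` P \<longleftrightarrow> a \<in> P"
proof -
  interpret P: primeideal P A by (rule P)
  interpret h: ring_hom_ring A B \<phi>
    by (intro ring_hom_ringI2 A.ring_axioms B.ring_axioms hom)
  show iff: "\<phi> a \<in> \<phi> ` P \<longleftrightarrow> a \<in> P" if a: "a \<in> carrier A" for a
  proof
    assume "\<phi> a \<in> \<phi> ` P"
    then obtain p where p: "p \<in> P" "\<phi> a = \<phi> p" by auto
    then have pc: "p \<in> carrier A" by (simp add: P.Icarr)
    have "\<phi> (a \<ominus>\<^bsub>A\<^esub> p) = \<zero>\<^bsub>B\<^esub>" using a pc p(2) by (simp add: A.minus_eq B.r_neg)
    then have "a \<ominus>\<^bsub>A\<^esub> p \<in> P" using k a pc by simp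
    then have "(a \<ominus>\<^bsub>A\<^esub> p) \<oplus>\<^bsub>A\<^esub> p \<in> P" using p(1) by (rule additive_subgroup.a_closed[OF P.additive_subgroup_axioms])
    then show "a \<in> P" using a pc by (simp add: A.minus_eq A.a_assoc A.l_neg)
  qed simp
  have PB: "\<phi> ` P \<subseteq> carrier B" using P.Icarr by auto
  have "ideal (\<phi> ` P) B"
  proof (rule idealI)
    show "ring B" by (rule B.ring_axioms)
    show "subgroup (\<phi> ` P) (add_monoid B)"
    proof (rule B.add.subgroupI)
      show "\<phi> ` P \<subseteq> carrier B" by (rule PB)
      show "\<phi> ` P \<noteq> {}" using additive_subgroup.zero_closed[OF P.additive_subgroup_axioms] by blast
      fix x assume "x \<in> \<phi> ` P"
      then obtain p where p: "p \<in> P" "x = \<phi> p" by auto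
      have "\<ominus>\<^bsub>B\<^esub> x = \<phi> (\<ominus>\<^bsub>A\<^esub> p)" using p P.Icarr by simp
      then show "\<ominus>\<^bsub>B\<^esub> x \<in> \<phi> ` P"
        using additive_subgroup.a_inv_closed[OF P.additive_subgroup_axioms p(1)] by blast
      fix y assume "y \<in> \<phi> ` P"
      then obtain q where q: "q \<in> P" "y = \<phi> q" by auto
      have "x \<oplus>\<^bsub>B\<^esub> y = \<phi> (p \<oplus>\<^bsub>A\<^esub> q)" using p q P.Icarr by simp
      then show "x \<oplus>\<^bsub>B\<^esub> y \<in> \<phi> ` P"
        using additive_subgroup.a_closed[OF P.additive_subgroup_axioms p(1) q(1)] by blast
    qed
    fix x b assume "x \<in> \<phi> ` P" "b \<in> carrier B"
    then obtain p a where p: "p \<in> P" "x = \<phi> p" "a \<in> carrier A" "b = \<phi> a" using surj by blast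
    have "b \<otimes>\<^bsub>B\<^esub> x = \<phi> (a \<otimes>\<^bsub>A\<^esub> p)" "x \<otimes>\<^bsub>B\<^esub> b = \<phi> (p \<otimes>\<^bsub>A\<^esub> a)" using p P.Icarr by simp_all
    then show "b \<otimes>\<^bsub>B\<^esub> x \<in> \<phi> ` P" "x \<otimes>\<^bsub>B\<^esub> b \<in> \<phi> ` P"
      using P.I_l_closed[OF p(1,3)] P.I_r_closed[OF p(1,3)] by blast+
  qed
  then show "primeideal (\<phi> ` P) B"
  proof (rule primeidealI[OF _ B.is_cring])
    show "carrier B \<noteq> \<phi> ` P"
    proof
      assume "carrier B = \<phi> ` P"
      then have "\<phi> \<one>\<^bsub>A\<^esub> \<in> \<phi> ` P" using B.one_closed by simp
      then show False using iff[OF A.one_closed] P.one_imp_carrier P.I_notcarr by auto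
    qed
    fix b c assume bc: "b \<in> carrier B" "c \<in> carrier B" "b \<otimes>\<^bsub>B\<^esub> c \<in> \<phi> ` P"
    then obtain x y where xy: "x \<in> carrier A" "b = \<phi> x" "y \<in> carrier A" "c = \<phi> y" using surj by metis
    then have "x \<otimes>\<^bsub>A\<^esub> y \<in> P" using bc(3) iff[of "x \<otimes>\<^bsub>A\<^esub> y"] by simp
    then show "b \<in> \<phi> ` P \<or> c \<in> \<phi> ` P" using P.I_prime xy by blast
  qed
qed

lemma image_closed:
  assumes S: "S \<subseteq> carrier B"
  shows "(\<lambda>Q. {a \<in> carrier A. \<phi> a \<in> Q}) ` {Q \<in> primes B. S \<subseteq> Q}
    = {P \<in> primes A. {a \<in> carrier A. \<phi> a \<in> S \<or> \<phi> a = \<zero>\<^bsub>B\<^esub>} \<subseteq> P}" (is "?f ` ?Q = ?P")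
proof (intro equalityI subsetI)
  fix P assume "P \<in> ?f ` ?Q"
  then obtain Q where Q: "primeideal Q B" "S \<subseteq> Q" "P = ?f Q" by (auto simp: primes_def)
  have "fst (spec_hom A B \<iota>' \<phi>) Q \<in> primes A"
    using morphism_point[OF spec_hom_morphism, of Q] points[of Q] Q(1) by (simp add: topspace_zariski[OF A.is_cring])
  then have "P \<in> primes A" using spec_hom_fst[OF Q(1)] Q(3) by simp
  moreover have "\<zero>\<^bsub>B\<^esub> \<in> Q" using Q(1) additive_subgroup.zero_closed[of Q B]
    by (auto simp: primeideal_def ideal_def)
  ultimately show "P \<in> ?P" using Q by auto
next
  fix P assume P: "P \<in> ?P"
  then have pr: "primeideal P A" and k: "\<And>a. a \<in> carrier A \<Longrightarrow> \<phi> a = \<zero>\<^bsub>B\<^esub> \<Longrightarrow> a \<in> P"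
    by (auto simp: primes_def)
  have "S \<subseteq> \<phi> ` P"
  proof
    fix b assume b: "b \<in> S"
    then obtain a where "a \<in> carrier A" "\<phi> a = b" using surj S by blast
    then show "b \<in> \<phi> ` P" using P b by blast
  qed
  moreover have "P = ?f (\<phi> ` P)"
    using image_prime(2)[OF pr k] ideal.Icarr[of P A] pr by (auto simp: primeideal_def)
  ultimately show "P \<in> ?f ` ?Q" using image_prime(1)[OF pr k] by (auto simp: primes_def)
qed

lemma image_points:
  "fst (spec_hom A B \<iota>' \<phi>) ` topspace (ktop (Spec B \<iota>')) = {P \<in> primes A. {a \<in> carrier A. \<phi> a = \<zero>\<^bsub>B\<^esub>} \<subseteq> P}"
proof -
  have "fst (spec_hom A B \<iota>' \<phi>) ` primes B = (\<lambda>Q. {a \<in> carrier A. \<phi> a \<in> Q}) ` {Q \<in> primes B. {} \<subseteq> Q}"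
    using spec_hom_fst by (auto simp: primes_def intro!: image_cong)
  then show ?thesis using image_closed[of "{}"] by (simp add: topspace_zariski[OF B.is_cring])
qed

lemma spec_hom_closed_immersion: "closed_immersion (Spec B \<iota>') (Spec A \<iota>) (spec_hom A B \<iota>' \<phi>)"
proof -
  let ?m = "spec_hom A B \<iota>' \<phi>"
  note tB = topspace_zariski[OF B.is_cring] and tA = topspace_zariski[OF A.is_cring]
  have cont: "continuous_map (zariski B) (zariski A) (fst ?m)"
    using spec_hom_morphism by (auto simp: morphism_def split: prod.splits)
  have img: "fst ?m ` {Q \<in> primes B. S \<subseteq> Q} = (\<lambda>Q. {a \<in> carrier A. \<phi> a \<in> Q}) ` {Q \<in> primes B. S \<subseteq> Q}" for S
    using spec_hom_fst by (auto simp: primes_def intro!: image_cong)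
  have closed: "closed_map (zariski B) (zariski A) (fst ?m)"
    unfolding closed_map_def
  proof (intro allI impI)
    fix C assume "closedin (zariski B) C"
    then obtain S where S: "S \<subseteq> carrier B" "C = {Q \<in> primes B. S \<subseteq> Q}"
      unfolding closedin_zariski[OF B.is_cring] by blast
    show "closedin (zariski A) (fst ?m ` C)"
      unfolding S(2) img image_closed[OF S(1)] closedin_zariski[OF A.is_cring] by blast
  qed
  have inj: "inj_on (fst ?m) (topspace (zariski B))"
  proof (rule inj_onI)
    fix Q Q' assume QQ: "Q \<in> topspace (zariski B)" "Q' \<in> topspace (zariski B)" "fst ?m Q = fst ?m Q'"
    then have pr: "primeideal Q B" "primeideal Q' B" by (auto simp: tB primes_def)
    have sub: "Q \<subseteq> carrier B" "Q' \<subseteq> carrier B" using pr ideal.Icarr by (auto simp: primeideal_def)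
    have e: "{a \<in> carrier A. \<phi> a \<in> Q} = {a \<in> carrier A. \<phi> a \<in> Q'}" using QQ(3) spec_hom_fst pr by simp
    show "Q = Q'"
    proof (intro Set.set_eqI)
      fix b show "b \<in> Q \<longleftrightarrow> b \<in> Q'"
      proof (cases "b \<in> carrier B")
        case True
        then obtain a where "a \<in> carrier A" "\<phi> a = b" using surj by blast
        then show ?thesis using e by blast
      qed (use sub in blast)
    qed
  qed
  have stalks: "snd ?m Q ` carrier (stalk_at A (fst ?m Q)) = carrier (stalk_at B Q)" if Q: "primeideal Q B" for Q
  proof
    have hq: "snd ?m Q \<in> ring_hom (stalk_at A (fst ?m Q)) (stalk_at B Q)"
      using morphism_hom[OF spec_hom_morphism, of Q] Q points by simp
    show "snd ?m Q ` carrier (stalk_at A (fst ?m Q)) \<subseteq> carrier (stalk_at B Q)"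
      by (rule image_subsetI) (erule ring_hom_closed[OF hq])
    interpret S: spec_map A \<iota> "Spec B \<iota>'"
      by (intro spec_map.intro A.k_algebra_axioms B.Spec_locally_ringed)
    let ?chi = "\<lambda>a. germ B Q (\<phi> a) \<one>\<^bsub>B\<^esub>"
    have sndm: "snd ?m Q = loc_lift (stalk_at B Q) ?chi" by (simp add: spec_hom_def to_spec_def)
    interpret MB: mult_set B "carrier B - Q" by (rule prime_mult_set[OF Q])
    have fQ: "fst ?m Q = {a \<in> carrier A. \<phi> a \<in> Q}" by (rule spec_hom_fst[OF Q])
    have fQ': "{a \<in> carrier A. ?chi a \<notin> Units (stalk (Spec B \<iota>') Q)} = fst ?m Q"
      by (simp add: spec_hom_def S.fst_to_spec)
    interpret L: loc_hom A "carrier A - fst ?m Q" "stalk_at B Q" ?chi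
      using S.lift_locale[of Q ?chi] germ_hom[OF Q] Q points unfolding fQ' by simp
    show "carrier (stalk_at B Q) \<subseteq> snd ?m Q ` carrier (stalk_at A (fst ?m Q))"
    proof
      fix x assume "x \<in> carrier (stalk_at B Q)"
      then obtain b t where bt: "b \<in> carrier B" "t \<in> carrier B - Q" "x = germ B Q b t" by (rule MB.loc_cases)
      then obtain a s where as: "a \<in> carrier A" "\<phi> a = b" "s \<in> carrier A" "\<phi> s = t" using surj by blast
      have s: "s \<in> carrier A - fst ?m Q" using as bt unfolding fQ by auto
      have "snd ?m Q (germ A (fst ?m Q) a s) = loc_lift (stalk_at B Q) ?chi (germ A (fst ?m Q) a s)"
        by (simp only: sndm)
      also have "\<dots> = x"
        unfolding L.lift_frac[OF as(1) s] as(2,4) bt(3) by (rule MB.frac_split[OF bt(1,2), symmetric])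
      finally show "x \<in> snd ?m Q ` carrier (stalk_at A (fst ?m Q))"
        using L.frac_in_loc[OF as(1) s] by (metis image_eqI)
    qed
  qed
  have "closedin (zariski A) (fst ?m ` topspace (zariski B))"
    using closed closedin_topspace unfolding closed_map_def by blast
  then show ?thesis
    unfolding closed_immersion_def Spec_simps
    using spec_hom_morphism injective_closed_imp_embedding_map[OF cont closed inj] stalks points
    by simp
qed

end

text \<open>Mutually inverse homomorphisms give mutually inverse morphisms because a morphism to a spectrum is
  determined by its pullback of functions.\<close>

lemma alg_iso_isomorphic:
  assumes "alg_hom A \<iota> B \<iota>' \<phi>" "alg_hom B \<iota>' A \<iota> \<psi>"
    and "\<And>a. a \<in> carrier A \<Longrightarrow> \<psi> (\<phi> a) = a" "\<And>b. b \<in> carrier B \<Longrightarrow> \<phi> (\<psi> b) = b"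
  shows "isomorphic (Spec A \<iota>) (Spec B \<iota>')"
proof -
  have *: "mor_eq (Spec A \<iota>) (Spec A \<iota>) (mor_comp (spec_hom A B \<iota>' \<phi>) (spec_hom B A \<iota> \<psi>)) mor_id"
    if "alg_hom A \<iota> B \<iota>' \<phi>" "alg_hom B \<iota>' A \<iota> \<psi>" and i: "\<And>a. a \<in> carrier A \<Longrightarrow> \<psi> (\<phi> a) = a"
    for A :: "'x ring" and \<iota> :: "'k::field \<Rightarrow> 'x" and B :: "'y ring" and \<iota>' \<phi> \<psi>
  proof -
    interpret f: alg_hom A \<iota> B \<iota>' \<phi> by fact
    interpret g: alg_hom B \<iota>' A \<iota> \<psi> by fact
    interpret S: spec_map A \<iota> "Spec A \<iota>"
      by (intro spec_map.intro f.A.k_algebra_axioms f.A.Spec_locally_ringed)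
    show ?thesis
    proof (rule S.mor_eq_specI)
      show "morphism (Spec A \<iota>) (Spec A \<iota>) (mor_comp (spec_hom A B \<iota>' \<phi>) (spec_hom B A \<iota> \<psi>))"
        by (rule mor_comp_morphism[OF g.spec_hom_morphism f.spec_hom_morphism])
      show "morphism (Spec A \<iota>) (Spec A \<iota>) mor_id" by (rule S.T.mor_id_morphism)
      fix t a assume "t \<in> topspace (ktop (Spec A \<iota>))" "a \<in> carrier A"
      then show "pullback A (mor_comp (spec_hom A B \<iota>' \<phi>) (spec_hom B A \<iota> \<psi>)) t a = pullback A mor_id t a"
        using f.pullback_comp[OF g.spec_hom_morphism] g.points g.pullback_spec_hom[of t "\<phi> a"] i f.phi_closed
        by (simp add: pullback_def mor_id_def)
    qed
  qed
  show ?thesis unfolding isomorphic_def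
    using *[OF assms(1-3)] *[OF assms(2,1,4)] alg_hom.spec_hom_morphism[OF assms(1)]
      alg_hom.spec_hom_morphism[OF assms(2)] by blast
qed

section \<open>Affine schemes given by equations\<close>

abbreviation eqs_ideal :: "'v set \<Rightarrow> ('v, 'k::field) mpoly set \<Rightarrow> ('v, 'k) mpoly set" where
  "eqs_ideal V G \<equiv> genideal (poly_ring V) G"

abbreviation coord_ring :: "'v set \<Rightarrow> ('v, 'k::field) mpoly set \<Rightarrow> ('v, 'k) mpoly set ring" where
  "coord_ring V G \<equiv> poly_ring V Quot eqs_ideal V G"

abbreviation residue :: "'v set \<Rightarrow> ('v, 'k::field) mpoly set \<Rightarrow> ('v, 'k) mpoly \<Rightarrow> ('v, 'k) mpoly set" where
  "residue V G f \<equiv> eqs_ideal V G +>\<^bsub>poly_ring V\<^esub> f"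

abbreviation zero_scheme where
  "zero_scheme V G \<equiv> affine_scheme V (eqs_ideal V G)"

text \<open>A homomorphism that vanishes on an ideal is constant on its cosets; this value is the induced map
  on the quotient.\<close>

definition quot_lift :: "('a \<Rightarrow> 'b) \<Rightarrow> 'a set \<Rightarrow> 'b" where
  "quot_lift h X = the_elem (h ` X)"

locale equations =
  fixes V :: "'v set" and G :: "('v, 'k::field) mpoly set"
  assumes G: "G \<subseteq> polys V"
begin

interpretation P: cring "poly_ring V" by (rule poly_ring_cring)

lemma ideal: "ideal (eqs_ideal V G) (poly_ring V)"
  using G by (rule P.genideal_ideal)

interpretation I: ideal "eqs_ideal V G" "poly_ring V" by (rule ideal)

lemma residue_eq:
  assumes "f \<in> polys V" "g \<in> polys V"
  shows "residue V G f = residue V G g \<longleftrightarrow> f - g \<in> eqs_ideal V G"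
  using P.quotient_eq_iff_same_a_r_cos[OF ideal assms] assms by (simp add: P.minus_eq poly_ring_minus)

lemma ideal_closed: "f \<in> eqs_ideal V G \<Longrightarrow> f \<in> polys V"
  by (rule I.Icarr)

lemma eqs_in_ideal: "g \<in> G \<Longrightarrow> g \<in> eqs_ideal V G"
  using P.genideal_self[OF G] by blast

lemma ideal_add: "f \<in> eqs_ideal V G \<Longrightarrow> g \<in> eqs_ideal V G \<Longrightarrow> f + g \<in> eqs_ideal V G"
  using additive_subgroup.a_closed[OF I.additive_subgroup_axioms] by simp

lemma ideal_mult: "f \<in> eqs_ideal V G \<Longrightarrow> g \<in> polys V \<Longrightarrow> g * f \<in> eqs_ideal V G"
  using I.I_l_closed by simp

lemma ideal_zero: "0 \<in> eqs_ideal V G"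
  using additive_subgroup.zero_closed[OF I.additive_subgroup_axioms] by simp

lemma ideal_uminus: "f \<in> eqs_ideal V G \<Longrightarrow> - f \<in> eqs_ideal V G"
  using additive_subgroup.a_inv_closed[OF I.additive_subgroup_axioms] poly_ring_minus ideal_closed by metis

lemma coord_cring: "cring (coord_ring V G)"
  by (rule I.quotient_is_cring[OF P.is_cring])

lemma residue_hom: "residue V G \<in> ring_hom (poly_ring V) (coord_ring V G)"
  by (rule I.rcos_ring_hom)

lemma residue_closed: "f \<in> polys V \<Longrightarrow> residue V G f \<in> carrier (coord_ring V G)"
  using residue_hom by (rule ring_hom_closed)

lemmas residue_simps = ring_hom_add[OF residue_hom] ring_hom_mult[OF residue_hom] ring_hom_one[OF residue_hom]

lemma coord_zero: "\<zero>\<^bsub>coord_ring V G\<^esub> = residue V G 0"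
proof -
  have "residue V G \<zero>\<^bsub>poly_ring V\<^esub> = \<zero>\<^bsub>coord_ring V G\<^esub>"
    using residue_hom P.ring_axioms cring.axioms(1)[OF coord_cring] by (rule ring_hom_zero)
  then show ?thesis by simp
qed

lemma coord_cases:
  assumes "X \<in> carrier (coord_ring V G)"
  obtains f where "f \<in> polys V" "X = residue V G f"
  using assms by (auto simp: FactRing_def A_RCOSETS_def')

lemma residue_zero_iff: "f \<in> polys V \<Longrightarrow> residue V G f = \<zero>\<^bsub>coord_ring V G\<^esub> \<longleftrightarrow> f \<in> eqs_ideal V G"
  using residue_eq[of f 0] by (simp add: coord_zero)

lemma coord_algebra: "k_algebra (coord_ring V G) (\<lambda>c. residue V G (poly_const c))"
  using coord_cring ring_hom_trans[OF poly_const_hom residue_hom]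
  by (simp add: k_algebra_def k_algebra_axioms_def comp_def)

lemma zero_scheme_Spec: "zero_scheme V G = Spec (coord_ring V G) (\<lambda>c. residue V G (poly_const c))"
  by (simp add: affine_scheme_def)

lemma kernel_contains:
  assumes h: "h \<in> ring_hom (poly_ring V) R" and R: "cring R" and z: "\<And>g. g \<in> G \<Longrightarrow> h g = \<zero>\<^bsub>R\<^esub>"
    and f: "f \<in> eqs_ideal V G"
  shows "h f = \<zero>\<^bsub>R\<^esub>"
proof -
  interpret R: cring R by (rule R)
  interpret h: ring_hom_ring "poly_ring V" R h by (intro ring_hom_ringI2 P.ring_axioms R.ring_axioms h)
  have "ideal (a_kernel (poly_ring V) R h) (poly_ring V)" by (rule h.kernel_is_ideal)
  moreover have "G \<subseteq> a_kernel (poly_ring V) R h"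
  proof
    fix g assume "g \<in> G"
    then show "g \<in> a_kernel (poly_ring V) R h" unfolding a_kernel_def' using z G by blast
  qed
  ultimately have "eqs_ideal V G \<subseteq> a_kernel (poly_ring V) R h" by (rule P.genideal_minimal)
  then have "f \<in> a_kernel (poly_ring V) R h" using f by (rule subsetD)
  then show ?thesis unfolding a_kernel_def' by blast
qed

lemma quot_lift_residue:
  assumes h: "h \<in> ring_hom (poly_ring V) R" and R: "cring R" and z: "\<And>g. g \<in> G \<Longrightarrow> h g = \<zero>\<^bsub>R\<^esub>"
    and f: "f \<in> polys V"
  shows "quot_lift h (residue V G f) = h f"
proof -
  interpret R: cring R by (rule R)
  have "h (i \<oplus>\<^bsub>poly_ring V\<^esub> f) = h f" if "i \<in> eqs_ideal V G" for i
    using kernel_contains[OF h R z that] ring_hom_add[OF h ideal_closed[OF that] f] ring_hom_closed[OF h f]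
    by simp
  moreover have "residue V G f = (\<lambda>i. i \<oplus>\<^bsub>poly_ring V\<^esub> f) ` eqs_ideal V G" by (auto simp: a_r_coset_def')
  ultimately have "h ` residue V G f = {h f}" using ideal_zero by (force simp: image_iff)
  then show ?thesis by (simp add: quot_lift_def)
qed

lemma quot_lift_hom:
  assumes h: "h \<in> ring_hom (poly_ring V) R" and R: "cring R" and z: "\<And>g. g \<in> G \<Longrightarrow> h g = \<zero>\<^bsub>R\<^esub>"
  shows "quot_lift h \<in> ring_hom (coord_ring V G) R"
proof (rule ring_hom_memI)
  note l = quot_lift_residue[OF h R z]
  fix X assume "X \<in> carrier (coord_ring V G)"
  then obtain f where f: "f \<in> polys V" "X = residue V G f" by (rule coord_cases)
  show "quot_lift h X \<in> carrier R" using f l ring_hom_closed[OF h] by simp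
  fix Y assume "Y \<in> carrier (coord_ring V G)"
  then obtain g where g: "g \<in> polys V" "Y = residue V G g" by (rule coord_cases)
  have "X \<otimes>\<^bsub>coord_ring V G\<^esub> Y = residue V G (f * g)" "X \<oplus>\<^bsub>coord_ring V G\<^esub> Y = residue V G (f + g)"
    using f g residue_simps by simp_all
  then show "quot_lift h (X \<otimes>\<^bsub>coord_ring V G\<^esub> Y) = quot_lift h X \<otimes>\<^bsub>R\<^esub> quot_lift h Y"
    "quot_lift h (X \<oplus>\<^bsub>coord_ring V G\<^esub> Y) = quot_lift h X \<oplus>\<^bsub>R\<^esub> quot_lift h Y"
    using f g l ring_hom_mult[OF h f(1) g(1)] ring_hom_add[OF h f(1) g(1)] by simp_all
next
  have "\<one>\<^bsub>coord_ring V G\<^esub> = residue V G 1" using residue_simps(3) by simp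
  then show "quot_lift h \<one>\<^bsub>coord_ring V G\<^esub> = \<one>\<^bsub>R\<^esub>"
    using quot_lift_residue[OF h R z, of 1] ring_hom_one[OF h] by simp
qed

lemma zero_scheme_locally_ringed: "locally_ringed (zero_scheme V G)"
  unfolding zero_scheme_Spec by (rule k_algebra.Spec_locally_ringed[OF coord_algebra])

end

text \<open>The points of an affine scheme with values in \<open>T\<close>: morphisms from \<open>T\<close> to the scheme of zeros
  of \<open>G\<close> are the tuples of global sections of \<open>T\<close>, indexed by the coordinates, that satisfy the
  equations. A tuple is given here by the stalkwise evaluations \<open>h t\<close> of polynomials at it.\<close>

locale scheme_points = equations V G + T: locally_ringed T
  for V :: "'v set" and G :: "('v, 'k::field) mpoly set" and T :: "('k, 'p, 's) kspace"
begin

interpretation S: spec_map "coord_ring V G" "\<lambda>c. residue V G (poly_const c)" T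
  by (intro spec_map.intro coord_algebra T.locally_ringed_axioms)

lemma affine_morphism:
  assumes h: "\<And>t. t \<in> topspace (ktop T) \<Longrightarrow> h t \<in> ring_hom (poly_ring V) (stalk T t)"
    and hc: "\<And>t c. t \<in> topspace (ktop T) \<Longrightarrow> h t (poly_const c) = scal T t c"
    and z: "\<And>t g. t \<in> topspace (ktop T) \<Longrightarrow> g \<in> G \<Longrightarrow> h t g = \<zero>\<^bsub>stalk T t\<^esub>"
    and sec: "\<And>v. v \<in> V \<Longrightarrow> (\<lambda>t\<in>topspace (ktop T). h t (poly_var v)) \<in> sect T (topspace (ktop T))"
  obtains m where "morphism T (zero_scheme V G) m"
    and "\<And>t f. t \<in> topspace (ktop T) \<Longrightarrow> f \<in> polys V \<Longrightarrow> pullback (coord_ring V G) m t (residue V G f) = h t f"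
proof -
  let ?chi = "\<lambda>t. quot_lift (h t)"
  note lift = quot_lift_residue[OF h S.stalk_cring z] and lift_hom = quot_lift_hom[OF h S.stalk_cring z]
  have secs: "(\<lambda>t\<in>topspace (ktop T). h t f) \<in> sect T (topspace (ktop T))" if "f \<in> polys V" for f
    using that
  proof (induction rule: polys_induct)
    case (const c)
    have "(\<lambda>t\<in>topspace (ktop T). h t (poly_const c)) = (\<lambda>t\<in>topspace (ktop T). scal T t c)"
      by (rule restrict_ext) (rule hc)
    then show ?case using T.sect_scal[OF openin_topspace, of c] by (simp only:)
  next
    case (add f g)
    have "(\<lambda>t\<in>topspace (ktop T). h t (f + g)) = (\<lambda>t\<in>topspace (ktop T).
        (\<lambda>t\<in>topspace (ktop T). h t f) t \<oplus>\<^bsub>stalk T t\<^esub> (\<lambda>t\<in>topspace (ktop T). h t g) t)"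
      by (rule restrict_ext) (use ring_hom_add[OF h add(1,2)] in simp)
    then show ?case using T.sect_add[OF openin_topspace add(3,4)] by (simp only:)
  next
    case (mult f g)
    have "(\<lambda>t\<in>topspace (ktop T). h t (f * g)) = (\<lambda>t\<in>topspace (ktop T).
        (\<lambda>t\<in>topspace (ktop T). h t f) t \<otimes>\<^bsub>stalk T t\<^esub> (\<lambda>t\<in>topspace (ktop T). h t g) t)"
      by (rule restrict_ext) (use ring_hom_mult[OF h mult(1,2)] in simp)
    then show ?case using T.sect_mult[OF openin_topspace mult(3,4)] by (simp only:)
  qed (rule sec)
  have "global_hom (coord_ring V G) (\<lambda>c. residue V G (poly_const c)) T ?chi"
    unfolding global_hom_def
  proof (intro conjI ballI allI)
    fix X assume "X \<in> carrier (coord_ring V G)"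
    then obtain f where f: "f \<in> polys V" "X = residue V G f" by (rule coord_cases)
    have "(\<lambda>t\<in>topspace (ktop T). ?chi t X) = (\<lambda>t\<in>topspace (ktop T). h t f)"
      by (rule restrict_ext) (use lift f in simp)
    then show "(\<lambda>t\<in>topspace (ktop T). ?chi t X) \<in> sect T (topspace (ktop T))" using secs[OF f(1)] by simp
  qed (use lift_hom lift hc in auto)
  then have "morphism T (zero_scheme V G) (to_spec (coord_ring V G) T ?chi)"
    unfolding zero_scheme_Spec by (rule S.to_spec_morphism)
  moreover have "pullback (coord_ring V G) (to_spec (coord_ring V G) T ?chi) t (residue V G f) = h t f"
    if "t \<in> topspace (ktop T)" "f \<in> polys V" for t f
    using S.pullback_to_spec[of t ?chi] lift_hom lift that residue_closed by simp
  ultimately show thesis by (rule that)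
qed

lemma pullback_residue_hom:
  assumes m: "morphism T (zero_scheme V G) m" and t: "t \<in> topspace (ktop T)"
  shows "(\<lambda>f. pullback (coord_ring V G) m t (residue V G f)) \<in> ring_hom (poly_ring V) (stalk T t)"
    and "pullback (coord_ring V G) m t (residue V G (poly_const c)) = scal T t c"
    and "g \<in> eqs_ideal V G \<Longrightarrow> pullback (coord_ring V G) m t (residue V G g) = \<zero>\<^bsub>stalk T t\<^esub>"
proof -
  have g: "global_hom (coord_ring V G) (\<lambda>c. residue V G (poly_const c)) T (pullback (coord_ring V G) m)"
    using m unfolding zero_scheme_Spec by (rule S.pullback_global_hom)
  then have hom: "pullback (coord_ring V G) m t \<in> ring_hom (coord_ring V G) (stalk T t)"
    using t by (simp add: global_hom_def)
  then show "(\<lambda>f. pullback (coord_ring V G) m t (residue V G f)) \<in> ring_hom (poly_ring V) (stalk T t)"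
    using ring_hom_trans[OF residue_hom] by (simp add: comp_def)
  show "pullback (coord_ring V G) m t (residue V G (poly_const c)) = scal T t c"
    using g t by (simp add: global_hom_def)
  show "pullback (coord_ring V G) m t (residue V G g) = \<zero>\<^bsub>stalk T t\<^esub>" if "g \<in> eqs_ideal V G"
    using ring_hom_zero[OF hom cring.axioms(1)[OF coord_cring] cring.axioms(1)[OF S.stalk_cring[OF t]]] that
      residue_zero_iff[OF ideal_closed[OF that]] by simp
qed

lemma pullback_section:
  assumes m: "morphism T (zero_scheme V G) m" and f: "f \<in> polys V"
  shows "(\<lambda>t\<in>topspace (ktop T). pullback (coord_ring V G) m t (residue V G f)) \<in> sect T (topspace (ktop T))"
  using S.pullback_global_hom(1)[OF m[unfolded zero_scheme_Spec]] residue_closed[OF f] by (simp add: global_hom_def)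

lemma affine_mor_eqI:
  assumes m: "morphism T (zero_scheme V G) m" and n: "morphism T (zero_scheme V G) n"
    and e: "\<And>t v. t \<in> topspace (ktop T) \<Longrightarrow> v \<in> V \<Longrightarrow> pullback (coord_ring V G) m t (residue V G (poly_var v))
      = pullback (coord_ring V G) n t (residue V G (poly_var v))"
  shows "mor_eq T (zero_scheme V G) m n"
  unfolding zero_scheme_Spec
proof (rule S.mor_eq_specI)
  fix t X assume t: "t \<in> topspace (ktop T)" and "X \<in> carrier (coord_ring V G)"
  then obtain f where f: "f \<in> polys V" "X = residue V G f" by (elim coord_cases)
  show "pullback (coord_ring V G) m t X = pullback (coord_ring V G) n t X"
    unfolding f(2)
    by (rule poly_hom_eq[OF pullback_residue_hom(1)[OF m t] pullback_residue_hom(1)[OF n t] _ _ f(1)])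
      (use pullback_residue_hom(2)[OF m t] pullback_residue_hom(2)[OF n t] e[OF t] in auto)
qed (use m n in \<open>simp_all add: zero_scheme_Spec\<close>)

end

text \<open>The map between the schemes of zeros that a polynomial map \<open>\<sigma>\<close> induces.\<close>

definition subst_hom :: "'w set \<Rightarrow> ('w, 'k::field) mpoly set \<Rightarrow> ('v \<Rightarrow> ('w, 'k) mpoly) \<Rightarrow>
    ('v, 'k) mpoly set \<Rightarrow> ('w, 'k) mpoly set" where
  "subst_hom W H \<sigma> = quot_lift (\<lambda>f. residue W H (psubst \<sigma> f))"

abbreviation subst_mor where
  "subst_mor V G W H \<sigma> \<equiv> spec_hom (coord_ring V G) (coord_ring W H)
    (\<lambda>c. residue W H (poly_const c)) (subst_hom W H \<sigma>)"

locale polynomial_map = A: equations V G + B: equations W H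
  for V :: "'v set" and G :: "('v, 'k::field) mpoly set" and W :: "'w set" and H :: "('w, 'k) mpoly set" +
  fixes \<sigma> :: "'v \<Rightarrow> ('w, 'k) mpoly"
  assumes \<sigma>: "v \<in> V \<Longrightarrow> \<sigma> v \<in> polys W" and \<sigma>_eqs: "g \<in> G \<Longrightarrow> psubst \<sigma> g \<in> eqs_ideal W H"
begin

lemma psubst_closed: "f \<in> polys V \<Longrightarrow> psubst \<sigma> f \<in> polys W"
  by (erule psubst_polys) (rule \<sigma>)

lemma psubst_residue_hom: "(\<lambda>f. residue W H (psubst \<sigma> f)) \<in> ring_hom (poly_ring V) (coord_ring W H)"
  by (rule ring_hom_memI) (use psubst_closed B.residue_closed B.residue_simps in auto)

lemma subst_hom_residue: "f \<in> polys V \<Longrightarrow> subst_hom W H \<sigma> (residue V G f) = residue W H (psubst \<sigma> f)"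
  unfolding subst_hom_def
  by (rule A.quot_lift_residue[OF psubst_residue_hom B.coord_cring])
    (use B.residue_zero_iff[OF B.ideal_closed] \<sigma>_eqs in auto)

lemma subst_hom_hom: "subst_hom W H \<sigma> \<in> ring_hom (coord_ring V G) (coord_ring W H)"
  unfolding subst_hom_def
  by (rule A.quot_lift_hom[OF psubst_residue_hom B.coord_cring])
    (use B.residue_zero_iff[OF B.ideal_closed] \<sigma>_eqs in auto)

lemma alg_hom: "alg_hom (coord_ring V G) (\<lambda>c. residue V G (poly_const c)) (coord_ring W H)
    (\<lambda>c. residue W H (poly_const c)) (subst_hom W H \<sigma>)"
  using A.coord_algebra B.coord_algebra subst_hom_hom
  by (simp add: alg_hom_def alg_hom_axioms_def subst_hom_residue)

lemma subst_mor_morphism: "morphism (zero_scheme W H) (zero_scheme V G) (subst_mor V G W H \<sigma>)"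
  unfolding A.zero_scheme_Spec B.zero_scheme_Spec by (rule alg_hom.spec_hom_morphism[OF alg_hom])

lemma pullback_subst_comp:
  assumes "morphism T (zero_scheme W H) m" "t \<in> topspace (ktop T)" "f \<in> polys V"
  shows "pullback (coord_ring V G) (mor_comp (subst_mor V G W H \<sigma>) m) t (residue V G f)
    = pullback (coord_ring W H) m t (residue W H (psubst \<sigma> f))"
  using alg_hom.pullback_comp[OF alg_hom, of T m t "residue V G f"] assms A.residue_closed
  by (simp add: B.zero_scheme_Spec subst_hom_residue)

lemma subst_closed_immersion:
  assumes "\<And>w. w \<in> W \<Longrightarrow> \<exists>f\<in>polys V. psubst \<sigma> f - poly_var w \<in> eqs_ideal W H"
  shows "closed_immersion (zero_scheme W H) (zero_scheme V G) (subst_mor V G W H \<sigma>)"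
    and "fst (subst_mor V G W H \<sigma>) ` topspace (ktop (zero_scheme W H))
      = {P \<in> primes (coord_ring V G). \<forall>f\<in>polys V. psubst \<sigma> f \<in> eqs_ideal W H \<longrightarrow> residue V G f \<in> P}"
proof -
  have sur: "\<exists>f\<in>polys V. residue W H (psubst \<sigma> f) = residue W H g" if "g \<in> polys W" for g
    using that
  proof (induction rule: polys_induct)
    case (const c)
    then show ?case by (intro bexI[of _ "poly_const c"]) auto
  next
    case (var w)
    then obtain f where "f \<in> polys V" "psubst \<sigma> f - poly_var w \<in> eqs_ideal W H" using assms by blast
    then show ?case using B.residue_eq[of "psubst \<sigma> f" "poly_var w"] psubst_closed var by auto
  next
    case (add f g)
    then obtain f' g' where "f' \<in> polys V" "residue W H (psubst \<sigma> f') = residue W H f"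
      "g' \<in> polys V" "residue W H (psubst \<sigma> g') = residue W H g" by blast
    then show ?case using add(1,2) psubst_closed B.residue_simps(1)[of "psubst \<sigma> f'" "psubst \<sigma> g'"]
        B.residue_simps(1)[of f g] by (intro bexI[of _ "f' + g'"]) auto
  next
    case (mult f g)
    then obtain f' g' where "f' \<in> polys V" "residue W H (psubst \<sigma> f') = residue W H f"
      "g' \<in> polys V" "residue W H (psubst \<sigma> g') = residue W H g" by blast
    then show ?case using mult(1,2) psubst_closed B.residue_simps(2)[of "psubst \<sigma> f'" "psubst \<sigma> g'"]
        B.residue_simps(2)[of f g] by (intro bexI[of _ "f' * g'"]) auto
  qed
  interpret S: surj_alg_hom "coord_ring V G" "\<lambda>c. residue V G (poly_const c)" "coord_ring W H"
    "\<lambda>c. residue W H (poly_const c)" "subst_hom W H \<sigma>"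
  proof (rule surj_alg_hom.intro[OF alg_hom surj_alg_hom_axioms.intro])
    fix b assume "b \<in> carrier (coord_ring W H)"
    then obtain g where g: "g \<in> polys W" "b = residue W H g" by (rule B.coord_cases)
    then obtain f where "f \<in> polys V" "residue W H (psubst \<sigma> f) = b" using sur by blast
    then show "\<exists>a\<in>carrier (coord_ring V G). subst_hom W H \<sigma> a = b"
      using A.residue_closed subst_hom_residue by (intro bexI[of _ "residue V G f"]) auto
  qed
  show "closed_immersion (zero_scheme W H) (zero_scheme V G) (subst_mor V G W H \<sigma>)"
    unfolding A.zero_scheme_Spec B.zero_scheme_Spec by (rule S.spec_hom_closed_immersion)
  have "(\<forall>f\<in>polys V. psubst \<sigma> f \<in> eqs_ideal W H \<longrightarrow> residue V G f \<in> P) \<longleftrightarrow>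
      {a \<in> carrier (coord_ring V G). subst_hom W H \<sigma> a = \<zero>\<^bsub>coord_ring W H\<^esub>} \<subseteq> P" for P
  proof -
    have z: "subst_hom W H \<sigma> (residue V G f) = \<zero>\<^bsub>coord_ring W H\<^esub> \<longleftrightarrow> psubst \<sigma> f \<in> eqs_ideal W H"
      if "f \<in> polys V" for f
      using that subst_hom_residue B.residue_zero_iff psubst_closed by simp
    have "x \<in> P" if "\<forall>f\<in>polys V. psubst \<sigma> f \<in> eqs_ideal W H \<longrightarrow> residue V G f \<in> P"
      "x \<in> carrier (coord_ring V G)" "subst_hom W H \<sigma> x = \<zero>\<^bsub>coord_ring W H\<^esub>" for x
      using that(2)
    proof (rule A.coord_cases)
      fix f assume "f \<in> polys V" "x = residue V G f"
      then show "x \<in> P" using that z by simp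
    qed
    moreover have "residue V G f \<in> P"
      if "{a \<in> carrier (coord_ring V G). subst_hom W H \<sigma> a = \<zero>\<^bsub>coord_ring W H\<^esub>} \<subseteq> P"
        "f \<in> polys V" "psubst \<sigma> f \<in> eqs_ideal W H" for f
      using that z[of f] A.residue_closed[of f] by blast
    ultimately show ?thesis by blast
  qed
  then show "fst (subst_mor V G W H \<sigma>) ` topspace (ktop (zero_scheme W H))
      = {P \<in> primes (coord_ring V G). \<forall>f\<in>polys V. psubst \<sigma> f \<in> eqs_ideal W H \<longrightarrow> residue V G f \<in> P}"
    unfolding B.zero_scheme_Spec S.image_points by simp
qed

end

text \<open>The working criterion for isomorphisms of affine schemes: two polynomial substitutions that respect
  the equations and are inverse to each other modulo them.\<close>

lemma subst_isomorphic:
  assumes "polynomial_map V G W H \<sigma>" "polynomial_map W H V G \<tau>"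
    and "\<And>v. v \<in> V \<Longrightarrow> psubst \<tau> (\<sigma> v) - poly_var v \<in> eqs_ideal V G"
    and "\<And>w. w \<in> W \<Longrightarrow> psubst \<sigma> (\<tau> w) - poly_var w \<in> eqs_ideal W H"
  shows "isomorphic (zero_scheme V G) (zero_scheme W H)"
proof -
  have *: "subst_hom V G \<tau> (subst_hom W H \<sigma> X) = X"
    if "polynomial_map V G W H \<sigma>" "polynomial_map W H V G \<tau>"
    and e: "\<And>v. v \<in> V \<Longrightarrow> psubst \<tau> (\<sigma> v) - poly_var v \<in> eqs_ideal V G"
    and X: "X \<in> carrier (coord_ring V G)"
    for V :: "'x set" and G :: "('x, 'k::field) mpoly set" and W :: "'y set" and H \<sigma> \<tau> X
  proof -
    interpret f: polynomial_map V G W H \<sigma> by fact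
    interpret g: polynomial_map W H V G \<tau> by fact
    obtain p where p: "p \<in> polys V" "X = residue V G p" using X by (rule f.A.coord_cases)
    have "(\<lambda>p. residue V G (psubst \<tau> (psubst \<sigma> p))) \<in> ring_hom (poly_ring V) (coord_ring V G)"
      by (rule ring_hom_memI) (use f.psubst_closed g.psubst_closed f.A.residue_closed f.A.residue_simps in auto)
    then have "residue V G (psubst \<tau> (psubst \<sigma> p)) = residue V G p"
      using f.A.residue_hom
      by (rule poly_hom_eq[OF _ _ _ _ p(1)])
        (use e f.A.residue_eq f.\<sigma> g.psubst_closed in auto)
    then show ?thesis using p f.subst_hom_residue g.subst_hom_residue f.psubst_closed by simp
  qed
  interpret f: polynomial_map V G W H \<sigma> by fact
  interpret g: polynomial_map W H V G \<tau> by fact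
  show ?thesis
    unfolding f.A.zero_scheme_Spec f.B.zero_scheme_Spec
    using *[OF assms(1,2,3)] *[OF assms(2,1,4)] by (intro alg_iso_isomorphic[OF f.alg_hom g.alg_hom]) auto
qed

section \<open>Affine varieties, their products and principal open subsets\<close>

lemma isomorphic_refl: "locally_ringed X \<Longrightarrow> isomorphic X X"
  unfolding isomorphic_def using locally_ringed.mor_id_morphism[of X]
  by (intro exI[of _ mor_id]) (simp add: mor_eq_def)

lemma isomorphic_sym: "isomorphic X Y \<Longrightarrow> isomorphic Y X"
  unfolding isomorphic_def by blast

lemma isomorphic_trans:
  assumes "isomorphic X Y" "isomorphic Y Z"
  shows "isomorphic X Z"
proof -
  obtain m n where m: "morphism X Y m" "morphism Y X n" "mor_eq X X (mor_comp n m) mor_id"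
    "mor_eq Y Y (mor_comp m n) mor_id" using assms(1) unfolding isomorphic_def by blast
  obtain k l where k: "morphism Y Z k" "morphism Z Y l" "mor_eq Y Y (mor_comp l k) mor_id"
    "mor_eq Z Z (mor_comp k l) mor_id" using assms(2) unfolding isomorphic_def by blast
  have *: "mor_eq A A (mor_comp (mor_comp n' l') (mor_comp k' m')) mor_id"
    if "morphism A B m'" "morphism B A n'" "mor_eq A A (mor_comp n' m') mor_id"
      "morphism B C k'" "morphism C B l'" "mor_eq B B (mor_comp l' k') mor_id"
    for A :: "('x1::field, 'x2, 'x3) kspace" and B :: "('x1, 'x4, 'x5) kspace" and C :: "('x1, 'x6, 'x7) kspace"
      and m' n' k' l'
  proof -
    have "mor_eq A B (mor_comp (mor_comp l' k') m') (mor_comp mor_id m')"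
      by (rule mor_eq_comp[OF mor_eq_refl that(6,1)]) (rule mor_comp_morphism[OF that(4,5)])
    then have "mor_eq A A (mor_comp n' (mor_comp (mor_comp l' k') m')) (mor_comp n' (mor_comp mor_id m'))"
      by (rule mor_eq_comp[OF _ mor_eq_refl _ that(2)])
        (rule mor_comp_morphism[OF that(1) mor_comp_morphism[OF that(4,5)]])
    then show ?thesis using that(3) mor_eq_trans by (simp add: mor_comp_assoc) blast
  qed
  show ?thesis unfolding isomorphic_def
    using *[OF m(1-3) k(1-3)] *[OF k(2,1,4) m(2,1,4)] mor_comp_morphism[OF m(1) k(1)] mor_comp_morphism[OF k(2) m(2)]
    by blast
qed

lemma open_subspace_simps [simp]:
  "ktop (open_subspace X U) = subtopology (ktop X) U" "stalk (open_subspace X U) = stalk X"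
  "scal (open_subspace X U) = scal X" "sect (open_subspace X U) = sect X"
  by (simp_all add: open_subspace_def)

lemma open_subspace_topspace: "open_subspace X (topspace (ktop X)) = X"
  by (simp add: open_subspace_def)

lemma open_subspace_locally_ringed:
  assumes X: "locally_ringed X" and D: "openin (ktop X) D"
  shows "locally_ringed (open_subspace X D)"
proof -
  interpret locally_ringed X by (rule X)
  have o: "openin (subtopology (ktop X) D) U \<longleftrightarrow> openin (ktop X) U \<and> U \<subseteq> D" for U
    by (rule openin_open_subtopology[OF D])
  have t: "topspace (subtopology (ktop X) D) = D" using openin_subset[OF D] by auto
  have pD: "p \<in> D \<Longrightarrow> p \<in> topspace (ktop X)" for p using openin_subset[OF D] by blast
  show ?thesis
  proof (unfold locally_ringed_def open_subspace_simps o t, intro conjI allI impI; (elim conjE)?)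
    fix p assume p: "p \<in> D"
    show "local_ring (stalk X p)" "scal X p \<in> ring_hom field_ring (stalk X p)"
      using stalk_local scal_hom pD[OF p] by auto
    fix a assume "a \<in> carrier (stalk X p)"
    then obtain U s where U: "openin (ktop X) U" "p \<in> U" "s \<in> sect X U" "s p = a"
      using germ_exists[OF pD[OF p]] by blast
    have "openin (ktop X) (U \<inter> D)" using U(1) D by (rule openin_Int)
    then have "restrict s (U \<inter> D) \<in> sect X (U \<inter> D)" using sect_restrict[OF U(1) _ _ U(3)] by blast
    then show "\<exists>U s. (openin (ktop X) U \<and> U \<subseteq> D) \<and> p \<in> U \<and> s \<in> sect X U \<and> s p = a"
      using U p D by (intro exI[of _ "U \<inter> D"] exI[of _ "restrict s (U \<inter> D)"]) auto
  next
    fix U assume "openin (ktop X) U"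
    then show "sect X U \<subseteq> (\<Pi>\<^sub>E p\<in>U. carrier (stalk X p))" by (rule sect_germs)
  next
    fix U c assume "openin (ktop X) U"
    then show "(\<lambda>p\<in>U. scal X p c) \<in> sect X U" by (rule sect_scal)
  next
    fix U s t assume h: "openin (ktop X) U" "U \<subseteq> D" "s \<in> sect X U" "t \<in> sect X U"
    show "(\<lambda>p\<in>U. s p \<oplus>\<^bsub>stalk X p\<^esub> t p) \<in> sect X U" "(\<lambda>p\<in>U. s p \<otimes>\<^bsub>stalk X p\<^esub> t p) \<in> sect X U"
      using h(1,3,4) by (rule sect_add, rule sect_mult)
    fix p assume "p \<in> U" "s p = t p"
    then obtain V where "openin (ktop X) V" "p \<in> V" "V \<subseteq> U" "\<forall>q\<in>V. s q = t q"
      using germ_eq[OF h(1,3,4)] by blast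
    then show "\<exists>V. (openin (ktop X) V \<and> V \<subseteq> D) \<and> p \<in> V \<and> V \<subseteq> U \<and> (\<forall>q\<in>V. s q = t q)"
      using h(2) by (intro exI[of _ V]) auto
  next
    fix U V s assume "openin (ktop X) U" "openin (ktop X) V" "V \<subseteq> U" "s \<in> sect X U"
    then show "restrict s V \<in> sect X V" by (rule sect_restrict)
  next
    fix U s assume U: "openin (ktop X) U" and s: "s \<in> (\<Pi>\<^sub>E p\<in>U. carrier (stalk X p))"
      and l: "\<forall>p. p \<in> U \<longrightarrow> (\<exists>V. (openin (ktop X) V \<and> V \<subseteq> D) \<and> p \<in> V \<and> V \<subseteq> U \<and> restrict s V \<in> sect X V)"
    show "s \<in> sect X U" using U s
    proof (rule sect_glue)
      fix p assume "p \<in> U"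
      then obtain V where "openin (ktop X) V" "p \<in> V" "V \<subseteq> U" "restrict s V \<in> sect X V" using l by blast
      then show "\<exists>V. openin (ktop X) V \<and> p \<in> V \<and> V \<subseteq> U \<and> restrict s V \<in> sect X V" by (intro exI[of _ V] conjI)
    qed
  qed
qed

lemma open_subspace_inclusion:
  assumes X: "locally_ringed X" and D: "openin (ktop X) D"
  shows "morphism (open_subspace X D) X mor_id"
proof -
  interpret locally_ringed X by (rule X)
  have t: "topspace (subtopology (ktop X) D) = D" using openin_subset[OF D] by auto
  have e: "{p \<in> topspace (ktop X). p \<in> D \<and> p \<in> V} = D \<inter> V" for V using openin_subset[OF D] by auto
  have "restrict s (D \<inter> V) \<in> sect X (D \<inter> V)" if V: "openin (ktop X) V" "s \<in> sect X V" for V s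
    using sect_restrict[OF V(1) openin_Int[OF D V(1)] _ V(2)] by blast
  then show ?thesis
    by (simp add: morphism_def mor_id_def e continuous_map_from_subtopology continuous_map_id[unfolded id_def] ring_hom_def)
qed

lemma morphism_into_open:
  assumes m: "morphism T X m" and D: "openin (ktop X) D" and i: "\<And>t. t \<in> topspace (ktop T) \<Longrightarrow> fst m t \<in> D"
  shows "morphism T (open_subspace X D) m"
proof -
  obtain f \<phi> where mf: "m = (f, \<phi>)" by fastforce
  have "continuous_map (ktop T) (subtopology (ktop X) D) f"
    using m i by (auto simp: mf morphism_def continuous_map_in_subtopology)
  then show ?thesis
    using m by (auto simp: mf morphism_def openin_open_subtopology[OF D])
qed

lemma zero_scheme_finite_type:
  fixes n :: nat
  assumes G: "G \<subseteq> polys {..<n}"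
  shows "finite_type_scheme (zero_scheme {..<n} G)"
proof -
  interpret equations "{..<n}" G using G by unfold_locales
  let ?X = "zero_scheme {..<n} G"
  have "isomorphic (open_subspace ?X (topspace (ktop ?X))) (affine_scheme {..<n} (eqs_ideal {..<n} G))"
    unfolding open_subspace_topspace by (rule isomorphic_refl[OF zero_scheme_locally_ringed])
  then have "\<exists>(n'::nat) I. ideal I (poly_ring {..<n'}) \<and>
      isomorphic (open_subspace ?X (topspace (ktop ?X))) (affine_scheme {..<n'} I)"
    by (intro exI[of _ n] exI[of _ "eqs_ideal {..<n} G"] conjI ideal)
  then show ?thesis
    unfolding finite_type_scheme_def using zero_scheme_locally_ringed
    by (intro conjI exI[of _ "{topspace (ktop ?X)}"] ballI) simp_all
qed

lemma mor_eq_pullback: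
  assumes "mor_eq T (Spec A \<iota>) m n" "morphism T (Spec A \<iota>) m" "k_algebra A \<iota>"
    "t \<in> topspace (ktop T)" "a \<in> carrier A"
  shows "pullback A m t a = pullback A n t a"
proof -
  interpret k_algebra A \<iota> by fact
  have "primeideal (fst m t) A"
    using morphism_point[OF assms(2,4)] by (simp add: topspace_zariski[OF is_cring] primes_def)
  then interpret M: mult_set A "carrier A - fst m t" by (rule prime_mult_set)
  have "germ A (fst m t) a \<one>\<^bsub>A\<^esub> \<in> carrier (stalk_at A (fst m t))" using assms(5) M.S_one by (rule M.frac_in_loc)
  then show ?thesis using assms(1,4) by (simp add: mor_eq_def pullback_def)
qed

lemma polynomial_mapI:
  assumes "G \<subseteq> polys V" "H \<subseteq> polys W" "\<And>v. v \<in> V \<Longrightarrow> \<sigma> v \<in> polys W"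
    "\<And>g. g \<in> G \<Longrightarrow> psubst \<sigma> g \<in> eqs_ideal W H"
  shows "polynomial_map V G W H \<sigma>"
  using assms by (simp add: polynomial_map_def equations_def polynomial_map_axioms_def)

lemma (in equations) stalk_evaluation:
  assumes T: "locally_ringed T" and t: "t \<in> topspace (ktop T)" and y: "\<And>v. y v \<in> carrier (stalk T t)"
  shows "evaluation (stalk T t) (scal T t) y"
  using locally_ringed.stalk_local[OF T t] locally_ringed.scal_hom[OF T t] y
  by (simp add: evaluation_def evaluation_axioms_def local_ring_def)

text \<open>The product of two affine schemes has as its equations those of the first in the coordinates \<open>0, \<dots>, n - 1\<close>
  and those of the second in the following coordinates.\<close>

locale two_systems = X: equations "{..<n}" G + Y: equations "{..<m}" H
  for n m :: nat and G H :: "(nat, 'k::field) mpoly set"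
begin

abbreviation shift :: "(nat, 'k) mpoly \<Rightarrow> (nat, 'k) mpoly" where
  "shift \<equiv> psubst (\<lambda>i. poly_var (n + i))"

definition prod_eqs :: "(nat, 'k) mpoly set" where "prod_eqs = G \<union> shift ` H"

lemma prod_eqs: "prod_eqs \<subseteq> polys {..<n + m}"
proof
  fix f assume "f \<in> prod_eqs"
  then consider "f \<in> G" | h where "h \<in> H" "f = shift h" by (auto simp: prod_eqs_def)
  then show "f \<in> polys {..<n + m}"
  proof cases
    case 1
    then have "f \<in> polys {..<n}" using X.G by blast
    then show ?thesis by (rule polys_mono[rotated]) auto
  next
    case 2
    then have "h \<in> polys {..<m}" using Y.G by blast
    then show ?thesis unfolding 2(2) by (rule psubst_polys) auto
  qed
qed

sublocale P: equations "{..<n + m}" prod_eqs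
  by unfold_locales (rule prod_eqs)

sublocale p: polynomial_map "{..<n}" G "{..<n + m}" prod_eqs poly_var
  by (rule polynomial_mapI) (use X.G prod_eqs P.eqs_in_ideal in \<open>auto simp: prod_eqs_def\<close>)

sublocale q: polynomial_map "{..<m}" H "{..<n + m}" prod_eqs "\<lambda>i. poly_var (n + i)"
  by (rule polynomial_mapI) (use Y.G prod_eqs P.eqs_in_ideal in \<open>auto simp: prod_eqs_def\<close>)

abbreviation proj1 where "proj1 \<equiv> subst_mor {..<n} G {..<n + m} prod_eqs poly_var"
abbreviation proj2 where "proj2 \<equiv> subst_mor {..<m} H {..<n + m} prod_eqs (\<lambda>i. poly_var (n + i))"

text \<open>A morphism to an affine scheme is a tuple of global sections, and a pair of tuples that satisfy the two
  systems of equations is one longer tuple that satisfies their union.\<close>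

lemma product_universal:
  fixes T :: "('k, 'p, 's) kspace"
  assumes T: "locally_ringed T" and f: "morphism T (zero_scheme {..<n} G) f"
    and g: "morphism T (zero_scheme {..<m} H) g"
  shows "\<exists>h. morphism T (zero_scheme {..<n + m} prod_eqs) h \<and>
    mor_eq T (zero_scheme {..<n} G) (mor_comp proj1 h) f \<and>
    mor_eq T (zero_scheme {..<m} H) (mor_comp proj2 h) g \<and>
    (\<forall>h'. morphism T (zero_scheme {..<n + m} prod_eqs) h' \<and>
      mor_eq T (zero_scheme {..<n} G) (mor_comp proj1 h') f \<and>
      mor_eq T (zero_scheme {..<m} H) (mor_comp proj2 h') g \<longrightarrow>
      mor_eq T (zero_scheme {..<n + m} prod_eqs) h' h)"
proof -
  interpret T: locally_ringed T by (rule T)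
  interpret SX: scheme_points "{..<n}" G T by unfold_locales
  interpret SY: scheme_points "{..<m}" H T by unfold_locales
  interpret SP: scheme_points "{..<n + m}" prod_eqs T by unfold_locales
  define F where "F = (\<lambda>t a. pullback (coord_ring {..<n} G) f t (residue {..<n} G a))"
  define K where "K = (\<lambda>t a. pullback (coord_ring {..<m} H) g t (residue {..<m} H a))"
  have F: "F t \<in> ring_hom (poly_ring {..<n}) (stalk T t)" "F t (poly_const c) = scal T t c"
    "e \<in> eqs_ideal {..<n} G \<Longrightarrow> F t e = \<zero>\<^bsub>stalk T t\<^esub>" if "t \<in> topspace (ktop T)" for t c e
    unfolding F_def using SX.pullback_residue_hom[OF f that] by simp_all
  have K: "K t \<in> ring_hom (poly_ring {..<m}) (stalk T t)" "K t (poly_const c) = scal T t c"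
    "e \<in> eqs_ideal {..<m} H \<Longrightarrow> K t e = \<zero>\<^bsub>stalk T t\<^esub>" if "t \<in> topspace (ktop T)" for t c e
    unfolding K_def using SY.pullback_residue_hom[OF g that] by simp_all
  define y where "y = (\<lambda>t i. if i < n then F t (poly_var i) else if i < n + m then K t (poly_var (i - n))
    else \<zero>\<^bsub>stalk T t\<^esub>)"
  define h where "h = (\<lambda>t. peval (stalk T t) (scal T t) (y t))"
  have ev: "evaluation (stalk T t) (scal T t) (y t)" if t: "t \<in> topspace (ktop T)" for t
  proof (rule X.stalk_evaluation[OF T t])
    interpret R: cring "stalk T t" by (rule local_ring_cring[OF T.stalk_local[OF t]])
    show "y t i \<in> carrier (stalk T t)" for i
      using ring_hom_closed[OF F(1)[OF t], of "poly_var i"] ring_hom_closed[OF K(1)[OF t], of "poly_var (i - n)"]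
      by (auto simp: y_def)
  qed
  have hh: "h t \<in> ring_hom (poly_ring V) (stalk T t)" and hc: "h t (poly_const c) = scal T t c"
    and hv: "h t (poly_var i) = y t i" if "t \<in> topspace (ktop T)" for t V c i
    unfolding h_def using evaluation.ev_hom[OF ev[OF that]] evaluation.ev_const[OF ev[OF that]]
      evaluation.ev_var[OF ev[OF that]] by auto
  have hF: "h t a = F t a" if t: "t \<in> topspace (ktop T)" and a: "a \<in> polys {..<n}" for t a
    by (rule poly_hom_eq[OF hh[OF t] F(1)[OF t] _ _ a])
      (use hc[OF t] hv[OF t] F(2)[OF t] in \<open>auto simp: y_def\<close>)
  have hK: "h t (shift a) = K t a" if t: "t \<in> topspace (ktop T)" and a: "a \<in> polys {..<m}" for t a
  proof -
    have "(\<lambda>a. h t (shift a)) \<in> ring_hom (poly_ring {..<m}) (stalk T t)"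
      using ring_hom_closed[OF hh[OF t, of UNIV]] ring_hom_mult[OF hh[OF t, of UNIV]]
        ring_hom_add[OF hh[OF t, of UNIV]] ring_hom_one[OF hh[OF t, of UNIV]]
      by (intro ring_hom_memI) auto
    then show ?thesis
      by (rule poly_hom_eq[OF _ K(1)[OF t] _ _ a])
        (use hc[OF t] hv[OF t] K(2)[OF t] in \<open>auto simp: y_def\<close>)
  qed
  have z: "h t e = \<zero>\<^bsub>stalk T t\<^esub>" if t: "t \<in> topspace (ktop T)" and e: "e \<in> prod_eqs" for t e
  proof -
    consider "e \<in> G" | e' where "e' \<in> H" "e = shift e'" using e by (auto simp: prod_eqs_def)
    then show ?thesis
    proof cases
      case 1
      then show ?thesis using hF[OF t] F(3)[OF t X.eqs_in_ideal] X.G by auto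
    next
      case 2
      then show ?thesis using hK[OF t] K(3)[OF t Y.eqs_in_ideal] Y.G by auto
    qed
  qed
  have sec: "(\<lambda>t\<in>topspace (ktop T). h t (poly_var i)) \<in> sect T (topspace (ktop T))" if i: "i \<in> {..<n + m}" for i
  proof (cases "i < n")
    case True
    then have "(\<lambda>t\<in>topspace (ktop T). h t (poly_var i)) = (\<lambda>t\<in>topspace (ktop T). F t (poly_var i))"
      using hv by (intro restrict_ext) (simp add: y_def)
    then show ?thesis using SX.pullback_section[OF f, of "poly_var i"] True by (simp only: F_def polys_var lessThan_iff)
  next
    case False
    then have "(\<lambda>t\<in>topspace (ktop T). h t (poly_var i)) = (\<lambda>t\<in>topspace (ktop T). K t (poly_var (i - n)))"
      using hv i by (intro restrict_ext) (simp add: y_def)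
    moreover have "poly_var (i - n) \<in> polys {..<m}" using False i by auto
    ultimately show ?thesis using SY.pullback_section[OF g, of "poly_var (i - n)"] by (simp only: K_def)
  qed
  obtain u where u: "morphism T (zero_scheme {..<n + m} prod_eqs) u"
    and pu: "\<And>t e. t \<in> topspace (ktop T) \<Longrightarrow> e \<in> polys {..<n + m} \<Longrightarrow>
      pullback (coord_ring {..<n + m} prod_eqs) u t (residue {..<n + m} prod_eqs e) = h t e"
    using SP.affine_morphism[of h, OF hh hc z sec] by blast
  have c1: "mor_eq T (zero_scheme {..<n} G) (mor_comp proj1 u) f"
  proof (rule SX.affine_mor_eqI[OF mor_comp_morphism[OF u p.subst_mor_morphism] f])
    fix t i assume "t \<in> topspace (ktop T)" "i \<in> {..<n}"
    then show "pullback (coord_ring {..<n} G) (mor_comp proj1 u) t (residue {..<n} G (poly_var i))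
        = pullback (coord_ring {..<n} G) f t (residue {..<n} G (poly_var i))"
      using p.pullback_subst_comp[OF u, of t "poly_var i"] pu[of t "poly_var i"] hF[of t "poly_var i"]
      by (simp add: F_def)
  qed
  have c2: "mor_eq T (zero_scheme {..<m} H) (mor_comp proj2 u) g"
  proof (rule SY.affine_mor_eqI[OF mor_comp_morphism[OF u q.subst_mor_morphism] g])
    fix t i assume "t \<in> topspace (ktop T)" "i \<in> {..<m}"
    then show "pullback (coord_ring {..<m} H) (mor_comp proj2 u) t (residue {..<m} H (poly_var i))
        = pullback (coord_ring {..<m} H) g t (residue {..<m} H (poly_var i))"
      using q.pullback_subst_comp[OF u, of t "poly_var i"] pu[of t "poly_var (n + i)"] hK[of t "poly_var i"]
      by (simp add: K_def)
  qed
  have un: "mor_eq T (zero_scheme {..<n + m} prod_eqs) u' u"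
    if u': "morphism T (zero_scheme {..<n + m} prod_eqs) u'"
      and e1: "mor_eq T (zero_scheme {..<n} G) (mor_comp proj1 u') f"
      and e2: "mor_eq T (zero_scheme {..<m} H) (mor_comp proj2 u') g" for u'
  proof (rule SP.affine_mor_eqI[OF u' u])
    fix t i assume t: "t \<in> topspace (ktop T)" and i: "i \<in> {..<n + m}"
    show "pullback (coord_ring {..<n + m} prod_eqs) u' t (residue {..<n + m} prod_eqs (poly_var i))
        = pullback (coord_ring {..<n + m} prod_eqs) u t (residue {..<n + m} prod_eqs (poly_var i))"
    proof (cases "i < n")
      case True
      then have v: "poly_var i \<in> polys {..<n}" by simp
      have "pullback (coord_ring {..<n} G) (mor_comp proj1 u') t (residue {..<n} G (poly_var i)) = F t (poly_var i)"
        unfolding F_def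
        by (rule mor_eq_pullback[OF e1[unfolded X.zero_scheme_Spec]
            mor_comp_morphism[OF u' p.subst_mor_morphism, unfolded X.zero_scheme_Spec] X.coord_algebra t
            X.residue_closed[OF v]])
      then show ?thesis
        using p.pullback_subst_comp[OF u' t v] pu[OF t, of "poly_var i"] hF[OF t v] i by simp
    next
      case False
      then have v: "poly_var (i - n) \<in> polys {..<m}" using i by auto
      have "pullback (coord_ring {..<m} H) (mor_comp proj2 u') t (residue {..<m} H (poly_var (i - n)))
          = K t (poly_var (i - n))"
        unfolding K_def
        by (rule mor_eq_pullback[OF e2[unfolded Y.zero_scheme_Spec]
            mor_comp_morphism[OF u' q.subst_mor_morphism, unfolded Y.zero_scheme_Spec] Y.coord_algebra t
            Y.residue_closed[OF v]])
      then show ?thesis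
        using q.pullback_subst_comp[OF u' t v] pu[OF t, of "poly_var i"] hK[OF t v] i False by simp
    qed
  qed
  show ?thesis using u c1 c2 un by blast
qed

lemma is_product: "is_product (zero_scheme {..<n + m} prod_eqs) proj1 proj2
    (zero_scheme {..<n} G) (zero_scheme {..<m} H)"
  unfolding is_product_def
proof (intro conjI allI impI)
  fix T :: "'k scheme" and f g
  assume "finite_type_scheme T \<and> morphism T (zero_scheme {..<n} G) f \<and> morphism T (zero_scheme {..<m} H) g"
  then have "locally_ringed T" "morphism T (zero_scheme {..<n} G) f" "morphism T (zero_scheme {..<m} H) g"
    by (auto simp: finite_type_scheme_def)
  then show "\<exists>h. morphism T (zero_scheme {..<n + m} prod_eqs) h \<and>
    mor_eq T (zero_scheme {..<n} G) (mor_comp proj1 h) f \<and>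
    mor_eq T (zero_scheme {..<m} H) (mor_comp proj2 h) g \<and>
    (\<forall>h'. morphism T (zero_scheme {..<n + m} prod_eqs) h' \<and>
      mor_eq T (zero_scheme {..<n} G) (mor_comp proj1 h') f \<and>
      mor_eq T (zero_scheme {..<m} H) (mor_comp proj2 h') g \<longrightarrow>
      mor_eq T (zero_scheme {..<n + m} prod_eqs) h' h)" by (rule product_universal)
qed (rule zero_scheme_finite_type[OF prod_eqs] p.subst_mor_morphism q.subst_mor_morphism)+

end

lemma (in polynomial_map) pullback_subst_mor:
  assumes "t \<in> topspace (ktop (zero_scheme W H))" "f \<in> polys V"
  shows "pullback (coord_ring V G) (subst_mor V G W H \<sigma>) t (residue V G f)
    = germ (coord_ring W H) t (residue W H (psubst \<sigma> f)) \<one>\<^bsub>coord_ring W H\<^esub>"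
  using alg_hom.pullback_spec_hom[OF alg_hom, of t "residue V G f"] assms A.residue_closed
    alg_hom.points[OF alg_hom]
  by (simp add: B.zero_scheme_Spec subst_hom_residue)

text \<open>The diagonal identifies the two copies of each coordinate. As the substitution is surjective on functions, the
  diagonal is a closed immersion, which gives separatedness.\<close>

lemma zero_scheme_variety:
  fixes n :: nat
  assumes G: "G \<subseteq> polys {..<n}"
  shows "variety (zero_scheme {..<n} G)"
proof -
  interpret X: equations "{..<n}" G using G by unfold_locales
  interpret XX: two_systems n n G G by unfold_locales
  let ?X = "zero_scheme {..<n} G"
  let ?\<sigma> = "\<lambda>i. poly_var (if i < n then i else i - n) :: (nat, 'a) mpoly"
  have s1: "psubst ?\<sigma> f = f" and s2: "psubst ?\<sigma> (XX.shift f) = f" if "f \<in> polys {..<n}" for f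
    using that by (auto simp: psubst_psubst intro!: psubst_ident)
  interpret d: polynomial_map "{..<n + n}" XX.prod_eqs "{..<n}" G ?\<sigma>
    by (rule polynomial_mapI)
      (use XX.prod_eqs G s1 s2 X.eqs_in_ideal in \<open>auto simp: XX.prod_eqs_def subset_iff\<close>)
  let ?d = "subst_mor {..<n + n} XX.prod_eqs {..<n} G ?\<sigma>"
  have closed: "closed_immersion ?X (zero_scheme {..<n + n} XX.prod_eqs) ?d"
  proof (rule d.subst_closed_immersion(1))
    fix w assume "w \<in> {..<n}"
    then show "\<exists>f\<in>polys {..<n + n}. psubst ?\<sigma> f - poly_var w \<in> eqs_ideal {..<n} G"
      using X.ideal_zero by (intro bexI[of _ "poly_var w"]) auto
  qed
  interpret S: scheme_points "{..<n}" G ?X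
    by (intro scheme_points.intro X.equations_axioms X.zero_scheme_locally_ringed)
  have id: "morphism ?X ?X mor_id" by (rule S.T.mor_id_morphism)
  have pid: "pullback (coord_ring {..<n} G) mor_id t (residue {..<n} G f)
      = germ (coord_ring {..<n} G) t (residue {..<n} G f) \<one>\<^bsub>coord_ring {..<n} G\<^esub>" for t f
    by (simp add: pullback_def mor_id_def)
  have 1: "mor_eq ?X ?X (mor_comp XX.proj1 ?d) mor_id"
  proof (rule S.affine_mor_eqI[OF mor_comp_morphism[OF d.subst_mor_morphism XX.p.subst_mor_morphism] id])
    fix t v assume tv: "t \<in> topspace (ktop ?X)" "v \<in> {..<n}"
    then show "pullback (coord_ring {..<n} G) (mor_comp XX.proj1 ?d) t (residue {..<n} G (poly_var v))
        = pullback (coord_ring {..<n} G) mor_id t (residue {..<n} G (poly_var v))"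
      using XX.p.pullback_subst_comp[OF d.subst_mor_morphism tv(1), of "poly_var v"]
        d.pullback_subst_mor[OF tv(1), of "poly_var v"] by (simp add: pid)
  qed
  have 2: "mor_eq ?X ?X (mor_comp XX.proj2 ?d) mor_id"
  proof (rule S.affine_mor_eqI[OF mor_comp_morphism[OF d.subst_mor_morphism XX.q.subst_mor_morphism] id])
    fix t v assume tv: "t \<in> topspace (ktop ?X)" "v \<in> {..<n}"
    then show "pullback (coord_ring {..<n} G) (mor_comp XX.proj2 ?d) t (residue {..<n} G (poly_var v))
        = pullback (coord_ring {..<n} G) mor_id t (residue {..<n} G (poly_var v))"
      using XX.q.pullback_subst_comp[OF d.subst_mor_morphism tv(1), of "poly_var v"]
        d.pullback_subst_mor[OF tv(1), of "poly_var (n + v)"] by (simp add: pid)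
  qed
  show ?thesis
    unfolding variety_def separated_def
    using zero_scheme_finite_type[OF G] XX.is_product closed 1 2 by blast
qed

text \<open>Inverting a function \<open>f\<close> on an affine scheme by a new coordinate \<open>s\<close> with \<open>s f = 1\<close> gives the
  open complement of the zeros of \<open>f\<close>.\<close>

lemma principal_open:
  fixes G :: "('v, 'k::field) mpoly set"
  assumes G: "G \<subseteq> polys V" and f: "f \<in> polys V" and s: "s \<notin> V"
  defines "H \<equiv> insert (poly_var s * f - 1) G"
  defines "Z \<equiv> subst_mor V G V (insert f G) poly_var"
  shows "closed_immersion (zero_scheme V (insert f G)) (zero_scheme V G) Z"
    and "isomorphic (zero_scheme (insert s V) H)
      (open_subspace (zero_scheme V G)
        (topspace (ktop (zero_scheme V G)) - fst Z ` topspace (ktop (zero_scheme V (insert f G)))))"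
proof -
  let ?W = "insert s V"
  interpret X: equations V G using G by unfold_locales
  have fW: "f \<in> polys ?W" using f by (rule polys_mono[rotated]) auto
  have "polys V \<subseteq> polys ?W" by (rule subsetI, rule polys_mono[of V]) auto
  with G have "G \<subseteq> polys ?W" by (rule subset_trans)
  then have H: "H \<subseteq> polys ?W" using fW by (simp add: H_def)
  interpret U: equations ?W H using H by unfold_locales
  interpret C: polynomial_map V G V "insert f G" poly_var
    using G f equations.eqs_in_ideal[of V "insert f G"] by (intro polynomial_mapI) (auto simp: equations_def)
  interpret i: polynomial_map V G ?W H poly_var
    by (rule polynomial_mapI) (use G H U.eqs_in_ideal in \<open>auto simp: H_def\<close>)
  have "\<exists>p\<in>polys V. psubst poly_var p - poly_var w \<in> eqs_ideal V (insert f G)" if "w \<in> V" for w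
    using that C.B.ideal_zero by (intro bexI[of _ "poly_var w"]) auto
  note closed = C.subst_closed_immersion[OF this]
  show "closed_immersion (zero_scheme V (insert f G)) (zero_scheme V G) Z"
    unfolding Z_def by (rule closed(1))
  let ?A = "coord_ring V G" and ?X = "zero_scheme V G"
  let ?D = "{P \<in> primes ?A. residue V G f \<notin> P}"
  have img: "fst Z ` topspace (ktop (zero_scheme V (insert f G))) = {P \<in> primes ?A. residue V G f \<in> P}"
  proof -
    have "fst Z ` topspace (ktop (zero_scheme V (insert f G))) = {P \<in> primes ?A.
        \<forall>p\<in>polys V. psubst poly_var p \<in> eqs_ideal V (insert f G) \<longrightarrow> residue V G p \<in> P}"
      unfolding Z_def by (rule closed(2))
    also have "\<dots> = {P \<in> primes ?A. residue V G f \<in> P}"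
  proof (intro Collect_cong conj_cong refl iffI)
    fix P assume P: "P \<in> primes ?A"
    show "residue V G f \<in> P" if "\<forall>p\<in>polys V. psubst poly_var p \<in> eqs_ideal V (insert f G) \<longrightarrow> residue V G p \<in> P"
      using that f C.B.eqs_in_ideal by simp
    assume fP: "residue V G f \<in> P"
    interpret P: primeideal P ?A using P by (simp add: primes_def)
    have h: "(\<lambda>p. P +>\<^bsub>?A\<^esub> residue V G p) \<in> ring_hom (poly_ring V) (?A Quot P)"
      using ring_hom_trans[OF X.residue_hom P.rcos_ring_hom] by (simp add: comp_def)
    have z: "P +>\<^bsub>?A\<^esub> residue V G g = \<zero>\<^bsub>?A Quot P\<^esub>" if "g \<in> insert f G" for g
    proof -
      have "g \<in> polys V" using that G f by auto
      moreover have "residue V G g \<in> P"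
      proof (cases "g = f")
        case False
        then have "residue V G g = \<zero>\<^bsub>?A\<^esub>" using that X.residue_zero_iff X.eqs_in_ideal G by auto
        then show ?thesis using additive_subgroup.zero_closed[OF P.additive_subgroup_axioms] by simp
      qed (use fP in simp)
      ultimately show ?thesis using P.a_rcos_const by (simp add: FactRing_def)
    qed
    show "\<forall>p\<in>polys V. psubst poly_var p \<in> eqs_ideal V (insert f G) \<longrightarrow> residue V G p \<in> P"
    proof (intro ballI impI)
      fix p assume p: "p \<in> polys V" "psubst poly_var p \<in> eqs_ideal V (insert f G)"
      have "P +>\<^bsub>?A\<^esub> residue V G p = P"
        using C.B.kernel_contains[OF h P.quotient_is_cring[OF X.coord_cring] z, of p] p by (simp add: FactRing_def)
      then show "residue V G p \<in> P" using P.a_rcos_self[OF X.residue_closed[OF p(1)]] by simp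
    qed
  qed
    finally show ?thesis .
  qed
  have tX: "topspace (ktop ?X) = primes ?A"
    by (simp add: X.zero_scheme_Spec topspace_zariski[OF X.coord_cring])
  have D: "topspace (ktop ?X) - fst Z ` topspace (ktop (zero_scheme V (insert f G))) = ?D"
    unfolding img tX by auto
  have oD: "openin (ktop ?X) ?D"
    using openin_basic[OF X.coord_cring X.residue_closed[OF f]] by (simp add: X.zero_scheme_Spec)
  let ?T = "open_subspace ?X ?D"
  have lT: "locally_ringed ?T" by (rule open_subspace_locally_ringed[OF X.zero_scheme_locally_ringed oD])
  have tT: "topspace (ktop ?T) = ?D" using openin_subset[OF oD] by auto
  have stT: "stalk ?T P = stalk_at ?A P" "scal ?T P c = germ ?A P (residue V G (poly_const c)) \<one>\<^bsub>?A\<^esub>"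
    "stalk ?X P = stalk_at ?A P" "scal ?X P c = germ ?A P (residue V G (poly_const c)) \<one>\<^bsub>?A\<^esub>" for P c
    by (simp_all add: X.zero_scheme_Spec)
  interpret ST: scheme_points ?W H ?T by (intro scheme_points.intro U.equations_axioms lT)
  interpret SX: scheme_points V G ?T by (intro scheme_points.intro X.equations_axioms lT)
  interpret SU: scheme_points ?W H "zero_scheme ?W H"
    by (intro scheme_points.intro U.equations_axioms U.zero_scheme_locally_ringed)
  define e where "e = residue V G f"
  have ec: "e \<in> carrier ?A" unfolding e_def by (rule X.residue_closed[OF f])
  interpret A: cring ?A by (rule X.coord_cring)
  have ms: "mult_set ?A (carrier ?A - P)" if "P \<in> ?D" for P
    using that by (intro prime_mult_set) (simp add: primes_def)
  define y where "y = (\<lambda>P v. if v \<in> V then germ ?A P (residue V G (poly_var v)) \<one>\<^bsub>?A\<^esub>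
     else if v = s then germ ?A P \<one>\<^bsub>?A\<^esub> e else \<zero>\<^bsub>stalk_at ?A P\<^esub>)"
  have eP: "e \<in> carrier ?A - P" if "P \<in> ?D" for P using that ec by (auto simp: e_def)
  have yc: "y P v \<in> carrier (stalk ?T P)" if P: "P \<in> ?D" for P v
  proof -
    interpret M: mult_set ?A "carrier ?A - P" by (rule ms[OF P])
    interpret L: cring M.loc by (rule M.loc_cring)
    show ?thesis
      unfolding stT y_def
      using M.frac_in_loc[OF X.residue_closed M.S_one, of "poly_var v"] M.frac_in_loc[OF A.one_closed eP[OF P]] L.zero_closed
      by (simp split: if_splits)
  qed
  define h where "h = (\<lambda>P. peval (stalk ?T P) (scal ?T P) (y P))"
  have ev: "evaluation (stalk ?T P) (scal ?T P) (y P)" if "P \<in> ?D" for P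
    using X.stalk_evaluation[OF lT, of P "y P"] yc[OF that] that tT by blast
  have hh: "h P \<in> ring_hom (poly_ring V') (stalk ?T P)" and hc: "h P (poly_const c) = scal ?T P c"
    and hv: "h P (poly_var v) = y P v" if "P \<in> ?D" for P V' c v
    unfolding h_def using evaluation.ev_hom[OF ev[OF that]] evaluation.ev_const[OF ev[OF that]]
      evaluation.ev_var[OF ev[OF that]] by auto
  have hV: "h P p = germ ?A P (residue V G p) \<one>\<^bsub>?A\<^esub>" if P: "P \<in> ?D" and p: "p \<in> polys V" for P p
  proof -
    have g: "(\<lambda>p. germ ?A P (residue V G p) \<one>\<^bsub>?A\<^esub>) \<in> ring_hom (poly_ring V) (stalk ?T P)"
      using ring_hom_trans[OF X.residue_hom mult_set.loc_hom[OF ms[OF P]]] by (simp add: comp_def stT)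
    show ?thesis
      by (rule poly_hom_eq[OF hh[OF P] g _ _ p]) (use hc[OF P] hv[OF P] in \<open>auto simp: stT y_def\<close>)
  qed
  have inv_e: "germ ?A P \<one>\<^bsub>?A\<^esub> e \<otimes>\<^bsub>stalk_at ?A P\<^esub> germ ?A P e \<one>\<^bsub>?A\<^esub> = \<one>\<^bsub>stalk_at ?A P\<^esub>"
    if P: "P \<in> ?D" for P
  proof -
    interpret M: mult_set ?A "carrier ?A - P" by (rule ms[OF P])
    have "germ ?A P \<one>\<^bsub>?A\<^esub> e \<otimes>\<^bsub>stalk_at ?A P\<^esub> germ ?A P e \<one>\<^bsub>?A\<^esub>
        = germ ?A P (\<one>\<^bsub>?A\<^esub> \<otimes>\<^bsub>?A\<^esub> e) (e \<otimes>\<^bsub>?A\<^esub> \<one>\<^bsub>?A\<^esub>)"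
      by (rule M.loc_mult[OF A.one_closed eP[OF P] ec M.S_one])
    also have "\<dots> = germ ?A P \<one>\<^bsub>?A\<^esub> \<one>\<^bsub>?A\<^esub>"
      by (rule M.frac_eqI) (use ec eP[OF P] M.S_one in auto)
    finally show ?thesis by (simp only: M.loc_one)
  qed
  have cancel: "x = \<zero>\<^bsub>R\<^esub>" if "cring R" "x \<in> carrier R" "x \<oplus>\<^bsub>R\<^esub> \<one>\<^bsub>R\<^esub> = \<one>\<^bsub>R\<^esub>" for R :: "'z ring" and x
  proof -
    interpret R: cring R by fact
    have "x = (x \<oplus>\<^bsub>R\<^esub> \<one>\<^bsub>R\<^esub>) \<ominus>\<^bsub>R\<^esub> \<one>\<^bsub>R\<^esub>" using that(2) by (simp add: R.minus_eq R.a_assoc R.r_neg)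
    then show ?thesis unfolding that(3) by (simp add: R.minus_eq R.r_neg)
  qed
  have z: "h P g = \<zero>\<^bsub>stalk ?T P\<^esub>" if P: "P \<in> topspace (ktop ?T)" and g: "g \<in> H" for P g
  proof (cases "g \<in> G")
    case True
    note P' = P[unfolded tT]
    interpret M: mult_set ?A "carrier ?A - P" by (rule ms[OF P'])
    have "residue V G g = \<zero>\<^bsub>?A\<^esub>" using True X.residue_zero_iff X.eqs_in_ideal G by auto
    then show ?thesis using hV[OF P', of g] True G by (auto simp: stT M.loc_zero)
  next
    case False
    note P' = P[unfolded tT]
    interpret M: mult_set ?A "carrier ?A - P" by (rule ms[OF P'])
    have g': "g = poly_var s * f - 1" using False g by (simp add: H_def)
    note hU = hh[OF P', of UNIV]
    have "h P g \<oplus>\<^bsub>stalk ?T P\<^esub> \<one>\<^bsub>stalk ?T P\<^esub> = h P (g + 1)"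
      using ring_hom_add[OF hU, of g 1] ring_hom_one[OF hU] by simp
    also have "\<dots> = h P (poly_var s) \<otimes>\<^bsub>stalk ?T P\<^esub> h P f"
      unfolding g' using ring_hom_mult[OF hU, of "poly_var s" f] by simp
    also have "\<dots> = \<one>\<^bsub>stalk ?T P\<^esub>"
      using hv[OF P', of s] s hV[OF P' f] inv_e[OF P'] by (simp add: y_def stT e_def)
    finally show ?thesis
      using ring_hom_closed[OF hU, of g] M.loc_cring by (intro cancel) (simp_all add: stT)
  qed
  have sec: "(\<lambda>P\<in>topspace (ktop ?T). h P (poly_var v)) \<in> sect ?T (topspace (ktop ?T))" if v: "v \<in> ?W" for v
  proof -
    interpret K: k_algebra ?A "\<lambda>c. residue V G (poly_const c)" by (rule X.coord_algebra)
    have st: "sect ?T U = sect (Spec ?A (\<lambda>c. residue V G (poly_const c))) U" for U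
      by (simp add: X.zero_scheme_Spec)
    have oz: "openin (zariski ?A) ?D" using oD by (simp add: X.zero_scheme_Spec)
    show ?thesis unfolding tT st
    proof (cases "v \<in> V")
      case True
      then have eq: "(\<lambda>P\<in>?D. h P (poly_var v)) = (\<lambda>P\<in>?D. germ ?A P (residue V G (poly_var v)) \<one>\<^bsub>?A\<^esub>)"
        using hv by (intro restrict_ext) (simp add: y_def)
      have c: "residue V G (poly_var v) \<in> carrier ?A" using True by (intro X.residue_closed) simp
      have n: "\<one>\<^bsub>?A\<^esub> \<notin> P" if "P \<in> ?D" for P using mult_set.S_one[OF ms[OF that]] by simp
      show "(\<lambda>P\<in>?D. h P (poly_var v)) \<in> sect (Spec ?A (\<lambda>c. residue V G (poly_const c))) ?D"
        unfolding eq by (rule K.germ_section[OF oz c A.one_closed n])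
    next
      case False
      then have eq: "(\<lambda>P\<in>?D. h P (poly_var v)) = (\<lambda>P\<in>?D. germ ?A P \<one>\<^bsub>?A\<^esub> e)"
        using hv v by (intro restrict_ext) (simp add: y_def)
      have n: "e \<notin> P" if "P \<in> ?D" for P using eP[OF that] by simp
      show "(\<lambda>P\<in>?D. h P (poly_var v)) \<in> sect (Spec ?A (\<lambda>c. residue V G (poly_const c))) ?D"
        unfolding eq by (rule K.germ_section[OF oz A.one_closed ec n])
    qed
  qed
  obtain m2 where m2: "morphism ?T (zero_scheme ?W H) m2"
    and p2: "\<And>P p. P \<in> ?D \<Longrightarrow> p \<in> polys ?W \<Longrightarrow> pullback (coord_ring ?W H) m2 P (residue ?W H p) = h P p"
    using ST.affine_morphism[of h, OF _ _ z sec] hh hc unfolding tT by blast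
  let ?m1 = "subst_mor V G ?W H poly_var"
  let ?B = "coord_ring ?W H"
  interpret B: cring ?B by (rule U.coord_cring)
  have sf: "residue ?W H (poly_var s) \<otimes>\<^bsub>?B\<^esub> residue ?W H f = \<one>\<^bsub>?B\<^esub>"
  proof -
    have "residue ?W H (poly_var s * f) = residue ?W H 1"
      using fW U.eqs_in_ideal[of "poly_var s * f - 1"] by (subst U.residue_eq) (auto simp: H_def)
    then show ?thesis using U.residue_simps(2)[of "poly_var s" f] U.residue_simps(3) fW by simp
  qed
  have resW: "residue ?W H p \<in> carrier ?B" if "p \<in> polys V" for p
    using polys_mono[of V ?W p] that U.residue_closed by blast
  have m1D: "fst ?m1 Q \<in> ?D" if Q: "Q \<in> topspace (ktop (zero_scheme ?W H))" for Q
  proof -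
    have pQ: "primeideal Q ?B" using Q alg_hom.points[OF i.alg_hom] by (simp add: U.zero_scheme_Spec)
    interpret Q: primeideal Q ?B by (rule pQ)
    have "residue ?W H f \<notin> Q"
    proof
      assume "residue ?W H f \<in> Q"
      then have "residue ?W H (poly_var s) \<otimes>\<^bsub>?B\<^esub> residue ?W H f \<in> Q"
        using U.residue_closed[of "poly_var s"] by (intro Q.I_l_closed) auto
      then show False unfolding sf using Q.one_imp_carrier Q.I_notcarr by blast
    qed
    then have "residue V G f \<notin> fst ?m1 Q"
      using alg_hom.spec_hom_fst[OF i.alg_hom pQ] i.subst_hom_residue[OF f] by simp
    moreover have "fst ?m1 Q \<in> primes ?A" using morphism_point[OF i.subst_mor_morphism Q] by (simp add: tX)
    ultimately show ?thesis by simp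
  qed
  have m1: "morphism (zero_scheme ?W H) ?T ?m1"
    by (rule morphism_into_open[OF i.subst_mor_morphism oD m1D])
  have "mor_eq ?T ?X (mor_comp ?m1 m2) mor_id"
  proof (rule SX.affine_mor_eqI)
    show "morphism ?T ?X (mor_comp ?m1 m2)" by (rule mor_comp_morphism[OF m2 i.subst_mor_morphism])
    show "morphism ?T ?X mor_id" by (rule open_subspace_inclusion[OF X.zero_scheme_locally_ringed oD])
    fix P v assume P: "P \<in> topspace (ktop ?T)" and v: "v \<in> V"
    have "pullback ?A (mor_comp ?m1 m2) P (residue V G (poly_var v)) = h P (poly_var v)"
      using i.pullback_subst_comp[OF m2 P, of "poly_var v"] p2[of P "poly_var v"] P[unfolded tT] v by simp
    then show "pullback ?A (mor_comp ?m1 m2) P (residue V G (poly_var v))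
        = pullback ?A mor_id P (residue V G (poly_var v))"
      using hV[of P "poly_var v"] P[unfolded tT] v by (simp add: pullback_def mor_id_def)
  qed
  then have e1: "mor_eq ?T ?T (mor_comp ?m1 m2) mor_id" by (simp add: mor_eq_def)
  have e2: "mor_eq (zero_scheme ?W H) (zero_scheme ?W H) (mor_comp m2 ?m1) mor_id"
  proof (rule SU.affine_mor_eqI)
    show "morphism (zero_scheme ?W H) (zero_scheme ?W H) (mor_comp m2 ?m1)" by (rule mor_comp_morphism[OF m1 m2])
    show "morphism (zero_scheme ?W H) (zero_scheme ?W H) mor_id" by (rule SU.T.mor_id_morphism)
    fix Q v assume Q: "Q \<in> topspace (ktop (zero_scheme ?W H))" and v: "v \<in> ?W"
    let ?P = "fst ?m1 Q"
    note PD = m1D[OF Q]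
    interpret MP: mult_set ?A "carrier ?A - ?P" by (rule ms[OF PD])
    have pQ: "primeideal Q ?B" using Q alg_hom.points[OF i.alg_hom] by (simp add: U.zero_scheme_Spec)
    interpret MQ: mult_set ?B "carrier ?B - Q" by (rule prime_mult_set[OF pQ])
    interpret LQ: cring "stalk_at ?B Q" by (rule MQ.loc_cring)
    have hom: "snd ?m1 Q \<in> ring_hom (stalk_at ?A ?P) (stalk_at ?B Q)"
      using morphism_hom[OF i.subst_mor_morphism Q] by (simp add: X.zero_scheme_Spec U.zero_scheme_Spec)
    have g1: "snd ?m1 Q (germ ?A ?P (residue V G p) \<one>\<^bsub>?A\<^esub>) = germ ?B Q (residue ?W H p) \<one>\<^bsub>?B\<^esub>"
      if "p \<in> polys V" for p
      using i.pullback_subst_mor[OF Q that] by (simp add: pullback_def)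
    have "snd ?m1 Q (h ?P (poly_var v)) = germ ?B Q (residue ?W H (poly_var v)) \<one>\<^bsub>?B\<^esub>"
    proof (cases "v \<in> V")
      case True
      then show ?thesis using hV[OF PD, of "poly_var v"] g1[of "poly_var v"] by simp
    next
      case False
      then have vs: "v = s" using v by simp
      let ?x = "snd ?m1 Q (germ ?A ?P \<one>\<^bsub>?A\<^esub> e)" and ?f = "germ ?B Q (residue ?W H f) \<one>\<^bsub>?B\<^esub>"
        and ?s = "germ ?B Q (residue ?W H (poly_var s)) \<one>\<^bsub>?B\<^esub>"
      have c: "?x \<in> carrier (stalk_at ?B Q)" "?f \<in> carrier (stalk_at ?B Q)" "?s \<in> carrier (stalk_at ?B Q)"
        using ring_hom_closed[OF hom MP.frac_in_loc[OF A.one_closed eP[OF PD]]]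
          MQ.frac_in_loc[OF resW[OF f] MQ.S_one] MQ.frac_in_loc[OF U.residue_closed MQ.S_one, of "poly_var s"] by auto
      have xf: "?x \<otimes>\<^bsub>stalk_at ?B Q\<^esub> ?f = \<one>\<^bsub>stalk_at ?B Q\<^esub>"
        using ring_hom_mult[OF hom MP.frac_in_loc[OF A.one_closed eP[OF PD]] MP.frac_in_loc[OF ec MP.S_one]]
          inv_e[OF PD] ring_hom_one[OF hom] g1[OF f] unfolding e_def by simp
      have fs: "?f \<otimes>\<^bsub>stalk_at ?B Q\<^esub> ?s = \<one>\<^bsub>stalk_at ?B Q\<^esub>"
      proof -
        have sc: "residue ?W H (poly_var s) \<in> carrier ?B" by (rule U.residue_closed) simp
        have "?f \<otimes>\<^bsub>stalk_at ?B Q\<^esub> ?s = germ ?B Q (residue ?W H f \<otimes>\<^bsub>?B\<^esub> residue ?W H (poly_var s)) \<one>\<^bsub>?B\<^esub>"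
          by (rule ring_hom_mult[OF MQ.loc_hom resW[OF f] sc, symmetric])
        then show ?thesis using sf B.m_comm[OF resW[OF f] sc] by (simp only: MQ.loc_one)
      qed
      have "?x = ?x \<otimes>\<^bsub>stalk_at ?B Q\<^esub> (?f \<otimes>\<^bsub>stalk_at ?B Q\<^esub> ?s)" unfolding fs using c by simp
      also have "\<dots> = (?x \<otimes>\<^bsub>stalk_at ?B Q\<^esub> ?f) \<otimes>\<^bsub>stalk_at ?B Q\<^esub> ?s" using c by (simp only: LQ.m_assoc)
      also have "\<dots> = ?s" unfolding xf using c by simp
      finally show ?thesis using hv[OF PD, of s] s by (simp add: vs y_def)
    qed
    then show "pullback ?B (mor_comp m2 ?m1) Q (residue ?W H (poly_var v))
        = pullback ?B mor_id Q (residue ?W H (poly_var v))"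
      using p2[OF PD, of "poly_var v"] v by (simp add: pullback_def mor_comp_def mor_id_def)
  qed
  show "isomorphic (zero_scheme ?W H) (open_subspace ?X
      (topspace (ktop ?X) - fst Z ` topspace (ktop (zero_scheme V (insert f G)))))"
    unfolding D isomorphic_def using m1 m2 e1 e2 by blast
qed

section \<open>The Grothendieck ring as a quotient of the group of isomorphism classes\<close>

lemma is_product_sym: "is_product W p q X Y \<Longrightarrow> is_product W q p Y X"
  unfolding is_product_def by blast

text \<open>Products are only given up to isomorphism, so the multiplication on isomorphism classes is well
  defined only once the universal property is known to be invariant in all three arguments.\<close>

lemma is_product_transport:
  fixes X X' Y :: "'k::field scheme"
  assumes P: "is_product W p q X Y" and i: "isomorphic X X'"
  shows "\<exists>p'. is_product W p' q X' Y"
proof -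
  obtain a b where a: "morphism X X' a" and b: "morphism X' X b"
    and ba: "mor_eq X X (mor_comp b a) mor_id" and ab: "mor_eq X' X' (mor_comp a b) mor_id"
    using i unfolding isomorphic_def by blast
  have W: "finite_type_scheme W" "morphism W X p" "morphism W Y q"
    and U: "\<And>(T :: 'k scheme) f g. finite_type_scheme T \<Longrightarrow> morphism T X f \<Longrightarrow> morphism T Y g \<Longrightarrow>
       (\<exists>h. morphism T W h \<and> mor_eq T X (mor_comp p h) f \<and> mor_eq T Y (mor_comp q h) g \<and>
         (\<forall>h'. morphism T W h' \<and> mor_eq T X (mor_comp p h') f \<and> mor_eq T Y (mor_comp q h') g
            \<longrightarrow> mor_eq T W h' h))"
    using P unfolding is_product_def by blast+
  have conv: "mor_eq T X' (mor_comp (mor_comp a p) h) f \<longleftrightarrow> mor_eq T X (mor_comp p h) (mor_comp b f)"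
    if h: "morphism T W h" and f: "morphism T X' f" for T :: "'k scheme" and h f
  proof
    note ph = mor_comp_morphism[OF h W(2)]
    note aph = mor_comp_morphism[OF ph a]
    assume "mor_eq T X' (mor_comp (mor_comp a p) h) f"
    then have "mor_eq T X (mor_comp b (mor_comp a (mor_comp p h))) (mor_comp b f)"
      using aph b by (intro mor_eq_comp[OF _ mor_eq_refl]) (simp_all add: mor_comp_assoc)
    moreover have "mor_eq T X (mor_comp (mor_comp b a) (mor_comp p h)) (mor_comp mor_id (mor_comp p h))"
      by (rule mor_eq_comp[OF mor_eq_refl ba ph mor_comp_morphism[OF a b]])
    ultimately show "mor_eq T X (mor_comp p h) (mor_comp b f)"
      using mor_eq_sym mor_eq_trans unfolding mor_comp_assoc mor_comp_id by blast
  next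
    note ph = mor_comp_morphism[OF h W(2)]
    assume "mor_eq T X (mor_comp p h) (mor_comp b f)"
    then have "mor_eq T X' (mor_comp a (mor_comp p h)) (mor_comp a (mor_comp b f))"
      by (rule mor_eq_comp[OF _ mor_eq_refl ph a])
    moreover have "mor_eq T X' (mor_comp (mor_comp a b) f) (mor_comp mor_id f)"
      by (rule mor_eq_comp[OF mor_eq_refl ab f mor_comp_morphism[OF b a]])
    ultimately show "mor_eq T X' (mor_comp (mor_comp a p) h) f"
      using mor_eq_trans unfolding mor_comp_assoc mor_comp_id by blast
  qed
  have "is_product W (mor_comp a p) q X' Y"
    unfolding is_product_def
  proof (intro conjI allI impI)
    fix T :: "'k scheme" and f g
    assume T: "finite_type_scheme T \<and> morphism T X' f \<and> morphism T Y g"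
    then have f: "morphism T X' f" by blast
    obtain h where h: "morphism T W h" "mor_eq T X (mor_comp p h) (mor_comp b f)" "mor_eq T Y (mor_comp q h) g"
      "\<And>h'. morphism T W h' \<Longrightarrow> mor_eq T X (mor_comp p h') (mor_comp b f) \<Longrightarrow> mor_eq T Y (mor_comp q h') g
            \<Longrightarrow> mor_eq T W h' h"
      using U[of T "mor_comp b f" g] T mor_comp_morphism[OF f b] by blast
    show "\<exists>h. morphism T W h \<and> mor_eq T X' (mor_comp (mor_comp a p) h) f \<and> mor_eq T Y (mor_comp q h) g \<and>
         (\<forall>h'. morphism T W h' \<and> mor_eq T X' (mor_comp (mor_comp a p) h') f \<and> mor_eq T Y (mor_comp q h') g
            \<longrightarrow> mor_eq T W h' h)"
      using h conv[OF _ f] by (intro exI[of _ h]) blast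
  qed (use W mor_comp_morphism[OF W(2) a] in auto)
  then show ?thesis by blast
qed

lemma is_product_unique:
  assumes P: "is_product W p q X Y" and Q: "is_product W' p' q' X Y"
  shows "isomorphic W W'"
proof -
  have *: "\<exists>h. morphism A B h \<and> mor_eq A X (mor_comp b h) a \<and> mor_eq A Y (mor_comp b' h) a'"
    if "is_product A a a' X Y" "is_product B b b' X Y" for A B a a' b b'
    using that unfolding is_product_def by blast
  have id: "mor_eq A A h mor_id" if A: "is_product A a a' X Y" and h: "morphism A A h"
    "mor_eq A X (mor_comp a h) a" "mor_eq A Y (mor_comp a' h) a'" for A a a' h
  proof -
    have "locally_ringed A" using A unfolding is_product_def finite_type_scheme_def by blast
    then have m: "morphism A A mor_id" by (rule locally_ringed.mor_id_morphism)
    have AX: "finite_type_scheme A" "morphism A X a" "morphism A Y a'" using A unfolding is_product_def by blast+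
    then obtain k where k: "\<And>h'. morphism A A h' \<Longrightarrow> mor_eq A X (mor_comp a h') a \<Longrightarrow> mor_eq A Y (mor_comp a' h') a'
        \<Longrightarrow> mor_eq A A h' k" using A unfolding is_product_def by blast
    show ?thesis using k[OF h] k[OF m] mor_eq_refl mor_eq_sym mor_eq_trans unfolding mor_comp_id by blast
  qed
  have comp: "mor_eq A Z (mor_comp a (mor_comp g h)) a"
    if "morphism A B h" "morphism B A g" "morphism A Z a" "mor_eq A Z (mor_comp b h) a" "mor_eq B Z (mor_comp a g) b"
    for A B Z :: "'a scheme" and a b g h
  proof -
    have "mor_eq A Z (mor_comp (mor_comp a g) h) (mor_comp b h)"
      by (rule mor_eq_comp[OF mor_eq_refl that(5,1) mor_comp_morphism[OF that(2,3)]])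
    then show ?thesis using that(4) mor_eq_trans unfolding mor_comp_assoc by blast
  qed
  have m: "morphism W X p" "morphism W Y q" "morphism W' X p'" "morphism W' Y q'"
    using P Q unfolding is_product_def by blast+
  obtain h where h: "morphism W W' h" "mor_eq W X (mor_comp p' h) p" "mor_eq W Y (mor_comp q' h) q"
    using *[OF P Q] by blast
  obtain g where g: "morphism W' W g" "mor_eq W' X (mor_comp p g) p'" "mor_eq W' Y (mor_comp q g) q'"
    using *[OF Q P] by blast
  have "mor_eq W W (mor_comp g h) mor_id"
    by (rule id[OF P mor_comp_morphism[OF h(1) g(1)] comp[OF h(1) g(1) m(1) h(2) g(2)] comp[OF h(1) g(1) m(2) h(3) g(3)]])
  moreover have "mor_eq W' W' (mor_comp h g) mor_id"
    by (rule id[OF Q mor_comp_morphism[OF g(1) h(1)] comp[OF g(1) h(1) m(3) g(2) h(2)] comp[OF g(1) h(1) m(4) g(3) h(3)]])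
  ultimately show ?thesis unfolding isomorphic_def using h(1) g(1) by blast
qed

lemma is_product_isomorphic:
  fixes W :: "'k::field scheme"
  assumes P: "is_product W p q X Y" and i: "isomorphic W' W" and ft: "finite_type_scheme W'"
  shows "\<exists>p' q'. is_product W' p' q' X Y"
proof -
  obtain a b where a: "morphism W' W a" and b: "morphism W W' b"
    and ba: "mor_eq W' W' (mor_comp b a) mor_id" and ab: "mor_eq W W (mor_comp a b) mor_id"
    using i unfolding isomorphic_def by blast
  have W: "morphism W X p" "morphism W Y q"
    and U: "\<And>(T :: 'k scheme) f g. finite_type_scheme T \<Longrightarrow> morphism T X f \<Longrightarrow> morphism T Y g \<Longrightarrow>
       (\<exists>h. morphism T W h \<and> mor_eq T X (mor_comp p h) f \<and> mor_eq T Y (mor_comp q h) g \<and>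
         (\<forall>h'. morphism T W h' \<and> mor_eq T X (mor_comp p h') f \<and> mor_eq T Y (mor_comp q h') g
            \<longrightarrow> mor_eq T W h' h))"
    using P unfolding is_product_def by blast+
  have pb: "mor_eq T Z (mor_comp (mor_comp r a) (mor_comp b h)) f"
    if "morphism T W h" "morphism W Z r" "mor_eq T Z (mor_comp r h) f" for T Z :: "'k scheme" and h r f
  proof -
    have "mor_eq T W (mor_comp (mor_comp a b) h) (mor_comp mor_id h)"
      by (rule mor_eq_comp[OF mor_eq_refl ab that(1) mor_comp_morphism[OF b a]])
    then have "mor_eq T Z (mor_comp r (mor_comp (mor_comp a b) h)) (mor_comp r (mor_comp mor_id h))"
      by (rule mor_eq_comp[OF _ mor_eq_refl mor_comp_morphism[OF that(1) mor_comp_morphism[OF b a]] that(2)])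
    then show ?thesis using that(3) mor_eq_trans unfolding mor_comp_assoc mor_comp_id by blast
  qed
  have "is_product W' (mor_comp p a) (mor_comp q a) X Y"
    unfolding is_product_def
  proof (intro conjI allI impI)
    fix T :: "'k scheme" and f g
    assume T: "finite_type_scheme T \<and> morphism T X f \<and> morphism T Y g"
    obtain h where h: "morphism T W h" "mor_eq T X (mor_comp p h) f" "mor_eq T Y (mor_comp q h) g"
      and un: "\<And>h'. morphism T W h' \<Longrightarrow> mor_eq T X (mor_comp p h') f \<Longrightarrow> mor_eq T Y (mor_comp q h') g
            \<Longrightarrow> mor_eq T W h' h"
      using U[of T f g] T by blast
    have un': "mor_eq T W' h' (mor_comp b h)"
      if h': "morphism T W' h'" "mor_eq T X (mor_comp (mor_comp p a) h') f" "mor_eq T Y (mor_comp (mor_comp q a) h') g" for h'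
    proof -
      have "mor_eq T W (mor_comp a h') h"
        using un[OF mor_comp_morphism[OF h'(1) a]] h'(2,3) by (simp add: mor_comp_assoc)
      then have "mor_eq T W' (mor_comp b (mor_comp a h')) (mor_comp b h)"
        by (rule mor_eq_comp[OF _ mor_eq_refl mor_comp_morphism[OF h'(1) a] b])
      moreover have "mor_eq T W' (mor_comp (mor_comp b a) h') (mor_comp mor_id h')"
        by (rule mor_eq_comp[OF mor_eq_refl ba h'(1) mor_comp_morphism[OF a b]])
      ultimately show ?thesis
        using mor_eq_sym mor_eq_trans unfolding mor_comp_assoc mor_comp_id by blast
    qed
    show "\<exists>h. morphism T W' h \<and> mor_eq T X (mor_comp (mor_comp p a) h) f \<and> mor_eq T Y (mor_comp (mor_comp q a) h) g \<and>
         (\<forall>h'. morphism T W' h' \<and> mor_eq T X (mor_comp (mor_comp p a) h') f \<and> mor_eq T Y (mor_comp (mor_comp q a) h') g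
            \<longrightarrow> mor_eq T W' h' h)"
      using mor_comp_morphism[OF h(1) b] pb[OF h(1) W(1) h(2)] pb[OF h(1) W(2) h(3)] un'
      by (intro exI[of _ "mor_comp b h"] conjI allI impI) auto
  qed (use ft mor_comp_morphism[OF a W(1)] mor_comp_morphism[OF a W(2)] in auto)
  then show ?thesis by blast
qed

lemma variety_ringed: "variety X \<Longrightarrow> locally_ringed X" "variety X \<Longrightarrow> finite_type_scheme X"
  by (simp_all add: variety_def finite_type_scheme_def)

lemma iso_class_self: "variety X \<Longrightarrow> X \<in> iso_class X"
  by (simp add: iso_class_def isomorphic_refl variety_ringed)

lemma iso_class_cong: "isomorphic X Y \<Longrightarrow> iso_class X = iso_class Y"
proof -
  assume i: "isomorphic X Y"
  have "isomorphic W X \<longleftrightarrow> isomorphic W Y" for W :: "'a scheme"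
    using isomorphic_trans[OF _ i, of W] isomorphic_trans[OF _ isomorphic_sym[OF i], of W] by (rule iffI)
  then show ?thesis by (simp add: iso_class_def)
qed

lemma iso_class_product:
  assumes "variety X" "variety Y" "variety W" and P: "is_product W p q X Y"
  shows "iso_class_prod (iso_class X) (iso_class Y) = iso_class W"
proof (intro equalityI subsetI)
  fix V assume "V \<in> iso_class_prod (iso_class X) (iso_class Y)"
  then obtain X' Y' p' q' where V: "variety V" "isomorphic X' X" "isomorphic Y' Y" "is_product V p' q' X' Y'"
    by (auto simp: iso_class_prod_def iso_class_def)
  obtain p1 where "is_product V p1 q' X Y'" using is_product_transport[OF V(4,2)] by blast
  then obtain q1 where "is_product V q1 p1 Y X" using is_product_transport[OF is_product_sym V(3)] by blast
  then have "isomorphic V W" using is_product_unique[OF _ P] is_product_sym by blast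
  then show "V \<in> iso_class W" using V(1) by (simp add: iso_class_def)
next
  fix V assume "V \<in> iso_class W"
  then have V: "variety V" "isomorphic V W" by (auto simp: iso_class_def)
  then obtain p' q' where "is_product V p' q' X Y"
    using is_product_isomorphic[OF P V(2)] variety_ringed by blast
  then show "V \<in> iso_class_prod (iso_class X) (iso_class Y)"
    using V(1) iso_class_self[OF assms(1)] iso_class_self[OF assms(2)] unfolding iso_class_prod_def by blast
qed

lemma iso_class_prod_commute: "iso_class_prod A B = iso_class_prod B A"
  unfolding iso_class_prod_def using is_product_sym by blast

lemma class_mult_commute: "class_mult A B = class_mult B A"
  by (simp add: class_mult_def iso_class_prod_commute)

abbreviation Classes :: "'k::field itself \<Rightarrow> 'k scheme set set" where
  "Classes k \<equiv> iso_class ` {X :: 'k scheme. variety X}"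

lemma class_mult_keys:
  assumes "A \<in> Classes TYPE('k::field)" "B \<in> Classes TYPE('k)"
  shows "Poly_Mapping.keys (class_mult A B) \<subseteq> Classes TYPE('k)"
proof (cases "iso_class_prod A B = {}")
  case False
  obtain X Y :: "'k scheme" where XY: "variety X" "variety Y" "A = iso_class X" "B = iso_class Y" using assms by auto
  obtain W where "W \<in> iso_class_prod A B" using False by blast
  then obtain X' Y' p q where W: "variety W" "isomorphic X' X" "isomorphic Y' Y" "variety X'" "variety Y'"
    "is_product W p q X' Y'"
    using XY by (auto simp: iso_class_prod_def iso_class_def)
  have "iso_class_prod A B = iso_class W"
    using iso_class_product[OF W(4,5,1,6)] iso_class_cong W(2,3) XY by metis
  then show ?thesis using W(1) False by (simp add: class_mult_def)
qed (simp add: class_mult_def)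

subsection \<open>Multiplication and the ideal of scissor relations\<close>

definition vmult :: "('k::field scheme set \<Rightarrow>\<^sub>0 int) \<Rightarrow> ('k scheme set \<Rightarrow>\<^sub>0 int) \<Rightarrow> ('k scheme set \<Rightarrow>\<^sub>0 int)" where
  "vmult u v = frag_extend (\<lambda>A. frag_extend (class_mult A) v) u"

abbreviation class_sums :: "('k::field scheme set \<Rightarrow>\<^sub>0 int) set" where
  "class_sums \<equiv> carrier variety_ring"

lemma variety_ring_simps [simp]:
  "monoid.mult variety_ring = vmult" "ring.zero variety_ring = 0" "ring.add variety_ring = (+)"
  "monoid.one (variety_ring :: ('k::field scheme set \<Rightarrow>\<^sub>0 int) ring) = frag_of (iso_class (Spec (field_ring :: 'k ring) (\<lambda>c::'k. c)))"
  by (simp_all add: variety_ring_def vmult_def fun_eq_iff)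

lemma class_sums_iff: "u \<in> class_sums \<longleftrightarrow> Poly_Mapping.keys u \<subseteq> Classes TYPE('k)"
  for u :: "'k::field scheme set \<Rightarrow>\<^sub>0 int"
  by (simp add: variety_ring_def)

lemma vmult_add_left: "vmult (u + u') v = vmult u v + vmult u' v"
  by (simp add: vmult_def frag_extend_add)

lemma vmult_diff_left: "vmult (u - u') v = vmult u v - vmult u' v"
  by (simp add: vmult_def frag_extend_diff)

lemma vmult_commute: "vmult u v = vmult v u"
proof -
  have 1: "vmult (frag_of A) v = vmult v (frag_of A)" for A and v :: "'k::field scheme set \<Rightarrow>\<^sub>0 int"
  proof (rule frag_induction[of v UNIV "\<lambda>v. vmult (frag_of A) v = vmult v (frag_of A)"])
    fix B show "vmult (frag_of A) (frag_of B) = vmult (frag_of B) (frag_of A)"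
      by (simp add: vmult_def class_mult_commute)
  next
    fix a b :: "'k scheme set \<Rightarrow>\<^sub>0 int"
    assume "vmult (frag_of A) a = vmult a (frag_of A)" "vmult (frag_of A) b = vmult b (frag_of A)"
    then show "vmult (frag_of A) (a - b) = vmult (a - b) (frag_of A)"
      by (simp add: vmult_def frag_extend_diff)
  qed (simp_all add: vmult_def)
  have d: "frag_extend (\<lambda>A. f A - g A) v = frag_extend f v - frag_extend g v"
    for f g :: "'k scheme set \<Rightarrow> 'k scheme set \<Rightarrow>\<^sub>0 int" and v
    by (rule frag_induction[of v UNIV]) (simp_all add: frag_extend_diff)
  show ?thesis
  proof (rule frag_induction[of u UNIV "\<lambda>u. vmult u v = vmult v u"])
    fix a b assume "vmult a v = vmult v a" "vmult b v = vmult v b"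
    then show "vmult (a - b) v = vmult v (a - b)"
      by (simp add: vmult_diff_left) (simp add: vmult_def frag_extend_diff d)
  qed (simp_all add: 1, simp_all add: vmult_def frag_extend_eq_0)
qed

lemma vmult_diff_right: "vmult u (v - v') = vmult u v - vmult u v'"
  using vmult_diff_left[of v v' u] by (simp add: vmult_commute)

lemma vmult_frag_of: "vmult (frag_of A) (frag_of B) = class_mult A B"
  by (simp add: vmult_def)

lemma class_sums_zero: "0 \<in> class_sums" by (simp add: class_sums_iff)

lemma class_sums_add: "u \<in> class_sums \<Longrightarrow> v \<in> class_sums \<Longrightarrow> u + v \<in> class_sums"
  using Poly_Mapping.keys_add[of u v] unfolding class_sums_iff by blast

lemma class_sums_diff: "u \<in> class_sums \<Longrightarrow> v \<in> class_sums \<Longrightarrow> u - v \<in> class_sums"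
  using Poly_Mapping.keys_diff[of u v] unfolding class_sums_iff by blast

lemma class_sums_frag_of: "variety X \<Longrightarrow> frag_of (iso_class X) \<in> class_sums"
  by (simp add: class_sums_iff)

lemma keys_frag_extend_subset:
  assumes "\<And>A. A \<in> Poly_Mapping.keys u \<Longrightarrow> Poly_Mapping.keys (f A) \<subseteq> C"
  shows "Poly_Mapping.keys (frag_extend f u) \<subseteq> C"
  by (rule subset_trans[OF keys_frag_extend]) (rule UN_least, rule assms)

lemma class_sums_vmult:
  fixes u v :: "'k::field scheme set \<Rightarrow>\<^sub>0 int"
  assumes "u \<in> class_sums" "v \<in> class_sums"
  shows "vmult u v \<in> class_sums"
  unfolding class_sums_iff vmult_def
proof (intro keys_frag_extend_subset)
  fix A B assume "A \<in> Poly_Mapping.keys u" "B \<in> Poly_Mapping.keys v"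
  then have "A \<in> Classes TYPE('k)" "B \<in> Classes TYPE('k)"
    using assms unfolding class_sums_iff by (simp_all only: subsetD)
  then show "Poly_Mapping.keys (class_mult A B) \<subseteq> Classes TYPE('k)" by (rule class_mult_keys)
qed

lemma scissor_sums: "u \<in> scissor_ideal \<Longrightarrow> u \<in> class_sums"
proof (induction rule: scissor_ideal.induct)
  case (scissor X Z U i)
  then show ?case by (intro class_sums_diff class_sums_frag_of)
qed (auto intro: class_sums_diff class_sums_vmult)

text \<open>An inductively defined set closed under differences contains zero as soon as it is inhabited; a member
  comes from removing the empty scheme from a point.\<close>

lemma scissor_zero: "(0 :: 'k::field scheme set \<Rightarrow>\<^sub>0 int) \<in> scissor_ideal"
proof -
  let ?G = "{} :: (nat, 'k) mpoly set"
  have "\<exists>u :: 'k scheme set \<Rightarrow>\<^sub>0 int. u \<in> scissor_ideal"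
  proof -
    note po = principal_open[of ?G "{..<0}" 1 0]
    have v: "variety (zero_scheme {..<0} ?G)" "variety (zero_scheme {..<0} (insert 1 ?G))" 
      by (rule zero_scheme_variety, simp)+
    have v3: "variety (zero_scheme {..<1} (insert (poly_var 0 * 1 - 1) ?G))"
      by (rule zero_scheme_variety) simp
    have "insert 0 {..<0} = {..<1::nat}" by auto
    then show ?thesis using scissor_ideal.scissor[OF v v3 po(1)] po(2) by fastforce
  qed
  then obtain u :: "'k scheme set \<Rightarrow>\<^sub>0 int" where "u \<in> scissor_ideal" by blast
  from scissor_ideal.diff[OF this this] show ?thesis by simp
qed

lemma scissor_uminus: "u \<in> scissor_ideal \<Longrightarrow> - u \<in> scissor_ideal"
  using scissor_ideal.diff[OF scissor_zero] by force

lemma scissor_add: "u \<in> scissor_ideal \<Longrightarrow> v \<in> scissor_ideal \<Longrightarrow> u + v \<in> scissor_ideal"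
  using scissor_ideal.diff[OF _ scissor_uminus, of u v] by simp

lemma scissor_mult: "u \<in> class_sums \<Longrightarrow> s \<in> scissor_ideal \<Longrightarrow> vmult u s \<in> scissor_ideal"
  using scissor_ideal.mult[of s u] by simp

lemma class_sums_cmul: "u \<in> class_sums \<Longrightarrow> frag_cmul c u \<in> class_sums"
  using keys_cmul[of c u] unfolding class_sums_iff by blast

subsection \<open>Computing in the quotient\<close>

abbreviation kclass :: "('k::field scheme set \<Rightarrow>\<^sub>0 int) \<Rightarrow> ('k scheme set \<Rightarrow>\<^sub>0 int) set" where
  "kclass u \<equiv> scissor_ideal +>\<^bsub>variety_ring\<^esub> u"

lemma kclass_def: "kclass u = (\<lambda>s. s + u) ` scissor_ideal"
  by (auto simp: a_r_coset_def')

lemma kclass_mem: "x \<in> kclass u \<longleftrightarrow> x - u \<in> scissor_ideal"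
proof
  assume "x - u \<in> scissor_ideal"
  then have "(x - u) + u \<in> (\<lambda>s. s + u) ` scissor_ideal" by (rule imageI)
  then show "x \<in> kclass u" by (simp add: kclass_def)
qed (auto simp: kclass_def)

lemma kclass_eq: "kclass u = kclass v \<longleftrightarrow> u - v \<in> scissor_ideal"
proof
  assume "kclass u = kclass v"
  moreover have "u \<in> kclass u" by (simp add: kclass_mem scissor_zero)
  ultimately show "u - v \<in> scissor_ideal" by (simp add: kclass_mem)
next
  assume a: "u - v \<in> scissor_ideal"
  have "x - u \<in> scissor_ideal \<longleftrightarrow> x - v \<in> scissor_ideal" for x
    using scissor_add[OF _ a, of "x - u"] scissor_ideal.diff[OF _ a, of "x - v"] by auto
  then show "kclass u = kclass v" by (auto simp: kclass_mem)
qed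

lemma K0_carrier: "carrier K0_Var = kclass ` class_sums"
  by (auto simp: K0_Var_def FactRing_def A_RCOSETS_def')

lemma K0_zero: "\<zero>\<^bsub>K0_Var\<^esub> = kclass 0"
  by (simp add: K0_Var_def FactRing_def kclass_def)

lemma K0_one: "\<one>\<^bsub>K0_Var\<^esub> = kclass \<one>\<^bsub>variety_ring\<^esub>"
  by (simp add: K0_Var_def FactRing_def)

lemma K0_add: "kclass u \<oplus>\<^bsub>K0_Var\<^esub> kclass v = kclass (u + v)"
proof -
  have "kclass u \<oplus>\<^bsub>K0_Var\<^esub> kclass v = {a + b | a b. a \<in> kclass u \<and> b \<in> kclass v}"
    by (auto simp: K0_Var_def FactRing_def set_add_defs)
  also have "\<dots> = kclass (u + v)"
  proof (intro equalityI subsetI)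
    fix x assume "x \<in> {a + b | a b. a \<in> kclass u \<and> b \<in> kclass v}"
    then obtain a b where ab: "x = a + b" "a - u \<in> scissor_ideal" "b - v \<in> scissor_ideal" by (auto simp: kclass_mem)
    have "(a - u) + (b - v) \<in> scissor_ideal" using ab by (intro scissor_add)
    then show "x \<in> kclass (u + v)" by (simp add: kclass_mem ab(1) algebra_simps)
  next
    fix x assume "x \<in> kclass (u + v)"
    then have "x - v \<in> kclass u" by (simp add: kclass_mem algebra_simps)
    moreover have "v \<in> kclass v" by (simp add: kclass_mem scissor_zero)
    ultimately show "x \<in> {a + b | a b. a \<in> kclass u \<and> b \<in> kclass v}" by force
  qed
  finally show ?thesis .
qed

lemma K0_mult:
  assumes "u \<in> class_sums" "v \<in> class_sums"
  shows "kclass u \<otimes>\<^bsub>K0_Var\<^esub> kclass v = kclass (vmult u v)"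
proof -
  have "kclass (vmult a b) = kclass (vmult u v)" if "a \<in> kclass u" "b \<in> kclass v" for a b
  proof -
    have a: "a - u \<in> scissor_ideal" and b: "b - v \<in> scissor_ideal" using that by (auto simp: kclass_mem)
    have "(b - v) + v \<in> class_sums" using scissor_sums[OF b] assms(2) by (rule class_sums_add)
    then have "vmult b (a - u) \<in> scissor_ideal" using a by (intro scissor_mult) simp_all
    moreover have "vmult u (b - v) \<in> scissor_ideal" using assms(1) b by (rule scissor_mult)
    ultimately have "vmult b (a - u) + vmult u (b - v) \<in> scissor_ideal" by (rule scissor_add)
    then show ?thesis unfolding kclass_eq by (simp add: vmult_diff_right vmult_commute[of b])
  qed
  then have "(\<Union>a\<in>kclass u. \<Union>b\<in>kclass v. kclass (vmult a b)) = (\<Union>a\<in>kclass u. \<Union>b\<in>kclass v. kclass (vmult u v))"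
    by simp
  moreover have "u \<in> kclass u" "v \<in> kclass v" by (simp_all add: kclass_mem scissor_zero)
  ultimately show ?thesis by (auto simp: K0_Var_def FactRing_def rcoset_mult_def)
qed

text \<open>The additive structure of the quotient, and the products of classes, suffice to evaluate polynomials at the Lefschetz class;
  the powers are computed one factor at a time.\<close>

lemma K0_abelian_group: "abelian_group (K0_Var :: ('k::field scheme set \<Rightarrow>\<^sub>0 int) set ring)"
proof (rule abelian_groupI)
  fix x :: "('k scheme set \<Rightarrow>\<^sub>0 int) set" assume "x \<in> carrier K0_Var"
  then obtain u where u: "u \<in> class_sums" "x = kclass u" by (auto simp: K0_carrier)
  have "kclass (- u) \<in> carrier K0_Var" unfolding K0_carrier
    using class_sums_diff[OF class_sums_zero u(1)] by (intro imageI) simp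
  moreover have "kclass (- u) \<oplus>\<^bsub>K0_Var\<^esub> x = \<zero>\<^bsub>K0_Var\<^esub>" by (simp add: u K0_add K0_zero)
  ultimately show "\<exists>y\<in>carrier K0_Var. y \<oplus>\<^bsub>K0_Var\<^esub> x = \<zero>\<^bsub>K0_Var\<^esub>" by blast
qed (auto simp: K0_carrier K0_zero K0_add add_ac class_sums_zero intro!: imageI class_sums_add)

lemma K0_nat_multiple:
  "add_pow K0_Var (n::nat) (kclass u) = kclass (frag_cmul (int n) u)"
proof (induction n)
  case 0
  then show ?case using K0_zero by (simp add: add_pow_def)
next
  case (Suc n)
  have "add_pow K0_Var (Suc n) (kclass u) = add_pow K0_Var n (kclass u) \<oplus>\<^bsub>K0_Var\<^esub> kclass u"
    by (simp add: add_pow_def)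
  then show ?case using Suc by (simp add: K0_add frag_cmul_distrib add_ac)
qed

lemma K0_multiple:
  fixes u :: "'k::field scheme set \<Rightarrow>\<^sub>0 int"
  assumes u: "u \<in> class_sums"
  shows "add_pow K0_Var (c::int) (kclass u) = kclass (frag_cmul c u)"
proof -
  interpret K: abelian_group "K0_Var :: ('k scheme set \<Rightarrow>\<^sub>0 int) set ring" by (rule K0_abelian_group)
  show ?thesis
  proof (cases c rule: int_cases2)
    case (nonneg n)
    then show ?thesis using K0_nat_multiple[of n u] by (simp add: add_pow_def int_pow_int)
  next
    case (nonpos n)
    have "kclass u \<in> carrier (add_monoid K0_Var)" using u by (auto simp: K0_carrier)
    then have "add_pow K0_Var c (kclass u) = \<ominus>\<^bsub>K0_Var\<^esub> add_pow K0_Var n (kclass u)"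
      unfolding nonpos add_pow_def a_inv_def by (rule group.int_pow_neg_int[OF K.a_group])
    also have "\<dots> = kclass (frag_cmul c u)"
    proof (rule K.minus_equality)
      show "kclass (frag_cmul c u) \<oplus>\<^bsub>K0_Var\<^esub> add_pow K0_Var n (kclass u) = \<zero>\<^bsub>K0_Var\<^esub>"
        unfolding K0_nat_multiple K0_add nonpos by (simp add: K0_zero flip: frag_cmul_distrib)
    qed (use u in \<open>auto simp: K0_nat_multiple K0_carrier intro!: imageI class_sums_cmul\<close>)
    finally show ?thesis .
  qed
qed

lemma K0_finsum:
  fixes u :: "nat \<Rightarrow> 'k::field scheme set \<Rightarrow>\<^sub>0 int"
  assumes "finite I" "\<And>i. i \<in> I \<Longrightarrow> u i \<in> class_sums"
  shows "(\<Oplus>\<^bsub>K0_Var\<^esub>i\<in>I. kclass (u i)) = kclass (\<Sum>i\<in>I. u i)"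
proof -
  interpret K: abelian_group "K0_Var :: ('k scheme set \<Rightarrow>\<^sub>0 int) set ring" by (rule K0_abelian_group)
  show ?thesis using assms
    by (induction I rule: finite_induct)
      (auto simp: K0_zero K0_add K.finsum_insert Pi_def K0_carrier)
qed

section \<open>The generating function\<close>

definition LL :: "int poly" where "LL = [:0, 1:]"
abbreviation MM :: "int poly" where "MM \<equiv> LL - 1"

text \<open>The classes of the loci where three families of determinants do not vanish: the continuants (\<open>path_cls\<close>), the
  bordered determinants with border parameter \<open>r = 0\<close> (\<open>zero_cls\<close>), and those with \<open>r\<close> an additional
  invertible coordinate (\<open>unit_cls\<close>). The index is the number of rows without the border.\<close>

fun path_cls :: "nat \<Rightarrow> int poly" where
  "path_cls 0 = 1"
| "path_cls (Suc 0) = MM * LL"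
| "path_cls (Suc (Suc m)) = MM * LL * path_cls (Suc m) + MM * LL^2 * path_cls m"

fun zero_cls :: "nat \<Rightarrow> int poly" and unit_cls :: "nat \<Rightarrow> int poly" where
  "zero_cls 0 = MM"
| "zero_cls (Suc 0) = MM * LL^2"
| "zero_cls (Suc (Suc m)) = 2 * MM * zero_cls (Suc m) + (LL - 2) * unit_cls (Suc m) + MM * LL^2 * zero_cls m"
| "unit_cls 0 = MM^2"
| "unit_cls (Suc 0) = MM^2 * LL^2"
| "unit_cls (Suc (Suc m)) = MM * (2 * MM - 1) * zero_cls (Suc m) + (MM^2 - MM + 1) * unit_cls (Suc m)
     + MM^2 * LL * (zero_cls m + unit_cls m) + MM * LL * path_cls (Suc m)"

text \<open>The recursions make the three generating functions the solution of a linear system. Its matrix has the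
  determinant \<open>D * E\<close>, and eliminating the generating function of the continuants brings in the second
  factor \<open>D\<close>, whence the square in the denominator.\<close>

lemma series_identity:
  fixes L t A C J :: "'a::comm_ring_1"
  defines "M \<equiv> L - 1"
  assumes A: "A = M + M*L*t + t*(2*M*A + (L-2)*C) + t^2*(M*L^2*A)"
    and C: "C = M^2 + (M^2*L - M*L)*t + t*(M*(2*M-1)*A + (M^2-M+1)*C + M*L*J) + t^2*(M^2*L*(A+C))"
    and J: "J = 1 + t*(M*L*J) + t^2*(M*L^2*J)"
  shows "((1 - M*L*t - M*L^2*t^2)^2 * (1 - t - M^2*L*t^2)) *
      (t*(A+C) - (M+M^2)*t - (M*L^2+M^2*L^2)*t^2) = M^2 * L^2 * t^3 * P_poly L (L*t)"
proof -
  define D where "D = 1 - M*L*t - M*L^2*t^2"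
  define E where "E = 1 - t - M^2*L*t^2"
  define x11 where "x11 = 1 - 2*M*t - M*L^2*t^2"
  define x12 where "x12 = - ((L-2)*t)"
  define x21 where "x21 = - (M*(2*M-1)*t + M^2*L*t^2)"
  define x22 where "x22 = 1 - (M^2-M+1)*t - M^2*L*t^2"
  define pA where "pA = M + M*L*t"
  define pC where "pC = M^2 + (M^2*L - M*L)*t"
  have r1: "x11*A + x12*C = pA" and r2: "x21*A + x22*C = pC + t*M*L*J" and r3: "D*J = 1"
    using A C J unfolding x11_def x12_def x21_def x22_def pA_def pC_def D_def by (simp_all add: algebra_simps)
  have "D*(x11*x22 - x12*x21)*(A+C) = D*((x22-x21)*(x11*A + x12*C) + (x11-x12)*(x21*A + x22*C))"
    by (simp add: algebra_simps)
  also have "\<dots> = D*((x22-x21)*pA + (x11-x12)*pC) + (x11-x12)*t*M*L*(D*J)"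
    unfolding r1 r2 by (simp add: algebra_simps)
  finally have sol: "D*(x11*x22 - x12*x21)*(A+C) = D*((x22-x21)*pA + (x11-x12)*pC) + (x11-x12)*t*M*L"
    by (simp add: r3)
  have det: "x11*x22 - x12*x21 = D*E"
    unfolding x11_def x12_def x21_def x22_def D_def E_def M_def
    by (simp add: algebra_simps power2_eq_square)
  have num: "D*((x22-x21)*pA + (x11-x12)*pC) + (x11-x12)*t*M*L
      - D^2*E*((M+M^2) + (M*L^2+M^2*L^2)*t) = M^2 * L^2 * t^2 * P_poly L (L*t)"
    unfolding x11_def x12_def x21_def x22_def D_def E_def M_def P_poly_def pA_def pC_def
    by (simp add: algebra_simps power2_eq_square power3_eq_cube eval_nat_numeral)
  have "D^2*E*(t*(A+C) - (M+M^2)*t - (M*L^2+M^2*L^2)*t^2)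
     = t * (D*(D*E)*(A+C) - D^2*E*((M+M^2) + (M*L^2+M^2*L^2)*t))"
    by (simp add: algebra_simps power2_eq_square)
  also have "\<dots> = t * (M^2 * L^2 * t^2 * P_poly L (L*t))"
    unfolding det[symmetric] sol num[symmetric] by (simp add: det)
  also have "\<dots> = M^2 * L^2 * t^3 * P_poly L (L*t)" by (simp add: power2_eq_square power3_eq_cube mult_ac)
  finally show ?thesis unfolding D_def E_def .
qed

lemma fps_left_inverse_unique:
  fixes f g :: "'a::comm_ring_1 fps"
  assumes "f * g = 1" "fps_nth f 0 = 1"
  shows "fps_left_inverse f 1 = g"
proof -
  have "fps_left_inverse f 1 * f = 1" using assms(2) by (intro fps_left_inverse) simp
  then have "fps_left_inverse f 1 * f * g = g" by simp
  then show ?thesis using assms(1) by (simp add: mult.assoc)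
qed

text \<open>The second fraction of the series is the generating function of \<open>zero_cls + unit_cls\<close>, shifted by one, without
  its terms in degrees 1 and 2: the graphs start with three loops.\<close>

lemma zigzag_series_coeff:
  assumes "n \<ge> 3"
  shows "fps_nth zigzag_series n = LL^(2*n) - (zero_cls (n-1) + unit_cls (n-1))"
proof -
  define L where "L = fps_const LL"
  define M where "M = L - 1"
  define t where "t = (fps_X :: int poly fps)"
  define A where "A = Abs_fps zero_cls"
  define C where "C = Abs_fps unit_cls"
  define J where "J = Abs_fps path_cls"
  have Mc: "M = fps_const MM" by (simp add: M_def L_def fps_const_sub[symmetric] del: fps_const_sub)
  have nth1: "fps_nth (t * F) n = (case n of 0 \<Rightarrow> 0 | Suc m \<Rightarrow> fps_nth F m)"
   and nth2: "fps_nth (t^2 * F) n = (case n of Suc (Suc m) \<Rightarrow> fps_nth F m | _ \<Rightarrow> 0)" for n F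
    by (simp_all add: t_def fps_X_power_mult_nth split: nat.splits)
  have nth_c: "fps_nth (fps_const c * t) n = (if n = 1 then c else 0)" for c n by (simp add: t_def)
  have cs: "M = fps_const MM" "M*L = fps_const (MM*LL)" "2*M = fps_const (2*MM)" "L-2 = fps_const (LL-2)"
    "M*L^2 = fps_const (MM*LL^2)" "M^2 = fps_const (MM^2)" "M^2*L - M*L = fps_const (MM^2*LL-MM*LL)"
    "M*(2*M-1) = fps_const (MM*(2*MM-1))" "M^2-M+1 = fps_const (MM^2-MM+1)" "M^2*L = fps_const (MM^2*LL)"
    unfolding Mc L_def by (simp_all add: numeral_fps_const fps_const_power flip: fps_const_1_eq_1)
  have t0: "fps_nth t 0 = 0" "fps_nth t (Suc 0) = 1" "fps_nth (t^2) 0 = 0" "fps_nth (t^2) (Suc 0) = 0"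
    "fps_nth t (Suc (Suc m)) = 0" "fps_nth (t^2) (Suc (Suc (Suc m))) = 0" for m
    by (simp_all add: t_def fps_X_power_nth)
  note nths = nth1 nth2 nth_c t0 A_def C_def J_def
  have "J = 1 + t*(fps_const (MM*LL)*J) + t^2*(fps_const (MM*LL^2)*J)"
  proof (rule fps_ext)
    fix n show "fps_nth J n = fps_nth (1 + t*(fps_const (MM*LL)*J) + t^2*(fps_const (MM*LL^2)*J)) n"
      by (cases n rule: path_cls.cases) (simp_all add: nths)
  qed
  then have J: "J = 1 + t*(M*L*J) + t^2*(M*L^2*J)" unfolding cs[symmetric] .
  have "A = fps_const MM + fps_const (MM*LL)*t + t*(fps_const (2*MM)*A + fps_const (LL-2)*C)
      + t^2*(fps_const (MM*LL^2)*A)" (is "_ = ?rhs")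
  proof (rule fps_ext)
    fix n show "fps_nth A n = fps_nth ?rhs n"
      by (cases n rule: path_cls.cases) (simp_all add: nths algebra_simps power2_eq_square)
  qed
  then have A: "A = M + M*L*t + t*(2*M*A + (L-2)*C) + t^2*(M*L^2*A)" unfolding cs[symmetric] .
  have "C = fps_const (MM^2) + fps_const (MM^2*LL-MM*LL)*t + t*(fps_const (MM*(2*MM-1))*A
      + fps_const (MM^2-MM+1)*C + fps_const (MM*LL)*J) + t^2*(fps_const (MM^2*LL)*(A+C))" (is "_ = ?rhs")
  proof (rule fps_ext)
    fix n show "fps_nth C n = fps_nth ?rhs n"
      by (cases n rule: path_cls.cases) (simp_all add: nths algebra_simps power2_eq_square)
  qed
  then have C: "C = M^2 + (M^2*L - M*L)*t + t*(M*(2*M-1)*A + (M^2-M+1)*C + M*L*J) + t^2*(M^2*L*(A+C))"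
    unfolding cs[symmetric] .
  define Q where "Q = (1 - M*L*t - M*L^2*t^2)^2 * (1 - t - M^2*L*t^2)"
  define S where "S = t*(A+C) - (M+M^2)*t - (M*L^2+M^2*L^2)*t^2"
  have id: "Q * S = M^2 * L^2 * t^3 * P_poly L (L*t)"
    unfolding Q_def S_def by (rule series_identity[of A L t C J, folded M_def, OF A C J])
  have Q0: "fps_nth Q 0 = 1" by (simp add: Q_def t_def fps_mult_nth_0 power2_eq_square)
  have Qi: "fps_left_inverse Q 1 * Q = 1" using Q0 by (intro fps_left_inverse) simp
  have second: "M^2 * L^2 * t^3 * P_poly L (L*t) * fps_left_inverse Q 1 = S"
  proof -
    have "Q * S * fps_left_inverse Q 1 = S * (fps_left_inverse Q 1 * Q)" by (simp only: mult_ac)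
    then show ?thesis by (simp only: id[symmetric] Qi mult_1_right)
  qed
  have first: "fps_left_inverse (1 - L^2*t) 1 = Abs_fps (\<lambda>n. LL^(2*n))"
  proof (rule fps_left_inverse_unique)
    have "Abs_fps (\<lambda>n. LL^(2*n)) = 1 + t * (L^2 * Abs_fps (\<lambda>n. LL^(2*n)))"
    proof (rule fps_ext)
      fix n show "fps_nth (Abs_fps (\<lambda>n. LL^(2*n))) n = fps_nth (1 + t * (L^2 * Abs_fps (\<lambda>n. LL^(2*n)))) n"
        unfolding L_def fps_const_power by (cases n) (simp_all add: nth1 t0 power_add power2_eq_square)
    qed
    then show "(1 - L^2*t) * Abs_fps (\<lambda>n. LL^(2*n)) = 1" by (simp add: algebra_simps)
    show "fps_nth (1 - L^2*t) 0 = 1" by (simp add: t_def)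
  qed
  have zz: "zigzag_series = Abs_fps (\<lambda>n. LL^(2*n)) - S"
    unfolding zigzag_series_def Let_def LL_def[symmetric] L_def[symmetric] M_def[symmetric] t_def[symmetric] Q_def[symmetric]
      first second ..
  obtain m where n: "n = Suc (Suc (Suc m))" using assms by (intro that[of "n - 3"]) simp
  have nS: "fps_nth S n = zero_cls (n-1) + unit_cls (n-1)"
  proof -
    have e: "(M+M^2) = fps_const (MM + MM^2)" "(M*L^2+M^2*L^2) = fps_const (MM*LL^2+MM^2*LL^2)"
      unfolding Mc L_def by (simp_all add: fps_const_power)
    have "S = t*(A+C) - fps_const (MM + MM^2)*t - t^2 * fps_const (MM*LL^2+MM^2*LL^2)"
      unfolding S_def e by (simp add: mult.commute)
    then show ?thesis by (simp add: n nths)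
  qed
  have "fps_nth zigzag_series n = fps_nth (Abs_fps (\<lambda>n. LL^(2*n)) - S) n"
    using zz by (rule arg_cong[where f = "\<lambda>F. fps_nth F n"])
  also have "\<dots> = LL^(2*n) - (zero_cls (n-1) + unit_cls (n-1))"
    unfolding fps_sub_nth nS by simp
  finally show ?thesis .
qed

section \<open>Classes that are polynomials in the Lefschetz class\<close>

lemma poly_ring_algebra: "k_algebra (poly_ring V) poly_const"
  by (intro k_algebra.intro k_algebra_axioms.intro poly_ring_cring poly_const_hom)

lemma affine_space_isomorphic: "isomorphic (affine_space n :: ('k::field, _, _) kspace) (zero_scheme {..<n} {})"
proof -
  interpret E: equations "{..<n}" "{} :: (nat, 'k) mpoly set" by unfold_locales simp
  have id: "(\<lambda>f. f) \<in> ring_hom (poly_ring {..<n} :: (nat, 'k) mpoly ring) (poly_ring {..<n})"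
    by (simp add: ring_hom_def)
  have l: "quot_lift (\<lambda>f. f) (residue {..<n} {} f) = f" if "f \<in> polys {..<n}" for f :: "(nat, 'k) mpoly"
    using E.quot_lift_residue[OF id poly_ring_cring _ that] by simp
  have lh: "quot_lift (\<lambda>f. f) \<in> ring_hom (coord_ring {..<n} {}) (poly_ring {..<n} :: (nat, 'k) mpoly ring)"
    using E.quot_lift_hom[OF id poly_ring_cring] by simp
  have "alg_hom (poly_ring {..<n}) poly_const (coord_ring {..<n} {}) (\<lambda>c::'k. residue {..<n} {} (poly_const c)) (residue {..<n} {})"
    using poly_ring_algebra E.coord_algebra E.residue_hom by (simp add: alg_hom_def alg_hom_axioms_def)
  moreover have "alg_hom (coord_ring {..<n} {}) (\<lambda>c::'k. residue {..<n} {} (poly_const c)) (poly_ring {..<n}) poly_const (quot_lift (\<lambda>f. f))"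
    using poly_ring_algebra E.coord_algebra lh l by (simp add: alg_hom_def alg_hom_axioms_def)
  ultimately show ?thesis
    unfolding affine_space_def E.zero_scheme_Spec
    by (rule alg_iso_isomorphic) (auto simp: l elim!: E.coord_cases)
qed

text \<open>The unit of the Grothendieck ring is the class of the spectrum of the field, which is not literally an
  affine space of dimension 0.\<close>

lemma point_isomorphic: "isomorphic (Spec (field_ring :: 'k ring) (\<lambda>c::'k::field. c)) (affine_space 0)"
proof -
  have ex: "\<exists>y. x + y = 0" for x :: 'k by (rule exI[of _ "- x"]) simp
  have f: "cring (field_ring :: 'k ring)"
    by (rule cringI) (auto intro!: abelian_groupI comm_monoidI simp: algebra_simps ex)
  have fa: "k_algebra (field_ring :: 'k ring) (\<lambda>c. c)"
    using f by (simp add: k_algebra_def k_algebra_axioms_def ring_hom_def)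
  interpret ev: evaluation "field_ring :: 'k ring" "\<lambda>c. c" "\<lambda>_ :: nat. 0"
    using f by (simp add: evaluation_def evaluation_axioms_def ring_hom_def)
  have "alg_hom field_ring (\<lambda>c::'k. c) (poly_ring {..<0::nat}) poly_const poly_const"
    by (intro alg_hom.intro alg_hom_axioms.intro fa poly_ring_algebra poly_const_hom refl)
  moreover have "alg_hom (poly_ring {..<0::nat}) poly_const field_ring (\<lambda>c::'k. c) ev.ev"
    by (intro alg_hom.intro alg_hom_axioms.intro fa poly_ring_algebra ev.ev_hom ev.ev_const)
  moreover have "poly_const (ev.ev p) = p" if "p \<in> polys {..<0}" for p
    using that by (induction rule: polys_induct) (auto simp: ev.ev_const ev.ev_add ev.ev_mult poly_const_simps)
  ultimately show ?thesis
    unfolding affine_space_def by (intro alg_iso_isomorphic) (auto simp: ev.ev_const)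
qed

abbreviation iclass :: "('k::field, 'p, 's) kspace \<Rightarrow> ('k scheme set \<Rightarrow>\<^sub>0 int)" where
  "iclass X \<equiv> frag_of (iso_class X)"

abbreviation Aff :: "nat \<Rightarrow> ('k::field scheme set \<Rightarrow>\<^sub>0 int)" where
  "Aff n \<equiv> iclass (affine_space n :: ('k, _, _) kspace)"

lemma Aff_eq: "(Aff n :: 'k::field scheme set \<Rightarrow>\<^sub>0 int) = iclass (zero_scheme {..<n} ({} :: (nat, 'k) mpoly set))"
  by (rule arg_cong[OF iso_class_cong[OF affine_space_isomorphic]])

text \<open>Multiplication by the class of the line adds a free coordinate; this is the product of affine schemes for an
  empty second system of equations.\<close>

lemma vmult_line:
  fixes G :: "(nat, 'k::field) mpoly set"
  assumes "G \<subseteq> polys {..<n}"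
  shows "vmult (iclass (zero_scheme {..<n} G)) (Aff 1) = iclass (zero_scheme {..<Suc n} G)"
proof -
  interpret T: two_systems n 1 G "{}" using assms by unfold_locales auto
  have "G \<subseteq> polys {..<Suc n}" using T.prod_eqs by (simp add: T.prod_eqs_def)
  then have "iso_class_prod (iso_class (zero_scheme {..<n} G)) (iso_class (zero_scheme {..<1} ({} :: (nat, 'k) mpoly set)))
      = iso_class (zero_scheme {..<Suc n} G)"
    using iso_class_product[OF _ _ _ T.is_product] zero_scheme_variety assms
    by (simp add: T.prod_eqs_def zero_scheme_variety)
  moreover have "iso_class (zero_scheme {..<Suc n} G) \<noteq> {}"
    using iso_class_self[OF zero_scheme_variety] \<open>G \<subseteq> polys {..<Suc n}\<close> by blast
  ultimately show ?thesis unfolding Aff_eq vmult_frag_of by (simp add: class_mult_def)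
qed

lemma Aff_sums: "(Aff n :: 'k::field scheme set \<Rightarrow>\<^sub>0 int) \<in> class_sums"
  unfolding Aff_eq by (rule class_sums_frag_of[OF zero_scheme_variety]) simp

lemma Aff_Suc: "vmult (Aff n) (Aff 1) = (Aff (Suc n) :: 'k::field scheme set \<Rightarrow>\<^sub>0 int)"
  using vmult_line[of "{} :: (nat, 'k) mpoly set" n] unfolding Aff_eq by simp

text \<open>A representative of \<open>f(L)\<close> in the free abelian group.\<close>

definition at_L :: "int poly \<Rightarrow> ('k::field scheme set \<Rightarrow>\<^sub>0 int)" where
  "at_L f = (\<Sum>i\<le>Polynomial.degree f. frag_cmul (Polynomial.coeff f i) (Aff i))"

lemma Lefschetz_power: "(Lefschetz :: ('k::field scheme set \<Rightarrow>\<^sub>0 int) set) [^]\<^bsub>K0_Var\<^esub> n = kclass (Aff n)"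
proof (induction n)
  case 0
  have "(iclass (Spec (field_ring :: 'k ring) (\<lambda>c::'k. c)) :: 'k scheme set \<Rightarrow>\<^sub>0 int) = Aff 0"
    by (rule arg_cong[OF iso_class_cong[OF point_isomorphic]])
  then show ?case by (simp add: K0_one)
next
  case (Suc n)
  have L: "Lefschetz = kclass (Aff 1 :: 'k scheme set \<Rightarrow>\<^sub>0 int)" by (simp add: Lefschetz_def K0_class_def)
  have "(Lefschetz :: ('k scheme set \<Rightarrow>\<^sub>0 int) set) [^]\<^bsub>K0_Var\<^esub> Suc n
      = Lefschetz [^]\<^bsub>K0_Var\<^esub> n \<otimes>\<^bsub>K0_Var\<^esub> Lefschetz" by simp
  also have "\<dots> = kclass (Aff n) \<otimes>\<^bsub>K0_Var\<^esub> kclass (Aff 1)" unfolding Suc.IH unfolding L ..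
  also have "\<dots> = kclass (vmult (Aff n) (Aff 1))" by (rule K0_mult[OF Aff_sums Aff_sums])
  finally show ?case unfolding Aff_Suc .
qed

lemma int_poly_eval_L: "int_poly_eval K0_Var f (Lefschetz :: ('k::field scheme set \<Rightarrow>\<^sub>0 int) set) = kclass (at_L f)"
  unfolding int_poly_eval_def at_L_def Lefschetz_power K0_multiple[OF Aff_sums]
  by (rule K0_finsum) (auto intro: class_sums_cmul Aff_sums)

lemma at_L_upto:
  assumes "Polynomial.degree f \<le> n"
  shows "at_L f = (\<Sum>i\<le>n. frag_cmul (Polynomial.coeff f i) (Aff i))"
  unfolding at_L_def
  by (rule sum.mono_neutral_left) (use assms in \<open>auto simp: coeff_eq_0\<close>)

lemma at_L_add: "at_L (f + g) = at_L f + at_L g"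
proof -
  define n where "n = max (Polynomial.degree f) (Polynomial.degree g)"
  have "Polynomial.degree f \<le> n" "Polynomial.degree g \<le> n" "Polynomial.degree (f + g) \<le> n"
    by (simp_all add: n_def degree_add_le_max)
  note d = this[THEN at_L_upto]
  show ?thesis unfolding d by (simp add: frag_cmul_distrib sum.distrib)
qed

lemma at_L_zero: "at_L 0 = 0" by (simp add: at_L_def)

lemma at_L_diff: "at_L (f - g) = at_L f - at_L g"
  by (simp only: eq_diff_eq at_L_add[symmetric] diff_add_cancel)

lemma at_L_one: "at_L 1 = Aff 0" by (simp add: at_L_def)

lemma at_L_shift: "vmult (at_L f) (Aff 1) = (at_L (LL * f) :: 'k::field scheme set \<Rightarrow>\<^sub>0 int)"
proof -
  have s: "vmult (sum u I) v = (\<Sum>i\<in>I. vmult (u i) v)" for u :: "nat \<Rightarrow> 'k scheme set \<Rightarrow>\<^sub>0 int" and I v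
    by (induction I rule: infinite_finite_induct) (auto simp: vmult_add_left, auto simp: vmult_def)
  have c: "vmult (frag_cmul a u) v = frag_cmul a (vmult u v)" for a and u v :: "'k scheme set \<Rightarrow>\<^sub>0 int"
    by (simp add: vmult_def frag_extend_cmul)
  have "Polynomial.degree (LL * f) \<le> Suc (Polynomial.degree f)" 
    by (simp add: LL_def degree_pCons_le)
  then have "(at_L (LL * f) :: 'k scheme set \<Rightarrow>\<^sub>0 int) = (\<Sum>i\<le>Suc (Polynomial.degree f). frag_cmul (Polynomial.coeff (LL * f) i) (Aff i))"
    by (rule at_L_upto)
  also have "\<dots> = (\<Sum>i\<le>Polynomial.degree f. frag_cmul (Polynomial.coeff f i) (Aff (Suc i)))"
    by (simp only: sum.atMost_Suc_shift) (simp add: LL_def coeff_pCons)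
  also have "\<dots> = vmult (at_L f) (Aff 1)" unfolding at_L_def s c Aff_Suc ..
  finally show ?thesis ..
qed

subsection \<open>Zero schemes in arbitrary coordinates\<close>

lemma zero_scheme_rename:
  fixes G :: "('v, 'k::field) mpoly set" and W :: "'w set"
  assumes e: "bij_betw e V W" and G: "G \<subseteq> polys V"
  shows "isomorphic (zero_scheme V G) (zero_scheme W (psubst (\<lambda>v. poly_var (e v)) ` G))"
proof -
  let ?s = "\<lambda>v. poly_var (e v) :: ('w, 'k) mpoly" and ?t = "\<lambda>w. poly_var (inv_into V e w) :: ('v, 'k) mpoly"
  have eW: "e v \<in> W" if "v \<in> V" for v using e that by (rule bij_betwE[rule_format])
  have iV: "inv_into V e w \<in> V" "e (inv_into V e w) = w" if "w \<in> W" for w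
    using e that by (auto simp: bij_betw_def inv_into_into f_inv_into_f)
  have ie: "inv_into V e (e v) = v" if "v \<in> V" for v using e that by (auto simp: bij_betw_def)
  have H: "psubst ?s ` G \<subseteq> polys W" using G eW by (auto intro!: psubst_polys)
  have ts: "psubst ?t (psubst ?s f) = f" if "f \<in> polys V" for f
    using that ie by (simp add: psubst_psubst psubst_ident)
  interpret A: equations V G using G by unfold_locales
  interpret B: equations W "psubst ?s ` G" using H by unfold_locales
  show ?thesis
  proof (rule subst_isomorphic)
    show "polynomial_map V G W (psubst ?s ` G) ?s"
      by (rule polynomial_mapI[OF G H]) (auto simp: eW intro: B.eqs_in_ideal)
    show "polynomial_map W (psubst ?s ` G) V G ?t"
    proof (rule polynomial_mapI[OF H G])
      fix h assume "h \<in> psubst ?s ` G"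
      then obtain g where "g \<in> G" "h = psubst ?s g" by auto
      then show "psubst ?t h \<in> eqs_ideal V G" using ts[of g] G A.eqs_in_ideal by auto
    qed (use iV in auto)
  qed (use ie iV A.ideal_zero B.ideal_zero in auto)
qed

lemma ex_renaming:
  assumes "finite V"
  obtains e :: "'v \<Rightarrow> nat" where "bij_betw e V {..<card V}"
  using ex_bij_betw_finite_nat[OF assms] by (auto simp: atLeast0LessThan)

lemma bij_betw_extend:
  assumes "bij_betw e V {..<n}" "s \<notin> V"
  shows "bij_betw (e(s := n)) (insert s V) {..<Suc n}"
  using assms by (auto simp: bij_betw_def inj_on_def lessThan_Suc)

lemma psubst_var_upd:
  assumes "f \<in> polys V" "s \<notin> V"
  shows "psubst (\<lambda>v. poly_var ((e(s := n)) v)) f = psubst (\<lambda>v. poly_var (e v)) f"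
  using assms by (intro psubst_cong) auto

lemma psubst_upd_image:
  assumes "G \<subseteq> polys V" "s \<notin> V"
  shows "psubst (\<lambda>v. poly_var ((e(s := n)) v)) ` G = psubst (\<lambda>v. poly_var (e v)) ` G"
  by (rule image_cong[OF refl], rule psubst_var_upd) (use assms in auto)

lemma polys_subset_insert: "polys V \<subseteq> polys (insert s V)"
  by (rule subsetI, rule polys_mono[of V]) auto

lemma polys_insert: "f \<in> polys V \<Longrightarrow> f \<in> polys (insert s V)"
  by (rule polys_mono[of V]) auto

text \<open>The open complement of \<open>f = 0\<close> is affine, with one more coordinate that is the inverse of \<open>f\<close>. Hence
  all schemes that occur stay within the zero schemes of polynomials.\<close>

lemma scissor_relation:
  fixes G :: "('v, 'k::field) mpoly set"
  assumes V: "finite V" and G: "G \<subseteq> polys V" and f: "f \<in> polys V" and s: "s \<notin> V"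
  shows "iclass (zero_scheme V G) - iclass (zero_scheme V (insert f G))
    - iclass (zero_scheme (insert s V) (insert (poly_var s * f - 1) G)) \<in> scissor_ideal"
proof -
  obtain e where e: "bij_betw e V {..<card V}" using V by (rule ex_renaming)
  define n where "n = card V"
  let ?e = "\<lambda>v. poly_var (e v) :: (nat, 'k) mpoly" and ?e' = "\<lambda>v. poly_var ((e(s := n)) v) :: (nat, 'k) mpoly"
  have e': "bij_betw (e(s := n)) (insert s V) {..<Suc n}" using e s unfolding n_def by (rule bij_betw_extend)
  have eV: "e v < n" if "v \<in> V" for v using bij_betwE[OF e] that by (auto simp: n_def)
  have G': "psubst ?e ` G \<subseteq> polys {..<n}" using G eV by (auto intro!: psubst_polys)
  have f': "psubst ?e f \<in> polys {..<n}" using f eV by (auto intro!: psubst_polys)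
  have sub: "polys {..<n} \<subseteq> polys (insert n {..<n})" by (rule polys_subset_insert)
  have ins: "insert n {..<n} = {..<Suc n}" by auto
  let ?X = "zero_scheme {..<n} (psubst ?e ` G)" and ?Z = "zero_scheme {..<n} (insert (psubst ?e f) (psubst ?e ` G))"
    and ?U = "zero_scheme {..<Suc n} (insert (poly_var n * psubst ?e f - 1) (psubst ?e ` G))"
  have "poly_var n * psubst ?e f - 1 \<in> polys {..<Suc n}" "psubst ?e ` G \<subseteq> polys {..<Suc n}"
    using f' G' sub unfolding ins by auto
  then have v: "variety ?X" "variety ?Z" "variety ?U"
    using G' f' by (auto intro!: zero_scheme_variety)
  have "iclass ?X - iclass ?Z - iclass ?U \<in> scissor_ideal"
    using scissor_ideal.scissor[OF v principal_open(1)[OF G' f', of n]] principal_open(2)[OF G' f', of n]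
    by (simp add: ins)
  moreover have "iclass (zero_scheme V G) = iclass ?X"
    using iso_class_cong[OF zero_scheme_rename[OF e G]] by (simp add: n_def)
  moreover have "iclass (zero_scheme V (insert f G)) = iclass ?Z"
    using iso_class_cong[OF zero_scheme_rename[OF e, of "insert f G"]] G f by (simp add: n_def)
  moreover have "iclass (zero_scheme (insert s V) (insert (poly_var s * f - 1) G)) = iclass ?U"
  proof -
    have "insert (poly_var s * f - 1) G \<subseteq> polys (insert s V)"
      using G f polys_subset_insert[of V s] by auto
    from iso_class_cong[OF zero_scheme_rename[OF e' this]] show ?thesis
      using psubst_var_upd[OF f s, of e n] psubst_upd_image[OF G s, of e n] by (simp add: fun_upd_def)
  qed
  ultimately show ?thesis by simp
qed

definition has_class :: "'v set \<Rightarrow> ('v, 'k::field) mpoly set \<Rightarrow> int poly \<Rightarrow> bool" where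
  "has_class V G f \<longleftrightarrow> iclass (zero_scheme V G) - (at_L f :: 'k scheme set \<Rightarrow>\<^sub>0 int) \<in> scissor_ideal"

lemma has_class_iso: "isomorphic (zero_scheme V G) (zero_scheme W H) \<Longrightarrow> has_class V G f \<longleftrightarrow> has_class W H f"
  unfolding has_class_def by (simp add: iso_class_cong)

lemma has_class_line:
  fixes G :: "('v, 'k::field) mpoly set"
  assumes V: "finite V" and G: "G \<subseteq> polys V" and s: "s \<notin> V" and f: "has_class V G f"
  shows "has_class (insert s V) G (LL * f)"
proof -
  obtain e where e: "bij_betw e V {..<card V}" using V by (rule ex_renaming)
  define n where "n = card V"
  let ?e = "\<lambda>v. poly_var (e v) :: (nat, 'k) mpoly" and ?e' = "\<lambda>v. poly_var ((e(s := n)) v) :: (nat, 'k) mpoly"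
  have e': "bij_betw (e(s := n)) (insert s V) {..<Suc n}" using e s unfolding n_def by (rule bij_betw_extend)
  have eV: "e v < n" if "v \<in> V" for v using bij_betwE[OF e] that by (auto simp: n_def)
  have G': "psubst ?e ` G \<subseteq> polys {..<n}" using G eV by (auto intro!: psubst_polys)
  have X: "iclass (zero_scheme V G) = iclass (zero_scheme {..<n} (psubst ?e ` G))"
    using iso_class_cong[OF zero_scheme_rename[OF e G]] by (simp add: n_def)
  have "G \<subseteq> polys (insert s V)" using G polys_subset_insert by (rule subset_trans)
  from iso_class_cong[OF zero_scheme_rename[OF e' this]]
  have X': "iclass (zero_scheme (insert s V) G) = iclass (zero_scheme {..<Suc n} (psubst ?e ` G))"
    using psubst_upd_image[OF G s, of e n] by (simp add: fun_upd_def)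
  have "vmult (Aff 1) (iclass (zero_scheme V G) - at_L f) \<in> scissor_ideal"
    using Aff_sums f unfolding has_class_def by (rule scissor_mult)
  then have "vmult (iclass (zero_scheme {..<n} (psubst ?e ` G))) (Aff 1) - vmult (at_L f) (Aff 1) \<in> scissor_ideal"
    unfolding X by (simp only: vmult_commute[of "Aff 1"] vmult_diff_left)
  then show ?thesis
    unfolding has_class_def X' vmult_line[OF G'] at_L_shift .
qed

lemma zero_scheme_same_ideal:
  assumes G: "G \<subseteq> polys V" and H: "H \<subseteq> polys V" and "G \<subseteq> eqs_ideal V H" "H \<subseteq> eqs_ideal V G"
  shows "isomorphic (zero_scheme V G) (zero_scheme V H)"
proof -
  interpret A: equations V G using G by unfold_locales
  interpret B: equations V H using H by unfold_locales
  show ?thesis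
    by (rule subst_isomorphic[of _ _ _ _ poly_var poly_var]; (rule polynomial_mapI)?)
      (use assms A.ideal_zero B.ideal_zero in auto)
qed

text \<open>The empty scheme has class zero, as removing it from itself leaves it unchanged.\<close>

lemma has_class_empty:
  fixes V :: "nat set"
  assumes V: "finite V"
  shows "has_class V {1 :: (nat, 'k::field) mpoly} 0"
proof -
  obtain s where s: "s \<notin> V" using ex_new_if_finite[OF infinite_UNIV_nat V] by blast
  let ?W = "insert s V" and ?H = "{poly_var s - 1, 1} :: (nat, 'k) mpoly set"
  interpret A: equations V "{1} :: (nat, 'k) mpoly set" by unfold_locales simp
  interpret B: equations ?W ?H by unfold_locales simp
  have one: "f \<in> eqs_ideal ?W ?H" if "f \<in> polys ?W" for f
    using B.ideal_mult[OF B.eqs_in_ideal[of 1] that] by simp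
  have one': "f \<in> eqs_ideal V {1}" if "f \<in> polys V" for f :: "(nat, 'k) mpoly"
    using A.ideal_mult[OF A.eqs_in_ideal[of 1] that] by simp
  have "isomorphic (zero_scheme V {1 :: (nat, 'k) mpoly}) (zero_scheme ?W ?H)"
    by (rule subst_isomorphic[of _ _ _ _ poly_var "\<lambda>v. if v \<in> V then poly_var v else 1"]; (rule polynomial_mapI)?)
      (auto intro!: one one')
  then have "iclass (zero_scheme ?W ?H) = iclass (zero_scheme V {1 :: (nat, 'k) mpoly})"
    using iso_class_cong by metis
  moreover have "iclass (zero_scheme V {1}) - iclass (zero_scheme V (insert 1 {1})) - iclass (zero_scheme ?W ?H) \<in> scissor_ideal"
    using scissor_relation[OF V _ _ s, of "{1 :: (nat, 'k) mpoly}" 1] by simp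
  ultimately have "- iclass (zero_scheme V {1 :: (nat, 'k) mpoly}) \<in> scissor_ideal" by simp
  from scissor_uminus[OF this] show ?thesis by (simp add: has_class_def at_L_zero)
qed

section \<open>Classes of principal open subsets of affine spaces\<close>

text \<open>The complement of the hypersurface \<open>g = 0\<close> in the affine space with coordinates \<open>V\<close> has
  class \<open>f(L)\<close>. Stating this as a relation between representatives allows the coordinates \<open>V\<close> and the
  polynomial \<open>g\<close> to change without any mention of the schemes.\<close>

definition open_class :: "nat set \<Rightarrow> (nat, 'k::field) mpoly \<Rightarrow> int poly \<Rightarrow> bool" where
  "open_class V g f \<longleftrightarrow> iclass (zero_scheme V {}) - iclass (zero_scheme V {g})
     - (at_L f :: 'k scheme set \<Rightarrow>\<^sub>0 int) \<in> scissor_ideal"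

lemma open_class_iff:
  assumes "finite V" "g \<in> polys V" "s \<notin> V"
  shows "open_class V g f \<longleftrightarrow> has_class (insert s V) {poly_var s * g - 1} f"
proof -
  have r: "iclass (zero_scheme V {}) - iclass (zero_scheme V {g})
      - iclass (zero_scheme (insert s V) {poly_var s * g - 1}) \<in> scissor_ideal"
    using scissor_relation[of V "{}" g s] assms by simp
  show ?thesis
    unfolding open_class_def has_class_def
    using scissor_ideal.diff[OF _ r, of "iclass (zero_scheme V {}) - iclass (zero_scheme V {g}) - at_L f"]
      scissor_add[OF r, of "iclass (zero_scheme (insert s V) {poly_var s * g - 1}) - at_L f"]
    by (auto simp: algebra_simps)
qed

lemma ex_fresh: "finite V \<Longrightarrow> \<exists>s :: nat. s \<notin> V"
  using ex_new_if_finite[OF infinite_UNIV_nat] by blast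

lemma open_class_iso:
  assumes "finite V" "g \<in> polys V" "s \<notin> V" "finite W" "h \<in> polys W" "t \<notin> W"
    and "isomorphic (zero_scheme (insert s V) {poly_var s * g - 1}) (zero_scheme (insert t W) {poly_var t * h - 1})"
  shows "open_class V g f \<longleftrightarrow> open_class W h f"
  using assms by (simp add: open_class_iff has_class_iso)

lemma (in equations) psubst_congruent:
  assumes "\<And>v. v \<in> W \<Longrightarrow> \<sigma> v \<in> polys V" "\<And>v. v \<in> W \<Longrightarrow> \<tau> v \<in> polys V"
    and e: "\<And>v. v \<in> W \<Longrightarrow> \<sigma> v - \<tau> v \<in> eqs_ideal V G" and f: "f \<in> polys W"
  shows "psubst \<sigma> f - psubst \<tau> f \<in> eqs_ideal V G"
proof -
  have h: "(\<lambda>f. residue V G (psubst \<rho> f)) \<in> ring_hom (poly_ring W) (coord_ring V G)"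
    if "\<And>v. v \<in> W \<Longrightarrow> \<rho> v \<in> polys V" for \<rho>
  proof -
    have c: "psubst \<rho> f \<in> polys V" if "f \<in> polys W" for f
      by (rule psubst_polys[OF that]) (rule \<open>\<And>v. v \<in> W \<Longrightarrow> \<rho> v \<in> polys V\<close>)
    show ?thesis by (rule ring_hom_memI) (use c residue_closed residue_simps in auto)
  qed
  have "residue V G (psubst \<sigma> f) = residue V G (psubst \<tau> f)"
    by (rule poly_hom_eq[OF h[of \<sigma>] h[of \<tau>] _ _ f]) (use assms residue_eq in auto)
  then show ?thesis using residue_eq psubst_polys[OF f] assms(1,2) by blast
qed

lemma (in equations) ideal_multiple:
  "\<lbrakk>g \<in> G; c \<in> polys V; f = c * g\<rbrakk> \<Longrightarrow> f \<in> eqs_ideal V G"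
  using ideal_mult[OF eqs_in_ideal] by simp

lemma (in equations) ideal_combination:
  "\<lbrakk>i \<in> eqs_ideal V G; g \<in> G; b \<in> polys V; c \<in> polys V; f = b * i + c * g\<rbrakk> \<Longrightarrow> f \<in> eqs_ideal V G"
  using ideal_add[OF ideal_mult ideal_mult[OF eqs_in_ideal]] by simp

abbreviation subst1 :: "nat \<Rightarrow> (nat, 'k::field) mpoly \<Rightarrow> (nat, 'k) mpoly \<Rightarrow> (nat, 'k) mpoly" where
  "subst1 x e \<equiv> psubst (poly_var(x := e))"

lemma subst1_polys: "g \<in> polys (insert x V) \<Longrightarrow> e \<in> polys V \<Longrightarrow> subst1 x e g \<in> polys V"
  by (rule psubst_polys[of g "insert x V"]) auto

lemma subst1_fresh: "g \<in> polys V \<Longrightarrow> x \<notin> V \<Longrightarrow> subst1 x e g = g"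
  by (rule psubst_ident) auto

text \<open>Where \<open>g\<close> is invertible, cut along \<open>x = 0\<close>: the closed part is the locus of \<open>g(0)\<close> in the remaining coordinates,
  the open part that of \<open>x g\<close>.\<close>

lemma open_class_scissor:
  fixes g :: "(nat, 'k::field) mpoly"
  assumes V: "finite V" and x: "x \<notin> V" and g: "g \<in> polys (insert x V)"
    and h: "open_class V (subst1 x 0 g) f0"
  shows "open_class (insert x V) g f \<longleftrightarrow> open_class (insert x V) (poly_var x * g) (f - f0)"
proof -
  obtain s where s: "s \<notin> insert x V" using ex_fresh[of "insert x V"] V by blast
  obtain t where t: "t \<notin> insert s (insert x V)" using ex_fresh[of "insert s (insert x V)"] V by blast
  let ?V = "insert x V" and ?g0 = "subst1 x 0 g" and ?e = "poly_var s * g - 1 :: (nat, 'k) mpoly"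
  let ?W = "insert s ?V"
  have gW: "g \<in> polys ?W" "g \<in> polys (insert t ?W)" by (intro polys_insert g)+
  have g0: "?g0 \<in> polys V" using g by (rule subst1_polys) simp
  have g0W: "?g0 \<in> polys ?W" "?g0 \<in> polys (insert s V)" by (intro polys_insert g0)+
  have r: "iclass (zero_scheme ?W {?e}) - iclass (zero_scheme ?W {poly_var x, ?e})
     - iclass (zero_scheme (insert t ?W) {poly_var t * poly_var x - 1, ?e}) \<in> scissor_ideal"
    by (rule scissor_relation) (use V t gW in auto)
  interpret A1: equations ?W "{poly_var x, ?e}" using gW by unfold_locales auto
  interpret B1: equations "insert s V" "{poly_var s * ?g0 - 1}" using g0W by unfold_locales auto
  have i1: "isomorphic (zero_scheme ?W {poly_var x, ?e}) (zero_scheme (insert s V) {poly_var s * ?g0 - 1})"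
  proof (rule subst_isomorphic)
    show "polynomial_map ?W {poly_var x, ?e} (insert s V) {poly_var s * ?g0 - 1} (poly_var(x := 0))"
      by (rule polynomial_mapI) (use gW g0W s B1.ideal_zero B1.eqs_in_ideal in auto)
    show "polynomial_map (insert s V) {poly_var s * ?g0 - 1} ?W {poly_var x, ?e} poly_var"
    proof (rule polynomial_mapI)
      fix h assume "h \<in> {poly_var s * ?g0 - 1}"
      then have h: "h = poly_var s * ?g0 - 1" by simp
      have "subst1 x 0 g - psubst poly_var g \<in> eqs_ideal ?W {poly_var x, ?e}"
        by (rule A1.psubst_congruent[OF _ _ _ g])
          (use A1.ideal_zero A1.ideal_uminus[OF A1.eqs_in_ideal[of "poly_var x"]] in auto)
      then show "psubst poly_var h \<in> eqs_ideal ?W {poly_var x, ?e}" unfolding h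
        by (rule A1.ideal_combination[of _ ?e "poly_var s" 1]) (auto simp: algebra_simps)
    qed (use gW g0W in auto)
    fix v assume "v \<in> ?W"
    then show "psubst poly_var ((poly_var(x := 0)) v) - poly_var v \<in> eqs_ideal ?W {poly_var x, ?e}"
      using A1.ideal_zero A1.ideal_uminus[OF A1.eqs_in_ideal[of "poly_var x"]] by auto
  next
    fix w assume "w \<in> insert s V"
    then show "subst1 x 0 (poly_var w) - poly_var w \<in> eqs_ideal (insert s V) {poly_var s * ?g0 - 1}"
      using B1.ideal_zero x s by auto
  qed
  let ?G2 = "{poly_var t * poly_var x - 1, ?e}" and ?H2 = "{poly_var s * (poly_var x * g) - 1}"
  interpret A2: equations "insert t ?W" ?G2 using gW by unfold_locales auto
  interpret B2: equations ?W ?H2 using gW by unfold_locales auto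
  have i2: "isomorphic (zero_scheme (insert t ?W) ?G2) (zero_scheme ?W ?H2)"
  proof (rule subst_isomorphic)
    let ?s = "poly_var(s := poly_var s * poly_var x, t := poly_var s * g)" and ?t = "poly_var(s := poly_var s * poly_var t) :: nat \<Rightarrow> (nat, 'k) mpoly"
    have sg: "psubst ?s g = g" "psubst ?t g = g" using s t by (auto intro!: psubst_ident[OF g])
    have st: "s \<noteq> x" "t \<noteq> x" "t \<noteq> s" using s t by auto
    have q: "poly_var s * (poly_var x * g) - 1 \<in> eqs_ideal ?W ?H2" by (rule B2.eqs_in_ideal) simp
    have p2: "?e \<in> eqs_ideal (insert t ?W) ?G2" by (rule A2.eqs_in_ideal) simp
    show "polynomial_map (insert t ?W) ?G2 ?W ?H2 ?s"
    proof (rule polynomial_mapI)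
      fix h assume h: "h \<in> ?G2"
      consider "h = poly_var t * poly_var x - 1" | "h = ?e" using h by blast
      then have "psubst ?s h = poly_var s * (poly_var x * g) - 1"
      proof cases
        case 1
        show ?thesis unfolding 1 using st by (simp add: mult_ac)
      next
        case 2
        show ?thesis unfolding 2 using sg st by (simp add: mult_ac)
      qed
      then show "psubst ?s h \<in> eqs_ideal ?W ?H2" using q by (simp only:)
    qed (use gW in auto)
    show "polynomial_map ?W ?H2 (insert t ?W) ?G2 ?t"
    proof (rule polynomial_mapI)
      fix h assume "h \<in> ?H2"
      then have h: "h = poly_var s * (poly_var x * g) - 1" by simp
      show "psubst ?t h \<in> eqs_ideal (insert t ?W) ?G2" unfolding h
        by (rule A2.ideal_combination[OF p2, of "poly_var t * poly_var x - 1" 1 "poly_var s * g"])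
          (use sg st gW in \<open>auto simp: algebra_simps\<close>)
    qed (use gW in auto)
    fix v assume v: "v \<in> insert t ?W"
    consider "v = s" | "v = t" | "v \<noteq> s" "v \<noteq> t" by blast
    then show "psubst ?t (?s v) - poly_var v \<in> eqs_ideal (insert t ?W) ?G2"
    proof cases
      case 1
      show ?thesis by (rule A2.ideal_multiple[of "poly_var t * poly_var x - 1" "poly_var s"])
          (use 1 st in \<open>auto simp: algebra_simps\<close>)
    next
      case 2
      show ?thesis by (rule A2.ideal_multiple[of ?e "poly_var t"])
          (use 2 st sg in \<open>auto simp: algebra_simps\<close>)
    qed (use A2.ideal_zero in simp)
  next
    let ?s = "poly_var(s := poly_var s * poly_var x, t := poly_var s * g)" and ?t = "poly_var(s := poly_var s * poly_var t) :: nat \<Rightarrow> (nat, 'k) mpoly"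
    fix w assume w: "w \<in> ?W"
    have st: "s \<noteq> x" "t \<noteq> x" "t \<noteq> s" "w \<noteq> t" using s t w by auto
    show "psubst ?s (?t w) - poly_var w \<in> eqs_ideal ?W ?H2"
    proof (cases "w = s")
      case True
      show ?thesis by (rule B2.ideal_multiple[of "poly_var s * (poly_var x * g) - 1" "poly_var s"])
          (use True st in \<open>auto simp: algebra_simps\<close>)
    qed (use B2.ideal_zero st in simp)
  qed
  have c1: "has_class ?W {poly_var x, ?e} f0"
    using h open_class_iff[OF V g0, of s] s has_class_iso[OF i1] by simp
  have c2: "open_class ?V (poly_var x * g) c \<longleftrightarrow> has_class (insert t ?W) ?G2 c" for c
    using open_class_iff[of ?V "poly_var x * g" s c] V g s has_class_iso[OF i2] by simp
  have c3: "open_class ?V g c \<longleftrightarrow> has_class ?W {?e} c" for c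
    using open_class_iff[of ?V g s c] V g s by simp
  note rc = scissor_add[OF r c1[unfolded has_class_def]]
  have rc': "iclass (zero_scheme ?W {?e}) - iclass (zero_scheme (insert t ?W) ?G2) - at_L f0 \<in> scissor_ideal"
    using rc by (simp add: algebra_simps)
  show ?thesis
    unfolding c2 c3 has_class_def at_L_diff
    using scissor_ideal.diff[OF _ rc', of "iclass (zero_scheme ?W {?e}) - at_L f"]
      scissor_add[OF rc', of "iclass (zero_scheme (insert t ?W) ?G2) - (at_L f - at_L f0)"]
    by (auto simp: algebra_simps)
qed

text \<open>On the locus in question \<open>u\<close> is invertible, so that \<open>x \<mapsto> u x + h\<close> is a change of coordinate there. The
  inverse of \<open>u\<close> is available as a polynomial: it is \<open>s g\<close>, for the coordinate \<open>s\<close> that inverts \<open>u g\<close>.\<close>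

lemma open_class_subst:
  fixes g :: "(nat, 'k::field) mpoly"
  assumes V: "finite V" and x: "x \<notin> V" and g: "g \<in> polys (insert x V)"
    and u: "u \<in> polys V" and h: "h \<in> polys V"
  shows "open_class (insert x V) (u * subst1 x (u * poly_var x + h) g) f \<longleftrightarrow> open_class (insert x V) (u * g) f"
proof -
  obtain s where s: "s \<notin> insert x V" using ex_fresh[of "insert x V"] V by blast
  let ?V = "insert x V" and ?g = "subst1 x (u * poly_var x + h) g"
  let ?W = "insert s ?V"
  have up: "f \<in> polys V \<Longrightarrow> f \<in> polys ?V" "f \<in> polys ?V \<Longrightarrow> f \<in> polys ?W" for f :: "(nat, 'k) mpoly"
    by (erule polys_insert)+
  have g': "?g \<in> polys ?V" by (rule psubst_polys[OF g]) (use u h up in auto)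
  let ?G = "{poly_var s * (u * g) - 1}" and ?H = "{poly_var s * (u * ?g) - 1}"
  have G: "?G \<subseteq> polys ?W" and H: "?H \<subseteq> polys ?W" using up u g g' by auto
  interpret A: equations ?W ?G using G by unfold_locales
  interpret B: equations ?W ?H using H by unfold_locales
  have sx: "s \<noteq> x" using s by auto
  let ?s = "poly_var(x := u * poly_var x + h)" and ?t = "poly_var(x := (poly_var x - h) * (poly_var s * g))"
  have fixed: "psubst (poly_var(x := e)) u = u" "psubst (poly_var(x := e)) h = h" for e
    using u h x by (auto intro: subst1_fresh)
  have q: "poly_var s * (u * ?g) - 1 \<in> eqs_ideal ?W ?H" by (rule B.eqs_in_ideal) simp
  have p: "poly_var s * (u * g) - 1 \<in> eqs_ideal ?W ?G" by (rule A.eqs_in_ideal) simp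
  have tx: "u * ((poly_var x - h) * (poly_var s * g)) + h - poly_var x \<in> eqs_ideal ?W ?G"
    by (rule A.ideal_multiple[of "poly_var s * (u * g) - 1" "poly_var x - h"])
      (use up h in \<open>auto simp: algebra_simps\<close>)
  have cl: "(poly_var x - h) * (poly_var s * g) \<in> polys ?W" using up h g by auto
  have "isomorphic (zero_scheme ?W ?G) (zero_scheme ?W ?H)"
  proof (rule subst_isomorphic)
    show "polynomial_map ?W ?G ?W ?H ?s"
      by (rule polynomial_mapI[OF G H]) (use up u h q sx fixed in auto)
    show "polynomial_map ?W ?H ?W ?G ?t"
    proof (rule polynomial_mapI[OF H G])
      fix k assume "k \<in> ?H"
      then have k: "k = poly_var s * (u * ?g) - 1" by simp
      have "psubst ?t ?g - g \<in> eqs_ideal ?W ?G"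
      proof -
        have "psubst (\<lambda>v. psubst ?t (?s v)) g - psubst poly_var g \<in> eqs_ideal ?W ?G"
        proof (rule A.psubst_congruent[OF _ _ _ g])
          fix v assume "v \<in> ?V"
          then show "psubst ?t (?s v) \<in> polys ?W" "psubst ?t (?s v) - poly_var v \<in> eqs_ideal ?W ?G"
            using cl up u h tx fixed A.ideal_zero by auto
        qed auto
        then show ?thesis by (simp add: psubst_psubst)
      qed
      then show "psubst ?t k \<in> eqs_ideal ?W ?G" unfolding k
        by (rule A.ideal_combination[of _ "poly_var s * (u * g) - 1" "poly_var s * u" 1])
          (use sx fixed up u in \<open>auto simp: algebra_simps\<close>)
    qed (use cl in auto)
    fix v assume "v \<in> ?W"
    then show "psubst ?t (?s v) - poly_var v \<in> eqs_ideal ?W ?G"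
      using tx fixed A.ideal_zero by auto
  next
    fix w assume w: "w \<in> ?W"
    show "psubst ?s (?t w) - poly_var w \<in> eqs_ideal ?W ?H"
    proof (cases "w = x")
      case True
      show ?thesis by (rule B.ideal_multiple[of "poly_var s * (u * ?g) - 1" "poly_var x"])
          (use True fixed sx in \<open>auto simp: algebra_simps\<close>)
    qed (use B.ideal_zero in simp)
  qed
  then show ?thesis
    using open_class_iso[of ?V "u * g" s ?V "u * ?g" s f] V s up u g g' by auto
qed

text \<open>The two loci are the same open set; the coordinate that inverts the polynomial changes by the unit \<open>a\<close>.\<close>

lemma open_class_square:
  fixes a g :: "(nat, 'k::field) mpoly"
  assumes V: "finite V" and a: "a \<in> polys V" and g: "g \<in> polys V"
  shows "open_class V (a * (a * g)) f \<longleftrightarrow> open_class V (a * g) f"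
proof -
  obtain s where s: "s \<notin> V" using ex_fresh[OF V] by blast
  let ?W = "insert s V" and ?G = "{poly_var s * (a * (a * g)) - 1}" and ?H = "{poly_var s * (a * g) - 1}"
  have up: "a \<in> polys ?W" "g \<in> polys ?W" by (intro polys_insert a g)+
  have G: "?G \<subseteq> polys ?W" and H: "?H \<subseteq> polys ?W" using up by auto
  interpret A: equations ?W ?G using G by unfold_locales
  interpret B: equations ?W ?H using H by unfold_locales
  let ?s = "poly_var(s := poly_var s * (poly_var s * g))" and ?t = "poly_var(s := poly_var s * a)"
  have fixed: "psubst (poly_var(s := e)) a = a" "psubst (poly_var(s := e)) g = g" for e
    using a g s by (auto intro: subst1_fresh)
  have "isomorphic (zero_scheme ?W ?G) (zero_scheme ?W ?H)"
  proof (rule subst_isomorphic)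
    show "polynomial_map ?W ?G ?W ?H ?s"
    proof (rule polynomial_mapI[OF G H])
      fix h assume "h \<in> ?G"
      then have h: "h = poly_var s * (a * (a * g)) - 1" by simp
      show "psubst ?s h \<in> eqs_ideal ?W ?H" unfolding h
        by (rule B.ideal_multiple[of "poly_var s * (a * g) - 1" "poly_var s * (a * g) + 1"])
          (use up fixed in \<open>auto simp: algebra_simps\<close>)
    qed (use up in auto)
    show "polynomial_map ?W ?H ?W ?G ?t"
    proof (rule polynomial_mapI[OF H G])
      fix h assume "h \<in> ?H"
      then have h: "h = poly_var s * (a * g) - 1" by simp
      show "psubst ?t h \<in> eqs_ideal ?W ?G" unfolding h
        by (rule A.ideal_multiple[of "poly_var s * (a * (a * g)) - 1" 1])
          (use up fixed in \<open>auto simp: algebra_simps\<close>)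
    qed (use up in auto)
    fix v
    show "psubst ?t (?s v) - poly_var v \<in> eqs_ideal ?W ?G"
    proof (cases "v = s")
      case True
      show ?thesis by (rule A.ideal_multiple[of "poly_var s * (a * (a * g)) - 1" "poly_var s"])
          (use True fixed in \<open>auto simp: algebra_simps\<close>)
    qed (use A.ideal_zero in simp)
    show "psubst ?s (?t v) - poly_var v \<in> eqs_ideal ?W ?H"
    proof (cases "v = s")
      case True
      show ?thesis by (rule B.ideal_multiple[of "poly_var s * (a * g) - 1" "poly_var s"])
          (use True fixed in \<open>auto simp: algebra_simps\<close>)
    qed (use B.ideal_zero in simp)
  qed
  then show ?thesis
    using open_class_iso[of V "a * (a * g)" s V "a * g" s f] V s a g by auto
qed

lemma open_class_uminus:
  assumes "finite V" "g \<in> polys V"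
  shows "open_class V (- g) f \<longleftrightarrow> open_class V g f"
proof -
  interpret A: equations V "{g}" using assms by unfold_locales auto
  interpret B: equations V "{- g}" using assms by unfold_locales auto
  have "isomorphic (zero_scheme V {- g}) (zero_scheme V {g})"
    by (rule zero_scheme_same_ideal)
      (use assms A.ideal_uminus[OF A.eqs_in_ideal] B.ideal_uminus[OF B.eqs_in_ideal] in auto)
  then show ?thesis unfolding open_class_def by (simp add: iso_class_cong)
qed

lemma open_class_zero:
  assumes "finite V"
  shows "open_class V 0 0"
proof -
  interpret A: equations V "{} :: (nat, 'a) mpoly set" by unfold_locales simp
  have "isomorphic (zero_scheme V {0}) (zero_scheme V ({} :: (nat, 'a) mpoly set))"
    by (rule zero_scheme_same_ideal) (use A.ideal_zero in auto)
  then show ?thesis unfolding open_class_def by (simp add: iso_class_cong at_L_zero scissor_zero)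
qed

lemma open_class_free:
  fixes g :: "(nat, 'k::field) mpoly"
  assumes V: "finite V" and g: "g \<in> polys V" and x: "x \<notin> V" and f: "open_class V g f"
  shows "open_class (insert x V) g (LL * f)"
proof -
  obtain s where s: "s \<notin> insert x V" using ex_fresh[of "insert x V"] V by blast
  have "has_class (insert s V) {poly_var s * g - 1} f" using open_class_iff[OF V g, of s f] s f by simp
  moreover have gs: "g \<in> polys (insert s V)" "g \<in> polys (insert x V)" by (intro polys_insert g)+
  ultimately have "has_class (insert x (insert s V)) {poly_var s * g - 1} (LL * f)"
    using V x s by (intro has_class_line) auto
  then show ?thesis using open_class_iff[of "insert x V" g s "LL * f"] V gs s by (simp add: insert_commute)
qed

lemma open_class_unit:
  fixes g :: "(nat, 'k::field) mpoly"
  assumes V: "finite V" and g: "g \<in> polys V" and x: "x \<notin> V" and f: "open_class V g f"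
  shows "open_class (insert x V) (poly_var x * g) (MM * f)"
proof -
  have gx: "g \<in> polys (insert x V)" by (intro polys_insert g)
  have "open_class V (subst1 x 0 g) f" using f subst1_fresh[OF g x] by simp
  from open_class_scissor[OF V x gx this, of "LL * f"] show ?thesis
    using open_class_free[OF V g x f] by (simp add: algebra_simps)
qed

lemma open_class_point: "open_class {} (1 :: (nat, 'k::field) mpoly) 1"
proof -
  have "- (iclass (zero_scheme {} {1 :: (nat, 'k) mpoly}) - 0) \<in> scissor_ideal"
    using has_class_empty[of "{}"] by (intro scissor_uminus) (simp add: has_class_def at_L_zero)
  then show ?thesis unfolding open_class_def at_L_one Aff_eq by simp
qed

text \<open>The indeterminates of a graph polynomial are edges; they are renamed to natural numbers, where fresh
  coordinates are always available.\<close>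

lemma hypersurface_class:
  fixes g :: "('v, 'k::field) mpoly"
  assumes V: "finite V" and g: "g \<in> polys V" and e: "bij_betw e V W"
    and c: "open_class W (psubst (\<lambda>v. poly_var (e v)) g) f"
  shows "K0_class (hypersurface V g) = int_poly_eval K0_Var (LL ^ card V - f) Lefschetz"
proof -
  interpret P: cring "poly_ring V :: ('v, 'k) mpoly ring" by (rule poly_ring_cring)
  have hyp: "hypersurface V g = zero_scheme V {g}"
    unfolding hypersurface_def using P.cgenideal_eq_genideal[OF g] by simp
  let ?g = "psubst (\<lambda>v. poly_var (e v)) g :: (nat, 'k) mpoly"
  have W: "finite W" and card: "card W = card V" using e V by (auto simp: bij_betw_finite bij_betw_same_card)
  have all: "has_class W' ({} :: (nat, 'k) mpoly set) (LL ^ card W')" if "finite W'" for W'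
    using that
  proof (induction W')
    case empty
    then show ?case unfolding has_class_def card.empty power_0 at_L_one Aff_eq by (simp add: scissor_zero)
  next
    case (insert x W')
    then show ?case using has_class_line[of W' "{} :: (nat, 'k) mpoly set" x] by simp
  qed
  have "isomorphic (zero_scheme V {g}) (zero_scheme W {?g})"
    using zero_scheme_rename[OF e, of "{g}"] g by simp
  then have "iclass (zero_scheme V {g}) = iclass (zero_scheme W {?g})" by (simp add: iso_class_cong)
  moreover have "iclass (zero_scheme W {}) - at_L (LL ^ card V)
      - (iclass (zero_scheme W {}) - iclass (zero_scheme W {?g}) - at_L f) \<in> scissor_ideal"
    using all[OF W] c unfolding has_class_def open_class_def card by (rule scissor_ideal.diff)
  ultimately have "iclass (zero_scheme V {g}) - at_L (LL ^ card V - f) \<in> scissor_ideal"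
    by (simp add: at_L_diff algebra_simps)
  then show ?thesis unfolding K0_class_def hyp int_poly_eval_L kclass_eq .
qed

section \<open>Bordered tridiagonal determinants\<close>

text \<open>The list \<open>[(p\<^sub>1, y\<^sub>1), \<dots>, (p\<^sub>m, y\<^sub>m)]\<close> encodes the symmetric matrix with the diagonal entries
  \<open>p\<^sub>1, \<dots>, p\<^sub>m, w\<close>, the entries \<open>y\<^sub>i\<close> at \<open>(i, i + 1)\<close> for \<open>i < m\<close>, and the last column \<open>y\<^bsub>i-1\<^esub> + y\<^sub>i\<close> in the rows
  \<open>i \<le> m\<close>, where \<open>y\<^sub>0 = r\<close>. Its determinant is \<open>bordered_det\<close>; \<open>continuant\<close> is the determinant without
  the last row and column, and \<open>border_cofactor\<close> results from the latter matrix if the last column replaces its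
  first column. The equations are the expansions along the first row.\<close>

fun continuant :: "('a::comm_ring_1 \<times> 'a) list \<Rightarrow> 'a" where
  "continuant [] = 1"
| "continuant [(p, y)] = p"
| "continuant ((p, y) # (q, z) # l) = p * continuant ((q, z) # l) - y^2 * continuant l"

fun border_cofactor :: "'a::comm_ring_1 \<Rightarrow> ('a \<times> 'a) list \<Rightarrow> 'a" where
  "border_cofactor r [] = 0"
| "border_cofactor r ((p, y) # l) = (y + r) * continuant l - y * border_cofactor y l"

fun bordered_det :: "'a::comm_ring_1 \<Rightarrow> ('a \<times> 'a) list \<Rightarrow> 'a \<Rightarrow> 'a" where
  "bordered_det r [] w = w"
| "bordered_det r [(p, y)] w = p * w - (y + r)^2"
| "bordered_det r ((p, y) # (q, z) # l) w = p * bordered_det y ((q, z) # l) w - y^2 * bordered_det z l w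
     + 2 * y * (y + r) * border_cofactor y ((q, z) # l) - (y + r)^2 * continuant ((q, z) # l)"

lemma continuant_first: "continuant ((p + c, y) # l) = continuant ((p, y) # l) + c * continuant l"
  by (cases l) (auto simp: algebra_simps)

lemma bordered_det_corner: "bordered_det r l w = bordered_det r l 0 + w * continuant l"
proof (induction r l w rule: bordered_det.induct)
  case (3 r p y q z l w)
  then show ?case by (simp add: algebra_simps del: continuant.simps(2))
qed (auto simp: algebra_simps)

lemma bordered_det_border: "bordered_det r ((p, y) # l) w = bordered_det 0 ((p, y) # l) w - 2 * r * border_cofactor 0 ((p, y) # l) - r^2 * continuant l"
  by (cases l) (auto simp: algebra_simps power2_eq_square)

lemma bordered_det_first: "bordered_det r ((p + c, y) # l) w = bordered_det r ((p, y) # l) w + c * bordered_det y l w"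
  by (cases l) (auto simp: algebra_simps)

text \<open>Gaussian elimination with an invertible first diagonal entry \<open>p\<close>; after rescaling \<open>y\<^sub>1\<close> and \<open>r\<close> by \<open>p\<close>
  no denominators remain. The remaining matrix has the same shape, with a new border parameter.\<close>

lemma bordered_det_pivot:
  "bordered_det (p * s) ((p, p * e) # (q + p * e^2, z) # l) (w + p * (e + s)^2)
    = p * bordered_det (p * e * (1 - s - e)) ((q, z) # l) w"
proof -
  define D K K' N where "D = bordered_det 0 ((q, z) # l) 0" and "K = continuant ((q, z) # l)" and "K' = continuant l"
    and "N = border_cofactor 0 ((q, z) # l)"
  define D' where "D' = bordered_det z l 0"
  have d: "bordered_det r ((q, z) # l) v = D + v * K - 2 * r * N - r^2 * K'" for r v
    using bordered_det_border[of r q z l v] bordered_det_corner[of 0 "(q, z) # l" v] by (simp add: D_def K_def N_def K'_def)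
  have d': "bordered_det z l v = D' + v * K'" for v using bordered_det_corner[of z l v] by (simp add: D'_def K'_def)
  have n: "border_cofactor r ((a, z) # l) = N + r * K'" for r a by (simp add: N_def K'_def algebra_simps)
  show ?thesis
    by (simp add: bordered_det_first continuant_first d d' n del: border_cofactor.simps continuant.simps(2,3) bordered_det.simps(2))
      (simp add: K_def[symmetric] K'_def[symmetric] algebra_simps power2_eq_square)
qed

text \<open>Elimination of two rows when the first diagonal entry vanishes but its neighbour \<open>y\<close> does not.\<close>

lemma bordered_det_zero_pivot:
  "bordered_det (y * s) ((0, y) # (q, z) # l) (w - q * (1 + s)^2 + 2 * (1 + s) * (y + z))
    = - (y * (y * bordered_det (- (z * s)) l w))"
proof (cases l)
  case Nil
  then show ?thesis by (simp add: algebra_simps power2_eq_square)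
next
  case (Cons a l')
  obtain b c where a: "a = (b, c)" by fastforce
  define D K K' N where "D = bordered_det 0 l 0" and "K = continuant l" and "K' = continuant l'" and "N = border_cofactor 0 l"
  have d: "bordered_det r l v = D + v * K - 2 * r * N - r^2 * K'" for r v
    using bordered_det_border[of r b c l' v] bordered_det_corner[of 0 l v] by (simp add: D_def K_def N_def K'_def Cons a)
  have n: "border_cofactor r l = N + r * K'" for r by (simp add: N_def K'_def Cons a algebra_simps)
  have k: "continuant ((q, z) # l) = q * K - z^2 * K'" by (simp add: Cons a K_def K'_def)
  show ?thesis by (simp add: k d n K_def[symmetric] algebra_simps power2_eq_square)
qed

lemma bordered_det_zero_row: "bordered_det r ((0, 0) # l) w = - (r * (r * continuant l))"
  by (cases l) (auto simp: power2_eq_square)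

text \<open>Substitution acts on determinants through their entries. For matrices whose entries are distinct
  indeterminates, \<open>sub_list_fixed\<close> says that a substitution for another indeterminate has no effect.\<close>

definition sub_list :: "('v \<Rightarrow> ('w, 'k::field) mpoly) \<Rightarrow> (('v, 'k) mpoly \<times> ('v, 'k) mpoly) list \<Rightarrow>
    (('w, 'k) mpoly \<times> ('w, 'k) mpoly) list" where
  "sub_list \<sigma> = map (map_prod (psubst \<sigma>) (psubst \<sigma>))"

lemma sub_list_simps [simp]:
  "sub_list \<sigma> [] = []" "sub_list \<sigma> ((p, y) # l) = (psubst \<sigma> p, psubst \<sigma> y) # sub_list \<sigma> l"
  by (simp_all add: sub_list_def)

lemma psubst_numeral [simp]: "psubst \<sigma> (numeral n) = numeral n"
proof -
  have "psubst \<sigma> (of_nat m) = of_nat m" for m by (induction m) auto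
  from this[of "numeral n"] show ?thesis by simp
qed

lemma psubst_continuant [simp]: "psubst \<sigma> (continuant l) = continuant (sub_list \<sigma> l)"
  by (induction l rule: continuant.induct) auto

lemma psubst_border_cofactor [simp]: "psubst \<sigma> (border_cofactor r l) = border_cofactor (psubst \<sigma> r) (sub_list \<sigma> l)"
  by (induction r l rule: border_cofactor.induct) auto

lemma psubst_bordered_det [simp]: "psubst \<sigma> (bordered_det r l w) = bordered_det (psubst \<sigma> r) (sub_list \<sigma> l) (psubst \<sigma> w)"
  by (induction r l w rule: bordered_det.induct) auto

definition list_polys :: "'v set \<Rightarrow> (('v, 'k::field) mpoly \<times> ('v, 'k) mpoly) list \<Rightarrow> bool" where
  "list_polys V l \<longleftrightarrow> (\<forall>x\<in>set l. fst x \<in> polys V \<and> snd x \<in> polys V)"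

lemma list_polys_simps [simp]:
  "list_polys V []" "list_polys V ((p, y) # l) \<longleftrightarrow> p \<in> polys V \<and> y \<in> polys V \<and> list_polys V l"
  by (auto simp: list_polys_def)

lemma polys_numeral [simp]: "numeral n \<in> polys V"
proof -
  have "of_nat m \<in> polys V" for m by (induction m) auto
  from this[of "numeral n"] show ?thesis by simp
qed

lemma polys_continuant [simp]: "list_polys V l \<Longrightarrow> continuant l \<in> polys V"
  by (induction l rule: continuant.induct) auto

lemma polys_border_cofactor [simp]: "list_polys V l \<Longrightarrow> r \<in> polys V \<Longrightarrow> border_cofactor r l \<in> polys V"
  by (induction r l rule: border_cofactor.induct) auto

lemma polys_bordered_det [simp]: "list_polys V l \<Longrightarrow> r \<in> polys V \<Longrightarrow> w \<in> polys V \<Longrightarrow> bordered_det r l w \<in> polys V"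
  by (induction r l w rule: bordered_det.induct) auto

definition var_list :: "(nat \<times> nat) list \<Rightarrow> ((nat, 'k::field) mpoly \<times> (nat, 'k) mpoly) list" where
  "var_list = map (map_prod poly_var poly_var)"

definition list_vars :: "(nat \<times> nat) list \<Rightarrow> nat set" where
  "list_vars l = set (map fst l) \<union> set (map snd l)"

lemma var_list_simps [simp]:
  "var_list [] = []" "var_list ((p, y) # l) = (poly_var p, poly_var y) # var_list l"
  by (simp_all add: var_list_def)

lemma list_vars_simps [simp]:
  "list_vars [] = {}" "list_vars ((p, y) # l) = insert p (insert y (list_vars l))" "finite (list_vars l)"
  by (auto simp: list_vars_def)

lemma list_polys_vars [simp]: "list_polys V (var_list l) \<longleftrightarrow> list_vars l \<subseteq> V"
  by (auto simp: list_polys_def var_list_def list_vars_def)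

lemma sub_list_fixed [simp]: "x \<notin> list_vars l \<Longrightarrow> sub_list (poly_var(x := e)) (var_list l) = var_list l"
  by (induction l) auto

section \<open>The classes of the determinantal loci\<close>

text \<open>The calculus of loci in a form that fits backward reasoning: each rule reduces the class of one locus to those of
  simpler ones, and leaves the new polynomial as an equation to be checked by simplification.\<close>

lemma scissorI:
  assumes "V = insert x W" "x \<notin> W" "finite W" "g \<in> polys V"
    and "g0 = subst1 x 0 g" "open_class W g0 f0" "open_class V (poly_var x * g) f1" "f = f0 + f1"
  shows "open_class V g f"
  using open_class_scissor[OF assms(3,2), of g f0 f] assms by simp

lemma punctureI:
  assumes "V = insert x W" "x \<notin> W" "finite W" "g \<in> polys V"
    and "g0 = subst1 x 0 g" "open_class W g0 f0" "open_class V g f1" "f = f1 - f0"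
  shows "open_class V (poly_var x * g) f"
  using open_class_scissor[OF assms(3,2), of g f0 f1] assms by simp

lemma scaleI:
  assumes "V = insert x W" "x \<notin> W" "finite W" "g \<in> polys V" "u \<in> polys W"
    and "g' = subst1 x (u * poly_var x) g" "open_class V (u * g') f"
  shows "open_class V (u * g) f"
  using open_class_subst[OF assms(3,2), of g u 0 f] assms by simp

lemma unscaleI:
  assumes "V = insert x W" "x \<notin> W" "finite W" "g' \<in> polys V" "u \<in> polys W"
    and "u * g = subst1 x (u * poly_var x) g'" "g \<in> polys V" "open_class V (u * g') f"
  shows "open_class V (u * g) f"
proof -
  have "open_class V (u * subst1 x (u * poly_var x) g') f"
    using open_class_subst[OF assms(3,2), of g' u 0 f] assms by simp
  then have "open_class V (u * (u * g)) f" unfolding assms(6)[symmetric] .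
  moreover have "u \<in> polys V" unfolding assms(1) by (rule polys_insert[OF assms(5)])
  ultimately show ?thesis using open_class_square[of V u g f] assms(1,3,7) by simp
qed

lemma shiftI:
  assumes "V = insert x W" "x \<notin> W" "finite W" "g \<in> polys V" "h \<in> polys W"
    and "g' = subst1 x (poly_var x + h) g" "open_class V g' f"
  shows "open_class V g f"
  using open_class_subst[OF assms(3,2), of g 1 h f] assms by simp

lemma reflectI:
  assumes "V = insert x W" "x \<notin> W" "finite W" "g \<in> polys V" "h \<in> polys W"
    and "g' = subst1 x (h - poly_var x) g" "open_class V g' f"
  shows "open_class V g f"
proof -
  have "subst1 x (h - poly_var x) g \<in> polys V"
    using polys_insert[OF assms(5), of x] assms(1) by (intro psubst_polys[OF assms(4)]) (auto intro: polys_insert)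
  then show ?thesis
    using open_class_subst[OF assms(3,2), of g "- 1" h f] assms open_class_uminus[of V g f]
      open_class_uminus[of V "subst1 x (h - poly_var x) g" f] by simp
qed

lemma dropI:
  assumes "V = insert x W" "x \<notin> W" "finite W" "g \<in> polys W" "open_class W g f'"
  shows "f = MM * f' \<Longrightarrow> open_class V (poly_var x * g) f" and "f = LL * f' \<Longrightarrow> open_class V g f"
  using open_class_unit[OF assms(3,4,2,5)] open_class_free[OF assms(3,4,2,5)] assms(1) by simp_all

lemma squareI: "finite V \<Longrightarrow> a \<in> polys V \<Longrightarrow> g \<in> polys V \<Longrightarrow> open_class V (a * g) f \<Longrightarrow> open_class V (a * (a * g)) f"
  by (simp add: open_class_square)

lemma uminusI: "finite V \<Longrightarrow> g \<in> polys V \<Longrightarrow> open_class V g f \<Longrightarrow> open_class V (- g) f"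
  by (simp add: open_class_uminus)

text \<open>The factor \<open>LL - 2\<close> is the class of a line without the points 0 and 1.\<close>

lemma two_punctures:
  assumes W: "finite W" "y \<notin> W" "h \<in> polys W" and c: "open_class W h c"
  shows "open_class (insert y W) (poly_var y * ((1 - poly_var y) * h)) ((LL - 2) * c)"
proof (rule punctureI[of _ y W _ h c "MM * c"])
  have hy: "h \<in> polys (insert y W)" using W(3) by (rule polys_insert)
  show "open_class (insert y W) ((1 - poly_var y) * h) (MM * c)"
    by (rule reflectI[of _ y W _ 1 "poly_var y * h"])
      (use W c hy dropI(1)[of _ y W h c] subst1_fresh[OF W(3,2)] in auto)
qed (use W c subst1_fresh[OF W(3,2)] polys_insert[OF W(3)] in \<open>auto simp: algebra_simps\<close>)

text \<open>The factor \<open>MM^2 - MM + 1\<close> is the class of the plane without three lines in general position.\<close>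

lemma three_lines:
  assumes W: "finite W" "y \<notin> W" "r \<notin> insert y W" "h \<in> polys W" and c: "open_class W h c"
  shows "open_class (insert r (insert y W)) (poly_var r * (poly_var y * ((1 - poly_var y - poly_var r) * h)))
    ((MM^2 - MM + 1) * c)"
proof (rule punctureI[of _ r "insert y W" _ "poly_var y * ((1 - poly_var y) * h)" "(LL - 2) * c" "MM^2 * c"])
  have h1: "h \<in> polys (insert y W)" by (intro polys_insert W)
  have h2: "h \<in> polys (insert r (insert y W))" by (intro polys_insert W)
  have fx: "subst1 r e h = h" for e using W(3,4) by (intro subst1_fresh) auto
  show "open_class (insert r (insert y W)) (poly_var y * ((1 - poly_var y - poly_var r) * h)) (MM^2 * c)"
  proof (rule reflectI[of _ r "insert y W" _ "1 - poly_var y" "poly_var r * (poly_var y * h)"])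
    have "open_class (insert y W) (poly_var y * h) (MM * c)"
      by (rule dropI(1)[of _ y W h c]) (use W c in auto)
    then show "open_class (insert r (insert y W)) (poly_var r * (poly_var y * h)) (MM^2 * c)"
      by (rule dropI(1)[of _ r "insert y W" _ "MM * c", rotated 4]) (use W h1 in \<open>auto simp: power2_eq_square\<close>)
    show "poly_var r * (poly_var y * h) = subst1 r (1 - poly_var y - poly_var r) (poly_var y * ((1 - poly_var y - poly_var r) * h))"
      using W(3) fx by (simp add: algebra_simps)
  qed (use W h2 in auto)
  show "poly_var y * ((1 - poly_var y) * h) = subst1 r 0 (poly_var y * ((1 - poly_var y - poly_var r) * h))"
    using W(3) fx by auto
  show "open_class (insert y W) (poly_var y * ((1 - poly_var y) * h)) ((LL - 2) * c)"
    by (rule two_punctures[OF W(1,2,4) c])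
  show "poly_var y * ((1 - poly_var y - poly_var r) * h) \<in> polys (insert r (insert y W))" using h2 by simp
qed (use W in \<open>auto simp: algebra_simps\<close>)

text \<open>If the first diagonal entry \<open>p\<close> is invertible, elimination leaves the continuant with one row less and makes \<open>y\<close> a free
  coordinate. If it vanishes, \<open>y\<close> must be invertible, \<open>q\<close> and \<open>z\<close> are free, and two rows disappear.\<close>

lemma path_class:
  "distinct (map fst l @ map snd l) \<Longrightarrow>
    open_class (list_vars l) (continuant (var_list l) :: (nat, 'k::field) mpoly) (path_cls (length l))"
proof (induction l rule: induct_list012)
  case 1
  then show ?case using open_class_point by simp
next
  case (2 x)
  obtain p y where x: "x = (p, y)" by fastforce
  have "open_class {y} (1 :: (nat, 'k) mpoly) (LL * 1)"
    by (rule dropI(2)[of _ y "{}"]) (use open_class_point in auto)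
  then have "open_class {p, y} (poly_var p * 1 :: (nat, 'k) mpoly) (MM * LL)"
    by (rule dropI(1)[of _ p "{y}" _ "LL * 1", rotated 4]) (use 2 x in auto)
  then show ?case by (simp add: x)
next
  case (3 x x' l)
  obtain p y q z where x: "x = (p, y)" "x' = (q, z)" by fastforce
  let ?T = "list_vars l" and ?L = "var_list l :: ((nat, 'k) mpoly \<times> (nat, 'k) mpoly) list"
  let ?P = "poly_var p :: (nat, 'k) mpoly" and ?Y = "poly_var y :: (nat, 'k) mpoly"
    and ?Q = "poly_var q :: (nat, 'k) mpoly" and ?Z = "poly_var z :: (nat, 'k) mpoly"
  let ?V = "insert p (insert y (insert q (insert z ?T)))"
  have d: "p \<notin> insert y (insert q (insert z ?T))" "y \<notin> insert p (insert q (insert z ?T))"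
    "q \<notin> insert p (insert y (insert z ?T))" "z \<notin> insert p (insert y (insert q ?T))"
    using 3(3) by (auto simp: list_vars_def x)
  have ih1: "open_class (insert q (insert z ?T)) (continuant ((?Q, ?Z) # ?L)) (path_cls (Suc (length l)))"
    using 3(2,3) by (simp add: x)
  have ih0: "open_class ?T (continuant ?L) (path_cls (length l))" using 3(1,3) by (simp add: x)
  have a: "open_class (insert y (insert q (insert z ?T))) (- (?Y * (?Y * continuant ?L))) (MM * LL^2 * path_cls (length l))"
  proof (intro uminusI squareI)
    have "open_class (insert z ?T) (continuant ?L) (LL * path_cls (length l))"
      by (rule dropI(2)[of _ z ?T, OF _ _ _ _ ih0]) (use d in \<open>auto simp: subset_insertI2\<close>)
    then have "open_class (insert q (insert z ?T)) (continuant ?L) (LL * (LL * path_cls (length l)))"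
      by (rule dropI(2)[of _ q "insert z ?T", rotated 4]) (use d in \<open>auto simp: subset_insertI2\<close>)
    then show "open_class (insert y (insert q (insert z ?T))) (?Y * continuant ?L) (MM * LL^2 * path_cls (length l))"
      by (rule dropI(1)[of _ y "insert q (insert z ?T)", rotated 4]) (use d in \<open>auto simp: subset_insertI2 power2_eq_square mult_ac\<close>)
  qed (auto simp: subset_insertI2)
  have b: "open_class ?V (?P * continuant ((?P, ?Y) # (?Q, ?Z) # ?L)) (MM * LL * path_cls (Suc (length l)))"
  proof (rule scaleI[of _ y "insert p (insert q (insert z ?T))" _ _ "continuant ((?P, ?P * ?Y) # (?Q, ?Z) # ?L)"])
    show "open_class ?V (?P * continuant ((?P, ?P * ?Y) # (?Q, ?Z) # ?L)) (MM * LL * path_cls (Suc (length l)))"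
    proof (rule shiftI[of _ q "insert p (insert y (insert z ?T))" _ "?P * ?Y^2" "?P * (?P * continuant ((?Q, ?Z) # ?L))"])
      have "open_class (insert y (insert q (insert z ?T))) (continuant ((?Q, ?Z) # ?L)) (LL * path_cls (Suc (length l)))"
        by (rule dropI(2)[of _ y "insert q (insert z ?T)", OF _ _ _ _ ih1]) (use d in \<open>auto simp: subset_insertI2\<close>)
      then have "open_class ?V (?P * continuant ((?Q, ?Z) # ?L)) (MM * LL * path_cls (Suc (length l)))"
        by (rule dropI(1)[of _ p "insert y (insert q (insert z ?T))", rotated 4]) (use d in \<open>auto simp: subset_insertI2 mult_ac\<close>)
      then show "open_class ?V (?P * (?P * continuant ((?Q, ?Z) # ?L))) (MM * LL * path_cls (Suc (length l)))"
        by (intro squareI) (auto simp: subset_insertI2)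
      show "?P * (?P * continuant ((?Q, ?Z) # ?L)) = subst1 q (?Q + ?P * ?Y^2) (?P * continuant ((?P, ?P * ?Y) # (?Q, ?Z) # ?L))"
        using d by (simp add: continuant_first) (simp add: algebra_simps power2_eq_square)
    qed (use d in \<open>auto simp: subset_insertI2\<close>)
  qed (use d in \<open>auto simp: subset_insertI2\<close>)
  have "open_class ?V (continuant ((?P, ?Y) # (?Q, ?Z) # ?L))
      (MM * LL^2 * path_cls (length l) + MM * LL * path_cls (Suc (length l)))"
    by (rule scissorI[OF _ _ _ _ _ a b]) (use d in \<open>auto simp: subset_insertI2 power2_eq_square\<close>)
  then show ?case by (simp add: x add_ac)
qed

lemma border_class_base:
  assumes "distinct [r, w, p, y]"
  shows "open_class {w} (bordered_det 0 [] (poly_var w) :: (nat, 'k::field) mpoly) (zero_cls 0)"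
    and "open_class {r, w} (poly_var r * bordered_det (poly_var r) [] (poly_var w) :: (nat, 'k) mpoly) (unit_cls 0)"
    and "open_class {w, p, y} (bordered_det 0 [(poly_var p, poly_var y)] (poly_var w) :: (nat, 'k) mpoly) (zero_cls 1)"
    and "open_class {r, w, p, y} (poly_var r * bordered_det (poly_var r) [(poly_var p, poly_var y)] (poly_var w) :: (nat, 'k) mpoly) (unit_cls 1)"
proof -
  let ?P = "poly_var p :: (nat, 'k) mpoly" and ?Y = "poly_var y :: (nat, 'k) mpoly"
    and ?R = "poly_var r :: (nat, 'k) mpoly" and ?W = "poly_var w :: (nat, 'k) mpoly"
  have w: "open_class {w} (?W * 1) MM"
    by (rule dropI(1)[of _ w "{}" _ 1]) (use open_class_point in auto)
  then show "open_class {w} (bordered_det 0 [] ?W) (zero_cls 0)" by simp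
  have "open_class {r, w} (?R * (?W * 1)) (MM * MM)"
    by (rule dropI(1)[of _ r "{w}", OF _ _ _ _ w]) (use assms in auto)
  then show "open_class {r, w} (?R * bordered_det ?R [] ?W) (unit_cls 0)" by (simp add: power2_eq_square)
  have "open_class {w} (1 :: (nat, 'k) mpoly) (LL * 1)"
    by (rule dropI(2)[of _ w "{}"]) (use open_class_point in auto)
  then have "open_class {w, y} (?Y * 1) (MM * LL)"
    by (rule dropI(1)[of _ y "{w}" _ "LL * 1", rotated 4]) (use assms in auto)
  then have a: "open_class {w, y} (- (?Y * (?Y * 1))) (MM * LL)"
    by (intro uminusI squareI) auto
  have b: "open_class {w, p, y} (?P * bordered_det 0 [(?P, ?Y)] ?W) (MM * (LL * MM))"
  proof (rule scaleI[of _ y "{w, p}" _ _ "bordered_det 0 [(?P, ?P * ?Y)] ?W"])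
    show "open_class {w, p, y} (?P * bordered_det 0 [(?P, ?P * ?Y)] ?W) (MM * (LL * MM))"
    proof (rule shiftI[of _ w "{p, y}" _ "?P * ?Y^2" "?P * (?P * ?W)"])
      have "open_class {w, y} (?W * 1) (LL * MM)"
        by (rule dropI(2)[of _ y "{w}", OF _ _ _ _ w]) (use assms in auto)
      then have "open_class {w, p, y} (?P * (?W * 1)) (MM * (LL * MM))"
        by (rule dropI(1)[of _ p "{w, y}" _ "LL * MM", rotated 4]) (use assms in auto)
      then show "open_class {w, p, y} (?P * (?P * ?W)) (MM * (LL * MM))" by (intro squareI) auto
      show "?P * (?P * ?W) = subst1 w (?W + ?P * ?Y^2) (?P * bordered_det 0 [(?P, ?P * ?Y)] ?W)"
        using assms by (simp add: algebra_simps power2_eq_square)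
    qed (use assms in auto)
  qed (use assms in auto)
  have z: "open_class {w, p, y} (bordered_det 0 [(?P, ?Y)] ?W) (MM * LL + MM * (LL * MM))"
    by (rule scissorI[of _ p "{w, y}", OF _ _ _ _ _ a b]) (use assms in \<open>auto simp: power2_eq_square\<close>)
  then show z1: "open_class {w, p, y} (bordered_det 0 [(?P, ?Y)] ?W) (zero_cls 1)"
    by (simp add: algebra_simps power2_eq_square)
  show "open_class {r, w, p, y} (?R * bordered_det ?R [(?P, ?Y)] ?W) (unit_cls 1)"
  proof (rule shiftI[of _ y "{r, w, p}" _ "- ?R" "?R * bordered_det 0 [(?P, ?Y)] ?W"])
    show "open_class {r, w, p, y} (?R * bordered_det 0 [(?P, ?Y)] ?W) (unit_cls 1)"
      by (rule dropI(1)[of _ r "{w, p, y}", OF _ _ _ _ z1]) (use assms in \<open>auto simp: power2_eq_square mult_ac\<close>)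
  qed (use assms in auto)
qed

text \<open>For invertible \<open>p\<close> elimination leaves one row less and the border parameter \<open>p y (1 - r - y)\<close>, in rescaled coordinates.
  Over the locus where it vanishes, the smaller determinant has the class \<open>z1\<close>; elsewhere the parameter
  can replace \<open>p\<close> as a coordinate, which gives \<open>u1\<close>. The coefficient of \<open>u1\<close> is the class of the
  latter locus in the \<open>y\<close>-line if \<open>r = 0\<close>, and in the \<open>(r, y)\<close>-plane without \<open>r = 0\<close> otherwise; that of \<open>z1\<close> is
  the class of the former locus times \<open>MM\<close>, for the invertible coordinate \<open>p\<close>. For \<open>p = 0\<close> and invertible \<open>y\<close>
  two rows are eliminated; for \<open>p = y = 0\<close> the only entry in the first row is \<open>r\<close>, which leaves a continuant.\<close>

lemma border_class_step:
  fixes T :: "nat set" and L :: "((nat, 'k::field) mpoly \<times> (nat, 'k) mpoly) list"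
  assumes dist: "distinct [r, w, p, y, q, z]" and L: "L = var_list l" and T: "T = list_vars l"
    and fresh: "{r, w, p, y, q, z} \<inter> T = {}"
    and z0: "open_class (insert w T) (bordered_det 0 L (poly_var w)) z0"
    and u0: "open_class (insert z (insert w T)) (poly_var z * bordered_det (poly_var z) L (poly_var w)) u0"
    and z1: "open_class (insert w (insert q (insert z T))) (bordered_det 0 ((poly_var q, poly_var z) # L) (poly_var w)) z1"
    and u1: "open_class (insert p (insert w (insert q (insert z T)))) (poly_var p * bordered_det (poly_var p) ((poly_var q, poly_var z) # L) (poly_var w)) u1"
    and k1: "open_class (insert q (insert z T)) (continuant ((poly_var q, poly_var z) # L)) k1"
  shows "open_class (insert w (insert p (insert y (insert q (insert z T)))))
      (bordered_det 0 ((poly_var p, poly_var y) # (poly_var q, poly_var z) # L) (poly_var w)) (2 * MM * z1 + (LL - 2) * u1 + MM * LL^2 * z0)"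
    and "open_class (insert r (insert w (insert p (insert y (insert q (insert z T))))))
      (poly_var r * bordered_det (poly_var r) ((poly_var p, poly_var y) # (poly_var q, poly_var z) # L) (poly_var w))
      (MM * (2 * MM - 1) * z1 + (MM^2 - MM + 1) * u1 + MM^2 * LL * (z0 + u0) + MM * LL * k1)"
proof -
  let ?P = "poly_var p :: (nat, 'k) mpoly" and ?Y = "poly_var y :: (nat, 'k) mpoly" and ?Q = "poly_var q :: (nat, 'k) mpoly" and ?Z = "poly_var z :: (nat, 'k) mpoly" and ?W = "poly_var w :: (nat, 'k) mpoly" and ?R = "poly_var r :: (nat, 'k) mpoly"
  have fin: "finite T" by (simp add: T)
  have LP: "list_polys V L \<longleftrightarrow> T \<subseteq> V" for V by (simp add: L T)
  have SL: "sub_list (poly_var(x := e)) L = L" if "x \<notin> T" for x e using that by (simp add: L T)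
  have f: "r \<notin> T" "w \<notin> T" "p \<notin> T" "y \<notin> T" "q \<notin> T" "z \<notin> T" using fresh by auto
  have n: "r \<noteq> w" "r \<noteq> p" "r \<noteq> y" "r \<noteq> q" "r \<noteq> z" "w \<noteq> p" "w \<noteq> y" "w \<noteq> q" "w \<noteq> z" "p \<noteq> y" "p \<noteq> q" "p \<noteq> z"
    "y \<noteq> q" "y \<noteq> z" "q \<noteq> z" using dist by auto
  note n' = n n[symmetric]
  note S = LP SL f n' fin subset_insertI2[of T]
  let ?B = "insert w (insert q (insert z T))"
  define G where "G = (\<lambda>\<rho>. bordered_det \<rho> ((?Q, ?Z) # L) ?W)"
  have GP: "G \<rho> \<in> polys V" if "\<rho> \<in> polys V" "?B \<subseteq> V" for \<rho> V using that by (simp add: G_def S)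
  have GS: "subst1 x e (G \<rho>) = G (subst1 x e \<rho>)" if "x \<notin> ?B" for x e \<rho> using that by (auto simp: G_def S)
  have zG: "open_class ?B (G 0) z1" using z1 by (simp add: G_def)
  have uG: "open_class (insert p ?B) (?P * G ?P) u1" using u1 by (simp add: G_def)
  have PzG: "open_class (insert p ?B) (?P * G 0) (MM * z1)"
    using dropI(1)[of "insert p ?B" p ?B "G 0" z1] zG by (simp add: S GP)

  \<comment> \<open>The first diagonal entry is invertible.\<close>
  let ?V = "insert w (insert p (insert y (insert q (insert z T))))"
  have piv0: "open_class ?V (?P * bordered_det 0 ((?P, ?Y) # (?Q, ?Z) # L) ?W) (2 * MM * z1 + (LL - 2) * u1)"
  proof (rule scaleI[of _ y "insert w (insert p (insert q (insert z T)))" _ _ "bordered_det 0 ((?P, ?P * ?Y) # (?Q, ?Z) # L) ?W"])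
    show "open_class ?V (?P * bordered_det 0 ((?P, ?P * ?Y) # (?Q, ?Z) # L) ?W) (2 * MM * z1 + (LL - 2) * u1)"
    proof (rule shiftI[of _ q "insert w (insert p (insert y (insert z T)))" _ "?P * ?Y^2"
          "?P * bordered_det 0 ((?P, ?P * ?Y) # (?Q + ?P * ?Y^2, ?Z) # L) ?W"])
      show "open_class ?V (?P * bordered_det 0 ((?P, ?P * ?Y) # (?Q + ?P * ?Y^2, ?Z) # L) ?W) (2 * MM * z1 + (LL - 2) * u1)"
      proof (rule shiftI[of _ w "insert p (insert y (insert q (insert z T)))" _ "?P * ?Y^2"
            "?P * (?P * G (?P * ?Y * (1 - ?Y)))"])
        show "?P * (?P * G (?P * ?Y * (1 - ?Y))) = subst1 w (?W + ?P * ?Y^2)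
            (?P * bordered_det 0 ((?P, ?P * ?Y) # (?Q + ?P * ?Y^2, ?Z) # L) ?W)"
          using bordered_det_pivot[of ?P 0 ?Y ?Q ?Z L ?W] by (simp add: S G_def del: bordered_det.simps)
        have V: "?V = insert y (insert p ?B)" by auto
        show "open_class ?V (?P * (?P * G (?P * ?Y * (1 - ?Y)))) (2 * MM * z1 + (LL - 2) * u1)"
        proof (rule squareI)
          show "open_class ?V (?P * G (?P * ?Y * (1 - ?Y))) (2 * MM * z1 + (LL - 2) * u1)"
          proof (rule scissorI[OF V _ _ _ _ PzG])
            show "open_class ?V (poly_var y * (?P * G (?P * ?Y * (1 - ?Y)))) (MM * z1 + (LL - 2) * u1)"
            proof (rule reflectI[OF V _ _ _ _ refl, of _ 1])
              have e: "subst1 y (1 - poly_var y) (poly_var y * (?P * G (?P * ?Y * (1 - ?Y)))) = (1 - ?Y) * (?P * G (?P * ?Y * (1 - ?Y)))"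
                by (simp add: S GS mult_ac)
              show "open_class ?V (subst1 y (1 - poly_var y) (poly_var y * (?P * G (?P * ?Y * (1 - ?Y))))) (MM * z1 + (LL - 2) * u1)"
                unfolding e
              proof (rule scissorI[OF V _ _ _ _ PzG])
                have "open_class ?V ((?Y * (1 - ?Y)) * (?P * G ((?Y * (1 - ?Y)) * ?P))) ((LL - 2) * u1)"
                proof (rule unscaleI[of _ p "insert y ?B" "?P * G ?P"])
                  have "open_class ?V (?Y * ((1 - ?Y) * (?P * G ?P))) ((LL - 2) * u1)"
                    unfolding V by (rule two_punctures[OF _ _ _ uG]) (auto simp: S GP)
                  then show "open_class ?V ((?Y * (1 - ?Y)) * (?P * G ?P)) ((LL - 2) * u1)" by (simp add: mult_ac)
                qed (auto simp: S GP GS mult_ac)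
                then show "open_class ?V (poly_var y * ((1 - ?Y) * (?P * G (?P * ?Y * (1 - ?Y))))) ((LL - 2) * u1)"
                  by (simp add: S mult_ac)
              qed (auto simp: S GP GS)
            qed (auto simp: S GP)
          qed (auto simp: S GP GS algebra_simps)
        qed (auto simp: S GP)
      qed (auto simp: S)
    qed (auto simp: S)
  qed (auto simp: S)
  let ?VR = "insert r ?V"
  have piv1: "open_class ?VR (?P * (?R * bordered_det ?R ((?P, ?Y) # (?Q, ?Z) # L) ?W))
     (MM * (2 * MM - 1) * z1 + (MM^2 - MM + 1) * u1)" (is "open_class _ _ ?f")
  proof (rule scaleI[of _ r ?V _ _ "(?P * ?R) * bordered_det (?P * ?R) ((?P, ?Y) # (?Q, ?Z) # L) ?W"])
    have "open_class ?VR (?P * (?P * (?R * bordered_det (?P * ?R) ((?P, ?Y) # (?Q, ?Z) # L) ?W))) ?f"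
    proof (rule squareI)
      show "open_class ?VR (?P * (?R * bordered_det (?P * ?R) ((?P, ?Y) # (?Q, ?Z) # L) ?W)) ?f"
      proof (rule scaleI[of _ y "insert r (insert w (insert p (insert q (insert z T))))" _ _
            "?R * bordered_det (?P * ?R) ((?P, ?P * ?Y) # (?Q, ?Z) # L) ?W"])
        show "open_class ?VR (?P * (?R * bordered_det (?P * ?R) ((?P, ?P * ?Y) # (?Q, ?Z) # L) ?W)) ?f"
        proof (rule shiftI[of _ q "insert r (insert w (insert p (insert y (insert z T))))" _ "?P * ?Y^2"
              "?P * (?R * bordered_det (?P * ?R) ((?P, ?P * ?Y) # (?Q + ?P * ?Y^2, ?Z) # L) ?W)"])
          show "open_class ?VR (?P * (?R * bordered_det (?P * ?R) ((?P, ?P * ?Y) # (?Q + ?P * ?Y^2, ?Z) # L) ?W)) ?f"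
          proof (rule shiftI[of _ w "insert r (insert p (insert y (insert q (insert z T))))" _ "?P * (?Y + ?R)^2"
                "?P * (?P * (?R * G (?P * ?Y * (1 - ?R - ?Y))))"])
            show "?P * (?P * (?R * G (?P * ?Y * (1 - ?R - ?Y)))) = subst1 w (poly_var w + ?P * (?Y + ?R)^2)
                (?P * (?R * bordered_det (?P * ?R) ((?P, ?P * ?Y) # (?Q + ?P * ?Y^2, ?Z) # L) ?W))"
              using bordered_det_pivot[of ?P ?R ?Y ?Q ?Z L ?W] by (simp add: S G_def mult_ac del: bordered_det.simps)
            have Vy: "?VR = insert y (insert r (insert p ?B))" and Vr: "?VR = insert r (insert y (insert p ?B))" by auto
            have Vp: "?VR = insert p (insert r (insert y ?B))" by auto
            show "open_class ?VR (?P * (?P * (?R * G (?P * ?Y * (1 - ?R - ?Y))))) ?f"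
            proof (rule squareI)
              have "open_class (insert r (insert p ?B)) (poly_var r * (?P * G 0)) (MM * (MM * z1))"
                by (rule dropI(1)[OF refl _ _ _ PzG]) (auto simp: S GP)
              then have y0: "open_class (insert r (insert p ?B)) (?P * (?R * G 0)) (MM * (MM * z1))"
                by (simp add: S mult_ac)
              show "open_class ?VR (?P * (?R * G (?P * ?Y * (1 - ?R - ?Y)))) ?f"
              proof (rule scissorI[OF Vy _ _ _ _ y0])
                show "open_class ?VR (poly_var y * (?P * (?R * G (?P * ?Y * (1 - ?R - ?Y)))))
                    ((LL - 2) * (MM * z1) + (MM^2 - MM + 1) * u1)"
                proof (rule reflectI[OF Vr _ _ _ _ refl, of _ "1 - ?Y"])
                  have e: "subst1 r (1 - ?Y - poly_var r) (poly_var y * (?P * (?R * G (?P * ?Y * (1 - ?R - ?Y)))))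
                      = ?Y * ((1 - ?Y - ?R) * (?P * G (?R * ?Y * ?P)))"
                    by (simp add: S GS algebra_simps)
                  have r0: "open_class (insert y (insert p ?B)) (?Y * ((1 - ?Y) * (?P * G 0))) ((LL - 2) * (MM * z1))"
                    by (rule two_punctures[OF _ _ _ PzG]) (auto simp: S GP)
                  show "open_class ?VR (subst1 r (1 - ?Y - poly_var r) (poly_var y * (?P * (?R * G (?P * ?Y * (1 - ?R - ?Y))))))
                      ((LL - 2) * (MM * z1) + (MM^2 - MM + 1) * u1)"
                    unfolding e
                  proof (rule scissorI[OF Vr _ _ _ _ r0])
                    have "open_class ?VR ((?R * ?Y) * ((1 - ?Y - ?R) * (?P * G (?R * ?Y * ?P)))) ((MM^2 - MM + 1) * u1)"
                    proof (rule unscaleI[OF Vp, of "(1 - ?Y - ?R) * (?P * G ?P)"])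
                      have "open_class ?VR (?R * (?Y * ((1 - ?Y - ?R) * (?P * G ?P)))) ((MM^2 - MM + 1) * u1)"
                        unfolding Vr by (rule three_lines[OF _ _ _ _ uG]) (auto simp: S GP)
                      then show "open_class ?VR ((?R * ?Y) * ((1 - ?Y - ?R) * (?P * G ?P))) ((MM^2 - MM + 1) * u1)"
                        by (simp add: mult_ac)
                    qed (auto simp: S GP GS mult_ac)
                    then show "open_class ?VR (poly_var r * (?Y * ((1 - ?Y - ?R) * (?P * G (?R * ?Y * ?P))))) ((MM^2 - MM + 1) * u1)"
                      by (simp add: S mult_ac)
                  qed (auto simp: S GP GS)
                qed (auto simp: S GP)
              qed (auto simp: S GP GS algebra_simps power2_eq_square)
            qed (auto simp: S GP)
          qed (auto simp: S)
        qed (auto simp: S)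
      qed (auto simp: S)
    qed (auto simp: S)
    then show "open_class ?VR (?P * ((?P * ?R) * bordered_det (?P * ?R) ((?P, ?Y) # (?Q, ?Z) # L) ?W)) ?f"
      by (simp add: mult_ac)
  qed (auto simp: S)

  \<comment> \<open>The first diagonal entry vanishes.\<close>
  let ?U = "insert w (insert y (insert q (insert z T)))"
  have V0y: "?U = insert y ?B" by auto
  have zf: "open_class (insert q (insert z (insert w T))) (bordered_det 0 L ?W) (LL * (LL * z0))"
    by (rule dropI(2)[OF refl _ _ _ dropI(2)[OF refl _ _ _ z0 refl] refl]) (auto simp: S)
  have np0: "open_class ?U (bordered_det 0 ((0, ?Y) # (?Q, ?Z) # L) ?W) (MM * LL^2 * z0)"
  proof (rule scissorI[OF V0y _ _ _ _ open_class_zero])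
    show "open_class ?U (poly_var y * bordered_det 0 ((0, ?Y) # (?Q, ?Z) # L) ?W) (MM * LL^2 * z0)"
    proof (rule shiftI[of _ w "insert y (insert q (insert z T))" _ "- ?Q + 2 * (?Y + ?Z)"
          "- (?Y * (?Y * (?Y * bordered_det 0 L ?W)))"])
      show "- (?Y * (?Y * (?Y * bordered_det 0 L ?W))) = subst1 w (poly_var w + (- ?Q + 2 * (?Y + ?Z)))
          (poly_var y * bordered_det 0 ((0, ?Y) # (?Q, ?Z) # L) ?W)"
        using bordered_det_zero_pivot[of ?Y 0 ?Q ?Z L ?W] by (simp add: S algebra_simps del: bordered_det.simps)
      have V: "?U = insert y (insert q (insert z (insert w T)))" by auto
      have "open_class ?U (poly_var y * bordered_det 0 L ?W) (MM * (LL * (LL * z0)))"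
        by (rule dropI(1)[OF V _ _ _ zf refl]) (auto simp: S)
      then have "open_class ?U (?Y * bordered_det 0 L ?W) (MM * LL^2 * z0)" by (simp add: S mult_ac power2_eq_square)
      then show "open_class ?U (- (?Y * (?Y * (?Y * bordered_det 0 L ?W)))) (MM * LL^2 * z0)"
        by (intro uminusI squareI) (auto simp: S)
    qed (auto simp: S)
  qed (auto simp: S bordered_det_zero_row simp del: bordered_det.simps)
  show "open_class ?V (bordered_det 0 ((?P, ?Y) # (?Q, ?Z) # L) ?W) (2 * MM * z1 + (LL - 2) * u1 + MM * LL^2 * z0)"
    by (rule scissorI[of _ p ?U, OF _ _ _ _ _ np0 piv0])
      (auto simp: S)
  let ?UR = "insert r ?U"
  have np1: "open_class ?UR (?R * bordered_det ?R ((0, ?Y) # (?Q, ?Z) # L) ?W) (MM^2 * LL * (z0 + u0) + MM * LL * k1)"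
  proof (rule scissorI[of _ y "insert r ?B" _ "- (?R * (?R * (?R * continuant ((?Q, ?Z) # L))))" "MM * LL * k1" "MM^2 * LL * (z0 + u0)"])
    have "open_class ?B (continuant ((?Q, ?Z) # L)) (LL * k1)"
      by (rule dropI(2)[OF refl _ _ _ k1 refl]) (auto simp: S)
    then have "open_class (insert r ?B) (poly_var r * continuant ((?Q, ?Z) # L)) (MM * (LL * k1))"
      by (rule dropI(1)[OF refl _ _ _ _ refl, rotated 3]) (auto simp: S)
    then have "open_class (insert r ?B) (?R * continuant ((?Q, ?Z) # L)) (MM * LL * k1)" by (simp add: S mult_ac)
    then show "open_class (insert r ?B) (- (?R * (?R * (?R * continuant ((?Q, ?Z) # L))))) (MM * LL * k1)"
      by (intro uminusI squareI) (auto simp: S)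
    have G2: "open_class (insert z (insert w T)) (bordered_det ?Z L ?W) (z0 + u0)"
      by (rule scissorI[OF refl _ _ _ _ z0 u0]) (auto simp: S)
    have "open_class (insert r (insert z (insert w T))) (poly_var r * bordered_det ?Z L ?W) (MM * (z0 + u0))"
      by (rule dropI(1)[OF refl _ _ _ G2 refl]) (auto simp: S)
    then have "open_class (insert r (insert z (insert w T))) (- (?R * bordered_det ?Z L ?W)) (MM * (z0 + u0))"
      by (intro uminusI) (auto simp: S)
    then have "open_class (insert r (insert z (insert w T))) ((- ?R) * bordered_det (- ?R * ?Z) L ?W) (MM * (z0 + u0))"
      using open_class_subst[of "insert r (insert w T)" z "bordered_det ?Z L ?W" "- ?R" 0 "MM * (z0 + u0)"]
      by (simp add: S insert_commute)
    then have "open_class (insert r (insert z (insert w T))) (- ((- ?R) * bordered_det (- ?R * ?Z) L ?W)) (MM * (z0 + u0))"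
      by (intro uminusI) (auto simp: S)
    then have "open_class (insert r (insert z (insert w T))) (?R * bordered_det (- (?Z * ?R)) L ?W) (MM * (z0 + u0))"
      by (simp add: mult_ac)
    then have "open_class (insert q (insert r (insert z (insert w T)))) (?R * bordered_det (- (?Z * ?R)) L ?W) (LL * (MM * (z0 + u0)))"
      by (rule dropI(2)[OF refl _ _ _ _ refl, rotated 3]) (auto simp: S)
    then have "open_class (insert y (insert q (insert r (insert z (insert w T))))) (poly_var y * (?R * bordered_det (- (?Z * ?R)) L ?W))
        (MM * (LL * (MM * (z0 + u0))))"
      by (rule dropI(1)[OF refl _ _ _ _ refl, rotated 3]) (auto simp: S)
    moreover have "insert y (insert q (insert r (insert z (insert w T)))) = ?UR" by auto
    ultimately have e: "open_class ?UR (?Y * (?R * bordered_det (- (?Z * ?R)) L ?W)) (MM^2 * LL * (z0 + u0))"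
      by (simp add: S mult_ac power2_eq_square)
    show "open_class ?UR (poly_var y * (?R * bordered_det ?R ((0, ?Y) # (?Q, ?Z) # L) ?W)) (MM^2 * LL * (z0 + u0))"
    proof (rule scaleI[of _ r ?U _ _ "(?Y * ?R) * bordered_det (?Y * ?R) ((0, ?Y) # (?Q, ?Z) # L) ?W"])
      show "open_class ?UR (poly_var y * ((?Y * ?R) * bordered_det (?Y * ?R) ((0, ?Y) # (?Q, ?Z) # L) ?W)) (MM^2 * LL * (z0 + u0))"
      proof (rule shiftI[of _ w "insert r (insert y (insert q (insert z T)))" _ "- ?Q * (1 + ?R)^2 + 2 * (1 + ?R) * (?Y + ?Z)"
            "- (?Y * (?Y * (?Y * (?Y * (?R * bordered_det (- (?Z * ?R)) L ?W)))))"])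
        show "- (?Y * (?Y * (?Y * (?Y * (?R * bordered_det (- (?Z * ?R)) L ?W)))))
           = subst1 w (poly_var w + (- ?Q * (1 + ?R)^2 + 2 * (1 + ?R) * (?Y + ?Z)))
             (poly_var y * ((?Y * ?R) * bordered_det (?Y * ?R) ((0, ?Y) # (?Q, ?Z) # L) ?W))"
        proof -
          have k: "bordered_det (?Y * ?R) ((0, ?Y) # (?Q, ?Z) # L) (?W + (- ?Q * (1 + ?R)^2 + 2 * (1 + ?R) * (?Y + ?Z)))
              = - (?Y * (?Y * bordered_det (- (?Z * ?R)) L ?W))"
            using bordered_det_zero_pivot[of ?Y ?R ?Q ?Z L ?W] by (simp only: add.assoc diff_conv_add_uminus mult_minus_left)
          have "subst1 w (poly_var w + (- ?Q * (1 + ?R)^2 + 2 * (1 + ?R) * (?Y + ?Z)))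
              (poly_var y * ((?Y * ?R) * bordered_det (?Y * ?R) ((0, ?Y) # (?Q, ?Z) # L) ?W))
            = ?Y * ((?Y * ?R) * bordered_det (?Y * ?R) ((0, ?Y) # (?Q, ?Z) # L) (?W + (- ?Q * (1 + ?R)^2 + 2 * (1 + ?R) * (?Y + ?Z))))"
            by (simp add: S del: bordered_det.simps)
          then show ?thesis unfolding k by (simp add: mult_ac)
        qed
        show "open_class ?UR (- (?Y * (?Y * (?Y * (?Y * (?R * bordered_det (- (?Z * ?R)) L ?W)))))) (MM^2 * LL * (z0 + u0))"
          using e by (intro uminusI squareI) (auto simp: S)
      qed (auto simp: S)
    qed (auto simp: S)
  qed (auto simp: S bordered_det_zero_row simp del: bordered_det.simps)
  show "open_class (insert r ?V) (?R * bordered_det ?R ((?P, ?Y) # (?Q, ?Z) # L) ?W)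
      (MM * (2 * MM - 1) * z1 + (MM^2 - MM + 1) * u1 + MM^2 * LL * (z0 + u0) + MM * LL * k1)"
    by (rule scissorI[of _ p ?UR, OF _ _ _ _ _ np1 piv1]) (auto simp: S)
qed

lemma border_class:
  assumes "distinct (r # w # map fst l @ map snd l)"
  shows "open_class (insert w (list_vars l)) (bordered_det 0 (var_list l) (poly_var w) :: (nat, 'k::field) mpoly) (zero_cls (length l))"
    and "open_class (insert r (insert w (list_vars l)))
      (poly_var r * bordered_det (poly_var r) (var_list l) (poly_var w) :: (nat, 'k) mpoly) (unit_cls (length l))"
proof -
  have "open_class (insert w (list_vars l)) (bordered_det 0 (var_list l) (poly_var w) :: (nat, 'k) mpoly) (zero_cls (length l))
    \<and> open_class (insert r (insert w (list_vars l)))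
      (poly_var r * bordered_det (poly_var r) (var_list l) (poly_var w) :: (nat, 'k) mpoly) (unit_cls (length l))"
    using assms
  proof (induction l arbitrary: r w rule: induct_list012)
    case 1
    obtain p where "p \<notin> {r, w}" using ex_fresh[of "{r, w}"] by auto
    moreover obtain y where "y \<notin> {r, w, p}" using ex_fresh[of "{r, w, p}"] by auto
    ultimately have "distinct [r, w, p, y]" using 1 by auto
    from border_class_base(1,2)[OF this] show ?case by simp
  next
    case (2 x)
    obtain p y where x: "x = (p, y)" by fastforce
    have "distinct [r, w, p, y]" using 2 x by auto
    from border_class_base(3,4)[OF this] show ?case by (simp add: x)
  next
    case (3 x x' l)
    obtain p y q z where x: "x = (p, y)" "x' = (q, z)" by fastforce
    have d: "distinct [r, w, p, y, q, z]" "{r, w, p, y, q, z} \<inter> list_vars l = {}"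
      "distinct (map fst l @ map snd l)"
      using 3(3) by (auto simp: x list_vars_def)
    have dz: "distinct (z # w # map fst l @ map snd l)"
      and dp: "distinct (p # w # map fst (x' # l) @ map snd (x' # l))"
      and dq: "distinct (map fst (x' # l) @ map snd (x' # l))"
      using 3(3) by (auto simp: x)
    note step = border_class_step[OF d(1) refl refl d(2) conjunct1[OF 3(1)[OF dz]] conjunct2[OF 3(1)[OF dz]]
      conjunct1[OF 3(2)[OF dp], unfolded x var_list_simps list_vars_simps]
      conjunct2[OF 3(2)[OF dp], unfolded x var_list_simps list_vars_simps]
      path_class[OF dq, unfolded x var_list_simps list_vars_simps]]
    from step show ?case by (simp add: x)
  qed
  then show "open_class (insert w (list_vars l)) (bordered_det 0 (var_list l) (poly_var w) :: (nat, 'k) mpoly) (zero_cls (length l))"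
    and "open_class (insert r (insert w (list_vars l)))
      (poly_var r * bordered_det (poly_var r) (var_list l) (poly_var w) :: (nat, 'k) mpoly) (unit_cls (length l))"
    by auto
qed

lemma bordered_class:
  assumes "distinct (r # w # map fst l @ map snd l)"
  shows "open_class (insert r (insert w (list_vars l))) (bordered_det (poly_var r) (var_list l) (poly_var w) :: (nat, 'k::field) mpoly)
    (zero_cls (length l) + unit_cls (length l))"
proof (rule scissorI[OF refl _ _ _ _ border_class[OF assms]])
  show r: "r \<notin> insert w (list_vars l)" using assms by (auto simp: list_vars_def)
  then show "bordered_det 0 (var_list l) (poly_var w) = subst1 r 0 (bordered_det (poly_var r) (var_list l) (poly_var w) :: (nat, 'k) mpoly)"
    by simp
  show "bordered_det (poly_var r) (var_list l) (poly_var w) \<in> polys (insert r (insert w (list_vars l)))"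
    by (intro polys_bordered_det) auto
qed auto

section \<open>Deletion and contraction\<close>

text \<open>A contraction of a graph is encoded by the map \<open>\<phi>\<close> that sends each vertex to the one it is merged into, while the edges
  keep their names; so the indeterminates do not change, and parallel edges and loops may arise.\<close>

definition adj :: "('v \<Rightarrow> 'v) \<Rightarrow> 'v set set \<Rightarrow> 'v \<Rightarrow> 'v \<Rightarrow> bool" where
  "adj \<phi> T u v \<longleftrightarrow> (\<exists>a b. {a, b} \<in> T \<and> u = \<phi> a \<and> v = \<phi> b)"

definition conn :: "('v \<Rightarrow> 'v) \<Rightarrow> 'v set \<Rightarrow> 'v set set \<Rightarrow> bool" where
  "conn \<phi> U T \<longleftrightarrow> U \<noteq> {} \<and> (\<forall>u\<in>U. \<forall>v\<in>U. (adj \<phi> T)\<^sup>*\<^sup>* u v)"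

text \<open>For contracted graphs minimality is easier to handle than the absence of cycles, which would have to account
  for loops and parallel edges.\<close>

definition min_conn :: "('v \<Rightarrow> 'v) \<Rightarrow> 'v set \<Rightarrow> 'v set set \<Rightarrow> bool" where
  "min_conn \<phi> U T \<longleftrightarrow> conn \<phi> U T \<and> (\<forall>e\<in>T. \<not> conn \<phi> U (T - {e}))"

definition tree_sum :: "('v \<Rightarrow> 'v) \<Rightarrow> 'v set \<Rightarrow> 'v set set \<Rightarrow> ('v set, 'k::field) mpoly" where
  "tree_sum \<phi> U E = (\<Sum>T | T \<subseteq> E \<and> min_conn \<phi> U T. \<Prod>e\<in>E - T. poly_var e)"

lemma adj_sym: "adj \<phi> T u v \<Longrightarrow> adj \<phi> T v u"
  unfolding adj_def by (metis insert_commute)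

lemma adj_edge: "{a, b} \<in> T \<Longrightarrow> adj \<phi> T (\<phi> a) (\<phi> b)"
  by (auto simp: adj_def)

lemma reach_sym: "(adj \<phi> T)\<^sup>*\<^sup>* u v \<Longrightarrow> (adj \<phi> T)\<^sup>*\<^sup>* v u"
  by (metis adj_sym sympI symp_rtranclp sympD)

lemma reach_simulate:
  assumes "\<And>u v. R u v \<Longrightarrow> S\<^sup>*\<^sup>* (g u) (g v)" "R\<^sup>*\<^sup>* u v"
  shows "S\<^sup>*\<^sup>* (g u) (g v)"
  using assms(2) by (induction rule: rtranclp_induct) (auto intro: rtranclp_trans assms(1))

lemma conn_simulate:
  assumes "conn \<phi> U T" "\<And>a b. {a, b} \<in> T \<Longrightarrow> (adj \<phi> S)\<^sup>*\<^sup>* (\<phi> a) (\<phi> b)"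
  shows "conn \<phi> U S"
proof -
  have "(adj \<phi> S)\<^sup>*\<^sup>* u v" if "adj \<phi> T u v" for u v using that assms(2) by (auto simp: adj_def)
  then show ?thesis using assms(1) reach_simulate[of "adj \<phi> T" "adj \<phi> S" "\<lambda>x. x"] unfolding conn_def by blast
qed

lemma distinct_path:
  assumes "R\<^sup>*\<^sup>* u v"
  shows "\<exists>c. distinct c \<and> c \<noteq> [] \<and> hd c = u \<and> last c = v \<and> (\<forall>i. Suc i < length c \<longrightarrow> R (c ! i) (c ! Suc i))"
  using assms
proof (induction rule: rtranclp_induct)
  case base
  show ?case by (rule exI[of _ "[u]"]) simp
next
  case (step y z)
  obtain c where c: "distinct c" "c \<noteq> []" "hd c = u" "last c = y"
    and R: "\<And>i. Suc i < length c \<Longrightarrow> R (c ! i) (c ! Suc i)"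
    using step.IH by blast
  show ?case
  proof (cases "z \<in> set c")
    case True
    then obtain k where k: "k < length c" "c ! k = z" by (auto simp: in_set_conv_nth)
    have "last (take (Suc k) c) = z" using k by (simp add: take_Suc_conv_app_nth)
    moreover have "hd (take (Suc k) c) = u" using c(2,3) by (cases c) auto
    ultimately show ?thesis
      using c k R by (intro exI[of _ "take (Suc k) c"]) auto
  next
    case False
    have "R ((c @ [z]) ! i) ((c @ [z]) ! Suc i)" if "Suc i < length (c @ [z])" for i
    proof (cases "Suc i < length c")
      case True
      then show ?thesis using R by (simp add: nth_append)
    next
      case False
      then have "i = length c - 1" "i < length c" using that c(2) by auto
      then show ?thesis using step(2) c(2,4) by (simp add: nth_append last_conv_nth)
    qed
    then show ?thesis using c False by (intro exI[of _ "c @ [z]"]) auto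
  qed
qed

text \<open>A connecting set of edges is a tree iff none of its edges can be left out: an edge whose end
  points remain connected closes a cycle, and conversely any edge of a cycle can be left out.\<close>

lemma spanning_trees_min_conn:
  assumes "\<And>e. e \<in> E \<Longrightarrow> e \<subseteq> V \<and> card e = 2"
  shows "spanning_trees (V, E) = {T. T \<subseteq> E \<and> min_conn (\<lambda>v. v) V T}"
proof -
  have adj_id: "adj (\<lambda>v. v) T = (\<lambda>u v. {u, v} \<in> T)" for T :: "'a set set"
    by (intro ext) (auto simp: adj_def)
  have conn_id: "graph_connected V T \<longleftrightarrow> conn (\<lambda>v. v) V T" for T
    by (auto simp: graph_connected_def conn_def adj_id)
  have "graph_acyclic T \<longleftrightarrow> (\<forall>e\<in>T. \<not> conn (\<lambda>v. v) V (T - {e}))" if T: "T \<subseteq> E" "conn (\<lambda>v. v) V T" for T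
  proof
    assume ac: "graph_acyclic T"
    show "\<forall>e\<in>T. \<not> conn (\<lambda>v. v) V (T - {e})"
    proof (intro ballI notI)
      fix e assume e: "e \<in> T" and c: "conn (\<lambda>v. v) V (T - {e})"
      obtain a b where ab: "e = {a, b}" "a \<noteq> b" using assms e T(1) by (metis card_2_iff subsetD)
      have "a \<in> V" "b \<in> V" using assms[of e] e T(1) ab by auto
      then have ne: "(adj (\<lambda>v. v) (T - {e}))\<^sup>*\<^sup>* a b" using c by (auto simp: conn_def)
        obtain p where p: "distinct p" "p \<noteq> []" "hd p = a" "last p = b"
          and R: "\<And>i. Suc i < length p \<Longrightarrow> {p ! i, p ! Suc i} \<in> T - {e}"
          using distinct_path[OF ne] unfolding adj_id by blast
        have l3: "3 \<le> length p"
        proof (rule ccontr)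
          assume "\<not> 3 \<le> length p"
          then consider "length p = 1" | "length p = 2" using p(2) by (cases p) (auto simp: not_le less_Suc_eq numeral_3_eq_3)
          then show False
          proof cases
            case 1
            then show ?thesis using p(3,4) ab(2) by (auto simp: length_Suc_conv)
          next
            case 2
            then show ?thesis using p(3,4) R[of 0] ab(1) by (auto simp: length_Suc_conv numeral_2_eq_2)
          qed
        qed
        have "{p ! i, p ! (Suc i mod length p)} \<in> T" if "i < length p" for i
        proof (cases "Suc i < length p")
          case True
          then show ?thesis using R by auto
        next
          case False
          then have "i = length p - 1" "Suc i = length p" using that by auto
          then have "{p ! i, p ! (Suc i mod length p)} = {b, a}"
            using p(2,3,4) by (simp add: last_conv_nth hd_conv_nth)
          then show ?thesis using e ab(1) by (simp add: insert_commute)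
        qed
        then show False using ac p(1) l3 unfolding graph_acyclic_def by blast
    qed
  next
    assume m: "\<forall>e\<in>T. \<not> conn (\<lambda>v. v) V (T - {e})"
    show "graph_acyclic T"
      unfolding graph_acyclic_def
    proof (intro notI, elim exE conjE)
      fix c assume c: "3 \<le> length c" "distinct c" and ed: "\<forall>i<length c. {c ! i, c ! (Suc i mod length c)} \<in> T"
      define n where "n = length c"
      let ?S = "T - {{c ! 0, c ! 1}}"
      have "c \<noteq> []" "Suc 0 mod length c = 1" using c(1) by auto
      then have e: "{c ! 0, c ! 1} \<in> T" using ed[rule_format, of 0] by simp
      have st: "adj (\<lambda>v. v) ?S (c ! i) (c ! (Suc i mod n))" if "1 \<le> i" "i < n" for i
      proof -
        have l: "0 < length c" "1 < length c" "2 < length c" using c(1) by linarith+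
        then have "c ! i \<noteq> c ! 0" using nth_eq_iff_index_eq[OF c(2), of i 0] that n_def by simp
        moreover have "c ! i = c ! 1 \<Longrightarrow> c ! (Suc i mod n) \<noteq> c ! 0"
        proof -
          assume "c ! i = c ! 1"
          then have "i = 1" using nth_eq_iff_index_eq[OF c(2), of i 1] that l n_def by simp
          then have "Suc i mod n = 2" using l n_def by simp
          then show "c ! (Suc i mod n) \<noteq> c ! 0" using nth_eq_iff_index_eq[OF c(2), of 2 0] l by simp
        qed
        ultimately show ?thesis using ed that by (auto simp: adj_id n_def doubleton_eq_iff)
      qed
      have "(adj (\<lambda>v. v) ?S)\<^sup>*\<^sup>* (c ! 1) (c ! i)" if "1 \<le> i" "i < n" for i
        using that
      proof (induction i)
        case (Suc i)
        show ?case
        proof (cases "i = 0")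
          case False
          then have "(adj (\<lambda>v. v) ?S)\<^sup>*\<^sup>* (c ! 1) (c ! i)" using Suc by simp
          moreover have "adj (\<lambda>v. v) ?S (c ! i) (c ! Suc i)" using st[of i] False Suc(3) by simp
          ultimately show ?thesis by simp
        qed simp
      qed simp
      from this[of "n - 1"] have "(adj (\<lambda>v. v) ?S)\<^sup>*\<^sup>* (c ! 1) (c ! (n - 1))" using c(1) by (simp add: n_def)
      moreover have "adj (\<lambda>v. v) ?S (c ! (n - 1)) (c ! 0)"
      proof -
        have n: "1 \<le> n - 1" "n - 1 < n" "Suc (n - 1) = n" using c(1) by (auto simp: n_def)
        show ?thesis using st[OF n(1,2)] unfolding n(3) by simp
      qed
      ultimately have r: "(adj (\<lambda>v. v) ?S)\<^sup>*\<^sup>* (c ! 1) (c ! 0)" by simp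
      have "conn (\<lambda>v. v) V ?S"
      proof (rule conn_simulate[OF T(2)])
        fix a b assume ab: "{a, b} \<in> T"
        show "(adj (\<lambda>v. v) ?S)\<^sup>*\<^sup>* a b"
        proof (cases "{a, b} = {c ! 0, c ! 1}")
          case True
          then show ?thesis using r reach_sym[OF r] by (auto simp: doubleton_eq_iff)
        next
          case False
          then show ?thesis using ab by (auto simp: adj_id)
        qed
      qed
      then show False using m e by blast
    qed
  qed
  then show ?thesis by (auto simp: spanning_trees_def min_conn_def conn_id)
qed

text \<open>A walk from \<open>x\<close> to \<open>y\<close> leaves \<open>x\<close> for the last time through some edge; that edge can be
  exchanged for a new edge between \<open>x\<close> and \<open>y\<close>.\<close>

lemma last_departure:
  assumes "R\<^sup>*\<^sup>* x y"
  shows "y = x \<or> (\<exists>z. R x z \<and> z \<noteq> x \<and> (\<lambda>u v. R u v \<and> u \<noteq> x \<and> v \<noteq> x)\<^sup>*\<^sup>* z y)"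
  using assms
proof (induction rule: rtranclp_induct)
  case (step y z)
  show ?case
  proof (cases "z = x \<or> y = x")
    case True
    then show ?thesis using step(2) by auto
  next
    case False
    then obtain t where t: "R x t" "t \<noteq> x" "(\<lambda>u v. R u v \<and> u \<noteq> x \<and> v \<noteq> x)\<^sup>*\<^sup>* t y" using step(3) by blast
    have "(\<lambda>u v. R u v \<and> u \<noteq> x \<and> v \<noteq> x)\<^sup>*\<^sup>* t z"
      by (rule rtranclp.rtrancl_into_rtrancl[OF t(3)]) (use step(2) False in simp)
    then show ?thesis using t by blast
  qed
qed simp

lemma edge_exchange:
  assumes c: "conn \<phi> U T" and xy: "\<phi> a \<in> U" "\<phi> b \<in> U" "\<phi> a \<noteq> \<phi> b"
  shows "\<exists>f\<in>T. conn \<phi> U (insert {a, b} (T - {f}))"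
proof -
  have "(adj \<phi> T)\<^sup>*\<^sup>* (\<phi> a) (\<phi> b)" using c xy by (auto simp: conn_def)
  from last_departure[OF this] xy obtain z where z: "adj \<phi> T (\<phi> a) z" "z \<noteq> \<phi> a"
    and w: "(\<lambda>u v. adj \<phi> T u v \<and> u \<noteq> \<phi> a \<and> v \<noteq> \<phi> a)\<^sup>*\<^sup>* z (\<phi> b)" by auto
  obtain p q where pq: "{p, q} \<in> T" "\<phi> a = \<phi> p" "z = \<phi> q" using z(1) by (auto simp: adj_def)
  let ?S = "insert {a, b} (T - {{p, q}})"
  have "(adj \<phi> ?S)\<^sup>*\<^sup>* z (\<phi> b)"
  proof (rule mono_rtranclp[rule_format, OF _ w])
    fix u v assume "adj \<phi> T u v \<and> u \<noteq> \<phi> a \<and> v \<noteq> \<phi> a"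
    then show "adj \<phi> ?S u v" using pq(2) unfolding adj_def by (metis DiffI insertCI doubleton_eq_iff singletonD)
  qed
  moreover have "adj \<phi> ?S (\<phi> b) (\<phi> a)" using adj_edge[of b a ?S \<phi>] by (simp add: insert_commute)
  ultimately have r: "(adj \<phi> ?S)\<^sup>*\<^sup>* (\<phi> q) (\<phi> p)" using pq by simp
  have "conn \<phi> U ?S"
  proof (rule conn_simulate[OF c])
    fix s t assume st: "{s, t} \<in> T"
    show "(adj \<phi> ?S)\<^sup>*\<^sup>* (\<phi> s) (\<phi> t)"
    proof (cases "{s, t} = {p, q}")
      case True
      then show ?thesis using r reach_sym[OF r] by (auto simp: doubleton_eq_iff)
    next
      case False
      then show ?thesis using st adj_edge[of s t ?S \<phi>] by auto
    qed
  qed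
  then show ?thesis using pq(1) by blast
qed

lemma conn_contract:
  assumes xy: "\<phi> a \<in> U" "\<phi> b \<in> U" "\<phi> a \<noteq> \<phi> b"
  shows "conn \<phi> U (insert {a, b} T) \<longleftrightarrow> conn (\<lambda>v. if \<phi> v = \<phi> a then \<phi> b else \<phi> v) (U - {\<phi> a}) T"
    (is "?l \<longleftrightarrow> conn ?\<psi> _ _")
proof -
  let ?S = "insert {a, b} T" and ?\<sigma> = "\<lambda>u. if u = \<phi> a then \<phi> b else u"
  have down: "(adj ?\<psi> T)\<^sup>*\<^sup>* (?\<sigma> u) (?\<sigma> v)" if "(adj \<phi> ?S)\<^sup>*\<^sup>* u v" for u v
  proof (rule reach_simulate[where g = ?\<sigma>, OF _ that])
    fix u v assume "adj \<phi> ?S u v"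
    then obtain s t where st: "{s, t} \<in> ?S" "u = \<phi> s" "v = \<phi> t" by (auto simp: adj_def)
    show "(adj ?\<psi> T)\<^sup>*\<^sup>* (?\<sigma> u) (?\<sigma> v)"
    proof (cases "{s, t} = {a, b}")
      case True
      then show ?thesis using st(2,3) by (auto simp: doubleton_eq_iff)
    next
      case False
      then have "adj ?\<psi> T (?\<psi> s) (?\<psi> t)" using st(1) by (intro adj_edge) auto
      then show ?thesis using st(2,3) by (auto intro: r_into_rtranclp)
    qed
  qed
  have ab: "adj \<phi> ?S (\<phi> a) (\<phi> b)" by (rule adj_edge) simp
  have \<sigma>: "(adj \<phi> ?S)\<^sup>*\<^sup>* u (?\<sigma> u)" "(adj \<phi> ?S)\<^sup>*\<^sup>* (?\<sigma> u) u" for u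
    using ab adj_sym[OF ab] by auto
  have up: "(adj \<phi> ?S)\<^sup>*\<^sup>* u v" if "(adj ?\<psi> T)\<^sup>*\<^sup>* u v" for u v
  proof (rule reach_simulate[where g = "\<lambda>u. u", OF _ that])
    fix u v assume "adj ?\<psi> T u v"
    then obtain s t where st: "{s, t} \<in> T" "u = ?\<sigma> (\<phi> s)" "v = ?\<sigma> (\<phi> t)" by (auto simp: adj_def)
    have "adj \<phi> ?S (\<phi> s) (\<phi> t)" using st(1) by (intro adj_edge) simp
    then have "(adj \<phi> ?S)\<^sup>*\<^sup>* u (\<phi> t)" unfolding st(2)
      using \<sigma>(2)[of "\<phi> s"] by (rule rtranclp.rtrancl_into_rtrancl[rotated])
    then show "(adj \<phi> ?S)\<^sup>*\<^sup>* u v" unfolding st(3) using \<sigma>(1)[of "\<phi> t"] by (rule rtranclp_trans)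
  qed
  show ?thesis
  proof
    assume l: ?l
    have "(adj ?\<psi> T)\<^sup>*\<^sup>* u v" if "u \<in> U - {\<phi> a}" "v \<in> U - {\<phi> a}" for u v
      using down[of u v] l that by (auto simp: conn_def)
    then show "conn ?\<psi> (U - {\<phi> a}) T" using xy unfolding conn_def by auto
  next
    assume r: "conn ?\<psi> (U - {\<phi> a}) T"
    have "(adj \<phi> ?S)\<^sup>*\<^sup>* u v" if "u \<in> U" "v \<in> U" for u v
    proof -
      have "?\<sigma> u \<in> U - {\<phi> a}" "?\<sigma> v \<in> U - {\<phi> a}" using that xy by auto
      then have "(adj \<phi> ?S)\<^sup>*\<^sup>* (?\<sigma> u) (?\<sigma> v)" using up r unfolding conn_def by blast
      then show ?thesis using \<sigma>(1)[of u] \<sigma>(2)[of v] by (meson rtranclp_trans)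
    qed
    then show ?l using xy unfolding conn_def by auto
  qed
qed

text \<open>Only the minimality at the contracted edge itself needs an argument: if the other edges connected the
  vertices without it, it could be exchanged for one of them, against the minimality after contraction.\<close>

lemma min_conn_contract:
  assumes xy: "\<phi> a \<in> U" "\<phi> b \<in> U" "\<phi> a \<noteq> \<phi> b" and T: "{a, b} \<notin> T"
  shows "min_conn \<phi> U (insert {a, b} T) \<longleftrightarrow>
    min_conn (\<lambda>v. if \<phi> v = \<phi> a then \<phi> b else \<phi> v) (U - {\<phi> a}) T" (is "_ \<longleftrightarrow> min_conn ?\<psi> ?U T")
proof -
  note cc = conn_contract[of \<phi> a U b, OF xy]
  have "insert {a, b} T - {f} = insert {a, b} (T - {f})" if "f \<in> T" for f using that T by auto
  then have d: "(\<forall>f\<in>T. \<not> conn \<phi> U (insert {a, b} T - {f})) \<longleftrightarrow> (\<forall>f\<in>T. \<not> conn ?\<psi> ?U (T - {f}))"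
    by (simp add: cc)
  have e: "insert {a, b} T - {{a, b}} = T" using T by auto
  have "\<not> conn \<phi> U T" if "\<forall>f\<in>T. \<not> conn ?\<psi> ?U (T - {f})"
    using edge_exchange[of \<phi> U T a b, OF _ xy] that by (auto simp: cc)
  then show ?thesis unfolding min_conn_def ball_simps cc using d e by auto
qed

lemma min_conn_loop:
  assumes "\<phi> a = \<phi> b" "{a, b} \<in> T"
  shows "\<not> min_conn \<phi> U T"
proof
  assume m: "min_conn \<phi> U T"
  have "conn \<phi> U (T - {{a, b}})"
  proof (rule conn_simulate)
    show "conn \<phi> U T" using m by (simp add: min_conn_def)
    fix s t assume st: "{s, t} \<in> T"
    show "(adj \<phi> (T - {{a, b}}))\<^sup>*\<^sup>* (\<phi> s) (\<phi> t)"
    proof (cases "{s, t} = {a, b}")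
      case True
      then show ?thesis using assms(1) by (auto simp: doubleton_eq_iff)
    next
      case False
      then have "adj \<phi> (T - {{a, b}}) (\<phi> s) (\<phi> t)" using st by (intro adj_edge) simp
      then show ?thesis by simp
    qed
  qed
  then show False using m assms(2) by (simp add: min_conn_def)
qed

lemma adj_cong:
  assumes "\<And>v. v \<in> \<Union>T \<Longrightarrow> \<phi> v = \<psi> v"
  shows "adj \<phi> T = adj \<psi> T"
proof -
  have "\<phi> a = \<psi> a \<and> \<phi> b = \<psi> b" if "{a, b} \<in> T" for a b using assms that by blast
  then show ?thesis by (intro ext) (simp add: adj_def, metis)
qed

lemma min_conn_cong:
  assumes "\<And>v. v \<in> \<Union>T \<Longrightarrow> \<phi> v = \<psi> v"
  shows "min_conn \<phi> U T = min_conn \<psi> U T"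
proof -
  have "adj \<phi> (T - A) = adj \<psi> (T - A)" for A by (rule adj_cong) (use assms in auto)
  from this this[of "{}"] show ?thesis by (simp add: min_conn_def conn_def)
qed

lemma tree_sum_cong:
  assumes "U = U'" "\<And>v. v \<in> \<Union>E \<Longrightarrow> \<phi> v = \<psi> v"
  shows "tree_sum \<phi> U E = tree_sum \<psi> U' E"
proof -
  have "{T. T \<subseteq> E \<and> min_conn \<phi> U T} = {T. T \<subseteq> E \<and> min_conn \<psi> U T}"
    using min_conn_cong[of _ \<phi> \<psi> U] assms(2) by (metis Union_mono subsetD)
  then show ?thesis by (simp add: tree_sum_def assms(1))
qed

lemma tree_sum_deletion:
  assumes "finite E" "e \<notin> E"
  shows "(\<Sum>T | T \<subseteq> E \<and> min_conn \<phi> U T. \<Prod>f\<in>insert e E - T. poly_var f) = poly_var e * tree_sum \<phi> U E"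
  unfolding tree_sum_def sum_distrib_left
proof (rule sum.cong)
  fix T assume "T \<in> {T. T \<subseteq> E \<and> min_conn \<phi> U T}"
  then have "insert e E - T = insert e (E - T)" using assms(2) by auto
  then show "(\<Prod>f\<in>insert e E - T. poly_var f) = poly_var e * (\<Prod>f\<in>E - T. poly_var f)"
    using assms by simp
qed simp

lemma tree_sum_loop:
  assumes "finite E" "e \<notin> E" "e = {a, b}" "\<phi> a = \<phi> b"
  shows "tree_sum \<phi> U (insert e E) = poly_var e * tree_sum \<phi> U E"
proof -
  have "{T. T \<subseteq> insert e E \<and> min_conn \<phi> U T} = {T. T \<subseteq> E \<and> min_conn \<phi> U T}"
    using min_conn_loop[of \<phi> a b] assms(3,4) by (metis subset_insert subset_insertI2)
  then show ?thesis unfolding tree_sum_deletion[OF assms(1,2), symmetric] by (simp add: tree_sum_def)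
qed

text \<open>Deletion and contraction; the contracted vertex map only matters at the ends of the remaining edges.\<close>

lemma tree_sum_edge:
  assumes E: "finite E" "e \<notin> E" "e = {a, b}" and xy: "\<phi> a \<in> U" "\<phi> b \<in> U" "\<phi> a \<noteq> \<phi> b"
    and U': "U' = U - {\<phi> a}" and \<psi>: "\<And>v. v \<in> \<Union>E \<Longrightarrow> \<psi> v = (if \<phi> v = \<phi> a then \<phi> b else \<phi> v)"
  shows "tree_sum \<phi> U (insert e E) = poly_var e * tree_sum \<phi> U E + tree_sum \<psi> U' E"
proof -
  let ?\<psi> = "\<lambda>v. if \<phi> v = \<phi> a then \<phi> b else \<phi> v"
  let ?D = "{T. T \<subseteq> E \<and> min_conn \<phi> U T}" and ?C = "{T. T \<subseteq> E \<and> min_conn ?\<psi> U' T}"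
  have mc: "min_conn \<phi> U (insert e T) \<longleftrightarrow> min_conn ?\<psi> U' T" if "T \<subseteq> E" for T
    using min_conn_contract[of \<phi> a U b T, OF xy] that E(2,3) U' by auto
  have "{T. T \<subseteq> insert e E \<and> min_conn \<phi> U T} = ?D \<union> insert e ` ?C" (is "?L = ?R")
  proof (intro equalityI subsetI)
    fix T assume T: "T \<in> ?L"
    show "T \<in> ?R"
    proof (cases "e \<in> T")
      case True
      have "T - {e} \<subseteq> E" "min_conn \<phi> U (insert e (T - {e}))" using T insert_Diff[OF True] by auto
      then have "T - {e} \<in> ?C" using mc[of "T - {e}"] by simp
      then have "insert e (T - {e}) \<in> insert e ` ?C" by (rule imageI)
      then show ?thesis using insert_Diff[OF True] by simp
    next
      case False
      then show ?thesis using T by auto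
    qed
  next
    fix T assume "T \<in> ?R"
    then show "T \<in> ?L" using mc by auto
  qed
  moreover have "?D \<inter> insert e ` ?C = {}" using E(2) by auto
  moreover have "finite ?D" "finite ?C" using E(1) by auto
  moreover have "inj_on (insert e) ?C"
  proof (rule inj_onI)
    fix S T assume "S \<in> ?C" "T \<in> ?C" and eq: "insert e S = insert e T"
    then have "e \<notin> S" "e \<notin> T" using E(2) by auto
    then show "S = T" using eq by (simp add: insert_ident)
  qed
  ultimately have "tree_sum \<phi> U (insert e E) = (\<Sum>T\<in>?D. \<Prod>f\<in>insert e E - T. poly_var f)
      + (\<Sum>T\<in>?C. \<Prod>f\<in>insert e E - insert e T. poly_var f)"
    unfolding tree_sum_def by (simp add: sum.union_disjoint sum.reindex)
  also have "(\<Sum>T\<in>?C. \<Prod>f\<in>insert e E - insert e T. poly_var f) = tree_sum ?\<psi> U' E"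
  proof -
    have "insert e E - insert e T = E - T" for T using E(2) by auto
    then show ?thesis by (simp add: tree_sum_def)
  qed
  also have "tree_sum ?\<psi> U' E = tree_sum \<psi> U' E" by (rule tree_sum_cong) (use \<psi> in auto)
  finally show ?thesis by (simp add: tree_sum_deletion[OF E(1,2)])
qed

lemma tree_sum_isolated:
  assumes "x \<in> U" "y \<in> U" "x \<noteq> y" "\<And>v. v \<in> \<Union>E \<Longrightarrow> \<phi> v \<noteq> x"
  shows "tree_sum \<phi> U E = 0"
proof -
  have "\<not> conn \<phi> U T" if "T \<subseteq> E" for T
  proof
    assume "conn \<phi> U T"
    then have "(adj \<phi> T)\<^sup>*\<^sup>* x y" using assms by (auto simp: conn_def)
    then obtain z where "adj \<phi> T x z" using assms(3) by (metis converse_rtranclpE)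
    then show False using assms(4) that by (fastforce simp: adj_def)
  qed
  then have e: "{T. T \<subseteq> E \<and> min_conn \<phi> U T} = {}" by (auto simp: min_conn_def)
  show ?thesis unfolding tree_sum_def e by simp
qed

lemma tree_sum_empty: "tree_sum \<phi> {u} {} = 1"
proof -
  have "{T. T \<subseteq> {} \<and> min_conn \<phi> {u} T} = {{}}" by (auto simp: min_conn_def conn_def)
  then show ?thesis by (simp add: tree_sum_def)
qed

section \<open>The zig-zag graphs\<close>

text \<open>The triangulated strip on the vertices \<open>i, \<dots>, i + m\<close>; the zig-zag graph is such a strip with one more edge
  between its two ends.\<close>

fun strip :: "nat \<Rightarrow> nat \<Rightarrow> nat set set" where
  "strip i 0 = {}"
| "strip i (Suc 0) = {{i, i + 1}}"
| "strip i (Suc (Suc m)) = insert {i, i + 1} (insert {i, i + 2} (strip (i + 1) (Suc m)))"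

lemma strip_vertices: "v \<in> \<Union>(strip i m) \<Longrightarrow> i \<le> v \<and> v \<le> i + m"
  by (induction i m arbitrary: v rule: strip.induct) fastforce+

lemma finite_strip: "finite (strip i m)"
  by (induction i m rule: strip.induct) auto

lemma strip_eq: "strip i m = {{j, j + 1} |j. i \<le> j \<and> j < i + m} \<union> {{j, j + 2} |j. i \<le> j \<and> j + 1 < i + m}"
proof (induction i m rule: strip.induct)
  case (2 i)
  have a: "{{j, j + 1} |j. i \<le> j \<and> j < i + Suc 0} = {{i, i + 1}}" using le_less_Suc_eq by fastforce
  have b: "{{j, j + 2} |j. i \<le> j \<and> j + 1 < i + Suc 0} = {}" by auto
  show ?case unfolding strip.simps a b by simp
next
  case (3 i m)
  have a: "{{j, j + 1} |j. i \<le> j \<and> j < i + Suc (Suc m)} = insert {i, i + 1} {{j, j + 1} |j. i + 1 \<le> j \<and> j < i + 1 + Suc m}"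
    (is "?l = ?r")
  proof
    show "?l \<subseteq> ?r"
    proof
      fix e assume "e \<in> ?l"
      then obtain j where "e = {j, j + 1}" "i \<le> j" "j < i + Suc (Suc m)" by blast
      then show "e \<in> ?r" by (cases "j = i") auto
    qed
    show "?r \<subseteq> ?l" by fastforce
  qed
  have b: "{{j, j + 2} |j. i \<le> j \<and> j + 1 < i + Suc (Suc m)} = insert {i, i + 2} {{j, j + 2} |j. i + 1 \<le> j \<and> j + 1 < i + 1 + Suc m}"
    (is "?l = ?r")
  proof
    show "?l \<subseteq> ?r"
    proof
      fix e assume "e \<in> ?l"
      then obtain j where "e = {j, j + 2}" "i \<le> j" "j + 1 < i + Suc (Suc m)" by blast
      then show "e \<in> ?r" by (cases "j = i") auto
    qed
    show "?r \<subseteq> ?l" by fastforce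
  qed
  show ?case unfolding strip.simps 3 a b by blast
qed auto

abbreviation near :: "nat \<Rightarrow> (nat set, 'k::field) mpoly" where
  "near j \<equiv> poly_var {j, j + 1}"

abbreviation far :: "nat \<Rightarrow> (nat set, 'k::field) mpoly" where
  "far j \<equiv> poly_var {j, j + 2}"

context
  fixes i m N :: nat
  assumes N: "N = i + Suc (Suc m)"
begin

text \<open>Removing the vertex \<open>i\<close> from the strip. Five sums occur, according to which of the vertices \<open>i\<close>, \<open>i + 1\<close> and
  the last vertex \<open>N\<close> are merged; the last vertex is involved since the extra edge of the zig-zag graph gets contracted.\<close>

abbreviation "rest \<equiv> strip (i + 1) (Suc m)"

lemma rest_vertices: "e \<in> rest \<Longrightarrow> v \<in> e \<Longrightarrow> i + 1 \<le> v \<and> v \<le> N"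
  using strip_vertices[of v "i + 1" "Suc m"] N by auto

lemma strip_fresh: "{i, i + 1} \<notin> insert {i, i + 2} rest" "{i, i + 2} \<notin> rest"
  using rest_vertices[of _ i] by (auto simp: doubleton_eq_iff)

lemma strip_cut: "strip i (Suc (Suc m)) = insert {i, i + 1} (insert {i, i + 2} rest)" by simp

lemma fins: "finite (insert {i, i + 2} rest)" "finite rest"
  by (simp_all add: finite_strip)

lemma strip_free:
  "tree_sum (\<lambda>v. v) {i..N} (strip i (Suc (Suc m)))
    = (near i + far i) * tree_sum (\<lambda>v. v) {i+1..N} rest + (tree_sum ((\<lambda>v. v)(i+1 := i+2)) {i+2..N} rest :: (nat set, 'k::field) mpoly)"
proof -
  let ?T = "tree_sum :: _ \<Rightarrow> _ \<Rightarrow> _ \<Rightarrow> (nat set, 'k) mpoly"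
  have 1: "?T (\<lambda>v. v) {i..N} (strip i (Suc (Suc m))) = near i * ?T (\<lambda>v. v) {i..N} (insert {i, i + 2} rest)
      + ?T ((\<lambda>v. v)(i := i + 1)) {i+1..N} (insert {i, i + 2} rest)"
    unfolding strip_cut by (rule tree_sum_edge[OF fins(1) strip_fresh(1) refl]) (use N in auto)
  have 2: "?T (\<lambda>v. v) {i..N} (insert {i, i + 2} rest) = far i * ?T (\<lambda>v. v) {i..N} rest + ?T (\<lambda>v. v) {i+1..N} rest"
    by (rule tree_sum_edge[OF fins(2) strip_fresh(2) refl]) (use N in \<open>auto dest: rest_vertices[simplified]\<close>)
  have 3: "?T (\<lambda>v. v) {i..N} rest = 0"
    by (rule tree_sum_isolated[of i _ N]) (use N in \<open>auto dest: rest_vertices[simplified]\<close>)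
  have 4: "?T ((\<lambda>v. v)(i := i + 1)) {i+1..N} (insert {i, i + 2} rest)
      = far i * ?T ((\<lambda>v. v)(i := i + 1)) {i+1..N} rest + ?T ((\<lambda>v. v)(i+1 := i+2)) {i+2..N} rest"
    by (rule tree_sum_edge[OF fins(2) strip_fresh(2) refl]) (use N in \<open>auto dest: rest_vertices[simplified]\<close>)
  have 5: "?T ((\<lambda>v. v)(i := i + 1)) {i+1..N} rest = ?T (\<lambda>v. v) {i+1..N} rest"
    by (rule tree_sum_cong) (auto dest: rest_vertices[simplified])
  show ?thesis unfolding 1 2 3 4 5 by (simp add: algebra_simps)
qed

lemma strip_12:
  "tree_sum ((\<lambda>v. v)(i := i+1)) {i+1..N} (strip i (Suc (Suc m)))
    = near i * (far i * tree_sum (\<lambda>v. v) {i+1..N} rest + (tree_sum ((\<lambda>v. v)(i+1 := i+2)) {i+2..N} rest :: (nat set, 'k::field) mpoly))"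
proof -
  let ?T = "tree_sum :: _ \<Rightarrow> _ \<Rightarrow> _ \<Rightarrow> (nat set, 'k) mpoly"
  have 1: "?T ((\<lambda>v. v)(i := i+1)) {i+1..N} (strip i (Suc (Suc m))) = near i * ?T ((\<lambda>v. v)(i := i + 1)) {i+1..N} (insert {i, i + 2} rest)"
    unfolding strip_cut by (rule tree_sum_loop[OF fins(1) strip_fresh(1) refl]) simp
  have 2: "?T ((\<lambda>v. v)(i := i + 1)) {i+1..N} (insert {i, i + 2} rest)
      = far i * ?T ((\<lambda>v. v)(i := i + 1)) {i+1..N} rest + ?T ((\<lambda>v. v)(i+1 := i+2)) {i+2..N} rest"
    by (rule tree_sum_edge[OF fins(2) strip_fresh(2) refl]) (use N in \<open>auto dest: rest_vertices[simplified]\<close>)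
  have 3: "?T ((\<lambda>v. v)(i := i + 1)) {i+1..N} rest = ?T (\<lambda>v. v) {i+1..N} rest"
    by (rule tree_sum_cong) (auto dest: rest_vertices[simplified])
  show ?thesis unfolding 1 2 3 ..
qed

context
  assumes m: "0 < m"
begin

lemma strip_1N:
  "tree_sum ((\<lambda>v. v)(i := N)) {i+1..N} (strip i (Suc (Suc m)))
    = near i * (far i * tree_sum (\<lambda>v. v) {i+1..N} rest + tree_sum ((\<lambda>v. v)(i+2 := N)) ({i+1..N} - {i+2}) rest)
      + (far i * tree_sum ((\<lambda>v. v)(i+1 := N)) {i+2..N} rest
         + (tree_sum ((\<lambda>v. v)(i+1 := N, i+2 := N)) {i+3..N} rest :: (nat set, 'k::field) mpoly))"
proof -
  let ?T = "tree_sum :: _ \<Rightarrow> _ \<Rightarrow> _ \<Rightarrow> (nat set, 'k) mpoly"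
  have 1: "?T ((\<lambda>v. v)(i := N)) {i+1..N} (strip i (Suc (Suc m)))
     = near i * ?T ((\<lambda>v. v)(i := N)) {i+1..N} (insert {i, i + 2} rest)
      + ?T ((\<lambda>v. v)(i := N, i + 1 := N)) {i+2..N} (insert {i, i + 2} rest)"
    unfolding strip_cut by (rule tree_sum_edge[OF fins(1) strip_fresh(1) insert_commute]) (use N m in auto)
  have 2: "?T ((\<lambda>v. v)(i := N)) {i+1..N} (insert {i, i + 2} rest)
      = far i * ?T ((\<lambda>v. v)(i := N)) {i+1..N} rest + ?T ((\<lambda>v. v)(i+2 := N)) ({i+1..N} - {i+2}) rest"
    by (rule tree_sum_edge[OF fins(2) strip_fresh(2) insert_commute]) (use N m in \<open>auto dest: rest_vertices[simplified]\<close>)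
  have 3: "?T ((\<lambda>v. v)(i := N)) {i+1..N} rest = ?T (\<lambda>v. v) {i+1..N} rest"
    by (rule tree_sum_cong) (auto dest: rest_vertices[simplified])
  have 4: "?T ((\<lambda>v. v)(i := N, i + 1 := N)) {i+2..N} (insert {i, i + 2} rest)
      = far i * ?T ((\<lambda>v. v)(i := N, i + 1 := N)) {i+2..N} rest + ?T ((\<lambda>v. v)(i+1 := N, i+2 := N)) {i+3..N} rest"
    by (rule tree_sum_edge[OF fins(2) strip_fresh(2) insert_commute]) (use N m in \<open>auto dest: rest_vertices[simplified]\<close>)
  have 5: "?T ((\<lambda>v. v)(i := N, i + 1 := N)) {i+2..N} rest = ?T ((\<lambda>v. v)(i + 1 := N)) {i+2..N} rest"
    by (rule tree_sum_cong) (auto dest: rest_vertices[simplified])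
  show ?thesis unfolding 1 2 3 4 5 ..
qed

lemma strip_2N:
  "tree_sum ((\<lambda>v. v)(i+1 := N)) ({i..N} - {i+1}) (strip i (Suc (Suc m)))
    = (near i + far i) * tree_sum ((\<lambda>v. v)(i+1 := N)) {i+2..N} rest
         + (tree_sum ((\<lambda>v. v)(i+1 := N, i+2 := N)) {i+3..N} rest :: (nat set, 'k::field) mpoly)"
proof -
  let ?T = "tree_sum :: _ \<Rightarrow> _ \<Rightarrow> _ \<Rightarrow> (nat set, 'k) mpoly"
  have 1: "?T ((\<lambda>v. v)(i+1 := N)) ({i..N} - {i+1}) (strip i (Suc (Suc m)))
     = near i * ?T ((\<lambda>v. v)(i+1 := N)) ({i..N} - {i+1}) (insert {i, i + 2} rest)
      + ?T ((\<lambda>v. v)(i := N, i + 1 := N)) {i+2..N} (insert {i, i + 2} rest)"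
    unfolding strip_cut by (rule tree_sum_edge[OF fins(1) strip_fresh(1) refl]) (use N m in auto)
  have 2: "?T ((\<lambda>v. v)(i+1 := N)) ({i..N} - {i+1}) (insert {i, i + 2} rest)
      = far i * ?T ((\<lambda>v. v)(i+1 := N)) ({i..N} - {i+1}) rest + ?T ((\<lambda>v. v)(i+1 := N)) {i+2..N} rest"
    by (rule tree_sum_edge[OF fins(2) strip_fresh(2) refl]) (use N m in \<open>auto dest: rest_vertices[simplified]\<close>)
  have 3: "?T ((\<lambda>v. v)(i+1 := N)) ({i..N} - {i+1}) rest = 0"
    by (rule tree_sum_isolated[of i _ N]) (use N in \<open>auto dest: rest_vertices[simplified]\<close>)
  have 4: "?T ((\<lambda>v. v)(i := N, i + 1 := N)) {i+2..N} (insert {i, i + 2} rest)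
      = far i * ?T ((\<lambda>v. v)(i := N, i + 1 := N)) {i+2..N} rest + ?T ((\<lambda>v. v)(i+1 := N, i+2 := N)) {i+3..N} rest"
    by (rule tree_sum_edge[OF fins(2) strip_fresh(2) insert_commute]) (use N m in \<open>auto dest: rest_vertices[simplified]\<close>)
  have 5: "?T ((\<lambda>v. v)(i := N, i + 1 := N)) {i+2..N} rest = ?T ((\<lambda>v. v)(i + 1 := N)) {i+2..N} rest"
    by (rule tree_sum_cong) (auto dest: rest_vertices[simplified])
  show ?thesis unfolding 1 2 3 4 5 by (simp add: algebra_simps)
qed

lemma strip_12N:
  "tree_sum ((\<lambda>v. v)(i := N, i+1 := N)) {i+2..N} (strip i (Suc (Suc m)))
    = near i * (far i * tree_sum ((\<lambda>v. v)(i+1 := N)) {i+2..N} rest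
         + (tree_sum ((\<lambda>v. v)(i+1 := N, i+2 := N)) {i+3..N} rest :: (nat set, 'k::field) mpoly))"
proof -
  let ?T = "tree_sum :: _ \<Rightarrow> _ \<Rightarrow> _ \<Rightarrow> (nat set, 'k) mpoly"
  have 1: "?T ((\<lambda>v. v)(i := N, i+1 := N)) {i+2..N} (strip i (Suc (Suc m)))
     = near i * ?T ((\<lambda>v. v)(i := N, i + 1 := N)) {i+2..N} (insert {i, i + 2} rest)"
    unfolding strip_cut by (rule tree_sum_loop[OF fins(1) strip_fresh(1) refl]) simp
  have 4: "?T ((\<lambda>v. v)(i := N, i + 1 := N)) {i+2..N} (insert {i, i + 2} rest)
      = far i * ?T ((\<lambda>v. v)(i := N, i + 1 := N)) {i+2..N} rest + ?T ((\<lambda>v. v)(i+1 := N, i+2 := N)) {i+3..N} rest"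
    by (rule tree_sum_edge[OF fins(2) strip_fresh(2) insert_commute]) (use N m in \<open>auto dest: rest_vertices[simplified]\<close>)
  have 5: "?T ((\<lambda>v. v)(i := N, i + 1 := N)) {i+2..N} rest = ?T ((\<lambda>v. v)(i + 1 := N)) {i+2..N} rest"
    by (rule tree_sum_cong) (auto dest: rest_vertices[simplified])
  show ?thesis unfolding 1 4 5 ..
qed

end

end


lemma tree_sum_one_edge:
  fixes e :: "'v set"
  assumes "e = {a, b}" "U = {\<phi> a, \<phi> b}"
  shows "(tree_sum \<phi> U {e} :: ('v set, 'k::field) mpoly) = (if \<phi> a = \<phi> b then poly_var e else 1)"
proof (cases "\<phi> a = \<phi> b")
  case True
  then show ?thesis using tree_sum_loop[of "{}" e a b \<phi> U] assms by (simp add: tree_sum_empty)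
next
  case False
  have "tree_sum \<phi> U {} = (0 :: ('v set, 'k) mpoly)"
    by (rule tree_sum_isolated[of "\<phi> a" _ "\<phi> b"]) (use assms False in auto)
  moreover have "U - {\<phi> a} = {\<phi> b}" using assms False by auto
  moreover have "(tree_sum \<phi> U {e} :: ('v set, 'k) mpoly) = poly_var e * tree_sum \<phi> U {} + tree_sum \<phi> (U - {\<phi> a}) {}"
    by (rule tree_sum_edge[OF _ _ assms(1)]) (use assms False in auto)
  ultimately show ?thesis using False by (simp add: tree_sum_empty)
qed

lemma strip_last:
  fixes i :: nat
  assumes N: "N = i + 2"
  shows "tree_sum ((\<lambda>v. v)(i := N)) {i+1..N} (strip i 2) = near i * far i + (far i * near (i+1) :: (nat set, 'k::field) mpoly)"
    and "tree_sum ((\<lambda>v. v)(i+1 := N)) ({i..N} - {i+1}) (strip i 2) = near i * near (i+1) + (far i * near (i+1) :: (nat set, 'k) mpoly)"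
    and "tree_sum ((\<lambda>v. v)(i := N, i+1 := N)) {i+2..N} (strip i 2) = near i * (far i * (near (i+1) :: (nat set, 'k) mpoly))"
proof -
  let ?T = "tree_sum :: _ \<Rightarrow> _ \<Rightarrow> _ \<Rightarrow> (nat set, 'k) mpoly" and ?Y = "{{i+1, i+2}}"
  have S: "strip i 2 = insert {i, i + 1} (insert {i, i + 2} ?Y)" by (simp add: numeral_2_eq_2)
  have f: "{i, i + 1} \<notin> insert {i, i + 2} ?Y" "{i, i + 2} \<notin> ?Y" by (auto simp: doubleton_eq_iff)
  have fin: "finite (insert {i, i + 2} ?Y)" "finite ?Y" by auto
  have I: "{i+1..N} = {i+1, i+2}" "{i..N} - {i+1} = {i, i+2}" "{i+2..N} = {i+2}" using N by auto
  have 1: "?T ((\<lambda>v. v)(i := N)) {i+1, i+2} (strip i 2) = near i * ?T ((\<lambda>v. v)(i := N)) {i+1, i+2} (insert {i, i + 2} ?Y)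
      + ?T ((\<lambda>v. v)(i := N, i+1 := N)) {i+2} (insert {i, i + 2} ?Y)"
    unfolding S by (rule tree_sum_edge[OF fin(1) f(1) insert_commute]) (use N in auto)
  have 2: "?T ((\<lambda>v. v)(i := N)) {i+1, i+2} (insert {i, i + 2} ?Y) = far i * ?T ((\<lambda>v. v)(i := N)) {i+1, i+2} ?Y"
    by (rule tree_sum_loop[OF fin(2) f(2) refl]) (use N in auto)
  have 3: "?T ((\<lambda>v. v)(i := N)) {i+1, i+2} ?Y = 1"
    by (subst tree_sum_one_edge[OF refl]) (use N in auto)
  have 4: "?T ((\<lambda>v. v)(i := N, i+1 := N)) {i+2} (insert {i, i + 2} ?Y) = far i * ?T ((\<lambda>v. v)(i := N, i+1 := N)) {i+2} ?Y"
    by (rule tree_sum_loop[OF fin(2) f(2) refl]) (use N in auto)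
  have 5: "?T ((\<lambda>v. v)(i := N, i+1 := N)) {i+2} ?Y = near (i+1)"
    by (subst tree_sum_one_edge[OF refl]) (use N in \<open>auto simp: numeral_2_eq_2\<close>)
  show "?T ((\<lambda>v. v)(i := N)) {i+1..N} (strip i 2) = near i * far i + far i * near (i+1)"
    unfolding I 1 2 3 4 5 by simp
  have 6: "?T ((\<lambda>v. v)(i+1 := N)) {i, i+2} (strip i 2) = near i * ?T ((\<lambda>v. v)(i+1 := N)) {i, i+2} (insert {i, i + 2} ?Y)
      + ?T ((\<lambda>v. v)(i := N, i+1 := N)) {i+2} (insert {i, i + 2} ?Y)"
    unfolding S by (rule tree_sum_edge[OF fin(1) f(1) refl]) (use N in auto)
  have 7: "?T ((\<lambda>v. v)(i+1 := N)) {i, i+2} (insert {i, i + 2} ?Y) = far i * ?T ((\<lambda>v. v)(i+1 := N)) {i, i+2} ?Y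
      + ?T ((\<lambda>v. v)(i := N, i+1 := N)) {i+2} ?Y"
    by (rule tree_sum_edge[OF fin(2) f(2) refl]) (use N in auto)
  have 8: "?T ((\<lambda>v. v)(i+1 := N)) {i, i+2} ?Y = 0"
    by (rule tree_sum_isolated[of i _ "i + 2"]) (use N in auto)
  show "?T ((\<lambda>v. v)(i+1 := N)) ({i..N} - {i+1}) (strip i 2) = near i * near (i+1) + far i * near (i+1)"
    unfolding I 6 7 8 4 5 by simp
  have 9: "?T ((\<lambda>v. v)(i := N, i+1 := N)) {i+2} (strip i 2) = near i * ?T ((\<lambda>v. v)(i := N, i+1 := N)) {i+2} (insert {i, i + 2} ?Y)"
    unfolding S by (rule tree_sum_loop[OF fin(1) f(1) refl]) (use N in auto)
  show "?T ((\<lambda>v. v)(i := N, i+1 := N)) {i+2..N} (strip i 2) = near i * (far i * near (i+1))"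
    unfolding I 9 4 5 ..
qed

text \<open>The triangles of the strip, together with the cycle that the extra edge closes with the path through all vertices,
  form a basis of the cycle space. The entries of the matrix are the sums of the indeterminates of the
  edges that two basis cycles share: a triangle has three edges, shares one with its successor and two with
  the long cycle.\<close>

fun strip_list :: "nat \<Rightarrow> nat \<Rightarrow> ((nat set, 'k::field) mpoly \<times> (nat set, 'k) mpoly) list" where
  "strip_list i 0 = []"
| "strip_list i (Suc 0) = []"
| "strip_list i (Suc (Suc m)) = (far i + near i + near (i+1), near (i+1)) # strip_list (i+1) (Suc m)"

lemma strip_list_map: "strip_list i (Suc m) = map (\<lambda>j. (far j + near j + near (j+1), near (j+1))) [i..<i+m]"
proof (induction m arbitrary: i)
  case (Suc m)
  have "[i..<i + Suc m] = i # [Suc i..<Suc i + m]" by (simp add: upt_conv_Cons)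
  then show ?case using Suc[of "Suc i"] by simp
qed simp

lemma bordered_det_add: "bordered_det r l (w + c) = bordered_det r l w + c * continuant l"
  using bordered_det_corner[of r l "w + c"] bordered_det_corner[of r l w] by (simp add: algebra_simps)

text \<open>The recursions of the five sums, verified for the expressions in \<open>continuant\<close>, \<open>border_cofactor\<close> and \<open>bordered_det\<close> that
  they turn out to be. Given the values for the shorter strip, this is an identity of polynomials.\<close>

lemma strip_algebra:
  fixes y a y' q z w :: "'a::comm_ring_1" and l
  defines "L' \<equiv> (q, z) # l" and "L \<equiv> (a + y + y', y') # (q, z) # l"
  defines "D \<equiv> bordered_det y' L' (y' + w)" and "N' \<equiv> border_cofactor y' L'"
  defines "P2 \<equiv> D + 2 * y' * N' - y' * continuant L' - y'^2 * continuant l"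
    and "P12 \<equiv> y' * (D - y' * (bordered_det z l w + y' * continuant l) + 2 * y' * N' - y' * continuant L')"
    and "F \<equiv> bordered_det y L (y + (y' + w))"
  shows "(y + a) * continuant L' + y' * (continuant L' - y' * continuant l) = continuant L"
    and "y * (a * continuant L' + y' * (continuant L' - y' * continuant l)) = y * (continuant L - y * continuant L')"
    and "y * (a * continuant L' + P2) + (a * D + P12) = F"
    and "(y + a) * D + P12 = F + 2 * y * border_cofactor y L - y * continuant L - y^2 * continuant L'"
    and "y * (a * D + P12) = y * (F - y * (D + y * continuant L') + 2 * y * border_cofactor y L - y * continuant L)"
proof -
  have K: "continuant L = (a + y + y') * continuant L' - y'^2 * continuant l" by (simp add: L_def L'_def)
  have N: "border_cofactor y L = (y' + y) * continuant L' - y' * N'" by (simp add: L_def L'_def N'_def)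
  have "bordered_det y' L' (y + (y' + w)) = D + y * continuant L'" unfolding D_def by (metis add.commute bordered_det_add)
  moreover have "bordered_det z l (y + (y' + w)) = bordered_det z l w + (y + y') * continuant l"
    by (metis add.assoc add.commute bordered_det_add)
  ultimately have F: "F = (a + y + y') * (D + y * continuant L') - y'^2 * (bordered_det z l w + (y + y') * continuant l)
      + 2 * y' * (y' + y) * N' - (y' + y)^2 * continuant L'"
    by (simp add: F_def L_def L'_def N'_def)
  note R = K N F P2_def P12_def power2_eq_square algebra_simps
  show "(y + a) * continuant L' + y' * (continuant L' - y' * continuant l) = continuant L"
    and "y * (a * continuant L' + y' * (continuant L' - y' * continuant l)) = y * (continuant L - y * continuant L')"
    and "y * (a * continuant L' + P2) + (a * D + P12) = F"
    and "(y + a) * D + P12 = F + 2 * y * border_cofactor y L - y * continuant L - y^2 * continuant L'"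
    and "y * (a * D + P12) = y * (F - y * (D + y * continuant L') + 2 * y * border_cofactor y L - y * continuant L)"
    by (simp_all add: R)
qed

abbreviation near_sum :: "nat \<Rightarrow> nat \<Rightarrow> (nat set, 'k::field) mpoly" where
  "near_sum i N \<equiv> (\<Sum>j=i..<N. near j)"

lemma near_sum_first: "i < N \<Longrightarrow> near_sum i N = near i + near_sum (i+1) N"
  by (simp add: sum.atLeast_Suc_lessThan)

lemma strip_sums:
  fixes i m N :: nat
  assumes "N = i + Suc (Suc m)"
  shows "(tree_sum (\<lambda>v. v) {i..N} (strip i (Suc (Suc m))) :: (nat set, 'k::field) mpoly)
      = continuant (strip_list i (Suc (Suc m)))
    \<and> (tree_sum ((\<lambda>v. v)(i := i+1)) {i+1..N} (strip i (Suc (Suc m))) :: (nat set, 'k) mpoly)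
      = near i * (continuant (strip_list i (Suc (Suc m))) - near i * continuant (strip_list (i+1) (Suc m)))
    \<and> (tree_sum ((\<lambda>v. v)(i := N)) {i+1..N} (strip i (Suc (Suc m))) :: (nat set, 'k) mpoly)
      = bordered_det (near i) (strip_list i (Suc (Suc m))) (near_sum i N)
    \<and> (tree_sum ((\<lambda>v. v)(i+1 := N)) ({i..N} - {i+1}) (strip i (Suc (Suc m))) :: (nat set, 'k) mpoly)
      = bordered_det (near i) (strip_list i (Suc (Suc m))) (near_sum i N) + 2 * near i * border_cofactor (near i) (strip_list i (Suc (Suc m)))
          - near i * continuant (strip_list i (Suc (Suc m))) - near i^2 * continuant (strip_list (i+1) (Suc m))
    \<and> (tree_sum ((\<lambda>v. v)(i := N, i+1 := N)) {i+2..N} (strip i (Suc (Suc m))) :: (nat set, 'k) mpoly)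
      = near i * (bordered_det (near i) (strip_list i (Suc (Suc m))) (near_sum i N)
          - near i * (bordered_det (near (i+1)) (strip_list (i+1) (Suc m)) (near_sum (i+1) N) + near i * continuant (strip_list (i+1) (Suc m)))
          + 2 * near i * border_cofactor (near i) (strip_list i (Suc (Suc m))) - near i * continuant (strip_list i (Suc (Suc m))))"
  using assms
proof (induction m arbitrary: i)
  case 0
  let ?T = "tree_sum :: _ \<Rightarrow> _ \<Rightarrow> _ \<Rightarrow> (nat set, 'k) mpoly"
  have N: "N = i + 2" using 0 by simp
  have w: "near_sum i N = near i + (near (i+1) :: (nat set, 'k) mpoly)" "near_sum (i+1) N = (near (i+1) :: (nat set, 'k) mpoly)"
    using N by (simp_all add: sum.atLeast_Suc_lessThan)
  have I: "{i+1..N} = {i+1, i+2}" "{i+2..N} = {i+2}" using N by auto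
  have 1: "?T (\<lambda>v. v) {i+1..N} (strip (i+1) (Suc 0)) = 1"
    unfolding I strip.simps by (subst tree_sum_one_edge[OF refl]) auto
  have 2: "?T ((\<lambda>v. v)(i+1 := i+2)) {i+2..N} (strip (i+1) (Suc 0)) = near (i+1)"
    unfolding I strip.simps by (subst tree_sum_one_edge[OF refl]) auto
  have S: "strip i (Suc (Suc 0)) = strip i 2" by (simp add: numeral_2_eq_2)
  show ?case
    unfolding strip_free[OF 0] strip_12[OF 0] 1 2 unfolding S strip_last[OF N] w
    by (simp add: algebra_simps power2_eq_square)
next
  case (Suc m)
  let ?j = "i + 1"
  let ?L = "strip_list ?j (Suc (Suc m)) :: ((nat set, 'k) mpoly \<times> _) list" and ?l = "strip_list (?j + 1) (Suc m) :: ((nat set, 'k) mpoly \<times> _) list"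
  have N': "N = ?j + Suc (Suc m)" using Suc(2) by simp
  have L: "?L = (far ?j + near ?j + near (?j+1), near (?j+1)) # ?l" by simp
  have L': "strip_list i (Suc (Suc (Suc m))) = (far i + near i + near ?j, near ?j) # ?L" by simp
  have lt: "i < N" "?j < N" using N' by simp_all
  have w: "near_sum i N = near i + (near ?j + near_sum (?j+1) N :: (nat set, 'k) mpoly)"
    "near_sum ?j N = near ?j + (near_sum (?j+1) N :: (nat set, 'k) mpoly)"
    by (simp_all only: near_sum_first[OF lt(1)] near_sum_first[OF lt(2)])
  have j: "i + 2 = ?j + 1" "i + 3 = ?j + 2" by simp_all
  note IH = Suc.IH[OF N']
  note ih = conjunct1[OF IH] conjunct1[OF conjunct2[OF IH]] conjunct1[OF conjunct2[OF conjunct2[OF IH]]]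
    conjunct1[OF conjunct2[OF conjunct2[OF conjunct2[OF IH]]]] conjunct2[OF conjunct2[OF conjunct2[OF conjunct2[OF IH]]]]
  show ?case
    unfolding strip_free[OF Suc(2)] strip_12[OF Suc(2)] strip_1N[OF Suc(2) zero_less_Suc] strip_2N[OF Suc(2) zero_less_Suc]
      strip_12N[OF Suc(2) zero_less_Suc]
    unfolding j ih w L'[unfolded j] L by (intro conjI) (rule strip_algebra)+
qed

lemma zigzag_edges:
  assumes "n \<ge> 3"
  shows "snd (zigzag n) = insert {1, n+1} (strip 1 n)"
proof -
  have "{{i, i+1} |i. 1 \<le> i \<and> i \<le> n} = {{j, j + 1} |j. 1 \<le> j \<and> j < 1 + n}"
    by (intro Collect_cong ex_cong1) auto
  moreover have "{{i, i+2} |i. 1 \<le> i \<and> i \<le> n-1} = {{j, j + 2} |j. 1 \<le> j \<and> j + 1 < 1 + n}"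
    using assms by (intro Collect_cong ex_cong1) auto
  ultimately show ?thesis by (auto simp: zigzag_def strip_eq)
qed

text \<open>The graph polynomial as a determinant of the Gram matrix of the cycle basis; deleting the extra edge leaves
  the continuant, the coefficient of the corner entry, and contracting it merges the two ends of the strip.\<close>

lemma zigzag_poly:
  assumes n: "n \<ge> 3"
  shows "(graph_poly (zigzag n) :: (nat set, 'k::field) mpoly)
    = bordered_det (near 1) (strip_list 1 n) (poly_var {1, n+1} + near_sum 1 (n+1))"
proof -
  let ?T = "tree_sum :: _ \<Rightarrow> _ \<Rightarrow> _ \<Rightarrow> (nat set, 'k) mpoly"
  define m where "m = n - 2"
  have m: "n = Suc (Suc m)" using n by (simp add: m_def)
  have N: "n + 1 = 1 + Suc (Suc m)" by (simp add: m)
  have card: "card e = 2" "e \<subseteq> {1..n+1}" if "e \<in> snd (zigzag n)" for e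
    using that n by (auto simp: zigzag_def)
  have "graph_poly (zigzag n) = ?T (\<lambda>v. v) {1..n+1} (snd (zigzag n))"
    using spanning_trees_min_conn[of "snd (zigzag n)" "{1..n+1}"] card
    by (simp add: graph_poly_def tree_sum_def zigzag_def)
  also have "\<dots> = ?T (\<lambda>v. v) {1..n+1} (insert {1, n+1} (strip 1 n))" by (simp only: zigzag_edges[OF n])
  also have "\<dots> = poly_var {1, n+1} * ?T (\<lambda>v. v) {1..n+1} (strip 1 n) + ?T ((\<lambda>v. v)(1 := n+1)) {1+1..n+1} (strip 1 n)"
  proof (rule tree_sum_edge[OF finite_strip _ refl])
    show "{1, n+1} \<notin> strip 1 n" using n by (auto simp: strip_eq doubleton_eq_iff)
  qed (use n in auto)
  also have "\<dots> = poly_var {1, n+1} * continuant (strip_list 1 n) + bordered_det (near 1) (strip_list 1 n) (near_sum 1 (n+1))"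
    using strip_sums[OF N, where 'k = 'k] by (simp only: m)
  also have "\<dots> = bordered_det (near 1) (strip_list 1 n) (poly_var {1, n+1} + near_sum 1 (n+1))"
    by (subst add.commute[of "poly_var {1, n+1} :: (nat set, 'k) mpoly" "near_sum 1 (n+1)"], subst bordered_det_add)
      (rule add.commute)
  finally show ?thesis .
qed

section \<open>The class of a zig-zag graph\<close>

text \<open>Simultaneous translation of several coordinates by polynomials in the others.\<close>

lemma shiftsI:
  fixes g :: "(nat, 'k::field) mpoly"
  assumes "finite X" "finite V" "X \<subseteq> V" "g \<in> polys V" "\<And>x. x \<in> X \<Longrightarrow> h x \<in> polys (V - X)"
    and "open_class V (psubst (\<lambda>v. if v \<in> X then poly_var v + h v else poly_var v) g) f"
  shows "open_class V g f"
  using assms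
proof (induction X arbitrary: g rule: finite_induct)
  case empty
  then show ?case by simp
next
  case (insert x X)
  have V: "V = insert x (V - {x})" using insert.prems by auto
  have hx: "h v \<in> polys (V - {x})" "h v \<in> polys (V - X)" if "v \<in> insert x X" for v
    using insert.prems(4)[OF that] by (auto elim: polys_mono[rotated])
  let ?g = "subst1 x (poly_var x + h x) g"
  have "?g \<in> polys V"
  proof (rule psubst_polys[OF insert.prems(3)])
    fix v assume "v \<in> V"
    moreover have "h x \<in> polys V" using hx(1)[of x] by (auto elim: polys_mono[rotated])
    ultimately show "(poly_var(x := poly_var x + h x)) v \<in> polys V" using insert.prems(2) by auto
  qed
  moreover have "psubst (\<lambda>v. if v \<in> X then poly_var v + h v else poly_var v) ?g
      = psubst (\<lambda>v. if v \<in> insert x X then poly_var v + h v else poly_var v) g"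
  proof -
    have "psubst (\<lambda>v. if v \<in> X then poly_var v + h v else poly_var v) (h x) = h x"
      by (rule psubst_ident[OF hx(2)]) auto
    then show ?thesis using insert.hyps(2) unfolding psubst_psubst by (intro arg_cong2[of _ _ _ _ psubst] ext) auto
  qed
  ultimately have "open_class V ?g f"
    using insert.IH[of ?g] insert.prems hx(2) by auto
  then show ?case
    using shiftI[of V x "V - {x}" g "h x" ?g f] V insert.prems hx(1)[of x] by simp
qed

text \<open>The numbering gives the even numbers to the edges of the zig-zag path and the odd ones to those
  that lie on one basis cycle only, so that the latter can be translated by polynomials in the former.\<close>

definition edge_of :: "nat \<Rightarrow> nat \<Rightarrow> nat set" where
  "edge_of n v = (if v = 1 then {1, n+1} else if even v then {v div 2, v div 2 + 1} else {v div 2, v div 2 + 2})"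

lemma edge_of_bij:
  assumes n: "n \<ge> 3"
  shows "bij_betw (edge_of n) {1..2*n} (snd (zigzag n))"
  unfolding bij_betw_def
proof
  show "inj_on (edge_of n) {1..2*n}"
  proof (rule inj_onI)
    fix v w assume "v \<in> {1..2*n}" "w \<in> {1..2*n}" "edge_of n v = edge_of n w"
    then show "v = w" using n unfolding edge_of_def
      by (auto simp: doubleton_eq_iff split: if_splits elim!: evenE oddE)
  qed
  show "edge_of n ` {1..2*n} = snd (zigzag n)"
  proof
    show "edge_of n ` {1..2*n} \<subseteq> snd (zigzag n)"
    proof
      fix e assume "e \<in> edge_of n ` {1..2*n}"
      then obtain v where v: "e = edge_of n v" "1 \<le> v" "v \<le> 2 * n" by auto
      then consider "v = 1" | "even v" "v \<noteq> 1" | "odd v" "v \<noteq> 1" by blast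
      then show "e \<in> snd (zigzag n)"
      proof cases
        case 2
        then have "e = {v div 2, v div 2 + 1}" "1 \<le> v div 2" "v div 2 \<le> n" using v by (auto simp: edge_of_def)
        then show ?thesis by (auto simp: zigzag_def)
      next
        case 3
        then have "e = {v div 2, v div 2 + 2}" "1 \<le> v div 2" "v div 2 \<le> n - 1" using v by (auto simp: edge_of_def elim!: oddE)
        then show ?thesis by (auto simp: zigzag_def)
      qed (auto simp: v(1) edge_of_def zigzag_def)
    qed
    show "snd (zigzag n) \<subseteq> edge_of n ` {1..2*n}"
    proof
      fix e assume "e \<in> snd (zigzag n)"
      then consider j where "e = {j, j+1}" "1 \<le> j" "j \<le> n" | j where "e = {j, j+2}" "1 \<le> j" "j \<le> n - 1" | "e = {1, n+1}"
        by (auto simp: zigzag_def)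
      then show "e \<in> edge_of n ` {1..2*n}"
      proof cases
        case (1 j)
        then show ?thesis by (intro image_eqI[of _ _ "2 * j"]) (auto simp: edge_of_def)
      next
        case (2 j)
        then show ?thesis using n by (intro image_eqI[of _ _ "2 * j + 1"]) (auto simp: edge_of_def)
      next
        case 3
        then show ?thesis using n by (intro image_eqI[of _ _ 1]) (auto simp: edge_of_def)
      qed
    qed
  qed
qed


lemma graph_poly_polys: "graph_poly G \<in> polys (snd G)"
  unfolding graph_poly_def by (intro polys_sum polys_prod) auto

text \<open>Each diagonal entry contains an indeterminate that occurs nowhere else, namely that of the edge on no
  other basis cycle. Translating it turns the matrix into one with independent entries: the diagonal
  becomes free, and the only constraint left is the dependence of the border on the other entries.\<close>

lemma zigzag_class:
  assumes n: "n \<ge> 3"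
  shows "(graph_class (zigzag n) :: ('k::field scheme set \<Rightarrow>\<^sub>0 int) set)
    = int_poly_eval K0_Var (LL^(2*n) - (zero_cls (n-1) + unit_cls (n-1))) Lefschetz"
proof -
  define e where "e = the_inv_into {1..2*n} (edge_of n)"
  let ?v = "poly_var :: nat \<Rightarrow> (nat, 'k) mpoly" and ?g = "graph_poly (zigzag n) :: (nat set, 'k) mpoly"
  let ?\<sigma> = "\<lambda>E. ?v (e E)" and ?s = "\<Sum>j=1..<n+1. ?v (2*j)"
  define g where "g = psubst ?\<sigma> ?g"
  have bij: "bij_betw e (snd (zigzag n)) {1..2*n}"
    unfolding e_def by (rule bij_betw_the_inv_into[OF edge_of_bij[OF n]])
  have fin: "finite (snd (zigzag n))" using bij by (simp add: bij_betw_finite)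
  have card: "card (snd (zigzag n)) = 2 * n" using bij_betw_same_card[OF bij] by simp
  have e: "e (edge_of n v) = v" if "v \<in> {1..2*n}" for v
    unfolding e_def using the_inv_into_f_f[OF bij_betw_imp_inj_on[OF edge_of_bij[OF n]] that] .
  have e1: "e {1, n+1} = 1" using e[of 1] n by (simp add: edge_of_def)
  have e2: "e {j, j+1} = 2*j" if "1 \<le> j" "j < n + 1" for j using e[of "2*j"] that by (simp add: edge_of_def)
  have e3: "e {j, j+2} = 2*j+1" if "1 \<le> j" "j < n" for j using e[of "2*j+1"] that by (simp add: edge_of_def)
  let ?l = "map (\<lambda>j. (2*j+1, 2*j+2)) [1..<n]"
  have g: "g = bordered_det (?v 2) (map (\<lambda>j. (?v (2*j+1) + ?v (2*j) + ?v (2*j+2), ?v (2*j+2))) [1..<n]) (?v 1 + ?s)"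
  proof -
    obtain m where m: "n = Suc m" using n by (cases n) auto
    have a: "psubst ?\<sigma> (poly_var {1, n+1} + near_sum 1 (n+1)) = ?v 1 + ?s"
      using e1 e2 by (simp add: psubst_sum del: sum.op_ivl_Suc)
    have sl: "(strip_list 1 n :: ((nat set, 'k) mpoly \<times> _) list)
        = map (\<lambda>j. (far j + near j + near (j+1), near (j+1))) [1..<n]"
      unfolding m strip_list_map by simp
    have "sub_list ?\<sigma> (strip_list 1 n) = map (\<lambda>j. (?v (2*j+1) + ?v (2*j) + ?v (2*j+2), ?v (2*j+2))) [1..<n]"
      unfolding sl sub_list_def map_map
    proof (rule map_cong[OF refl])
      fix j assume "j \<in> set [1..<n]"
      then have j: "1 \<le> j" "j < n" "1 \<le> j + 1" "j + 1 < n + 1" "j < n + 1" by auto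
      show "(map_prod (psubst ?\<sigma>) (psubst ?\<sigma>) \<circ> (\<lambda>j. (far j + near j + near (j+1), near (j+1)))) j
          = (?v (2*j+1) + ?v (2*j) + ?v (2*j+2), ?v (2*j+2))"
        using e2[OF j(1,5)] e2[OF j(3,4)] e3[OF j(1,2)] by simp
    qed
    moreover have "psubst ?\<sigma> (near 1) = ?v 2" using e2[of 1] n by simp
    ultimately show ?thesis unfolding g_def zigzag_poly[OF n] psubst_bordered_det a by simp
  qed
  define X where "X = {v \<in> {1..2*n}. odd v}"
  define h where "h v = (if v = 1 then - ?s else - (?v (v - 1) + ?v (v + 1)))" for v
  define \<tau> where "\<tau> v = (if v \<in> X then ?v v + h v else ?v v)" for v
  have "open_class {1..2*n} g (zero_cls (n-1) + unit_cls (n-1))"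
  proof (rule shiftsI[of X _ _ h, folded \<tau>_def])
    have "psubst ?\<sigma> ?g \<in> polys {1..2*n}"
      by (rule psubst_polys[OF graph_poly_polys]) (use bij in \<open>auto simp: bij_betw_def\<close>)
    then show "g \<in> polys {1..2*n}" by (simp add: g_def)
    show "h x \<in> polys ({1..2*n} - X)" if "x \<in> X" for x
    proof (cases "x = 1")
      case True
      have "?s \<in> polys ({1..2*n} - X)" by (rule polys_sum) (auto simp: X_def)
      then show ?thesis using True by (simp add: h_def)
    next
      case False
      have x: "odd x" "x \<le> 2 * n" using that by (auto simp: X_def)
      from x(1) obtain j where j: "x = 2 * j + 1" by (rule oddE)
      moreover have "j \<ge> 1" "j < n" using j x(2) False by auto
      ultimately have "x - 1 \<in> {1..2*n} - X" "x + 1 \<in> {1..2*n} - X" by (auto simp: X_def)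
      then show ?thesis using False by (simp add: h_def)
    qed
    have odd: "\<tau> (2*j+1) = ?v (2*j+1) - (?v (2*j) + ?v (2*j+2))" if "1 \<le> j" "j < n" for j
      using that by (simp add: \<tau>_def h_def X_def)
    have even: "\<tau> (2*j) = ?v (2*j)" for j by (simp add: \<tau>_def X_def)
    have one: "\<tau> 1 = ?v 1 - ?s" using n by (simp add: \<tau>_def h_def X_def)
    have "psubst \<tau> g = bordered_det (?v 2) (var_list ?l) (?v 1)"
    proof -
      have "psubst \<tau> (?v 1 + ?s) = ?v 1" using one even by (simp add: psubst_sum del: sum.op_ivl_Suc)
      moreover have "sub_list \<tau> (map (\<lambda>j. (?v (2*j+1) + ?v (2*j) + ?v (2*j+2), ?v (2*j+2))) [1..<n]) = var_list ?l"
        unfolding sub_list_def var_list_def map_map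
      proof (rule map_cong[OF refl])
        fix j assume "j \<in> set [1..<n]"
        then have j: "1 \<le> j" "j < n" by auto
        show "(map_prod (psubst \<tau>) (psubst \<tau>) \<circ> (\<lambda>j. (?v (2*j+1) + ?v (2*j) + ?v (2*j+2), ?v (2*j+2)))) j
            = (map_prod ?v ?v \<circ> (\<lambda>j. (2*j+1, 2*j+2))) j"
          using odd[OF j] even[of j] even[of "j+1"] by simp
      qed
      moreover have "psubst \<tau> (?v 2) = ?v 2" using even[of 1] by simp
      ultimately show ?thesis unfolding g psubst_bordered_det by (simp only:)
    qed
    moreover have "open_class (insert 2 (insert 1 (list_vars ?l))) (bordered_det (?v 2) (var_list ?l) (?v 1))
        (zero_cls (length ?l) + unit_cls (length ?l))"
      by (rule bordered_class) (auto simp: distinct_map inj_on_def comp_def, presburger+)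
    moreover have "insert 2 (insert 1 (list_vars ?l)) = {1..2*n}"
    proof -
      have "v \<in> insert 2 (insert 1 (list_vars ?l))" if "v \<in> {1..2*n}" for v
      proof (cases "v \<le> 2")
        case False
        then have "v = 2 * ((v - 1) div 2) + 1 \<or> v = 2 * ((v - 1) div 2) + 2" "(v - 1) div 2 \<in> {1..<n}"
          using that by auto
        then show ?thesis by (auto simp: list_vars_def)
      qed (use that in auto)
      moreover have "insert 2 (insert 1 (list_vars ?l)) \<subseteq> {1..2*n}" using n by (auto simp: list_vars_def)
      ultimately show ?thesis by blast
    qed
    ultimately show "open_class {1..2*n} (psubst \<tau> g) (zero_cls (n-1) + unit_cls (n-1))" by simp
  qed (auto simp: X_def)
  from hypersurface_class[OF fin graph_poly_polys bij this[unfolded g_def]] show ?thesis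
    by (simp add: graph_class_def card)
qed

theorem mainTheorem10:
  fixes n :: nat
  assumes "n \<ge> 3"
  shows "(graph_class (zigzag n) :: ('k::field scheme set \<Rightarrow>\<^sub>0 int) set) =
    int_poly_eval K0_Var (fps_nth zigzag_series n) Lefschetz"
  unfolding zigzag_series_coeff[OF assms] by (rule zigzag_class[OF assms])

end
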